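(* Let $M$ be a closed connected smooth Riemannian manifold and let $G:T^*M\to\mathbb{R}$ be continuous, convex in $p$, and superlinear in $p$ ($G(x,p)/\|p\|_x\to+\infty$ as $\|p\|_x\to\infty$). For any fixed continuous function $\sigma:M\to(0,+\infty)$, the image in $C(M)$ of the operator $\mathbb{P}^\sigma_G:C(M)\to C(M)$, $$\mathbb{P}^\sigma_G\varphi(x)=\inf_{\mu\in\mathfrak M(L_G)}\left\{\frac{\int_M\sigma(y)h_G(y,x)\,d\mu(y)}{\int_M\sigma(y)\,d\mu(y)}+\frac{\int_M\sigma(y)\varphi(y)\,d\mu(y)}{\int_M\sigma(y)\,d\mu(y)}\right\},$$ coincides with the set of all viscosity solutions of the Hamilton-Jacobi equation $G(x,d_xu)=c(G)$ in $M$.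
   Context: $C(M)$ is the space of continuous real functions on $M$. The critical value of $G$ is $c(G)=\inf_{f\in C^1(M)}\max_{x\in M}G(x,d_xf)$; it is the only constant $c$ for which $G(x,d_xu)=c$ admits viscosity solutions on $M$. The Lagrangian is $L_G(x,v)=\sup_{p\in T_x^*M}(p(v)-G(x,p))$ on $TM$. A Borel probability measure $\tilde\mu$ on $TM$ is closed if $\int_{TM}\|v\|_x\,d\tilde\mu<\infty$ and $\int_{TM}d_x\varphi(v)\,d\tilde\mu(x,v)=0$ for all $\varphi\in C^1(M)$. A Mather measure of $L_G$ is a closed probability measure $\tilde\mu$ with $\int_{TM}L_G\,d\tilde\mu=-c(G)$. A projected Mather measure is $\mu=\pi_\#\tilde\mu$ with $\tilde\mu$ a Mather measure and $\pi:TM\to M$ the canonical projection; $\mathfrak M(L_G)$ is the set of all projected Mather measures. The Peierls barrier of $L_G$ is $h_G(x,y)=\liminf_{t\to+\infty}[h_t(x,y)+c(G)t]$, where $h_t(x,y)=\inf\int_0^tL_G(\gamma(s),\dot\gamma(s))\,ds$ over absolutely continuous $\gamma:[0,t]\to M$ with $\gamma(0)=x$, $\gamma(t)=y$. *)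

theory Defs
  imports "HOL-Probability.Probability"
begin

section \<open>Smooth manifolds\<close>

text \<open>
  The manifold is a whole Hausdorff topological type \<open>'m\<close>, with a smooth atlas of charts onto open
  subsets of a Euclidean space \<open>'e\<close>. A chart is a pair of its domain and its coordinate map; the
  values of the map outside the domain are irrelevant. The atlas need not be maximal: all
  notions below depend only on the smooth structure that it generates.
\<close>

primrec Ck_on :: "nat \<Rightarrow> ('a::real_normed_vector \<Rightarrow> 'b::real_normed_vector) \<Rightarrow> 'a set \<Rightarrow> bool" where
  "Ck_on 0 f S \<longleftrightarrow> continuous_on S f"
| "Ck_on (Suc k) f S \<longleftrightarrow>
     (\<forall>x\<in>S. f differentiable (at x)) \<and> (\<forall>v. Ck_on k (\<lambda>x. frechet_derivative f (at x) v) S)"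

definition smooth_on :: "('a::real_normed_vector \<Rightarrow> 'b::real_normed_vector) \<Rightarrow> 'a set \<Rightarrow> bool" where
  "smooth_on f S \<longleftrightarrow> (\<forall>k. Ck_on k f S)"

type_synonym ('m, 'e) chart = "'m set \<times> ('m \<Rightarrow> 'e)"

abbreviation cdom :: "('m, 'e) chart \<Rightarrow> 'm set" where
  "cdom c \<equiv> fst c"

abbreviation cmap :: "('m, 'e) chart \<Rightarrow> 'm \<Rightarrow> 'e" where
  "cmap c \<equiv> snd c"

abbreviation cimage :: "('m, 'e) chart \<Rightarrow> 'e set" where
  "cimage c \<equiv> cmap c ` cdom c"

definition cinv :: "('m, 'e) chart \<Rightarrow> 'e \<Rightarrow> 'm" where
  "cinv c = inv_into (cdom c) (cmap c)"

definition smooth_atlas :: "('m::topological_space, 'e::euclidean_space) chart set \<Rightarrow> bool" where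
  "smooth_atlas A \<longleftrightarrow>
     (\<Union>c\<in>A. cdom c) = UNIV \<and>
     (\<forall>c\<in>A. open (cdom c) \<and> open (cimage c) \<and> homeomorphism (cdom c) (cimage c) (cmap c) (cinv c)) \<and>
     (\<forall>c\<in>A. \<forall>d\<in>A. smooth_on (cmap d \<circ> cinv c) (cmap c ` (cdom c \<inter> cdom d)))"

definition C1_manifold ::
  "('m::topological_space, 'e::euclidean_space) chart set \<Rightarrow> ('m \<Rightarrow> real) set" where
  "C1_manifold A = {f. \<forall>c\<in>A. Ck_on 1 (f \<circ> cinv c) (cimage c)}"


section \<open>Tangent and cotangent bundles\<close>

text \<open>
  A tangent vector at \<open>x\<close> is the family of its coordinate representations, indexed by the charts
  around \<open>x\<close> and transforming by the derivatives of the coordinate changes; it is \<open>0\<close> at all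
  other indices. A covector is a linear functional on the tangent space, \<open>0\<close> outside of it.
\<close>

type_synonym ('m, 'e) tvec = "('m, 'e) chart \<Rightarrow> 'e"

type_synonym ('m, 'e) covec = "('m, 'e) tvec \<Rightarrow> real"

definition tangent_space ::
  "('m::topological_space, 'e::euclidean_space) chart set \<Rightarrow> 'm \<Rightarrow> ('m, 'e) tvec set" where
  "tangent_space A x =
     {v. (\<forall>c. \<not> (c \<in> A \<and> x \<in> cdom c) \<longrightarrow> v c = 0) \<and>
         (\<forall>c\<in>A. \<forall>d\<in>A. x \<in> cdom c \<longrightarrow> x \<in> cdom d \<longrightarrow>
            v d = frechet_derivative (cmap d \<circ> cinv c) (at (cmap c x)) (v c))}"

definition cotangent_space ::
  "('m::topological_space, 'e::euclidean_space) chart set \<Rightarrow> 'm \<Rightarrow> ('m, 'e) covec set" where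
  "cotangent_space A x =
     {p. (\<forall>v. v \<notin> tangent_space A x \<longrightarrow> p v = 0) \<and>
         (\<forall>v\<in>tangent_space A x. \<forall>w\<in>tangent_space A x. p (\<lambda>c. v c + w c) = p v + p w) \<and>
         (\<forall>a. \<forall>v\<in>tangent_space A x. p (\<lambda>c. a *\<^sub>R v c) = a * p v)}"

text \<open>
  The tangent vector, and the covector, at \<open>x\<close> with coordinates \<open>w\<close> in the chart \<open>c\<close>.
\<close>

definition tvec_of ::
  "('m::topological_space, 'e::euclidean_space) chart set \<Rightarrow> ('m, 'e) chart \<Rightarrow> 'm \<Rightarrow> 'e
    \<Rightarrow> ('m, 'e) tvec" where
  "tvec_of A c x w =
     (\<lambda>d. if d \<in> A \<and> x \<in> cdom d
          then frechet_derivative (cmap d \<circ> cinv c) (at (cmap c x)) w else 0)"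

definition covec_of ::
  "('m::topological_space, 'e::euclidean_space) chart set \<Rightarrow> ('m, 'e) chart \<Rightarrow> 'm \<Rightarrow> 'e
    \<Rightarrow> ('m, 'e) covec" where
  "covec_of A c x w = (\<lambda>v. if v \<in> tangent_space A x then w \<bullet> v c else 0)"

text \<open>
  The usual topologies of \<open>TM\<close> and \<open>T*M\<close>: a set is open iff it is open in all the
  local trivialisations induced by the charts.
\<close>

definition tangent_bundle ::
  "('m::topological_space, 'e::euclidean_space) chart set \<Rightarrow> ('m \<times> ('m, 'e) tvec) topology" where
  "tangent_bundle A = topology (\<lambda>T.
     T \<subseteq> Sigma UNIV (tangent_space A) \<and>
     (\<forall>c\<in>A. open {(z, w). z \<in> cimage c \<and> (cinv c z, tvec_of A c (cinv c z) w) \<in> T}))"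

definition cotangent_bundle ::
  "('m::topological_space, 'e::euclidean_space) chart set \<Rightarrow> ('m \<times> ('m, 'e) covec) topology" where
  "cotangent_bundle A = topology (\<lambda>T.
     T \<subseteq> Sigma UNIV (cotangent_space A) \<and>
     (\<forall>c\<in>A. open {(z, w). z \<in> cimage c \<and> (cinv c z, covec_of A c (cinv c z) w) \<in> T}))"

lemma istopology_trivialisations:
  fixes E :: "'b set" and tr :: "'c \<Rightarrow> 'a::topological_space \<Rightarrow> 'd::topological_space \<Rightarrow> 'b"
  assumes "\<And>c. c \<in> A \<Longrightarrow> open (V c)"
  shows "istopology (\<lambda>T. T \<subseteq> E \<and> (\<forall>c\<in>A. open {(z, w). z \<in> V c \<and> tr c z w \<in> T}))"
  unfolding istopology_def
proof (intro conjI allI impI ballI; (elim conjE)?)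
  fix S T c
  assume S: "\<forall>c\<in>A. open {(z, w). z \<in> V c \<and> tr c z w \<in> S}"
    and T: "\<forall>c\<in>A. open {(z, w). z \<in> V c \<and> tr c z w \<in> T}" and "c \<in> A"
  have "{(z, w). z \<in> V c \<and> tr c z w \<in> S \<inter> T} =
      {(z, w). z \<in> V c \<and> tr c z w \<in> S} \<inter> {(z, w). z \<in> V c \<and> tr c z w \<in> T}"
    by auto
  then show "open {(z, w). z \<in> V c \<and> tr c z w \<in> S \<inter> T}"
    using S T \<open>c \<in> A\<close> by (simp add: open_Int)
next
  fix K c
  assume K: "\<forall>S\<in>K. S \<subseteq> E \<and> (\<forall>c\<in>A. open {(z, w). z \<in> V c \<and> tr c z w \<in> S})" and "c \<in> A"
  have "{(z, w). z \<in> V c \<and> tr c z w \<in> \<Union>K} = (\<Union>S\<in>K. {(z, w). z \<in> V c \<and> tr c z w \<in> S})"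
    by auto
  then show "open {(z, w). z \<in> V c \<and> tr c z w \<in> \<Union>K}"
    using K \<open>c \<in> A\<close> by auto
qed auto

lemma openin_tangent_bundle:
  assumes "smooth_atlas A"
  shows "openin (tangent_bundle A) T \<longleftrightarrow>
     T \<subseteq> Sigma UNIV (tangent_space A) \<and>
     (\<forall>c\<in>A. open {(z, w). z \<in> cimage c \<and> (cinv c z, tvec_of A c (cinv c z) w) \<in> T})"
  unfolding tangent_bundle_def
  by (subst topology_inverse', rule istopology_trivialisations[where V = "\<lambda>c. cimage c"
        and tr = "\<lambda>c z w. (cinv c z, tvec_of A c (cinv c z) w)"])
    (use assms in \<open>auto simp: smooth_atlas_def\<close>)

lemma openin_cotangent_bundle:
  assumes "smooth_atlas A"
  shows "openin (cotangent_bundle A) T \<longleftrightarrow>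
     T \<subseteq> Sigma UNIV (cotangent_space A) \<and>
     (\<forall>c\<in>A. open {(z, w). z \<in> cimage c \<and> (cinv c z, covec_of A c (cinv c z) w) \<in> T})"
  unfolding cotangent_bundle_def
  by (subst topology_inverse', rule istopology_trivialisations[where V = "\<lambda>c. cimage c"
        and tr = "\<lambda>c z w. (cinv c z, covec_of A c (cinv c z) w)"])
    (use assms in \<open>auto simp: smooth_atlas_def\<close>)

definition borel_of :: "'a topology \<Rightarrow> 'a measure" where
  "borel_of X = sigma (topspace X) {U. openin X U}"

text \<open>
  The differential is computed in an arbitrary chart around \<open>x\<close>; by the chain rule the choice does
  not matter.
\<close>

definition chart_at ::
  "('m::topological_space, 'e::euclidean_space) chart set \<Rightarrow> 'm \<Rightarrow> ('m, 'e) chart" where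
  "chart_at A x = (SOME c. c \<in> A \<and> x \<in> cdom c)"

definition differential ::
  "('m::topological_space, 'e::euclidean_space) chart set \<Rightarrow> ('m \<Rightarrow> real) \<Rightarrow> 'm
    \<Rightarrow> ('m, 'e) covec" where
  "differential A f x =
     (\<lambda>v. if v \<in> tangent_space A x
          then (let c = chart_at A x
                in frechet_derivative (f \<circ> cinv c) (at (cmap c x)) (v c))
          else 0)"


section \<open>Riemannian metrics\<close>

definition riemannian_metric ::
  "('m::topological_space, 'e::euclidean_space) chart set
    \<Rightarrow> ('m \<Rightarrow> ('m, 'e) tvec \<Rightarrow> ('m, 'e) tvec \<Rightarrow> real) \<Rightarrow> bool" where
  "riemannian_metric A g \<longleftrightarrow>
     (\<forall>x. \<forall>u\<in>tangent_space A x. \<forall>v\<in>tangent_space A x. \<forall>w\<in>tangent_space A x. \<forall>a b.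
        g x (\<lambda>c. a *\<^sub>R u c + b *\<^sub>R v c) w = a * g x u w + b * g x v w) \<and>
     (\<forall>x. \<forall>v\<in>tangent_space A x. \<forall>w\<in>tangent_space A x. g x v w = g x w v) \<and>
     (\<forall>x. \<forall>v\<in>tangent_space A x. v \<noteq> (\<lambda>_. 0) \<longrightarrow> g x v v > 0) \<and>
     (\<forall>c\<in>A. \<forall>a b. smooth_on
        (\<lambda>z. g (cinv c z) (tvec_of A c (cinv c z) a) (tvec_of A c (cinv c z) b)) (cimage c))"

definition closed_connected_riemannian_manifold ::
  "('m::t2_space, 'e::euclidean_space) chart set
    \<Rightarrow> ('m \<Rightarrow> ('m, 'e) tvec \<Rightarrow> ('m, 'e) tvec \<Rightarrow> real) \<Rightarrow> bool" where
  "closed_connected_riemannian_manifold A g \<longleftrightarrow>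
     smooth_atlas A \<and> riemannian_metric A g \<and> compact (UNIV :: 'm set) \<and> connected (UNIV :: 'm set)"

definition tnorm ::
  "('m \<Rightarrow> ('m, 'e) tvec \<Rightarrow> ('m, 'e) tvec \<Rightarrow> real) \<Rightarrow> 'm \<Rightarrow> ('m, 'e) tvec \<Rightarrow> real" where
  "tnorm g x v = sqrt (g x v v)"

definition conorm ::
  "('m::topological_space, 'e::euclidean_space) chart set
    \<Rightarrow> ('m \<Rightarrow> ('m, 'e) tvec \<Rightarrow> ('m, 'e) tvec \<Rightarrow> real) \<Rightarrow> 'm \<Rightarrow> ('m, 'e) covec \<Rightarrow> real" where
  "conorm A g x p = (SUP v\<in>{v \<in> tangent_space A x. tnorm g x v \<le> 1}. p v)"


section \<open>Hamiltonian and Lagrangian\<close>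

definition continuous_hamiltonian ::
  "('m::topological_space, 'e::euclidean_space) chart set \<Rightarrow> ('m \<Rightarrow> ('m, 'e) covec \<Rightarrow> real)
    \<Rightarrow> bool" where
  "continuous_hamiltonian A G \<longleftrightarrow>
     continuous_map (cotangent_bundle A) euclideanreal (\<lambda>(x, p). G x p)"

definition convex_hamiltonian ::
  "('m::topological_space, 'e::euclidean_space) chart set \<Rightarrow> ('m \<Rightarrow> ('m, 'e) covec \<Rightarrow> real)
    \<Rightarrow> bool" where
  "convex_hamiltonian A G \<longleftrightarrow>
     (\<forall>x. \<forall>p\<in>cotangent_space A x. \<forall>q\<in>cotangent_space A x. \<forall>t\<in>{0..1}.
        G x (\<lambda>v. (1 - t) * p v + t * q v) \<le> (1 - t) * G x p + t * G x q)"

definition superlinear_hamiltonian ::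
  "('m::topological_space, 'e::euclidean_space) chart set
    \<Rightarrow> ('m \<Rightarrow> ('m, 'e) tvec \<Rightarrow> ('m, 'e) tvec \<Rightarrow> real) \<Rightarrow> ('m \<Rightarrow> ('m, 'e) covec \<Rightarrow> real)
    \<Rightarrow> bool" where
  "superlinear_hamiltonian A g G \<longleftrightarrow>
     (\<forall>x K. \<exists>R. \<forall>p\<in>cotangent_space A x. conorm A g x p > R \<longrightarrow> G x p / conorm A g x p \<ge> K)"

definition critical_value ::
  "('m::topological_space, 'e::euclidean_space) chart set \<Rightarrow> ('m \<Rightarrow> ('m, 'e) covec \<Rightarrow> real)
    \<Rightarrow> real" where
  "critical_value A G = (INF f\<in>C1_manifold A. SUP x. G x (differential A f x))"

definition lagrangian ::
  "('m::topological_space, 'e::euclidean_space) chart set \<Rightarrow> ('m \<Rightarrow> ('m, 'e) covec \<Rightarrow> real)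
    \<Rightarrow> 'm \<Rightarrow> ('m, 'e) tvec \<Rightarrow> real" where
  "lagrangian A G x v = (SUP p\<in>cotangent_space A x. p v - G x p)"

definition viscosity_solution ::
  "('m::topological_space, 'e::euclidean_space) chart set \<Rightarrow> ('m \<Rightarrow> ('m, 'e) covec \<Rightarrow> real)
    \<Rightarrow> real \<Rightarrow> ('m \<Rightarrow> real) \<Rightarrow> bool" where
  "viscosity_solution A G a u \<longleftrightarrow>
     continuous_on UNIV u \<and>
     (\<forall>f\<in>C1_manifold A. \<forall>x.
        (\<forall>\<^sub>F y in nhds x. u y - f y \<le> u x - f x) \<longrightarrow> G x (differential A f x) \<le> a) \<and>
     (\<forall>f\<in>C1_manifold A. \<forall>x.
        (\<forall>\<^sub>F y in nhds x. u y - f y \<ge> u x - f x) \<longrightarrow> G x (differential A f x) \<ge> a)"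


section \<open>Mather measures\<close>

definition closed_measure ::
  "('m::topological_space, 'e::euclidean_space) chart set
    \<Rightarrow> ('m \<Rightarrow> ('m, 'e) tvec \<Rightarrow> ('m, 'e) tvec \<Rightarrow> real) \<Rightarrow> ('m \<times> ('m, 'e) tvec) measure
    \<Rightarrow> bool" where
  "closed_measure A g m \<longleftrightarrow>
     sets m = sets (borel_of (tangent_bundle A)) \<and> prob_space m \<and>
     integrable m (\<lambda>(x, v). tnorm g x v) \<and>
     (\<forall>f\<in>C1_manifold A. (LINT (x, v)|m. differential A f x v) = 0)"

definition mather_measure ::
  "('m::topological_space, 'e::euclidean_space) chart set
    \<Rightarrow> ('m \<Rightarrow> ('m, 'e) tvec \<Rightarrow> ('m, 'e) tvec \<Rightarrow> real) \<Rightarrow> ('m \<Rightarrow> ('m, 'e) covec \<Rightarrow> real)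
    \<Rightarrow> ('m \<times> ('m, 'e) tvec) measure \<Rightarrow> bool" where
  "mather_measure A g G m \<longleftrightarrow>
     closed_measure A g m \<and>
     integrable m (\<lambda>(x, v). lagrangian A G x v) \<and>
     (LINT (x, v)|m. lagrangian A G x v) = - critical_value A G"

definition projected_mather_measures ::
  "('m::topological_space, 'e::euclidean_space) chart set
    \<Rightarrow> ('m \<Rightarrow> ('m, 'e) tvec \<Rightarrow> ('m, 'e) tvec \<Rightarrow> real) \<Rightarrow> ('m \<Rightarrow> ('m, 'e) covec \<Rightarrow> real)
    \<Rightarrow> 'm measure set" where
  "projected_mather_measures A g G = (\<lambda>m. distr m borel fst) ` {m. mather_measure A g G m}"


section \<open>Peierls barrier\<close>

definition abs_continuous_on :: "real \<Rightarrow> real \<Rightarrow> (real \<Rightarrow> 'a::metric_space) \<Rightarrow> bool" where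
  "abs_continuous_on a b f \<longleftrightarrow>
     (\<forall>e>0. \<exists>d>0. \<forall>D. finite D \<and> (\<forall>(r, s)\<in>D. a \<le> r \<and> r \<le> s \<and> s \<le> b) \<and>
        pairwise (\<lambda>(r, s) (r', s'). {r<..<s} \<inter> {r'<..<s'} = {}) D \<and> (\<Sum>(r, s)\<in>D. s - r) < d
        \<longrightarrow> (\<Sum>(r, s)\<in>D. dist (f r) (f s)) < e)"

definition abs_continuous_curve ::
  "('m::topological_space, 'e::euclidean_space) chart set \<Rightarrow> real \<Rightarrow> (real \<Rightarrow> 'm) \<Rightarrow> bool" where
  "abs_continuous_curve A t \<gamma> \<longleftrightarrow>
     continuous_on {0..t} \<gamma> \<and>
     (\<forall>c\<in>A. \<forall>a b. 0 \<le> a \<longrightarrow> a \<le> b \<longrightarrow> b \<le> t \<longrightarrow> \<gamma> ` {a..b} \<subseteq> cdom c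
        \<longrightarrow> abs_continuous_on a b (cmap c \<circ> \<gamma>))"

text \<open>
  The velocity is meaningful at almost every time only, namely where the coordinate representations
  of an absolutely continuous curve are differentiable.
\<close>

definition velocity ::
  "('m::topological_space, 'e::euclidean_space) chart set \<Rightarrow> (real \<Rightarrow> 'm) \<Rightarrow> real
    \<Rightarrow> ('m, 'e) tvec" where
  "velocity A \<gamma> s =
     (\<lambda>c. if c \<in> A \<and> \<gamma> s \<in> cdom c then vector_derivative (cmap c \<circ> \<gamma>) (at s) else 0)"

text \<open>
  The Lagrangian of a continuous superlinear Hamiltonian is continuous and bounded below, so along
  an absolutely continuous curve its integral is either finite or \<open>+\<infinity>\<close>.
\<close>

definition action ::
  "('m::topological_space, 'e::euclidean_space) chart set \<Rightarrow> ('m \<Rightarrow> ('m, 'e) covec \<Rightarrow> real)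
    \<Rightarrow> real \<Rightarrow> (real \<Rightarrow> 'm) \<Rightarrow> ereal" where
  "action A G t \<gamma> =
     (if (\<lambda>s. lagrangian A G (\<gamma> s) (velocity A \<gamma> s)) absolutely_integrable_on {0..t}
      then ereal (integral {0..t} (\<lambda>s. lagrangian A G (\<gamma> s) (velocity A \<gamma> s)))
      else \<infinity>)"

definition minimal_action ::
  "('m::topological_space, 'e::euclidean_space) chart set \<Rightarrow> ('m \<Rightarrow> ('m, 'e) covec \<Rightarrow> real)
    \<Rightarrow> real \<Rightarrow> 'm \<Rightarrow> 'm \<Rightarrow> ereal" where
  "minimal_action A G t x y =
     (INF \<gamma>\<in>{\<gamma>. abs_continuous_curve A t \<gamma> \<and> \<gamma> 0 = x \<and> \<gamma> t = y}. action A G t \<gamma>)"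

definition peierls_barrier ::
  "('m::topological_space, 'e::euclidean_space) chart set \<Rightarrow> ('m \<Rightarrow> ('m, 'e) covec \<Rightarrow> real)
    \<Rightarrow> 'm \<Rightarrow> 'm \<Rightarrow> ereal" where
  "peierls_barrier A G x y =
     Liminf at_top (\<lambda>t. minimal_action A G t x y + ereal (critical_value A G * t))"


section \<open>The operator\<close>

text \<open>
  The Peierls barrier is finite on a closed connected manifold, hence the use of
  \<open>real_of_ereal\<close>.
\<close>

definition P_operator ::
  "('m::topological_space, 'e::euclidean_space) chart set
    \<Rightarrow> ('m \<Rightarrow> ('m, 'e) tvec \<Rightarrow> ('m, 'e) tvec \<Rightarrow> real) \<Rightarrow> ('m \<Rightarrow> ('m, 'e) covec \<Rightarrow> real)
    \<Rightarrow> ('m \<Rightarrow> real) \<Rightarrow> ('m \<Rightarrow> real) \<Rightarrow> 'm \<Rightarrow> real" where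
  "P_operator A g G \<sigma> \<phi> x =
     (INF \<mu>\<in>projected_mather_measures A g G.
        (LINT y|\<mu>. \<sigma> y * real_of_ereal (peierls_barrier A G y x)) / (LINT y|\<mu>. \<sigma> y)
        + (LINT y|\<mu>. \<sigma> y * \<phi> y) / (LINT y|\<mu>. \<sigma> y))"

end

theory Submission
  imports Defs
begin

text \<open>
  Write \<open>c\<close> for the critical value. A subsolution can be approximated uniformly by smooth
  \<open>f\<close> with \<open>G(x, df) \<le> c + \<epsilon>\<close>, and integrating \<open>df(v) \<le> L + G(x, df)\<close> against a
  Mather measure shows that a subsolution with a margin \<open>b \<ge> 0\<close>, that is
  \<open>G(x, du) + b \<le> c\<close>, satisfies \<open>b = 0\<close> almost everywhere for its projection. Applied to
  time averages of the finite time potentials, this gives that the Peierls barrier \<open>h\<close> is finite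
  and that \<open>h(z, z) \<le> 0\<close> almost everywhere. By a separation argument, over every compact set
  \<open>K\<close> there is either a Mather measure or a smooth \<open>f\<close> with \<open>G(x, df) < c\<close> on \<open>K\<close>.

  The key step is the constraint that the \<open>\<sigma>\<close>-weighted integral of \<open>P\<phi>\<close> is at most that of
  \<open>\<phi>\<close> for every projected Mather measure: multiplying a Mather measure by a function of the
  difference of two subsolutions preserves closedness and minimality, so the measure can be cut
  into pieces on which \<open>h(z, x) + h(x, z)\<close> is small, and on such a piece the barrier averages to
  almost nothing.

  \<open>P\<phi>\<close> is a subsolution. If it failed to be a supersolution, a bump would give a larger
  subsolution with a margin where it is larger; this agrees with \<open>P\<phi>\<close> almost everywhere, hence
  satisfies the constraint, hence is at most \<open>P\<phi>\<close>. Conversely, a solution \<open>u\<close> satisfies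
  \<open>u \<le> Pu\<close>. On the compact set \<open>K\<close> where \<open>Pu - u\<close> is maximal, a Mather measure together
  with the constraint forces \<open>Pu \<le> u\<close>, while a strict subsolution on \<open>K\<close>, mixed with a
  smooth approximation of \<open>Pu\<close>, would touch \<open>u\<close> from below near \<open>K\<close>.
\<close>

subsection \<open>Convex functions and gradients in Euclidean space\<close>

text \<open>G is only continuous in x and convex in p, so in general there is no Euler-Lagrange
  flow, and neither invariance of Mather measures nor orbits of minimizing curves are available.
  Curves therefore occur only in inequalities: a curve with action strictly below a bound takes the
  place of a minimizer, and minimality of a measure is exploited only by testing it against
  differentials of smooth functions.

  The main obstacle is the integral constraint. For an ergodic measure living on a single static
  class one has h(y,x) + h(x,y) = 0 on its support, so the double integral of h vanishes and the
  constraint follows by integrating the definition of the operator once more. Without a flow there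
  is no ergodic decomposition; cutting a measure into small pieces replaces it. The weight \<sigma>
  causes no harm, because each normalised piece competes in the infimum with the same weight.

  The inclusion of all solutions in the image comes in the stronger form that the operator fixes
  every solution.\<close>

lemma convex_subgradient_exists:
  fixes f :: "'a::euclidean_space \<Rightarrow> real"
  assumes "convex_on UNIV f"
  obtains v where "\<And>q. f q \<ge> f p + v \<bullet> (q - p)"
proof -
  \<comment> \<open>The strict epigraph, translated so that the point over p becomes the origin.
    Being strict, it omits the origin, which a hyperplane then separates from it.\<close>
  define S where "S = {(y, s). s > f (y + p) - f p}"
  have "convex S"
  proof (rule convexI)
    fix x y :: "'a \<times> real" and u v :: real
    assume x: "x \<in> S" and y: "y \<in> S" and uv: "0 \<le> u" "0 \<le> v" "u + v = 1"
    have eq: "u *\<^sub>R fst x + v *\<^sub>R fst y + p = u *\<^sub>R (fst x + p) + v *\<^sub>R (fst y + p)"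
      using uv(3) by (simp add: scaleR_add_right algebra_simps flip: scaleR_add_left)
    have "f (u *\<^sub>R fst x + v *\<^sub>R fst y + p) \<le> u * f (fst x + p) + v * f (fst y + p)"
      unfolding eq using assms uv by (simp add: convex_on_def)
    moreover have "u * f (fst x + p) + v * f (fst y + p) - f p
        = u * (f (fst x + p) - f p) + v * (f (fst y + p) - f p)"
    proof -
      have "f p = u * f p + v * f p" using uv(3) by (metis distrib_right mult_1)
      then show ?thesis by (simp add: right_diff_distrib)
    qed
    moreover have "u * (f (fst x + p) - f p) + v * (f (fst y + p) - f p) < u * snd x + v * snd y"
    proof (cases "u = 0")
      case True
      then show ?thesis using y uv by (auto simp: S_def)
    next
      case False
      then show ?thesis using x y uv
        by (intro add_less_le_mono mult_strict_left_mono mult_left_mono) (auto simp: S_def)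
    qed
    ultimately have "f (u *\<^sub>R fst x + v *\<^sub>R fst y + p) - f p < u * snd x + v * snd y"
      by linarith
    then show "u *\<^sub>R x + v *\<^sub>R y \<in> S"
      by (simp add: S_def case_prod_beta)
  qed
  moreover have "0 \<notin> S" by (auto simp: S_def zero_prod_def)
  ultimately have "\<exists>a. a \<noteq> 0 \<and> (\<forall>x\<in>S. 0 \<le> a \<bullet> x)"
    by (rule separating_hyperplane_set_0)
  then obtain a where a: "a \<noteq> 0" "\<And>x. x \<in> S \<Longrightarrow> 0 \<le> a \<bullet> x"
    by auto
  obtain \<alpha> \<beta> where ab: "a = (\<alpha>, \<beta>)" by (cases a)
  have *: "0 \<le> \<alpha> \<bullet> y + \<beta> * s" if "s > f (y + p) - f p" for y s
    using a(2)[of "(y, s)"] that by (simp add: S_def ab inner_Pair)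
  have "\<beta> \<ge> 0"
    using *[of 0 1] by simp
  \<comment> \<open>The hyperplane cannot be vertical because f is finite in the direction -\<alpha>
    too.\<close>
  moreover have "\<beta> \<noteq> 0"
  proof
    assume "\<beta> = 0"
    then have "0 \<le> \<alpha> \<bullet> (- \<alpha>)"
      using *[of "- \<alpha>" "f (- \<alpha> + p) - f p + 1"] by simp
    then have "\<alpha> = 0" by (metis inner_minus_right inner_gt_zero_iff neg_0_le_iff_le not_le)
    with \<open>\<beta> = 0\<close> a(1) show False by (simp add: ab zero_prod_def)
  qed
  ultimately have "\<beta> > 0" by simp
  have "f q \<ge> f p + (- (1 / \<beta>) *\<^sub>R \<alpha>) \<bullet> (q - p)" for q
  proof -
    have "f q - f p \<ge> - (\<alpha> \<bullet> (q - p)) / \<beta>"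
    proof (rule dense_ge)
      fix s assume "f q - f p < s"
      then have "0 \<le> \<alpha> \<bullet> (q - p) + \<beta> * s"
        using *[where y = "q - p" and s = s] by simp
      then show "- (\<alpha> \<bullet> (q - p)) / \<beta> \<le> s"
        using \<open>\<beta> > 0\<close> by (simp add: field_simps)
    qed
    then show ?thesis by simp
  qed
  then show thesis using that by blast
qed

text \<open>C1 regularity with the gradient as an explicit argument, so that the rules for products
  and compositions produce the gradient along with the function. The derivative is taken in the full
  space, so S is meant to be open.\<close>

definition grad_on :: "('a::euclidean_space \<Rightarrow> real) \<Rightarrow> ('a \<Rightarrow> 'a) \<Rightarrow> 'a set \<Rightarrow> bool" where
  "grad_on f D S \<longleftrightarrow>
     (\<forall>x\<in>S. (f has_derivative (\<lambda>v. D x \<bullet> v)) (at x)) \<and> continuous_on S D"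

lemma grad_onD: "grad_on f D S \<Longrightarrow> x \<in> S \<Longrightarrow> (f has_derivative (\<lambda>v. D x \<bullet> v)) (at x)"
  by (simp add: grad_on_def)

lemma grad_on_subset: "grad_on f D S \<Longrightarrow> T \<subseteq> S \<Longrightarrow> grad_on f D T"
  by (auto simp: grad_on_def intro: continuous_on_subset)

lemma grad_on_imp_continuous_on: "grad_on f D S \<Longrightarrow> continuous_on S f"
  unfolding grad_on_def
  by (meson continuous_at_imp_continuous_on has_derivative_continuous)

lemma grad_on_const: "grad_on (\<lambda>_. a) (\<lambda>_. 0) S"
  by (auto simp: grad_on_def)

lemma grad_on_add:
  "grad_on f D S \<Longrightarrow> grad_on g E S \<Longrightarrow> grad_on (\<lambda>x. f x + g x) (\<lambda>x. D x + E x) S"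
  unfolding grad_on_def
  by (auto intro!: continuous_intros has_derivative_eq_rhs[OF has_derivative_add] simp: inner_add_left)

lemma grad_on_mult:
  assumes "grad_on f D S" "grad_on g E S"
  shows "grad_on (\<lambda>x. f x * g x) (\<lambda>x. f x *\<^sub>R E x + g x *\<^sub>R D x) S"
  using assms grad_on_imp_continuous_on[OF assms(1)] grad_on_imp_continuous_on[OF assms(2)]
  unfolding grad_on_def
  by (auto intro!: continuous_intros has_derivative_eq_rhs[OF has_derivative_mult]
      simp: inner_add_left algebra_simps)

lemma grad_on_compose_real:
  fixes \<theta> \<theta>' :: "real \<Rightarrow> real"
  assumes "grad_on f D S" "\<And>x. x \<in> S \<Longrightarrow> (\<theta> has_real_derivative \<theta>' (f x)) (at (f x))"
    and "continuous_on (f ` S) \<theta>'"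
  shows "grad_on (\<lambda>x. \<theta> (f x)) (\<lambda>x. \<theta>' (f x) *\<^sub>R D x) S"
  unfolding grad_on_def
proof (intro conjI ballI)
  fix x assume x: "x \<in> S"
  show "((\<lambda>x. \<theta> (f x)) has_derivative (\<lambda>v. \<theta>' (f x) *\<^sub>R D x \<bullet> v)) (at x)"
    using has_derivative_compose[OF grad_onD[OF assms(1) x] assms(2)[OF x, unfolded has_field_derivative_def]]
    by simp
next
  show "continuous_on S (\<lambda>x. \<theta>' (f x) *\<^sub>R D x)"
    using assms(1) continuous_on_compose2[OF assms(3) grad_on_imp_continuous_on[OF assms(1)]]
    by (intro continuous_intros) (auto simp: grad_on_def)
qed

lemma grad_on_inner: "grad_on (\<lambda>x. (x - a) \<bullet> b) (\<lambda>_. b) S"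
  unfolding grad_on_def by (auto intro!: derivative_eq_intros simp: inner_commute)

lemma grad_on_norm2: "grad_on (\<lambda>x. (x - a) \<bullet> (x - a)) (\<lambda>x. 2 *\<^sub>R (x - a)) S"
  unfolding grad_on_def
  by (auto intro!: continuous_intros derivative_eq_intros simp: inner_commute)

subsection \<open>A continuously differentiable cut-off function\<close>

definition sqpos :: "real \<Rightarrow> real" where
  "sqpos t = (max 0 t)\<^sup>2"

lemma sqpos_nonneg [simp]: "sqpos t \<ge> 0"
  by (simp add: sqpos_def)

lemma sqpos_pos_iff: "sqpos t > 0 \<longleftrightarrow> t > 0"
  by (auto simp: sqpos_def max_def)

lemma sqpos_eq_0: "t \<le> 0 \<Longrightarrow> sqpos t = 0"
  by (simp add: sqpos_def max_def)

lemma has_derivative_sqpos: "(sqpos has_real_derivative 2 * max 0 t) (at t)"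
proof -
  consider "t > 0" | "t < 0" | "t = 0" by linarith
  then show ?thesis
  proof cases
    case 1
    have "((\<lambda>t. t\<^sup>2) has_real_derivative 2 * max 0 t) (at t)"
      using 1 by (auto intro!: derivative_eq_intros)
    then show ?thesis
      using 1 by (elim has_field_derivative_transform_within_open[where S = "{0<..}"])
        (auto simp: sqpos_def)
  next
    case 2
    have "((\<lambda>t. 0) has_real_derivative 2 * max 0 t) (at t)"
      using 2 by (auto intro!: derivative_eq_intros)
    then show ?thesis
      using 2 by (elim has_field_derivative_transform_within_open[where S = "{..<0}"])
        (auto simp: sqpos_def)
  next
    case 3
    have "((\<lambda>h. (sqpos (0 + h) - sqpos 0) / h) \<longlongrightarrow> 0) (at 0)"
    proof (rule Lim_null_comparison)
      show "\<forall>\<^sub>F h in at 0. norm ((sqpos (0 + h) - sqpos 0) / h) \<le> \<bar>h\<bar>"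
        by (intro always_eventually allI) (auto simp: sqpos_def max_def power2_eq_square)
      show "((\<lambda>h. \<bar>h\<bar>) \<longlongrightarrow> (0::real)) (at 0)"
        by (auto intro: tendsto_eq_intros)
    qed
    then show ?thesis by (simp add: 3 DERIV_def)
  qed
qed

lemma continuous_on_sqpos: "continuous_on S sqpos"
  unfolding sqpos_def by (intro continuous_intros)

text \<open>The denominator never vanishes since t and 1 - t are not both nonpositive. Test
  functions only have to be C1, so squares of positive parts serve in place of a smooth
  profile.\<close>

definition cutoff :: "real \<Rightarrow> real" where
  "cutoff t = sqpos (1 - t) / (sqpos t + sqpos (1 - t))"

definition cutoff' :: "real \<Rightarrow> real" where
  "cutoff' t = (- 2 * max 0 (1 - t) * (sqpos t + sqpos (1 - t))
      - sqpos (1 - t) * (2 * max 0 t - 2 * max 0 (1 - t))) / (sqpos t + sqpos (1 - t))\<^sup>2"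

lemma sqpos_sum_pos: "sqpos t + sqpos (1 - t) > 0"
proof -
  have "sqpos t > 0 \<or> sqpos (1 - t) > 0" by (simp add: sqpos_pos_iff) linarith
  then show ?thesis using sqpos_nonneg[of t] sqpos_nonneg[of "1 - t"] by linarith
qed

lemma has_derivative_cutoff: "(cutoff has_real_derivative cutoff' t) (at t)"
proof -
  have 1: "((\<lambda>t. sqpos (1 - t)) has_real_derivative - 2 * max 0 (1 - t)) (at t)"
  proof -
    have "((\<lambda>t. 1 - t) has_real_derivative - 1) (at t)"
      by (auto intro!: derivative_eq_intros)
    from DERIV_chain2[where f = sqpos, OF has_derivative_sqpos this] show ?thesis by simp
  qed
  have ne: "sqpos t + sqpos (1 - t) \<noteq> 0"
    using sqpos_sum_pos[of t] by simp
  show ?thesis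
    unfolding cutoff_def[abs_def]
    by (rule DERIV_cong[OF DERIV_divide[OF 1 DERIV_add[OF has_derivative_sqpos 1] ne]])
      (simp add: cutoff'_def power2_eq_square)
qed

lemma continuous_on_cutoff': "continuous_on S cutoff'"
proof -
  have ne: "sqpos t + sqpos (1 - t) \<noteq> 0" for t using sqpos_sum_pos[of t] by simp
  have c1: "continuous_on S (\<lambda>t. sqpos (1 - t))"
    by (rule continuous_on_compose2[OF continuous_on_sqpos[of UNIV]]) (auto intro!: continuous_intros)
  have c2: "continuous_on S (\<lambda>t::real. max 0 t)" "continuous_on S (\<lambda>t::real. max 0 (1 - t))"
    by (intro continuous_intros)+
  show ?thesis
    unfolding cutoff'_def
    by (rule continuous_on_divide)
      (auto simp: ne intro!: continuous_on_mult continuous_on_diff continuous_on_add continuous_on_power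
        continuous_on_sqpos c1 c2 continuous_on_const continuous_on_minus)
qed

lemma cutoff_eq_1: "t \<le> 0 \<Longrightarrow> cutoff t = 1"
  using sqpos_sum_pos[of t] by (simp add: cutoff_def sqpos_eq_0)

lemma cutoff_eq_0: "t \<ge> 1 \<Longrightarrow> cutoff t = 0"
  by (simp add: cutoff_def sqpos_eq_0)

lemma cutoff_nonneg [simp]: "cutoff t \<ge> 0"
  by (simp add: cutoff_def)

lemma cutoff_le_1 [simp]: "cutoff t \<le> 1"
  using sqpos_sum_pos[of t] by (simp add: cutoff_def divide_le_eq)

lemma grad_on_cutoff_norm:
  assumes "a > 0"
  shows "\<exists>D. grad_on (\<lambda>x::'a::euclidean_space. cutoff (((x - z) \<bullet> (x - z)) / a - b)) D S"
proof -
  have 1: "grad_on (\<lambda>x::'a. (1 / a) * ((x - z) \<bullet> (x - z)) + (- b))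
      (\<lambda>x. ((1 / a) *\<^sub>R (2 *\<^sub>R (x - z)) + ((x - z) \<bullet> (x - z)) *\<^sub>R 0) + 0) S"
    by (intro grad_on_add grad_on_mult grad_on_norm2 grad_on_const)
  show ?thesis
    using grad_on_compose_real[OF 1 has_derivative_cutoff continuous_on_cutoff'] by auto
qed

text \<open>The squared distance is rescaled affinely so that r squared goes to 0 and s squared to
  1; using the square keeps the function differentiable at the centre.\<close>

definition bump :: "'a::euclidean_space \<Rightarrow> real \<Rightarrow> real \<Rightarrow> 'a \<Rightarrow> real" where
  "bump z r s x = cutoff (((x - z) \<bullet> (x - z)) / (s\<^sup>2 - r\<^sup>2) - r\<^sup>2 / (s\<^sup>2 - r\<^sup>2))"

lemma bump_grad: "0 < r \<Longrightarrow> r < s \<Longrightarrow> \<exists>D. grad_on (bump z r s) D S"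
  unfolding bump_def[abs_def]
  by (rule grad_on_cutoff_norm) (auto intro!: power_strict_mono)

lemma bump_nonneg [simp]: "bump z r s x \<ge> 0" and bump_le_1 [simp]: "bump z r s x \<le> 1"
  by (simp_all add: bump_def)

lemma bump_eq_1:
  assumes "0 < r" "r < s" "dist z x \<le> r" shows "bump z r s x = 1"
proof -
  have "r\<^sup>2 < s\<^sup>2" using assms by (intro power_strict_mono) auto
  have "(x - z) \<bullet> (x - z) \<le> r\<^sup>2"
    using assms by (metis dist_commute dist_norm power2_norm_eq_inner power_mono norm_ge_zero)
  then show ?thesis unfolding bump_def
    using \<open>r\<^sup>2 < s\<^sup>2\<close> by (intro cutoff_eq_1) (simp add: divide_right_mono)
qed

lemma bump_eq_0:
  assumes "0 < r" "r < s" "dist z x \<ge> s" shows "bump z r s x = 0"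
proof -
  have "r\<^sup>2 < s\<^sup>2" using assms by (intro power_strict_mono) auto
  have "(x - z) \<bullet> (x - z) \<ge> s\<^sup>2"
    using assms by (smt (verit) dist_commute dist_norm power2_norm_eq_inner power_mono)
  then show ?thesis unfolding bump_def
    using \<open>r\<^sup>2 < s\<^sup>2\<close> by (intro cutoff_eq_0) (simp add: le_divide_eq flip: diff_divide_distrib)
qed

subsection \<open>Mollification\<close>

lemma lborel_integral_reflect:
  fixes f :: "'a::euclidean_space \<Rightarrow> real"
  assumes [measurable]: "f \<in> borel_measurable borel"
  shows "(\<integral>x. f x \<partial>lborel) = (\<integral>x. f (z - x) \<partial>lborel)"
proof -
  have "lborel = distr lborel borel (\<lambda>x::'a. z - x)"
    using lborel_affine[of "-1" z] by (simp add: density_1)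
  then have "(\<integral>x. f x \<partial>lborel) = (\<integral>x. f x \<partial>distr lborel borel (\<lambda>x::'a. z - x))"
    by simp
  also have "\<dots> = (\<integral>x. f (z - x) \<partial>lborel)"
    by (rule integral_distr) simp_all
  finally show ?thesis .
qed

text \<open>In place of a convergence statement, the two conclusions say that increments and values
  of F are averages of those of W over shifts of length at most \<epsilon>. One-sided bounds on
  increments are exactly what subsolutions provide, and in this form they pass to F.\<close>

lemma mollification:
  fixes W :: "'a::euclidean_space \<Rightarrow> real"
  assumes W: "continuous_on UNIV W" and "\<epsilon> > 0"
  obtains F D where "grad_on F D (ball z0 R)"
    and "\<And>z z' k. z \<in> ball z0 R \<Longrightarrow> z' \<in> ball z0 R
      \<Longrightarrow> (\<And>\<zeta>. norm \<zeta> \<le> \<epsilon> \<Longrightarrow> W (z' - \<zeta>) - W (z - \<zeta>) \<le> k) \<Longrightarrow> F z' - F z \<le> k"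
    and "\<And>z a k. z \<in> ball z0 R \<Longrightarrow> (\<And>\<zeta>. norm \<zeta> \<le> \<epsilon> \<Longrightarrow> \<bar>W (z - \<zeta>) - a\<bar> \<le> k)
      \<Longrightarrow> \<bar>F z - a\<bar> \<le> k"
proof -
  define \<rho> :: "'a \<Rightarrow> real" where "\<rho> y = sqpos (\<epsilon>\<^sup>2 - y \<bullet> y)" for y
  define \<rho>' :: "'a \<Rightarrow> 'a" where "\<rho>' y = (2 * max 0 (\<epsilon>\<^sup>2 - y \<bullet> y)) *\<^sub>R (- 2 *\<^sub>R y)" for y
  have \<rho>0: "\<rho> y = 0" if "norm y > \<epsilon>" for y
  proof -
    have "\<epsilon>\<^sup>2 \<le> (norm y)\<^sup>2" using that \<open>\<epsilon> > 0\<close> by (intro power_mono) auto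
    then show ?thesis by (simp add: \<rho>_def sqpos_eq_0 power2_norm_eq_inner)
  qed
  have \<rho>_nonneg: "\<rho> y \<ge> 0" for y by (simp add: \<rho>_def)
  have \<rho>_cont: "continuous_on S \<rho>" for S
    unfolding \<rho>_def by (intro continuous_intros continuous_on_compose2[OF continuous_on_sqpos[of UNIV]]) auto
  have \<rho>_deriv: "(\<rho> has_derivative (\<lambda>v. \<rho>' y \<bullet> v)) (at y)" for y
  proof -
    have "grad_on (\<lambda>y::'a. (- 1) * ((y - 0) \<bullet> (y - 0)) + \<epsilon>\<^sup>2)
        (\<lambda>y. ((- 1) *\<^sub>R (2 *\<^sub>R (y - 0)) + ((y - 0) \<bullet> (y - 0)) *\<^sub>R 0) + 0) UNIV"
      by (intro grad_on_add grad_on_mult grad_on_norm2 grad_on_const)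
    then have "grad_on (\<lambda>y::'a. \<epsilon>\<^sup>2 - y \<bullet> y) (\<lambda>y. - 2 *\<^sub>R y) UNIV"
      by simp
    from grad_on_compose_real[OF this has_derivative_sqpos]
    have "grad_on \<rho> \<rho>' UNIV"
      by (force simp: \<rho>_def[abs_def] \<rho>'_def[abs_def] intro!: continuous_intros)
    then show ?thesis by (simp add: grad_on_def)
  qed
  have \<rho>'_cont: "continuous_on S \<rho>'" for S
    unfolding \<rho>'_def by (intro continuous_intros)
  obtain b where "ball z0 (\<bar>R\<bar> + \<epsilon> + 1) \<subseteq> cbox (- b) b"
    using bounded_subset_cbox_symmetric[OF bounded_ball] by blast
  then have b: "t \<in> cbox (- b) b" if "dist z0 t < \<bar>R\<bar> + \<epsilon> + 1" for t
    using that by auto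
  define Q where "Q = cbox (- b) b"
  have int\<rho>: "integrable lborel (\<lambda>\<zeta>. \<rho> \<zeta> * \<phi> \<zeta>)" if "continuous_on UNIV \<phi>" for \<phi>
  proof -
    have "integrable lborel (\<lambda>\<zeta>. indicator (cball 0 \<epsilon>) \<zeta> *\<^sub>R (\<rho> \<zeta> * \<phi> \<zeta>))"
      by (intro borel_integrable_compact continuous_intros \<rho>_cont continuous_on_subset[OF that]) auto
    then show ?thesis
      by (rule back_subst[where P = "integrable lborel"]) (auto simp: indicator_def \<rho>0 intro!: ext)
  qed
  define N where "N = (\<integral>\<zeta>. \<rho> \<zeta> \<partial>lborel)"
  have intN: "integrable lborel \<rho>"
    using int\<rho>[of "\<lambda>_. 1"] by simp
  have "N > 0"
  proof -
    have "N \<noteq> 0"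
    proof
      assume "N = 0"
      then have "AE \<zeta> in lborel. \<rho> \<zeta> = 0"
        using integral_nonneg_eq_0_iff_AE[OF intN] \<rho>_nonneg by (simp add: N_def)
      moreover have "\<rho> \<zeta> \<noteq> 0" if "\<zeta> \<in> ball 0 \<epsilon>" for \<zeta>
      proof -
        have "(norm \<zeta>)\<^sup>2 < \<epsilon>\<^sup>2" using that by (intro power_strict_mono) auto
        then have "\<rho> \<zeta> > 0" by (simp add: \<rho>_def sqpos_pos_iff power2_norm_eq_inner)
        then show ?thesis by simp
      qed
      ultimately have "AE \<zeta> in lborel. \<zeta> \<notin> ball (0::'a) \<epsilon>"
        by (auto elim!: eventually_mono)
      then have "emeasure lborel (ball (0::'a) \<epsilon>) = 0"
        by (subst (asm) AE_iff_measurable[where N = "ball 0 \<epsilon>"]) auto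
      then show False
        using \<open>\<epsilon> > 0\<close> content_ball_pos[of \<epsilon> "0::'a"] by (simp add: measure_def)
    qed
    moreover have "N \<ge> 0" unfolding N_def by (rule integral_nonneg_AE) (simp add: \<rho>_nonneg)
    ultimately show ?thesis by simp
  qed
  \<comment> \<open>The derivative has to fall on the kernel, since W is only continuous.
    Integrating over one fixed box that contains the support of the kernel for all z in the ball
    makes Leibniz' rule applicable; \<open>F_avg\<close> recovers the average of translates of
    W.\<close>
  define F where "F z = integral Q (\<lambda>t. \<rho> (z - t) * W t) / N" for z
  have F_avg: "F z = (\<integral>\<zeta>. \<rho> \<zeta> * W (z - \<zeta>) \<partial>lborel) / N" if z: "z \<in> ball z0 R" for z
  proof -
    have cont: "continuous_on S (\<lambda>t. \<rho> (z - t) * W t)" for S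
      by (intro continuous_intros continuous_on_compose2[OF \<rho>_cont[of UNIV]] continuous_on_subset[OF W]) auto
    have "integral Q (\<lambda>t. \<rho> (z - t) * W t) = (\<integral>t. indicator Q t *\<^sub>R (\<rho> (z - t) * W t) \<partial>lborel)"
      using set_borel_integral_eq_integral(2)[of Q "\<lambda>t. \<rho> (z - t) * W t"]
        borel_integrable_compact[of Q, OF _ cont]
      by (simp add: set_integrable_def set_lebesgue_integral_def Q_def)
    also have "\<dots> = (\<integral>t. \<rho> (z - t) * W t \<partial>lborel)"
    proof (rule Bochner_Integration.integral_cong[OF refl])
      fix t show "indicator Q t *\<^sub>R (\<rho> (z - t) * W t) = \<rho> (z - t) * W t"
      proof (cases "norm (z - t) > \<epsilon>")
        case True then show ?thesis by (simp add: \<rho>0)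
      next
        case False
        then have "dist z0 t < \<bar>R\<bar> + \<epsilon> + 1"
          using z dist_triangle[of z0 t z] by (auto simp: dist_norm)
        then show ?thesis using b by (simp add: Q_def)
      qed
    qed
    also have "\<dots> = (\<integral>\<zeta>. \<rho> (z - (z - \<zeta>)) * W (z - \<zeta>) \<partial>lborel)"
      using cont[of UNIV] by (intro lborel_integral_reflect borel_measurable_continuous_onI)
    finally show ?thesis by (simp add: F_def)
  qed
  define fx where "fx z t = blinfun_inner_right (W t *\<^sub>R \<rho>' (z - t))" for z t
  have cont_fx: "continuous_on (UNIV \<times> Q) (\<lambda>(z, t). fx z t)"
    unfolding fx_def case_prod_beta
    by (intro continuous_intros continuous_on_compose2[OF W] continuous_on_compose2[OF \<rho>'_cont[of UNIV]]
        bounded_linear.continuous_on[OF bounded_linear_blinfun_inner_right]) auto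
  define dF where "dF z = integral Q (fx z)" for z
  have deriv: "((\<lambda>z. integral Q (\<lambda>t. \<rho> (z - t) * W t)) has_derivative blinfun_apply (dF z)) (at z)" for z
  proof -
    have "((\<lambda>z. integral (cbox (- b) b) (\<lambda>t. \<rho> (z - t) * W t))
        has_derivative blinfun_apply (integral (cbox (- b) b) (fx z))) (at z within UNIV)"
    proof (rule leibniz_rule)
      fix x t :: 'a
      have "((\<lambda>x. x - t) has_derivative (\<lambda>v. v)) (at x)"
        by (auto intro!: derivative_eq_intros)
      from has_derivative_mult_left[OF has_derivative_compose[OF this \<rho>_deriv], of "W t"]
      show "((\<lambda>x. \<rho> (x - t) * W t) has_derivative blinfun_apply (fx x t)) (at x within UNIV)"
        by (rule has_derivative_eq_rhs[OF has_derivative_transform[rotated 2]])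
          (auto simp: fx_def mult.commute[of _ "W t"])
      show "(\<lambda>t. \<rho> (x - t) * W t) integrable_on cbox (- b) b"
        by (intro integrable_continuous continuous_intros continuous_on_subset[OF W]
            continuous_on_compose2[OF \<rho>_cont[of UNIV]]) auto
    qed (use cont_fx in \<open>auto simp: Q_def\<close>)
    then show ?thesis by (simp add: dF_def Q_def)
  qed
  have cont_dF: "continuous_on UNIV dF"
    unfolding dF_def Q_def
    by (rule integral_continuous_on_param) (use cont_fx Q_def in auto)
  define D where "D z = (\<Sum>i\<in>Basis. (dF z i / N) *\<^sub>R i)" for z
  have D: "D z \<bullet> v = dF z v / N" for z v
  proof -
    have "dF z v = dF z (\<Sum>i\<in>Basis. (v \<bullet> i) *\<^sub>R i)" by (simp add: euclidean_representation)
    also have "\<dots> = (\<Sum>i\<in>Basis. (v \<bullet> i) * dF z i)"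
      by (simp add: blinfun.sum_right blinfun.scaleR_right)
    finally show ?thesis
      by (simp add: D_def inner_sum_left sum_divide_distrib) (simp add: inner_commute[of _ v] mult.commute)
  qed
  have 1: "grad_on F D (ball z0 R)"
    unfolding grad_on_def
  proof (intro conjI ballI)
    fix z
    show "(F has_derivative (\<lambda>v. D z \<bullet> v)) (at z)"
      unfolding F_def D using has_derivative_mult_left[OF deriv, of "1 / N"] by simp
  next
    show "continuous_on (ball z0 R) D"
      unfolding D_def using \<open>N > 0\<close>
      by (intro continuous_intros continuous_on_subset[OF cont_dF]) auto
  qed
  have cW: "continuous_on UNIV (\<lambda>\<zeta>. W (z - \<zeta>))" for z
    by (intro continuous_on_compose2[OF W] continuous_intros) auto
  have 2: "F z' - F z \<le> k" if z: "z \<in> ball z0 R" "z' \<in> ball z0 R"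
    and k: "\<And>\<zeta>. norm \<zeta> \<le> \<epsilon> \<Longrightarrow> W (z' - \<zeta>) - W (z - \<zeta>) \<le> k" for z z' k
  proof -
    have "(\<integral>\<zeta>. \<rho> \<zeta> * W (z' - \<zeta>) \<partial>lborel) \<le> (\<integral>\<zeta>. \<rho> \<zeta> * W (z - \<zeta>) + \<rho> \<zeta> * k \<partial>lborel)"
    proof (rule integral_mono)
      fix \<zeta>
      show "\<rho> \<zeta> * W (z' - \<zeta>) \<le> \<rho> \<zeta> * W (z - \<zeta>) + \<rho> \<zeta> * k"
        using k[of \<zeta>] \<rho>0[of \<zeta>] mult_left_mono[OF _ \<rho>_nonneg[of \<zeta>], of "W (z' - \<zeta>)" "W (z - \<zeta>) + k"]
        by (cases "norm \<zeta> \<le> \<epsilon>") (auto simp: algebra_simps)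
    qed (intro int\<rho> cW Bochner_Integration.integrable_add continuous_on_const)+
    also have "\<dots> = (\<integral>\<zeta>. \<rho> \<zeta> * W (z - \<zeta>) \<partial>lborel) + N * k"
      by (subst Bochner_Integration.integral_add) (auto simp: N_def intro: int\<rho> cW intN)
    finally show ?thesis using \<open>N > 0\<close> by (simp add: F_avg[OF z(1)] F_avg[OF z(2)] field_simps)
  qed
  have 3: "\<bar>F z - a\<bar> \<le> k" if z: "z \<in> ball z0 R"
    and k: "\<And>\<zeta>. norm \<zeta> \<le> \<epsilon> \<Longrightarrow> \<bar>W (z - \<zeta>) - a\<bar> \<le> k" for z a k
  proof -
    have "(\<integral>\<zeta>. \<rho> \<zeta> * W (z - \<zeta>) \<partial>lborel) \<le> (\<integral>\<zeta>. \<rho> \<zeta> * (a + k) \<partial>lborel)"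
    proof (rule integral_mono)
      fix \<zeta>
      show "\<rho> \<zeta> * W (z - \<zeta>) \<le> \<rho> \<zeta> * (a + k)"
        using k[of \<zeta>] \<rho>0[of \<zeta>] \<rho>_nonneg[of \<zeta>]
        by (cases "norm \<zeta> \<le> \<epsilon>") (auto intro!: mult_left_mono)
    qed (intro int\<rho> cW continuous_on_const)+
    moreover have "(\<integral>\<zeta>. \<rho> \<zeta> * (a - k) \<partial>lborel) \<le> (\<integral>\<zeta>. \<rho> \<zeta> * W (z - \<zeta>) \<partial>lborel)"
    proof (rule integral_mono)
      fix \<zeta>
      show "\<rho> \<zeta> * (a - k) \<le> \<rho> \<zeta> * W (z - \<zeta>)"
        using k[of \<zeta>] \<rho>0[of \<zeta>] \<rho>_nonneg[of \<zeta>]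
        by (cases "norm \<zeta> \<le> \<epsilon>") (auto intro!: mult_left_mono)
    qed (intro int\<rho> cW continuous_on_const)+
    moreover have "(\<integral>\<zeta>. \<rho> \<zeta> * x \<partial>lborel) = N * x" for x
      by (simp add: N_def)
    ultimately have "(\<integral>\<zeta>. \<rho> \<zeta> * W (z - \<zeta>) \<partial>lborel) \<le> N * (a + k)"
      "N * (a - k) \<le> (\<integral>\<zeta>. \<rho> \<zeta> * W (z - \<zeta>) \<partial>lborel)"
      by metis+
    then show ?thesis
      using \<open>N > 0\<close> unfolding F_avg[OF z] abs_le_iff by (auto simp: field_simps)
  qed
  show thesis using that[OF 1 2 3] by blast
qed

subsection \<open>Monotone functions are differentiable almost everywhere\<close>

lemma negligible_if_countable: "countable S \<Longrightarrow> negligible (S :: real set)"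
  using null_sets_completionI[OF countable_imp_null_set_lborel] by (simp add: negligible_iff_null_sets)

text \<open>Points contained in arbitrarily short open intervals of slope above q. Using intervals
  around the point rather than quotients at the point makes the set a countable intersection of open
  sets, hence Borel. Points with arbitrarily short intervals of slope below p are those of
  \<open>steep (\<lambda>x. - F x) (- p)\<close>.\<close>

definition steep :: "(real \<Rightarrow> real) \<Rightarrow> real \<Rightarrow> real set" where
  "steep F q = (\<Inter>n. \<Union>{{u<..<v} |u v. u < v \<and> v - u < inverse (real (Suc n)) \<and> F v - F u > q * (v - u)})"

lemma steep_borel [measurable]: "steep F q \<in> sets borel"
  unfolding steep_def by (rule sets.countable_INT'') (auto intro!: borel_open open_Union)

lemma steepD:
  assumes "x \<in> steep F q" "e > 0"
  obtains u v where "u < x" "x < v" "v - u < e" "F v - F u > q * (v - u)"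
proof -
  obtain n where "inverse (real (Suc n)) < e" using reals_Archimedean[OF \<open>e > 0\<close>] by blast
  moreover have "x \<in> \<Union>{{u<..<v} |u v. u < v \<and> v - u < inverse (real (Suc n)) \<and> F v - F u > q * (v - u)}"
    using assms(1) by (auto simp: steep_def)
  ultimately show thesis using that by (auto intro: less_trans)
qed

lemma not_steepD:
  assumes "x \<notin> steep F q"
  obtains e where "e > 0" "\<And>u v. u < x \<Longrightarrow> x < v \<Longrightarrow> v - u < e \<Longrightarrow> F v - F u \<le> q * (v - u)"
proof -
  obtain n where n: "x \<notin> \<Union>{{u<..<v} |u v. u < v \<and> v - u < inverse (real (Suc n)) \<and> F v - F u > q * (v - u)}"
    using assms by (auto simp: steep_def)
  show thesis
  proof (rule that[of "inverse (real (Suc n))"])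
    fix u v assume "u < x" "x < v" "v - u < inverse (real (Suc n))"
    moreover from this have "u < v" by simp
    moreover have "\<not> (u < v \<and> v - u < inverse (real (Suc n)) \<and> F v - F u > q * (v - u)) \<or> x \<notin> {u<..<v}"
      using n by blast
    ultimately show "F v - F u \<le> q * (v - u)" by simp
  qed simp
qed

text \<open>Intervals are closed balls around their midpoints, so the Vitali theorem for balls
  applies; shrinking them first keeps them inside Ob.\<close>

lemma Vitali_covering_intervals:
  fixes S :: "real set"
  assumes S: "\<And>x e. x \<in> S \<Longrightarrow> e > 0 \<Longrightarrow> \<exists>u v. u < x \<and> x < v \<and> v - u < e \<and> P u v"
    and Ob: "open Ob" "S \<subseteq> Ob"
  obtains C where "countable C" "\<And>u v. (u, v) \<in> C \<Longrightarrow> u < v \<and> {u..v} \<subseteq> Ob \<and> P u v"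
    "disjoint_family_on (\<lambda>(u, v). {u..v}) C" "negligible (S - (\<Union>(u, v)\<in>C. {u..v}))"
proof -
  define K where "K = {(u, v). u < v \<and> {u..v} \<subseteq> Ob \<and> P u v}"
  have cb: "cball ((fst i + snd i) / 2) ((snd i - fst i) / 2) = {fst i..snd i}" for i :: "real \<times> real"
    by (auto simp: cball_def dist_real_def abs_if field_simps split: if_splits)
  obtain C where C: "countable C" "C \<subseteq> K"
     "pairwise (\<lambda>i j. disjnt (cball ((fst i + snd i) / 2) ((snd i - fst i) / 2))
        (cball ((fst j + snd j) / 2) ((snd j - fst j) / 2))) C"
     "negligible(S - (\<Union>i \<in> C. cball ((fst i + snd i) / 2) ((snd i - fst i) / 2)))"
  proof (rule Vitali_covering_theorem_cballs[of K "\<lambda>i. (snd i - fst i) / 2" S "\<lambda>i. (fst i + snd i) / 2"])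
    fix x d :: real assume x: "x \<in> S" and "0 < d"
    obtain e where e: "e > 0" "ball x e \<subseteq> Ob"
      using Ob x by (meson open_contains_ball subsetD)
    obtain u v where uv: "u < x" "x < v" "v - u < min d e" "P u v"
      using S[OF x, of "min d e"] \<open>0 < d\<close> \<open>e > 0\<close> by auto
    have "{u..v} \<subseteq> ball x e" using uv by (auto simp: dist_real_def)
    then show "\<exists>i. i \<in> K \<and> x \<in> cball ((fst i + snd i) / 2) ((snd i - fst i) / 2) \<and> (snd i - fst i) / 2 < d"
      using uv e by (intro exI[of _ "(u, v)"]) (auto simp only: cb, auto simp: K_def)
  qed (auto simp: K_def)
  show thesis
  proof (rule that[OF C(1)])
    show "u < v \<and> {u..v} \<subseteq> Ob \<and> P u v" if "(u, v) \<in> C" for u v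
      using that C(2) by (auto simp: K_def)
    show "disjoint_family_on (\<lambda>(u, v). {u..v}) C"
      using C(3) unfolding cb disjoint_family_on_def pairwise_def disjnt_def by (auto simp: case_prod_beta)
    show "negligible (S - (\<Union>(u, v)\<in>C. {u..v}))"
      using C(4) unfolding cb by (simp add: case_prod_beta)
  qed
qed

context
  fixes F :: "real \<Rightarrow> real"
  assumes mono: "\<And>x y. x \<le> y \<Longrightarrow> F x \<le> F y" and cont: "continuous_on UNIV F"
begin

lemma emeasure_F_Icc: "u \<le> v \<Longrightarrow> emeasure (interval_measure F) {u..v} = ennreal (F v - F u)"
  by (rule emeasure_interval_measure_Icc[OF _ mono cont])

text \<open>On each interval of a Vitali covering by steep intervals the Stieltjes measure of F
  exceeds q times the length, and these disjoint intervals exhaust E up to a null set.\<close>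

lemma steep_emeasure_le:
  assumes Ob: "open Ob" "E \<subseteq> Ob" and E: "E \<in> sets borel" "E \<subseteq> steep F q" and "q \<ge> 0"
  shows "ennreal q * emeasure lborel E \<le> emeasure (interval_measure F) Ob"
proof -
  obtain C where C: "countable C" "\<And>u v. (u, v) \<in> C \<Longrightarrow> u < v \<and> {u..v} \<subseteq> Ob \<and> F v - F u > q * (v - u)"
    "disjoint_family_on (\<lambda>(u, v). {u..v}) C" "negligible (E - (\<Union>(u, v)\<in>C. {u..v}))"
  proof (rule Vitali_covering_intervals[where S = E and Ob = Ob and P = "\<lambda>u v. F v - F u > q * (v - u)"])
    fix x e :: real assume "x \<in> E" "e > 0"
    then show "\<exists>u v. u < x \<and> x < v \<and> v - u < e \<and> q * (v - u) < F v - F u"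
      using E(2) by (meson steepD subsetD)
  qed (use Ob in auto)
  let ?U = "\<Union>(u, v)\<in>C. {u..v}"
  have U: "?U \<in> sets borel"
    using C(1) by (intro sets.countable_UN') auto
  have "emeasure lborel E \<le> emeasure lborel (?U \<union> (E - ?U))"
    using E(1) U by (intro emeasure_mono) auto
  also have "\<dots> \<le> emeasure lborel ?U + emeasure lborel (E - ?U)"
    using E(1) U by (intro emeasure_subadditive) auto
  also have "emeasure lborel (E - ?U) = 0"
    using C(4) E(1) U by (simp add: negligible_iff_null_sets null_sets_def emeasure_completion)
  also have "emeasure lborel ?U + 0 = (\<integral>\<^sup>+i. emeasure lborel (case i of (u, v) \<Rightarrow> {u..v}) \<partial>count_space C)"
    using C by (simp, intro emeasure_UN_countable) auto
  finally have "ennreal q * emeasure lborel E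
      \<le> ennreal q * (\<integral>\<^sup>+i. emeasure lborel (case i of (u, v) \<Rightarrow> {u..v}) \<partial>count_space C)"
    by (rule mult_left_mono) simp
  also have "\<dots> = (\<integral>\<^sup>+i. ennreal q * emeasure lborel (case i of (u, v) \<Rightarrow> {u..v}) \<partial>count_space C)"
    by (rule nn_integral_cmult[symmetric]) simp
  also have "\<dots> \<le> (\<integral>\<^sup>+i. emeasure (interval_measure F) (case i of (u, v) \<Rightarrow> {u..v}) \<partial>count_space C)"
  proof (rule nn_integral_mono, clarsimp)
    fix u v assume "(u, v) \<in> C"
    with C(2) have "u < v" "q * (v - u) < F v - F u" by blast+
    then show "ennreal q * emeasure lborel {u..v} \<le> emeasure (interval_measure F) {u..v}"
      using \<open>q \<ge> 0\<close> by (simp add: emeasure_F_Icc ennreal_leI flip: ennreal_mult)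
  qed
  also have "\<dots> = emeasure (interval_measure F) ?U"
    using C by (intro emeasure_UN_countable[symmetric]) auto
  also have "\<dots> \<le> emeasure (interval_measure F) Ob"
    using Ob(1) C(2) by (intro emeasure_mono) auto
  finally show ?thesis .
qed

text \<open>Two coverings are nested. Flat intervals inside an open set barely larger than E have
  Stieltjes measure at most p times about |E|; almost all of E lies inside them and is steep, which
  forces at least q |E|. Hence q |E| \<le> p |E| with p < q.\<close>

lemma steep_up_down_null:
  assumes "0 \<le> p" "p < q" "bounded B" "B \<in> sets borel"
  shows "emeasure lborel (steep F q \<inter> steep (\<lambda>x. - F x) (- p) \<inter> B) = 0"
proof -
  define E where "E = steep F q \<inter> steep (\<lambda>x. - F x) (- p) \<inter> B"
  have E[measurable]: "E \<in> sets borel" using assms(4) by (auto simp: E_def)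
  have fin: "emeasure lborel E < \<infinity>"
    using assms(3) by (intro emeasure_bounded_finite) (auto simp: E_def intro: bounded_subset)
  have "ennreal q * emeasure lborel E \<le> ennreal p * (emeasure lborel E + ennreal \<epsilon>)" if "\<epsilon> > 0" for \<epsilon>
  proof -
    obtain Ob where Ob: "open Ob" "E \<subseteq> Ob" "emeasure lborel (Ob - E) < ennreal \<epsilon>"
      using outer_regular_lborel[OF E \<open>\<epsilon> > 0\<close>] by blast
    obtain C where C: "countable C" "\<And>u v. (u, v) \<in> C \<Longrightarrow> u < v \<and> {u..v} \<subseteq> Ob \<and> F v - F u < p * (v - u)"
      "disjoint_family_on (\<lambda>(u, v). {u..v}) C" "negligible (E - (\<Union>(u, v)\<in>C. {u..v}))"
    proof (rule Vitali_covering_intervals[where S = E and Ob = Ob and P = "\<lambda>u v. F v - F u < p * (v - u)"])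
      fix x e :: real assume "x \<in> E" "e > 0"
      then obtain u v where "u < x" "x < v" "v - u < e" "- F v - - F u > - p * (v - u)"
        using steepD[of x "\<lambda>x. - F x" "- p" e] unfolding E_def by blast
      then show "\<exists>u v. u < x \<and> x < v \<and> v - u < e \<and> F v - F u < p * (v - u)"
        by (intro exI[of _ u] exI[of _ v]) simp
    qed (use Ob in auto)
    let ?U = "\<Union>(u, v)\<in>C. {u..v}"
    \<comment> \<open>The inner covering requires an open set, so the closed intervals are replaced
      by their interiors; only countably many endpoints are lost.\<close>
    define V where "V = (\<Union>(u, v)\<in>C. {u<..<v})"
    have U: "?U \<in> sets borel"
      using C(1) by (intro sets.countable_UN') auto
    have "open V" by (auto simp: V_def)
    have "V \<subseteq> ?U" unfolding V_def by (rule UN_mono) auto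
    have "E - V \<subseteq> (E - ?U) \<union> (fst ` C \<union> snd ` C)"
    proof
      fix x assume x: "x \<in> E - V"
      show "x \<in> (E - ?U) \<union> (fst ` C \<union> snd ` C)"
      proof (cases "x \<in> ?U")
        case True
        then obtain u v where uv: "(u, v) \<in> C" "u \<le> x" "x \<le> v" by auto
        then have "x \<notin> {u<..<v}" using x by (auto simp: V_def)
        then have "x = u \<or> x = v" using uv by auto
        then show ?thesis using uv(1) by force
      qed (use x in auto)
    qed
    moreover have "negligible ((E - ?U) \<union> (fst ` C \<union> snd ` C))"
      using C(1,4) by (intro negligible_Un[OF C(4)] negligible_if_countable countable_Un countable_image) auto
    ultimately have neg: "negligible (E - V)" by (rule negligible_subset[rotated])
    have "emeasure lborel (E - V) = 0"
      using neg \<open>open V\<close> by (simp add: negligible_iff_null_sets null_sets_def emeasure_completion)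
    have "emeasure lborel E \<le> emeasure lborel ((E \<inter> V) \<union> (E - V))"
      using \<open>open V\<close> by (intro emeasure_mono) auto
    also have "\<dots> \<le> emeasure lborel (E \<inter> V) + emeasure lborel (E - V)"
      using \<open>open V\<close> by (intro emeasure_subadditive) auto
    finally have "emeasure lborel E \<le> emeasure lborel (E \<inter> V)"
      using \<open>emeasure lborel (E - V) = 0\<close> by simp
    then have "ennreal q * emeasure lborel E \<le> ennreal q * emeasure lborel (E \<inter> V)"
      by (rule mult_left_mono) simp
    also have "\<dots> \<le> emeasure (interval_measure F) V"
      using \<open>open V\<close> assms by (intro steep_emeasure_le) (auto simp: E_def)
    also have "\<dots> \<le> emeasure (interval_measure F) ?U"
      using \<open>V \<subseteq> ?U\<close> U by (intro emeasure_mono) auto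
    also have "\<dots> = (\<integral>\<^sup>+i. emeasure (interval_measure F) (case i of (u, v) \<Rightarrow> {u..v}) \<partial>count_space C)"
      using C by (intro emeasure_UN_countable) auto
    also have "\<dots> \<le> (\<integral>\<^sup>+i. ennreal p * emeasure lborel (case i of (u, v) \<Rightarrow> {u..v}) \<partial>count_space C)"
    proof (rule nn_integral_mono, clarsimp)
      fix u v assume "(u, v) \<in> C"
      with C(2) have "u < v" "F v - F u < p * (v - u)" by blast+
      then show "emeasure (interval_measure F) {u..v} \<le> ennreal p * emeasure lborel {u..v}"
        using \<open>0 \<le> p\<close> by (simp add: emeasure_F_Icc ennreal_leI flip: ennreal_mult)
    qed
    also have "\<dots> = ennreal p * (\<integral>\<^sup>+i. emeasure lborel (case i of (u, v) \<Rightarrow> {u..v}) \<partial>count_space C)"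
      by (rule nn_integral_cmult) simp
    also have "(\<integral>\<^sup>+i. emeasure lborel (case i of (u, v) \<Rightarrow> {u..v}) \<partial>count_space C) = emeasure lborel ?U"
      using C by (intro emeasure_UN_countable[symmetric]) auto
    also have "\<dots> \<le> emeasure lborel (E \<union> (Ob - E))"
      using C(2) Ob by (intro emeasure_mono) auto
    also have "\<dots> \<le> emeasure lborel E + emeasure lborel (Ob - E)"
      using Ob by (intro emeasure_subadditive) auto
    also have "\<dots> \<le> emeasure lborel E + ennreal \<epsilon>"
      using Ob(3) by (intro add_left_mono) simp
    finally show ?thesis by (simp add: mult_left_mono)
  qed
  moreover define e where "e = enn2real (emeasure lborel E)"
  then have e: "emeasure lborel E = ennreal e" "e \<ge> 0" using fin by auto
  ultimately have *: "q * e \<le> p * (e + \<epsilon>)" if "\<epsilon> > 0" for \<epsilon>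
    using that assms by (simp add: ennreal_mult''[symmetric] flip: ennreal_plus ennreal_mult)
  have "q * e \<le> p * e"
  proof (rule field_le_epsilon)
    fix \<epsilon> :: real assume "\<epsilon> > 0"
    have "p * (\<epsilon> / (p + 1)) \<le> \<epsilon>" using \<open>\<epsilon> > 0\<close> \<open>0 \<le> p\<close> by (simp add: field_simps)
    then show "q * e \<le> p * e + \<epsilon>"
      using *[of "\<epsilon> / (p + 1)"] \<open>\<epsilon> > 0\<close> \<open>0 \<le> p\<close> by (simp add: distrib_left)
  qed
  then have "e = 0" using assms e(2) by (auto simp: mult_le_cancel_right)
  then show ?thesis using e(1) by (simp add: E_def)
qed

text \<open>Here the derivative would be infinite: n |E| is bounded for every n by the finite
  Stieltjes measure of the bounded interval.\<close>

lemma Inter_steep_null: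
  "emeasure lborel ((\<Inter>n::nat. steep F (real n)) \<inter> {-a<..<a}) = 0"
proof -
  define E where "E = (\<Inter>n::nat. steep F (real n)) \<inter> {-a<..<a}"
  have E: "E \<in> sets borel" unfolding E_def by measurable
  have fin: "emeasure (interval_measure F) {-a<..<a} < \<infinity>"
  proof -
    have "emeasure (interval_measure F) {-a<..<a} \<le> emeasure (interval_measure F) {-\<bar>a\<bar>..\<bar>a\<bar>}"
      by (intro emeasure_mono) auto
    then show ?thesis by (simp add: emeasure_F_Icc order_le_less_trans)
  qed
  have fin': "emeasure lborel E < \<infinity>"
    by (intro emeasure_bounded_finite) (auto simp: E_def intro: bounded_subset)
  define e where "e = enn2real (emeasure lborel E)"
  have e: "emeasure lborel E = ennreal e" "e \<ge> 0" using fin' by (auto simp: e_def)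
  define m where "m = enn2real (emeasure (interval_measure F) {-a<..<a})"
  have m: "emeasure (interval_measure F) {-a<..<a} = ennreal m" "m \<ge> 0" using fin by (auto simp: m_def)
  have "real n * e \<le> m" for n
  proof -
    have "ennreal (real n) * emeasure lborel E \<le> emeasure (interval_measure F) {-a<..<a}"
      by (rule steep_emeasure_le) (use E in \<open>auto simp: E_def\<close>)
    then show ?thesis using e m by (simp flip: ennreal_mult)
  qed
  then have "e = 0"
    using e(2) by (meson linorder_not_le order_less_le reals_Archimedean3)
  then show ?thesis using e by (simp add: E_def)
qed

lemma differentiable_if_not_exceptional:
  assumes n: "x \<notin> steep F (real n)"
    and pq: "\<And>p q. p \<in> \<rat> \<Longrightarrow> q \<in> \<rat> \<Longrightarrow> 0 \<le> p \<Longrightarrow> p < q \<Longrightarrow> x \<notin> steep F q \<inter> steep (\<lambda>x. - F x) (- p)"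
  shows "\<exists>D. (F has_real_derivative D) (at x)"
proof -
  \<comment> \<open>The derivative will be the infimum of the slopes that are eventually not
    exceeded. Any smaller q' is exceeded in arbitrarily short intervals, so by the second assumption
    slopes below p < q' do not persist.\<close>
  define S where "S = {q. q \<ge> 0 \<and> x \<notin> steep F q}"
  have S: "real n \<in> S" using n by (simp add: S_def)
  have bdd: "bdd_below S" by (auto simp: S_def bdd_below_def)
  define D where "D = Inf S"
  have "D \<ge> 0" unfolding D_def by (rule cInf_greatest) (use S in blast, simp add: S_def)
  have lim: "\<exists>e>0. \<forall>u v. u < x \<and> x < v \<and> v - u < e \<longrightarrow> \<bar>F v - F u - D * (v - u)\<bar> \<le> \<epsilon> * (v - u)"
    if "\<epsilon> > 0" for \<epsilon>
  proof -
    obtain q where q: "q \<in> S" "q < D + \<epsilon>"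
      using cInf_lessD[of S "D + \<epsilon>"] S \<open>\<epsilon> > 0\<close> unfolding D_def by (metis empty_iff less_add_same_cancel1)
    obtain e1 where e1: "e1 > 0" "\<And>u v. u < x \<Longrightarrow> x < v \<Longrightarrow> v - u < e1 \<Longrightarrow> F v - F u \<le> q * (v - u)"
      using q(1) not_steepD[of x F q] by (auto simp: S_def)
    have up: "F v - F u \<le> (D + \<epsilon>) * (v - u)" if "u < x" "x < v" "v - u < e1" for u v
      using e1(2)[OF that] q(2) that by (smt (verit) mult_right_mono)
    have "\<exists>e2>0. \<forall>u v. u < x \<longrightarrow> x < v \<longrightarrow> v - u < e2 \<longrightarrow> F v - F u \<ge> (D - \<epsilon>) * (v - u)"
    \<comment> \<open>For a negative bound monotonicity is enough; otherwise there is room for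
      rationals p < q' between D - \<epsilon> and D, both nonnegative.\<close>
    proof (cases "D - \<epsilon> < 0")
      case True
      then have "(D - \<epsilon>) * (v - u) \<le> F v - F u" if "u < x" "x < v" for u v
        using mono[of u v] that mult_nonpos_nonneg[of "D - \<epsilon>" "v - u"] by (smt (verit))
      then show ?thesis by (intro exI[of _ 1]) auto
    next
      case False
      obtain q' where q': "q' \<in> \<rat>" "D - \<epsilon> < q'" "q' < D"
        using Rats_dense_in_real[of "D - \<epsilon>" D] \<open>\<epsilon> > 0\<close> by auto
      obtain p where p: "p \<in> \<rat>" "D - \<epsilon> < p" "p < q'"
        using Rats_dense_in_real[of "D - \<epsilon>" q'] q' by auto
      have "x \<in> steep F q'"
      proof (rule ccontr)
        assume "x \<notin> steep F q'"
        then have "q' \<in> S" using q' False by (auto simp: S_def)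
        then show False using cInf_lower[OF _ bdd, of q'] q' by (simp add: D_def)
      qed
      then have "x \<notin> steep (\<lambda>x. - F x) (- p)" using pq[of p q'] p q' False by auto
      then obtain e2 where "e2 > 0" "\<And>u v. u < x \<Longrightarrow> x < v \<Longrightarrow> v - u < e2 \<Longrightarrow> - F v - - F u \<le> - p * (v - u)"
        using not_steepD[of x "\<lambda>x. - F x" "- p"] by blast
      then show ?thesis using p(2)
        by (intro exI[of _ e2]) (smt (verit) mult_right_mono minus_mult_left)
    qed
    then obtain e2 where e2: "e2 > 0" "\<And>u v. u < x \<Longrightarrow> x < v \<Longrightarrow> v - u < e2 \<Longrightarrow> F v - F u \<ge> (D - \<epsilon>) * (v - u)"
      by blast
    show ?thesis
    proof (intro exI[of _ "min e1 e2"] conjI allI impI)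
      fix u v assume "u < x \<and> x < v \<and> v - u < min e1 e2"
      then show "\<bar>F v - F u - D * (v - u)\<bar> \<le> \<epsilon> * (v - u)"
        using up[of u v] e2(2)[of u v] by (auto simp: abs_le_iff algebra_simps)
    qed (use e1 e2 in auto)
  qed
  \<comment> \<open>So far the slopes are over intervals strictly around x. Letting one endpoint
    tend to x and using continuity of F turns them into difference quotients at x.\<close>
  have lim': "\<exists>e>0. \<forall>y. \<bar>y - x\<bar> < e \<longrightarrow> \<bar>F y - F x - D * (y - x)\<bar> \<le> \<epsilon> * \<bar>y - x\<bar>"
    if "\<epsilon> > 0" for \<epsilon>
  proof -
    obtain e where e: "e > 0" "\<And>u v. u < x \<Longrightarrow> x < v \<Longrightarrow> v - u < e \<Longrightarrow> \<bar>F v - F u - D * (v - u)\<bar> \<le> \<epsilon> * (v - u)"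
      using lim[OF \<open>\<epsilon> > 0\<close>] by blast
    have isC: "isCont F x" using cont by (simp add: continuous_on_eq_continuous_at)
    have "\<bar>F y - F x - D * (y - x)\<bar> \<le> \<epsilon> * \<bar>y - x\<bar>" if y: "\<bar>y - x\<bar> < e" for y
    proof -
      consider "y = x" | "y > x" | "y < x" by linarith
      then show ?thesis
      proof cases
        case 2
        have "((\<lambda>u. \<bar>F y - F u - D * (y - u)\<bar>) \<longlongrightarrow> \<bar>F y - F x - D * (y - x)\<bar>) (at_left x)"
          using isC by (intro tendsto_intros) (auto simp: isCont_def intro: tendsto_within_subset)
        moreover have "((\<lambda>u. \<epsilon> * (y - u)) \<longlongrightarrow> \<epsilon> * (y - x)) (at_left x)"
          by (intro tendsto_intros)
        moreover have "\<forall>\<^sub>F u in at_left x. \<bar>F y - F u - D * (y - u)\<bar> \<le> \<epsilon> * (y - u)"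
          using eventually_at_left_field[of _ x] y 2 e(2)
          by (subst eventually_at_left_field) (intro exI[of _ "y - e"], auto)
        ultimately have "\<bar>F y - F x - D * (y - x)\<bar> \<le> \<epsilon> * (y - x)"
          by (intro tendsto_le[of "at_left x"]) auto
        then show ?thesis using 2 by simp
      next
        case 3
        have "((\<lambda>v. \<bar>F v - F y - D * (v - y)\<bar>) \<longlongrightarrow> \<bar>F x - F y - D * (x - y)\<bar>) (at_right x)"
          using isC by (intro tendsto_intros) (auto simp: isCont_def intro: tendsto_within_subset)
        moreover have "((\<lambda>v. \<epsilon> * (v - y)) \<longlongrightarrow> \<epsilon> * (x - y)) (at_right x)"
          by (intro tendsto_intros)
        moreover have "\<forall>\<^sub>F v in at_right x. \<bar>F v - F y - D * (v - y)\<bar> \<le> \<epsilon> * (v - y)"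
          using y 3 e(2)
          by (subst eventually_at_right_field) (intro exI[of _ "y + e"], auto)
        ultimately have "\<bar>F x - F y - D * (x - y)\<bar> \<le> \<epsilon> * (x - y)"
          by (intro tendsto_le[of "at_right x"]) auto
        then show ?thesis using 3 by (simp add: abs_if algebra_simps split: if_splits)
      qed simp
    qed
    then show ?thesis using e(1) by blast
  qed
  have "(F has_derivative (\<lambda>h. D * h)) (at x)"
    unfolding has_derivative_at_alt using lim' by (auto simp: bounded_linear_mult_right)
  then show ?thesis by (auto simp: has_field_derivative_def)
qed

theorem mono_differentiable_ae: "negligible {x. \<nexists>D. (F has_real_derivative D) (at x)}"
proof -
  \<comment> \<open>Intersecting with bounded intervals makes all measures finite, and restricting
    to rational pairs keeps the union countable.\<close>
  define N where "N = (\<Union>k::nat. (\<Inter>n::nat. steep F (real n)) \<inter> {-real k<..<real k}) \<union>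
    (\<Union>k::nat. \<Union>(p, q)\<in>{(p, q). p \<in> \<rat> \<and> q \<in> \<rat> \<and> 0 \<le> p \<and> p < q}.
        steep F q \<inter> steep (\<lambda>x. - F x) (- p) \<inter> {-real k<..<real k})"
  have c: "countable {(p, q). p \<in> \<rat> \<and> q \<in> \<rat> \<and> 0 \<le> p \<and> p < (q::real)}"
    by (rule countable_subset[of _ "\<rat> \<times> \<rat>"]) (auto simp: countable_rat)
  have "N \<in> null_sets lborel"
    unfolding N_def
  proof (intro null_sets.Un null_sets_UN null_sets_UN'[OF c])
    show "(\<Inter>n::nat. steep F (real n)) \<inter> {-real k<..<real k} \<in> null_sets lborel" for k
      using Inter_steep_null[of "real k"] by (auto simp: null_sets_def)
    show "(case x of (p, q) \<Rightarrow> steep F q \<inter> steep (\<lambda>x. - F x) (- p) \<inter> {-real k<..<real k}) \<in> null_sets lborel"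
      if "x \<in> {(p, q). p \<in> \<rat> \<and> q \<in> \<rat> \<and> 0 \<le> p \<and> p < q}" for x k
      using that steep_up_down_null[of "fst x" "snd x" "{-real k<..<real k}"] by (auto simp: null_sets_def)
  qed
  then have "negligible N"
    using null_sets_completionI[of N lborel] by (simp add: negligible_iff_null_sets)
  moreover have "{x. \<nexists>D. (F has_real_derivative D) (at x)} \<subseteq> N"
  proof (rule subsetI, rule ccontr)
    fix x assume x: "x \<in> {x. \<nexists>D. (F has_real_derivative D) (at x)}" "x \<notin> N"
    obtain k :: nat where "\<bar>x\<bar> < real k" using reals_Archimedean2 by blast
    then have k: "x \<in> {-real k<..<real k}" by auto
    obtain n :: nat where "x \<notin> steep F (real n)" using x(2) k by (auto simp: N_def)
    moreover have "x \<notin> steep F q \<inter> steep (\<lambda>x. - F x) (- p)" if "p \<in> \<rat>" "q \<in> \<rat>" "0 \<le> p" "p < q" for p q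
      using x(2) k that unfolding N_def by blast
    ultimately show False using differentiable_if_not_exceptional[of x n] x(1) by blast
  qed
  ultimately show ?thesis by (rule negligible_subset)
qed

end


subsection \<open>Absolutely continuous functions\<close>

definition intervals_in :: "real \<Rightarrow> real \<Rightarrow> (real \<times> real) set \<Rightarrow> bool" where
  "intervals_in a b D \<longleftrightarrow> finite D \<and> (\<forall>(r, s)\<in>D. a \<le> r \<and> r \<le> s \<and> s \<le> b) \<and>
     pairwise (\<lambda>(r, s) (r', s'). {r<..<s} \<inter> {r'<..<s'} = {}) D"

abbreviation total_length :: "(real \<times> real) set \<Rightarrow> real" where
  "total_length D \<equiv> (\<Sum>(r, s)\<in>D. s - r)"

abbreviation variation :: "(real \<Rightarrow> 'a::metric_space) \<Rightarrow> (real \<times> real) set \<Rightarrow> real" where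
  "variation f D \<equiv> (\<Sum>(r, s)\<in>D. dist (f r) (f s))"

lemma abs_continuous_on_alt:
  "abs_continuous_on a b f \<longleftrightarrow>
     (\<forall>e>0. \<exists>d>0. \<forall>D. intervals_in a b D \<and> total_length D < d
        \<longrightarrow> variation f D < e)"
  unfolding abs_continuous_on_def intervals_in_def by (simp add: conj_assoc)

lemma intervals_in_subset: "intervals_in a b D \<Longrightarrow> a' \<le> a \<Longrightarrow> b \<le> b' \<Longrightarrow> intervals_in a' b' D"
  unfolding intervals_in_def by fastforce

lemma intervals_in_length:
  assumes D: "intervals_in a b D" and U: "U \<in> sets borel" "emeasure lborel U \<le> ennreal l" "l \<ge> 0"
    and sub: "\<And>r s. (r, s) \<in> D \<Longrightarrow> {r<..<s} \<subseteq> U"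
  shows "total_length D \<le> l"
proof -
  have fin: "finite D" and le: "\<And>i. i \<in> D \<Longrightarrow> fst i \<le> snd i"
    using D by (auto simp: intervals_in_def)
  have "ennreal (total_length D) = (\<Sum>i\<in>D. emeasure lborel {fst i<..<snd i})"
    using le by (subst sum_ennreal[symmetric]) (auto simp: case_prod_beta intro!: sum.cong)
  also have "\<dots> = emeasure lborel (\<Union>i\<in>D. {fst i<..<snd i})"
    using D fin by (intro sum_emeasure)
      (auto simp: intervals_in_def disjoint_family_on_def pairwise_def case_prod_beta)
  also have "\<dots> \<le> emeasure lborel U"
    using sub U by (intro emeasure_mono UN_least) (auto simp del: greaterThanLessThan_subseteq_greaterThanLessThan)
  also note U(2)
  finally show ?thesis using U(3) by simp
qed

text \<open>Clipping or shifting may map several intervals to the same degenerate one. Sums are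
  unaffected as long as the summand vanishes on degenerate intervals, which lengths and distances
  do.\<close>

lemma intervals_in_reindex:
  fixes \<phi> :: "'i \<Rightarrow> real \<times> real" and F :: "real \<times> real \<Rightarrow> real"
  assumes fin: "finite I" and le: "\<And>i. i \<in> I \<Longrightarrow> a \<le> fst (\<phi> i) \<and> fst (\<phi> i) \<le> snd (\<phi> i) \<and> snd (\<phi> i) \<le> b"
    and disj: "\<And>i j. i \<in> I \<Longrightarrow> j \<in> I \<Longrightarrow> i \<noteq> j
      \<Longrightarrow> {fst (\<phi> i)<..<snd (\<phi> i)} \<inter> {fst (\<phi> j)<..<snd (\<phi> j)} = {}"
  shows "intervals_in a b (\<phi> ` I)"
    and "(\<And>r. F (r, r) = 0) \<Longrightarrow> sum F (\<phi> ` I) = (\<Sum>i\<in>I. F (\<phi> i))"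
proof -
  show "intervals_in a b (\<phi> ` I)"
    unfolding intervals_in_def
  proof (intro conjI)
    show "pairwise (\<lambda>(r, s) (r', s'). {r<..<s} \<inter> {r'<..<s'} = {}) (\<phi> ` I)"
      unfolding pairwise_def using disj by (simp add: case_prod_beta) blast
    show "\<forall>(r, s)\<in>\<phi> ` I. a \<le> r \<and> r \<le> s \<and> s \<le> b"
      using le by (auto simp: case_prod_beta)
  qed (use fin in simp)
  assume F: "\<And>r. F (r, r) = 0"
  show "sum F (\<phi> ` I) = (\<Sum>i\<in>I. F (\<phi> i))"
  proof (subst sum.reindex_nontrivial[OF fin])
    fix i j assume ij: "i \<in> I" "j \<in> I" "i \<noteq> j" "\<phi> i = \<phi> j"
    then have "{fst (\<phi> i)<..<snd (\<phi> i)} = {}" using disj[of i j] by auto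
    then have "fst (\<phi> i) = snd (\<phi> i)" using le[OF ij(1)] by (auto simp: not_less)
    then show "F (\<phi> i) = 0" using F[of "fst (\<phi> i)"] by (metis prod.collapse)
  qed simp
qed

text \<open>Every interval is clipped at m from both sides; the one that contains m contributes to
  both families, and the triangle inequality accounts for it.\<close>

lemma intervals_in_split:
  fixes f :: "real \<Rightarrow> 'a::metric_space"
  assumes D: "intervals_in a b D" and m: "a \<le> m" "m \<le> b"
  obtains D1 D2 where "intervals_in a m D1" "intervals_in m b D2"
    "total_length D1 \<le> total_length D" "total_length D2 \<le> total_length D"
    "variation f D
      \<le> variation f D1 + variation f D2"
proof -
  let ?p = "\<lambda>i::real \<times> real. (min (fst i) m, min (snd i) m)"
  let ?q = "\<lambda>i::real \<times> real. (max (fst i) m, max (snd i) m)"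
  have fin: "finite D" and le: "\<And>i. i \<in> D \<Longrightarrow> a \<le> fst i \<and> fst i \<le> snd i \<and> snd i \<le> b"
    and disj: "\<And>i j. i \<in> D \<Longrightarrow> j \<in> D \<Longrightarrow> i \<noteq> j \<Longrightarrow> {fst i<..<snd i} \<inter> {fst j<..<snd j} = {}"
    using D by (auto simp: intervals_in_def pairwise_def case_prod_beta)
  have pd: "{fst (?p i)<..<snd (?p i)} \<inter> {fst (?p j)<..<snd (?p j)} = {}"
    if "i \<in> D" "j \<in> D" "i \<noteq> j" for i j
  proof -
    have "{fst (?p i)<..<snd (?p i)} \<subseteq> {fst i<..<snd i}" for i :: "real \<times> real"
      by (auto simp: min_def split: if_splits)
    then show ?thesis using disj[OF that] by blast
  qed
  have qd: "{fst (?q i)<..<snd (?q i)} \<inter> {fst (?q j)<..<snd (?q j)} = {}"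
    if "i \<in> D" "j \<in> D" "i \<noteq> j" for i j
  proof -
    have "{fst (?q i)<..<snd (?q i)} \<subseteq> {fst i<..<snd i}" for i :: "real \<times> real"
      by (auto simp: max_def split: if_splits)
    then show ?thesis using disj[OF that] by blast
  qed
  have ple: "a \<le> fst (?p i) \<and> fst (?p i) \<le> snd (?p i) \<and> snd (?p i) \<le> m" if "i \<in> D" for i
    using le[OF that] m by auto
  have qle: "m \<le> fst (?q i) \<and> fst (?q i) \<le> snd (?q i) \<and> snd (?q i) \<le> b" if "i \<in> D" for i
    using le[OF that] m by auto
  have sum: "(\<Sum>(r, s)\<in>?p ` D. g r s) = (\<Sum>i\<in>D. g (min (fst i) m) (min (snd i) m))"
    "(\<Sum>(r, s)\<in>?q ` D. g r s) = (\<Sum>i\<in>D. g (max (fst i) m) (max (snd i) m))"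
    if "\<And>r. g r r = 0" for g :: "real \<Rightarrow> real \<Rightarrow> real"
    using intervals_in_reindex(2)[OF fin ple pd, where F = "\<lambda>(r, s). g r s"]
      intervals_in_reindex(2)[OF fin qle qd, where F = "\<lambda>(r, s). g r s"] that by simp_all
  show thesis
  proof (rule that[of "?p ` D" "?q ` D"])
    show "intervals_in a m (?p ` D)" by (rule intervals_in_reindex(1)[OF fin ple pd])
    show "intervals_in m b (?q ` D)" by (rule intervals_in_reindex(1)[OF fin qle qd])
    show "total_length (?p ` D) \<le> total_length D"
      using le by (subst sum) (fastforce simp: case_prod_beta min_def intro!: sum_mono)+
    show "total_length (?q ` D) \<le> total_length D"
      using le by (subst sum) (fastforce simp: case_prod_beta max_def intro!: sum_mono)+
    have "dist (f (fst i)) (f (snd i)) \<le> dist (f (min (fst i) m)) (f (min (snd i) m))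
        + dist (f (max (fst i) m)) (f (max (snd i) m))" if "i \<in> D" for i
      using le[OF that] dist_triangle[of "f (fst i)" "f (snd i)" "f m"] by (auto simp: min_def max_def)
    moreover have "variation f (?p ` D) = (\<Sum>i\<in>D. dist (f (min (fst i) m)) (f (min (snd i) m)))"
      "variation f (?q ` D) = (\<Sum>i\<in>D. dist (f (max (fst i) m)) (f (max (snd i) m)))"
      by (rule sum; simp)+
    ultimately show "variation f D
      \<le> variation f (?p ` D) + variation f (?q ` D)"
      by (auto simp: case_prod_beta simp flip: sum.distrib intro!: sum_mono)
  qed
qed

lemma abs_continuous_on_join:
  assumes "abs_continuous_on a m f" "abs_continuous_on m b f" "a \<le> m" "m \<le> b"
  shows "abs_continuous_on a b f"
  unfolding abs_continuous_on_alt
proof (intro allI impI)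
  fix e :: real assume "e > 0"
  then obtain d1 d2 where d: "d1 > 0" "d2 > 0"
    "\<And>D. intervals_in a m D \<Longrightarrow> total_length D < d1 \<Longrightarrow> variation f D < e / 2"
    "\<And>D. intervals_in m b D \<Longrightarrow> total_length D < d2 \<Longrightarrow> variation f D < e / 2"
    using assms(1,2)[unfolded abs_continuous_on_alt, rule_format, of "e / 2"] by auto
  show "\<exists>d>0. \<forall>D. intervals_in a b D \<and> total_length D < d
      \<longrightarrow> variation f D < e"
  proof (intro exI[of _ "min d1 d2"] conjI allI impI)
    fix D assume D: "intervals_in a b D \<and> total_length D < min d1 d2"
    obtain D1 D2 where "intervals_in a m D1" "intervals_in m b D2"
      "total_length D1 \<le> total_length D" "total_length D2 \<le> total_length D"
      "variation f D
        \<le> variation f D1 + variation f D2"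
      using intervals_in_split[of a b D m f] D assms(3,4) by blast
    then show "variation f D < e"
      using d(3)[of D1] d(4)[of D2] D by auto
  qed (use d in auto)
qed

lemma abs_continuous_on_imp_continuous_on:
  fixes f :: "real \<Rightarrow> 'a::metric_space"
  assumes "abs_continuous_on a b f"
  shows "continuous_on {a..b} f"
  unfolding continuous_on_iff
proof (intro ballI allI impI)
  fix x e :: real assume x: "x \<in> {a..b}" and "e > 0"
  obtain d where d: "d > 0"
    "\<And>D. intervals_in a b D \<Longrightarrow> total_length D < d \<Longrightarrow> variation f D < e"
    using assms[unfolded abs_continuous_on_alt] \<open>e > 0\<close> by blast
  show "\<exists>d>0. \<forall>x'\<in>{a..b}. dist x' x < d \<longrightarrow> dist (f x') (f x) < e"
  proof (intro exI[of _ d] conjI ballI impI)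
    fix y assume y: "y \<in> {a..b}" "dist y x < d"
    have "dist (f (min x y)) (f (max x y)) < e"
      using d(2)[of "{(min x y, max x y)}"] x y
      by (auto simp: intervals_in_def dist_real_def min_def max_def split: if_splits)
    then show "dist (f y) (f x) < e"
      by (auto simp: min_def max_def dist_commute split: if_splits)
  qed (rule d)
qed

lemma abs_continuous_on_lipschitz_compose:
  fixes f :: "real \<Rightarrow> 'a::metric_space" and g :: "'a \<Rightarrow> 'b::metric_space"
  assumes f: "abs_continuous_on a b f"
    and g: "\<And>x y. x \<in> {a..b} \<Longrightarrow> y \<in> {a..b} \<Longrightarrow> dist (g (f x)) (g (f y)) \<le> C * dist (f x) (f y)"
  shows "abs_continuous_on a b (\<lambda>s. g (f s))"
  unfolding abs_continuous_on_alt
proof (intro allI impI)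
  fix e :: real assume "e > 0"
  obtain d where d: "d > 0"
    "\<And>D. intervals_in a b D \<Longrightarrow> total_length D < d
      \<Longrightarrow> variation f D < e / (\<bar>C\<bar> + 1)"
    using f[unfolded abs_continuous_on_alt] \<open>e > 0\<close> by (metis abs_ge_zero add_nonneg_pos divide_pos_pos zero_less_one)
  show "\<exists>d>0. \<forall>D. intervals_in a b D \<and> total_length D < d
      \<longrightarrow> (\<Sum>(r, s)\<in>D. dist (g (f r)) (g (f s))) < e"
  proof (intro exI[of _ d] conjI allI impI)
    fix D assume D: "intervals_in a b D \<and> total_length D < d"
    have "dist (g (f (fst i))) (g (f (snd i))) \<le> (\<bar>C\<bar> + 1) * dist (f (fst i)) (f (snd i))" if "i \<in> D" for i
    proof -
      have "fst i \<in> {a..b}" "snd i \<in> {a..b}" using D that by (force simp: intervals_in_def)+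
      then have "dist (g (f (fst i))) (g (f (snd i))) \<le> C * dist (f (fst i)) (f (snd i))" by (rule g)
      also have "\<dots> \<le> (\<bar>C\<bar> + 1) * dist (f (fst i)) (f (snd i))" by (intro mult_right_mono) auto
      finally show ?thesis .
    qed
    then have "(\<Sum>(r, s)\<in>D. dist (g (f r)) (g (f s))) \<le> (\<bar>C\<bar> + 1) * variation f D"
      by (auto simp: sum_distrib_left case_prod_beta intro!: sum_mono)
    also have "\<dots> < (\<bar>C\<bar> + 1) * (e / (\<bar>C\<bar> + 1))"
      using d(2)[of D] D by (intro mult_strict_left_mono) auto
    finally show "(\<Sum>(r, s)\<in>D. dist (g (f r)) (g (f s))) < e" by simp
  qed (rule d)
qed

lemma abs_continuous_on_ident: "abs_continuous_on a b (\<lambda>s::real. s)"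
  unfolding abs_continuous_on_alt
proof (intro allI impI)
  fix e :: real assume "e > 0"
  have "(\<Sum>(r, s)\<in>D. dist r s) = total_length D" if "intervals_in a b D" for D
    using that by (intro sum.cong) (auto simp: intervals_in_def dist_real_def)
  then show "\<exists>d>0. \<forall>D. intervals_in a b D \<and> total_length D < d \<longrightarrow> (\<Sum>(r, s)\<in>D. dist r s) < e"
    using \<open>e > 0\<close> by auto
qed

lemma abs_continuous_on_cong:
  assumes "abs_continuous_on a b f" "\<And>s. s \<in> {a..b} \<Longrightarrow> f s = g s"
  shows "abs_continuous_on a b g"
proof -
  have "(\<Sum>(r, s)\<in>D. dist (g r) (g s)) = variation f D" if "intervals_in a b D" for D
  proof (rule sum.cong[OF refl], clarify)
    fix r s assume "(r, s) \<in> D"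
    then have "r \<in> {a..b}" "s \<in> {a..b}" using that by (force simp: intervals_in_def)+
    then show "dist (g r) (g s) = dist (f r) (f s)" using assms(2) by simp
  qed
  then show ?thesis using assms(1) unfolding abs_continuous_on_alt by (metis (no_types, lifting))
qed

lemma abs_continuous_on_shift:
  assumes "abs_continuous_on a b f"
  shows "abs_continuous_on (a + t) (b + t) (\<lambda>s. f (s - t))"
  unfolding abs_continuous_on_alt
proof (intro allI impI)
  fix e :: real assume "e > 0"
  then obtain d where d: "d > 0"
    "\<And>D. intervals_in a b D \<Longrightarrow> total_length D < d \<Longrightarrow> variation f D < e"
    using assms[unfolded abs_continuous_on_alt] by blast
  show "\<exists>d>0. \<forall>D. intervals_in (a + t) (b + t) D \<and> total_length D < d
      \<longrightarrow> (\<Sum>(r, s)\<in>D. dist (f (r - t)) (f (s - t))) < e"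
  proof (intro exI[of _ d] conjI allI impI)
    fix D assume D: "intervals_in (a + t) (b + t) D \<and> total_length D < d"
    let ?p = "\<lambda>i::real \<times> real. (fst i - t, snd i - t)"
    have fin: "finite D" and le: "\<And>i. i \<in> D \<Longrightarrow> a + t \<le> fst i \<and> fst i \<le> snd i \<and> snd i \<le> b + t"
      and disj: "\<And>i j. i \<in> D \<Longrightarrow> j \<in> D \<Longrightarrow> i \<noteq> j \<Longrightarrow> {fst i<..<snd i} \<inter> {fst j<..<snd j} = {}"
      using D by (auto simp: intervals_in_def pairwise_def case_prod_beta)
    have pd: "{fst (?p i)<..<snd (?p i)} \<inter> {fst (?p j)<..<snd (?p j)} = {}"
      if "i \<in> D" "j \<in> D" "i \<noteq> j" for i j
    proof -
      have "x + t \<in> {fst i<..<snd i} \<inter> {fst j<..<snd j}"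
        if "x \<in> {fst (?p i)<..<snd (?p i)} \<inter> {fst (?p j)<..<snd (?p j)}" for x
        using that by auto
      then show ?thesis using disj[OF that] by blast
    qed
    have ple: "a \<le> fst (?p i) \<and> fst (?p i) \<le> snd (?p i) \<and> snd (?p i) \<le> b" if "i \<in> D" for i
      using le[OF that] by auto
    have sum: "(\<Sum>(r, s)\<in>?p ` D. g r s) = (\<Sum>i\<in>D. g (fst i - t) (snd i - t))"
      if "\<And>r. g r r = 0" for g :: "real \<Rightarrow> real \<Rightarrow> real"
      using intervals_in_reindex(2)[OF fin ple pd, where F = "\<lambda>(r, s). g r s"] that by simp
    show "(\<Sum>(r, s)\<in>D. dist (f (r - t)) (f (s - t))) < e"
    proof -
      have "intervals_in a b (?p ` D)" by (rule intervals_in_reindex(1)[OF fin ple pd])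
      moreover have "total_length (?p ` D) = total_length D"
        by (subst sum) (auto simp: case_prod_beta)
      moreover have "variation f (?p ` D) = (\<Sum>(r, s)\<in>D. dist (f (r - t)) (f (s - t)))"
        by (subst sum) (auto simp: case_prod_beta)
      ultimately show ?thesis using d(2)[of "?p ` D"] D by simp
    qed
  qed (rule d)
qed


section \<open>Bounded variation and differentiability almost everywhere\<close>

lemma abs_continuous_on_bounded_variation:
  fixes f :: "real \<Rightarrow> 'a::metric_space"
  assumes f: "abs_continuous_on a b f" and "a \<le> b"
  obtains B where "\<And>D. intervals_in a b D \<Longrightarrow> variation f D \<le> B"
proof -
  obtain d where d: "d > 0"
    "\<And>D. intervals_in a b D \<Longrightarrow> total_length D < d \<Longrightarrow> variation f D < 1"
    using f[unfolded abs_continuous_on_alt] zero_less_one by blast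
  have "variation f D \<le> real n"
    if "a \<le> x" "x \<le> b" "x \<le> a + real n * (d / 2)" "intervals_in a x D" for n x D
    using that
  proof (induction n arbitrary: x D)
    case 0
    then have "i \<in> D \<Longrightarrow> fst i = a \<and> snd i = a" for i
      by (force simp: intervals_in_def)
    then have "variation f D = 0"
      by (intro sum.neutral) force
    then show ?case by simp
  next
    case (Suc n)
    \<comment> \<open>Peels off a last piece of length at most d/2, strictly below d, whose
      variation is below 1; the induction counts such pieces.\<close>
    define m where "m = max a (x - d / 2)"
    have m: "a \<le> m" "m \<le> x" "m \<le> a + real n * (d / 2)" "x - m < d"
      using Suc.prems d(1) by (auto simp: m_def max_def algebra_simps add_divide_distrib)
    obtain D1 D2 where D: "intervals_in a m D1" "intervals_in m x D2"
      "variation f D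
        \<le> variation f D1 + variation f D2"
      using intervals_in_split[OF Suc.prems(4) m(1,2), of f] by blast
    have "total_length D2 \<le> x - m"
      using m D(2) by (intro intervals_in_length[OF D(2), of "{m..x}"]) (auto simp: intervals_in_def)
    then have "variation f D2 < 1"
      using m Suc.prems by (intro d(2) intervals_in_subset[OF D(2)]) auto
    moreover have "variation f D1 \<le> real n"
      using Suc.prems m by (intro Suc.IH[OF _ _ _ D(1)]) auto
    ultimately show ?case using D(3) by simp
  qed
  moreover obtain n where "(b - a) / (d / 2) < real n" using reals_Archimedean2 by blast
  then have "b \<le> a + real n * (d / 2)" using d(1) by (simp add: field_simps)
  ultimately show thesis using that \<open>a \<le> b\<close> by blast
qed

lemma abs_continuous_on_monotone_decomposition:
  fixes f :: "real \<Rightarrow> real"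
  assumes f: "abs_continuous_on a b f" and "a \<le> b"
  obtains V where "\<And>x y. x \<le> y \<Longrightarrow> V x \<le> V y" "continuous_on UNIV V"
    "\<And>x y. x \<le> y \<Longrightarrow> V x - f (max a (min b x)) \<le> V y - f (max a (min b y))"
proof -
  obtain B where B: "\<And>D. intervals_in a b D \<Longrightarrow> variation f D \<le> B"
    using abs_continuous_on_bounded_variation[OF assms] by blast
  define S where "S x = {variation f D |D. intervals_in a x D}" for x
  define Var where "Var x = Sup (S x)" for x
  have bdd: "bdd_above (S x)" if "x \<le> b" for x
    using B intervals_in_subset[of a x _ a b] that by (intro bdd_aboveI[of _ B]) (auto simp: S_def)
  have ne: "S x \<noteq> {}" for x
    by (auto simp: S_def intro!: exI[of _ "{}"] simp: intervals_in_def)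
  have upper: "variation f D \<le> Var x" if "intervals_in a x D" "x \<le> b" for D x
    unfolding Var_def using that by (intro cSup_upper bdd) (auto simp: S_def)
  have inc: "Var x + dist (f x) (f y) \<le> Var y" if xy: "a \<le> x" "x \<le> y" "y \<le> b" for x y
  proof (cases "x = y")
    case False
    then have "x < y" using xy by simp
    have "Var x \<le> Var y - dist (f x) (f y)"
      unfolding Var_def[of x]
    proof (rule cSup_least[OF ne])
      fix s assume "s \<in> S x"
      then obtain D where D: "intervals_in a x D" "s = variation f D" by (auto simp: S_def)
      have nin: "(x, y) \<notin> D" using D(1) \<open>x < y\<close> by (force simp: intervals_in_def)
      have "intervals_in a y (insert (x, y) D)"
        using D(1) xy unfolding intervals_in_def pairwise_insert
        by auto
      from upper[OF this xy(3)] show "s \<le> Var y - dist (f x) (f y)"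
        using nin D by (simp add: intervals_in_def)
    qed
    then show ?thesis by simp
  qed simp
  \<comment> \<open>\<open>Var\<close> is the total variation from a. Clamping the argument extends
    it to the whole line, where the differentiability theorem for monotone functions is
    stated.\<close>
  define V where "V x = Var (max a (min b x))" for x
  show thesis
  proof (rule that[of V])
    show "V x \<le> V y" if "x \<le> y" for x y
      using inc[of "max a (min b x)" "max a (min b y)"] that \<open>a \<le> b\<close>
        zero_le_dist[of "f (max a (min b x))" "f (max a (min b y))"]
      unfolding V_def by (smt (verit))
    show "V x - f (max a (min b x)) \<le> V y - f (max a (min b y))" if "x \<le> y" for x y
      using inc[of "max a (min b x)" "max a (min b y)"] that \<open>a \<le> b\<close>
      unfolding V_def dist_real_def by (smt (verit))
    show "continuous_on UNIV V"
      unfolding continuous_on_iff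
    proof (intro ballI allI impI)
      fix x e :: real assume "e > 0"
      obtain d where d: "d > 0"
        "\<And>D. intervals_in a b D \<Longrightarrow> total_length D < d \<Longrightarrow> variation f D < e / 2"
        using f[unfolded abs_continuous_on_alt] half_gt_zero[OF \<open>e > 0\<close>] by blast
      have step: "Var v \<le> Var u + e / 2" if uv: "a \<le> u" "u \<le> v" "v \<le> b" "v - u < d" for u v
        unfolding Var_def[of v]
      proof (rule cSup_least[OF ne])
        fix s assume "s \<in> S v"
        then obtain D where D: "intervals_in a v D" "s = variation f D" by (auto simp: S_def)
        obtain D1 D2 where D12: "intervals_in a u D1" "intervals_in u v D2"
          "variation f D
            \<le> variation f D1 + variation f D2"
          using intervals_in_split[OF D(1) uv(1,2), of f] by blast
        have "total_length D2 \<le> v - u"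
          using uv D12(2) by (intro intervals_in_length[OF D12(2), of "{u..v}"]) (auto simp: intervals_in_def)
        then have "variation f D2 < e / 2"
          using uv by (intro d(2) intervals_in_subset[OF D12(2)]) auto
        then show "s \<le> Var u + e / 2"
          using D12(3) D(2) upper[OF D12(1)] uv by simp
      qed
      show "\<exists>d>0. \<forall>y\<in>UNIV. dist y x < d \<longrightarrow> dist (V y) (V x) < e"
      proof (intro exI[of _ d] conjI ballI impI)
        fix y assume y: "dist y x < d"
        let ?u = "max a (min b (min x y))" and ?v = "max a (min b (max x y))"
        have "Var ?v \<le> Var ?u + e / 2"
          using y \<open>a \<le> b\<close> by (intro step) (auto simp: dist_real_def min_def max_def)
        moreover have "Var ?u \<le> Var ?v"
          using inc[of ?u ?v] \<open>a \<le> b\<close> zero_le_dist[of "f ?u" "f ?v"] by (smt (verit))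
        ultimately show "dist (V y) (V x) < e"
          using \<open>e > 0\<close> by (cases "x \<le> y") (auto simp: V_def dist_real_def min_def max_def split: if_splits)
      qed (rule d)
    qed
  qed
qed

lemma abs_continuous_on_differentiable_ae_real:
  fixes f :: "real \<Rightarrow> real"
  assumes f: "abs_continuous_on a b f" and "a \<le> b"
  obtains N where "negligible N" "\<And>x. x \<in> {a<..<b} - N \<Longrightarrow> f differentiable (at x)"
proof -
  obtain V where V: "\<And>x y. x \<le> y \<Longrightarrow> V x \<le> V y" "continuous_on UNIV V"
    "\<And>x y. x \<le> y \<Longrightarrow> V x - f (max a (min b x)) \<le> V y - f (max a (min b y))"
    using abs_continuous_on_monotone_decomposition[OF assms] by blast
  define W where "W x = V x - f (max a (min b x))" for x
  have W: "\<And>x y. x \<le> y \<Longrightarrow> W x \<le> W y" using V(3) by (simp add: W_def)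
  have cW: "continuous_on UNIV W"
    unfolding W_def using \<open>a \<le> b\<close>
    by (intro continuous_intros V(2) continuous_on_compose2[OF abs_continuous_on_imp_continuous_on[OF f]]) auto
  show thesis
  proof (rule that[of "{x. \<nexists>D. (V has_real_derivative D) (at x)} \<union> {x. \<nexists>D. (W has_real_derivative D) (at x)}"])
    show "negligible ({x. \<nexists>D. (V has_real_derivative D) (at x)} \<union> {x. \<nexists>D. (W has_real_derivative D) (at x)})"
      by (intro negligible_Un mono_differentiable_ae V W cW)
    fix x assume x: "x \<in> {a<..<b} - ({x. \<nexists>D. (V has_real_derivative D) (at x)} \<union> {x. \<nexists>D. (W has_real_derivative D) (at x)})"
    then obtain D E where "(V has_real_derivative D) (at x)" "(W has_real_derivative E) (at x)" by auto
    then have "((\<lambda>x. V x - W x) has_real_derivative (D - E)) (at x)" by (rule DERIV_diff)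
    then have "(f has_real_derivative (D - E)) (at x)"
      using x by (elim has_field_derivative_transform_within_open[where S = "{a<..<b}"]) (auto simp: W_def)
    then show "f differentiable (at x)" by (auto simp: real_differentiable_def)
  qed
qed

lemma abs_continuous_on_differentiable_ae:
  fixes f :: "real \<Rightarrow> 'a::euclidean_space"
  assumes f: "abs_continuous_on a b f" and "a \<le> b"
  obtains N where "negligible N" "\<And>x. x \<in> {a<..<b} - N \<Longrightarrow> f differentiable (at x)"
proof -
  have "\<exists>N. negligible N \<and> (\<forall>x\<in>{a<..<b} - N. (\<lambda>s. f s \<bullet> i) differentiable (at x))" if "i \<in> Basis" for i
  proof -
    have "abs_continuous_on a b (\<lambda>s. f s \<bullet> i)"
    proof (rule abs_continuous_on_lipschitz_compose[OF f, of "\<lambda>x. x \<bullet> i" 1])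
      fix x y
      show "dist (f x \<bullet> i) (f y \<bullet> i) \<le> 1 * dist (f x) (f y)"
        using Basis_le_norm[OF that, of "f x - f y"] by (simp add: dist_norm inner_diff_left)
    qed
    then show ?thesis using abs_continuous_on_differentiable_ae_real[OF _ \<open>a \<le> b\<close>] by metis
  qed
  then obtain N where N: "\<And>i. i \<in> Basis \<Longrightarrow> negligible (N i)"
    "\<And>i x. i \<in> Basis \<Longrightarrow> x \<in> {a<..<b} - N i \<Longrightarrow> (\<lambda>s. f s \<bullet> i) differentiable (at x)"
    by metis
  show thesis
  proof (rule that[of "\<Union>i\<in>Basis. N i"])
    show "negligible (\<Union>i\<in>Basis. N i)" using N(1) by (intro negligible_Union) auto
    fix x assume "x \<in> {a<..<b} - (\<Union>i\<in>Basis. N i)"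
    then show "f differentiable (at x)"
      using N(2) by (subst differentiable_componentwise_within) auto
  qed
qed

text \<open>
  In a fine tagged division, the tags outside of the exceptional null set are controlled by the
  derivative, and the remaining intervals by absolute continuity.
\<close>

lemma abs_continuous_on_le_integral:
  fixes \<Phi> g :: "real \<Rightarrow> real"
  assumes \<Phi>: "abs_continuous_on a b \<Phi>" and "a \<le> b" and N: "negligible N"
    and D: "\<And>s. s \<in> {a..b} - N \<Longrightarrow> \<exists>D. (\<Phi> has_real_derivative D) (at s) \<and> D \<le> g s"
    and g: "g integrable_on {a..b}"
  shows "\<Phi> b - \<Phi> a \<le> integral {a..b} g"
proof (rule field_le_epsilon)
  fix e :: real assume "e > 0"
  \<comment> \<open>One e' goes to the Riemann sum, one to the variation over the exceptional
    intervals, and e' times the total length to the remaining tags.\<close>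
  define e' where "e' = e / (3 + (b - a))"
  have e': "e' > 0" "e' * (3 + (b - a)) = e"
    using \<open>e > 0\<close> \<open>a \<le> b\<close> by (simp_all add: e'_def)
  \<comment> \<open>At tags in N nothing relates g to \<Phi>, so g is set to zero there; this does
    not change the integral.\<close>
  define g' where "g' s = (if s \<in> N then 0 else g s)" for s
  have "(g' has_integral integral {a..b} g) {a..b}"
    by (rule has_integral_spike[OF N _ integrable_integral[OF g]]) (simp add: g'_def)
  then have "\<exists>\<gamma>. gauge \<gamma> \<and> (\<forall>p. p tagged_division_of {a..b} \<and> \<gamma> fine p \<longrightarrow>
      norm ((\<Sum>(x, k)\<in>p. measure lborel k *\<^sub>R g' x) - integral {a..b} g) < e')"
    unfolding has_integral_real using e'(1) by (elim allE[of _ e']) simp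
  then obtain \<gamma>1 where \<gamma>1: "gauge \<gamma>1" "\<And>p. p tagged_division_of {a..b} \<Longrightarrow> \<gamma>1 fine p
      \<Longrightarrow> norm ((\<Sum>(x, k)\<in>p. measure lborel k *\<^sub>R g' x) - integral {a..b} g) < e'"
    by auto
  obtain d where d: "d > 0"
    "\<And>D. intervals_in a b D \<Longrightarrow> total_length D < d \<Longrightarrow> variation \<Phi> D < e'"
    using \<Phi>[unfolded abs_continuous_on_alt] e'(1) by blast
  have "N \<in> null_sets lebesgue" using N by (simp add: negligible_iff_null_sets)
  then have "N \<in> lmeasurable" by (simp add: N negligible_imp_measurable)
  then obtain T where T: "open T" "N \<subseteq> T" "emeasure lebesgue (T - N) < ennreal (d / 2)"
    using sets_lebesgue_outer_open[of N "d / 2"] d(1) by (metis half_gt_zero fmeasurableD)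
  have mT: "emeasure lborel T \<le> ennreal (d / 2)"
  proof -
    have "emeasure lborel T = emeasure lebesgue T"
      using T(1) by (simp add: emeasure_completion)
    also have "\<dots> = emeasure lebesgue (T - N)"
      using \<open>N \<in> null_sets lebesgue\<close> T(1) by (intro emeasure_Diff_null_set[symmetric]) auto
    finally show ?thesis using T(3) by simp
  qed
  have "\<exists>r>0. \<forall>u v. s \<in> {u..v} \<and> {u..v} \<subseteq> ball s r \<longrightarrow> \<Phi> v - \<Phi> u \<le> (g s + e') * (v - u)"
    if s: "s \<in> {a..b} - N" for s
  proof -
    obtain D where D: "(\<Phi> has_real_derivative D) (at s)" "D \<le> g s" using D[OF s] by blast
    then have "(\<Phi> has_derivative (\<lambda>h. D * h)) (at s)" by (simp add: has_field_derivative_def)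
    then obtain r where r: "r > 0"
      "\<And>y. norm (y - s) < r \<Longrightarrow> norm (\<Phi> y - \<Phi> s - D * (y - s)) \<le> e' * norm (y - s)"
      using e'(1) unfolding has_derivative_at_alt by blast
    have "\<Phi> v - \<Phi> u \<le> (g s + e') * (v - u)" if uv: "s \<in> {u..v}" "{u..v} \<subseteq> ball s r" for u v
    proof -
      have "u \<in> {u..v}" "v \<in> {u..v}" using uv(1) by auto
      then have "u \<in> ball s r" "v \<in> ball s r" using uv(2) by blast+
      then have "\<bar>\<Phi> v - \<Phi> s - D * (v - s)\<bar> \<le> e' * (v - s)" "\<bar>\<Phi> u - \<Phi> s - D * (u - s)\<bar> \<le> e' * (s - u)"
        using r(2)[of v] r(2)[of u] uv by (auto simp: dist_real_def)
      then have "\<Phi> v - \<Phi> u \<le> (D + e') * (v - u)" by (auto simp: abs_le_iff algebra_simps)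
      also have "\<dots> \<le> (g s + e') * (v - u)" using D(2) uv by (intro mult_right_mono) auto
      finally show ?thesis .
    qed
    then show ?thesis using r(1) by blast
  qed
  then obtain r where r: "\<And>s. s \<in> {a..b} - N \<Longrightarrow> r s > 0"
    "\<And>s u v. s \<in> {a..b} - N \<Longrightarrow> s \<in> {u..v} \<Longrightarrow> {u..v} \<subseteq> ball s (r s) \<Longrightarrow> \<Phi> v - \<Phi> u \<le> (g s + e') * (v - u)"
    by metis
  \<comment> \<open>Intervals tagged in N are forced into T, an open superset of N of measure at
    most d/2, so absolute continuity bounds their total variation.\<close>
  define \<gamma>2 where "\<gamma>2 s = (if s \<in> N then T else if s \<in> {a..b} then ball s (r s) else UNIV)" for s
  have "gauge \<gamma>2" using T r(1) by (auto simp: gauge_def \<gamma>2_def)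
  then have "gauge (\<lambda>x. \<gamma>1 x \<inter> \<gamma>2 x)" using \<gamma>1(1) by (rule gauge_Int[rotated])
  then obtain p where p: "p tagged_division_of {a..b}" "(\<lambda>x. \<gamma>1 x \<inter> \<gamma>2 x) fine p"
    using fine_division_exists_real by blast
  then have fine: "\<gamma>1 fine p" "\<gamma>2 fine p" by (auto simp: fine_Int)
  note p' = tagged_division_ofD[OF p(1)]
  have k: "\<exists>u v. k = {u..v} \<and> u \<le> v \<and> Inf k = u \<and> Sup k = v \<and> a \<le> u \<and> v \<le> b \<and> s \<in> {u..v} \<and> measure lborel k = v - u"
    if sk: "(s, k) \<in> p" for s k
  proof -
    obtain u v where uv: "k = {u..v}" using p'(4)[OF sk] by auto
    have "s \<in> k" using p'(2)[OF sk] .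
    then have "u \<le> v" using uv by simp
    moreover have "a \<le> u" "v \<le> b" using p'(3)[OF sk] uv \<open>u \<le> v\<close> by auto
    ultimately show ?thesis using uv \<open>s \<in> k\<close> by auto
  qed
  define pN where "pN = {i \<in> p. fst i \<in> N}"
  define \<phi> where "\<phi> i = (Inf (snd i), Sup (snd i))" for i :: "real \<times> real set"
  have fin: "finite p" using p'(1) .
  have finN: "finite pN" using fin by (simp add: pN_def)
  have le: "a \<le> fst (\<phi> i) \<and> fst (\<phi> i) \<le> snd (\<phi> i) \<and> snd (\<phi> i) \<le> b" if "i \<in> pN" for i
    using k[of "fst i" "snd i"] that by (auto simp: pN_def \<phi>_def)
  have int: "{fst (\<phi> i)<..<snd (\<phi> i)} = interior (snd i)" if ip: "i \<in> p" for i
  proof -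
    obtain u v where "snd i = {u..v}" "Inf (snd i) = u" "Sup (snd i) = v"
      using k[of "fst i" "snd i"] ip by auto
    then show ?thesis unfolding \<phi>_def by (metis fst_conv snd_conv interior_atLeastAtMost_real)
  qed
  have disj: "{fst (\<phi> i)<..<snd (\<phi> i)} \<inter> {fst (\<phi> j)<..<snd (\<phi> j)} = {}"
    if "i \<in> pN" "j \<in> pN" "i \<noteq> j" for i j
    using p'(5)[of "fst i" "snd i" "fst j" "snd j"] that int[of i] int[of j] by (auto simp: pN_def)
  have inD: "intervals_in a b (\<phi> ` pN)" by (rule intervals_in_reindex(1)[OF finN le disj])
  have sum: "(\<Sum>(r, s)\<in>\<phi> ` pN. h r s) = (\<Sum>i\<in>pN. h (Inf (snd i)) (Sup (snd i)))"
    if "\<And>r. h r r = 0" for h :: "real \<Rightarrow> real \<Rightarrow> real"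
    using intervals_in_reindex(2)[OF finN le disj, where F = "\<lambda>(r, s). h r s"] that by (simp add: \<phi>_def)
  have "total_length (\<phi> ` pN) \<le> d / 2"
  proof (rule intervals_in_length[OF inD _ mT])
    fix r s assume "(r, s) \<in> \<phi> ` pN"
    then obtain i where i: "i \<in> pN" "r = Inf (snd i)" "s = Sup (snd i)" by (auto simp: \<phi>_def)
    then have "snd i \<subseteq> T" using fine(2) by (force simp: fine_def \<gamma>2_def pN_def)
    then show "{r<..<s} \<subseteq> T" using k[of "fst i" "snd i"] i by (force simp: pN_def)
  qed (use T d in auto)
  then have "variation \<Phi> (\<phi> ` pN) < e'"
    using d by (intro d(2) inD) auto
  then have small: "(\<Sum>i\<in>pN. dist (\<Phi> (Inf (snd i))) (\<Phi> (Sup (snd i)))) < e'"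
    by (simp add: sum)
  have "\<Phi> b - \<Phi> a = (\<Sum>(x, K)\<in>p. \<Phi> (Sup K) - \<Phi> (Inf K))"
    using additive_tagged_division_1[OF \<open>a \<le> b\<close> p(1), of \<Phi>] by simp
  also have "\<dots> \<le> (\<Sum>(x, K)\<in>p. (measure lborel K * g' x + e' * measure lborel K) +
      (if x \<in> N then dist (\<Phi> (Inf K)) (\<Phi> (Sup K)) else 0))"
  proof (rule sum_mono, clarify)
    fix x K assume xK: "(x, K) \<in> p"
    then obtain u v where uv: "K = {u..v}" "u \<le> v" "Inf K = u" "Sup K = v" "a \<le> u" "v \<le> b" "x \<in> {u..v}" "measure lborel K = v - u"
      using k by blast
    show "\<Phi> (Sup K) - \<Phi> (Inf K) \<le> (measure lborel K * g' x + e' * measure lborel K) +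
      (if x \<in> N then dist (\<Phi> (Inf K)) (\<Phi> (Sup K)) else 0)"
    proof (cases "x \<in> N")
      case True
      moreover have "0 \<le> e' * (v - u)" using uv e'(1) by simp
      ultimately show ?thesis using uv by (simp add: g'_def dist_real_def)
    next
      case False
      then have "x \<in> {a..b} - N" using uv by auto
      moreover have "{u..v} \<subseteq> ball x (r x)"
        using fine(2) xK uv False by (force simp: fine_def \<gamma>2_def)
      ultimately have "\<Phi> v - \<Phi> u \<le> (g x + e') * (v - u)" using r(2) uv by blast
      then show ?thesis using False uv by (simp add: g'_def algebra_simps)
    qed
  qed
  also have "\<dots> = (\<Sum>(x, K)\<in>p. measure lborel K *\<^sub>R g' x) + e' * (\<Sum>(x, K)\<in>p. measure lborel K)
      + (\<Sum>i\<in>p. if fst i \<in> N then dist (\<Phi> (Inf (snd i))) (\<Phi> (Sup (snd i))) else 0)"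
    by (simp add: sum.distrib case_prod_beta sum_distrib_left)
  also have "(\<Sum>i\<in>p. if fst i \<in> N then dist (\<Phi> (Inf (snd i))) (\<Phi> (Sup (snd i))) else 0)
      = (\<Sum>i\<in>pN. dist (\<Phi> (Inf (snd i))) (\<Phi> (Sup (snd i))))"
    unfolding pN_def using fin by (simp add: sum.inter_filter)
  also have "(\<Sum>(x, K)\<in>p. measure lborel K) = b - a"
    using additive_content_tagged_division[of p a b] p(1) \<open>a \<le> b\<close> by simp
  also have "(\<Sum>(x, k)\<in>p. measure lborel k *\<^sub>R g' x) \<le> integral {a..b} g + e'"
    using \<gamma>1(2)[OF p(1) fine(1)] by simp
  finally have "\<Phi> b - \<Phi> a \<le> integral {a..b} g + e' + e' * (b - a) + e'"
    using small by linarith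
  then show "\<Phi> b - \<Phi> a \<le> integral {a..b} g + e"
    using e' by (simp add: algebra_simps)
qed

subsection \<open>Weak compactness of probability measures on a compact set\<close>

text \<open>
  A not necessarily continuous injection into the reals whose inverse is uniformly continuous:
  the ternary digits of \<open>s y\<close> tell which sets of a countable basis contain \<open>y\<close>. It reduces the
  compactness of measures to Helly's theorem on the real line.
\<close>

lemma ternary_digits_separate:
  fixes P Q :: "nat \<Rightarrow> bool"
  assumes "P j \<noteq> Q j" and "\<And>i. i < j \<Longrightarrow> P i = Q i"
  shows "\<bar>(\<Sum>k. of_bool (P k) * 2 / 3 ^ Suc k) - (\<Sum>k. of_bool (Q k) * 2 / 3 ^ Suc k)\<bar> \<ge> (1 / 3 ^ Suc j :: real)"
proof -
  have geo: "summable (\<lambda>k. 2 / 3 ^ Suc k :: real)"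
    by (rule summable_mult2[OF summable_geometric[of "1 / 3 :: real"], of "2/3", THEN back_subst[where P = summable]])
      (auto simp: power_one_over field_simps)
  have s: "summable (\<lambda>k. of_bool (R k) * 2 / 3 ^ Suc k :: real)" for R
    by (rule summable_comparison_test'[OF geo, of 0]) auto
  define c :: "nat \<Rightarrow> real" where "c k = of_bool (P k) * 2 / 3 ^ Suc k - of_bool (Q k) * 2 / 3 ^ Suc k" for k
  have sc: "summable c" unfolding c_def by (intro summable_diff s)
  have "(\<Sum>k. of_bool (P k) * 2 / 3 ^ Suc k) - (\<Sum>k. of_bool (Q k) * 2 / 3 ^ Suc k :: real) = (\<Sum>k. c k)"
    unfolding c_def by (rule suminf_diff[OF s s])
  also have "\<dots> = (\<Sum>k. c (k + Suc j)) + (\<Sum>k<Suc j. c k)"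
    by (rule suminf_split_initial_segment[OF sc])
  also have "(\<Sum>k<Suc j. c k) = c j"
    using assms(2) by (simp add: c_def)
  finally have eq: "(\<Sum>k. of_bool (P k) * 2 / 3 ^ Suc k) - (\<Sum>k. of_bool (Q k) * 2 / 3 ^ Suc k :: real)
      = (\<Sum>k. c (k + Suc j)) + c j" .
  \<comment> \<open>With digits 0 and 2 the first difference amounts to 2/3^(j+1), while all later
    digits together can cancel at most half of it.\<close>
  have "\<bar>\<Sum>k. c (k + Suc j)\<bar> \<le> (\<Sum>k. 2 / 3 ^ Suc (k + Suc j))"
  proof -
    have b: "\<bar>c k\<bar> \<le> 2 / 3 ^ Suc k" for k by (auto simp: c_def)
    note ign = summable_ignore_initial_segment[OF geo, of "Suc j"]
    have sa: "summable (\<lambda>k. \<bar>c (k + Suc j)\<bar>)"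
      by (rule summable_comparison_test'[OF ign, of 0]) (simp only: real_norm_def abs_idempotent b)
    have "\<bar>\<Sum>k. c (k + Suc j)\<bar> \<le> (\<Sum>k. \<bar>c (k + Suc j)\<bar>)" by (rule summable_rabs[OF sa])
    also have "\<dots> \<le> (\<Sum>k. 2 / 3 ^ Suc (k + Suc j))" by (rule suminf_le[OF _ sa ign]) (rule b)
    finally show ?thesis .
  qed
  also have "(\<Sum>k. 2 / 3 ^ Suc (k + Suc j) :: real) = 1 / 3 ^ Suc j"
  proof -
    have "(\<lambda>k. 2 / 3 ^ Suc (k + Suc j) :: real) = (\<lambda>k. 2 / 3 ^ Suc (Suc j) * (1 / 3) ^ k)"
      by (auto simp: power_add power_one_over field_simps)
    then have "(\<Sum>k. 2 / 3 ^ Suc (k + Suc j) :: real) = (\<Sum>k. 2 / 3 ^ Suc (Suc j) * (1 / 3) ^ k)" by simp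
    also have "\<dots> = 2 / 3 ^ Suc (Suc j) * (\<Sum>k. (1 / 3) ^ k)" by (rule suminf_mult) simp
    finally show ?thesis by (simp add: suminf_geometric)
  qed
  finally have "\<bar>\<Sum>k. c (k + Suc j)\<bar> \<le> 1 / 3 ^ Suc j" .
  moreover have "\<bar>c j\<bar> = 2 / 3 ^ Suc j" using assms(1) by (auto simp: c_def)
  moreover have "\<bar>x + y\<bar> \<ge> d" if "\<bar>x\<bar> \<le> d" "\<bar>y\<bar> = 2 * d" for x y d :: real
    using that by arith
  ultimately show ?thesis unfolding eq by simp
qed

lemma compact_coding:
  fixes D :: "'a::{metric_space, second_countable_topology} set"
  assumes "compact D"
  obtains s :: "'a \<Rightarrow> real" where "\<And>y. s y \<in> {0..1}"
    "\<And>e. e > 0 \<Longrightarrow> \<exists>d>0. \<forall>y\<in>D. \<forall>y'\<in>D. \<bar>s y - s y'\<bar> < d \<longrightarrow> dist y y' < e"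
proof -
  obtain \<B> :: "'a set set" where B: "countable \<B>" "topological_basis \<B>"
    using ex_countable_basis by blast
  have "\<B> \<noteq> {}"
  proof
    assume "\<B> = {}"
    then have "\<exists>B'. B' \<subseteq> {} \<and> \<Union>B' = (UNIV :: 'a set)"
      using B(2) open_UNIV unfolding topological_basis_def by blast
    then show False by auto
  qed
  define A where "A = from_nat_into \<B>"
  have A: "range A = \<B>" unfolding A_def by (rule range_from_nat_into[OF \<open>\<B> \<noteq> {}\<close> B(1)])
  define s :: "'a \<Rightarrow> real" where "s y = (\<Sum>k. of_bool (y \<in> A k) * 2 / 3 ^ Suc k)" for y
  have geo: "(\<lambda>k. 2 / 3 ^ Suc k :: real) sums 1"
    using sums_mult2[OF geometric_sums[of "1 / 3 :: real"], of "2 / 3"]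
    by (simp add: power_one_over field_simps)
  have summ: "summable (\<lambda>k. of_bool (R k) * 2 / 3 ^ Suc k :: real)" for R
    by (rule summable_comparison_test'[OF sums_summable[OF geo], of 0]) auto
  show thesis
  proof (rule that[of s])
    fix y
    have "s y \<le> (\<Sum>k. 2 / 3 ^ Suc k)"
      unfolding s_def by (intro suminf_le summ sums_summable[OF geo]) auto
    moreover have "s y \<ge> 0" unfolding s_def by (intro suminf_nonneg summ) auto
    ultimately show "s y \<in> {0..1}" using sums_unique[OF geo] by auto
  next
    fix e :: real assume "e > 0"
    \<comment> \<open>D is covered by finitely many basis sets of diameter at most e. Points whose
      codes agree in all digits up to K lie in a common one of them.\<close>
    define \<U> where "\<U> = {U \<in> \<B>. \<exists>x. U \<subseteq> ball x (e / 2)}"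
    have cov: "\<exists>U\<in>\<U>. y \<in> U" for y
    proof -
      obtain U where "U \<in> \<B>" "y \<in> U" "U \<subseteq> ball y (e / 2)"
        using topological_basisE[OF B(2) open_ball, of y y "e / 2"] \<open>e > 0\<close> by auto
      then show ?thesis by (auto simp: \<U>_def)
    qed
    have "D \<subseteq> \<Union>\<U>" using cov by blast
    moreover have "open U" if "U \<in> \<U>" for U
      using that B(2) topological_basis_open by (auto simp: \<U>_def)
    ultimately obtain T where T: "T \<subseteq> \<U>" "finite T" "D \<subseteq> \<Union>T"
      by (rule compactE[OF assms])
    have "\<exists>k. U = A k" if "U \<in> T" for U using that T(1) A by (auto simp: \<U>_def)
    then obtain idx where idx: "\<And>U. U \<in> T \<Longrightarrow> A (idx U) = U" by metis
    obtain K where K: "\<And>U. U \<in> T \<Longrightarrow> idx U < K"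
      using finite_nat_set_iff_bounded[of "idx ` T"] T(2) by auto
    show "\<exists>d>0. \<forall>y\<in>D. \<forall>y'\<in>D. \<bar>s y - s y'\<bar> < d \<longrightarrow> dist y y' < e"
    proof (intro exI[of _ "1 / 3 ^ K"] conjI ballI impI)
      fix y y' assume y: "y \<in> D" "y' \<in> D" "\<bar>s y - s y'\<bar> < 1 / 3 ^ K"
      have same: "y \<in> A k \<longleftrightarrow> y' \<in> A k" if "k < K" for k
      proof (rule ccontr)
        assume "(y \<in> A k) \<noteq> (y' \<in> A k)"
        define j where "j = (LEAST j. (y \<in> A j) \<noteq> (y' \<in> A j))"
        have j: "(y \<in> A j) \<noteq> (y' \<in> A j)" "j \<le> k"
          unfolding j_def using \<open>(y \<in> A k) \<noteq> (y' \<in> A k)\<close>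
          by (rule LeastI[where P = "\<lambda>j. (y \<in> A j) \<noteq> (y' \<in> A j)"], rule Least_le)
        have "1 / 3 ^ Suc j \<le> \<bar>s y - s y'\<bar>"
          unfolding s_def by (rule ternary_digits_separate) (use j(1) not_less_Least in \<open>auto simp: j_def\<close>)
        moreover have "(1::real) / 3 ^ K \<le> 1 / 3 ^ Suc j"
          using j(2) that by (intro divide_left_mono power_increasing) auto
        ultimately show False using y(3) by simp
      qed
      obtain U where U: "U \<in> T" "y \<in> U" using T(3) y(1) by blast
      then have "y' \<in> U" using same[OF K[OF U(1)]] idx[OF U(1)] by simp
      obtain x where "U \<subseteq> ball x (e / 2)" using T(1) U(1) by (auto simp: \<U>_def)
      then have "dist x y < e / 2" "dist x y' < e / 2" using U(2) \<open>y' \<in> U\<close> by auto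
      then show "dist y y' < e" by (metis dist_commute dist_triangle_half_l)
    qed simp
  qed
qed

text \<open>The measures are pushed to [0,1] by the code, where tightness yields a weakly convergent
  subsequence. The code itself need not be continuous, but its inverse extends continuously to the
  closure of its range, and the limit is carried back along this extension.\<close>

theorem pmf_weak_limit:
  fixes D :: "'a::euclidean_space set" and \<Lambda> :: "nat \<Rightarrow> 'a pmf"
  assumes D: "compact D" and \<Lambda>: "\<And>n. set_pmf (\<Lambda> n) \<subseteq> D"
  obtains r :: "nat \<Rightarrow> nat" and \<nu> :: "'a measure" where "strict_mono r" "prob_space \<nu>" "sets \<nu> = sets borel"
    "AE y in \<nu>. y \<in> D"
    "\<And>f :: 'a \<Rightarrow> real. continuous_on D f
      \<Longrightarrow> (\<lambda>n. measure_pmf.expectation (\<Lambda> (r n)) f) \<longlonglongrightarrow> (\<integral>y. indicator D y *\<^sub>R f y \<partial>\<nu>)"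
proof -
  obtain s :: "'a \<Rightarrow> real" where s: "\<And>y. s y \<in> {0..1}"
    "\<And>e. e > 0 \<Longrightarrow> \<exists>d>0. \<forall>y\<in>D. \<forall>y'\<in>D. \<bar>s y - s y'\<bar> < d \<longrightarrow> dist y y' < e"
    using compact_coding[OF D] by blast
  have inj: "inj_on s D"
  proof (rule inj_onI, rule ccontr)
    fix x y assume "x \<in> D" "y \<in> D" "s x = s y" "x \<noteq> y"
    then show False using s(2)[of "dist x y"] by force
  qed
  define q where "q = inv_into D s"
  have q: "q (s y) = y" if "y \<in> D" for y unfolding q_def by (rule inv_into_f_f[OF inj that])
  have "uniformly_continuous_on (s ` D) q"
    unfolding uniformly_continuous_on_def
  proof (intro allI impI)
    fix e :: real assume "e > 0"
    then obtain d where "d > 0" "\<forall>y\<in>D. \<forall>y'\<in>D. \<bar>s y - s y'\<bar> < d \<longrightarrow> dist y y' < e" using s(2) by blast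
    then show "\<exists>d>0. \<forall>x\<in>s ` D. \<forall>x'\<in>s ` D. dist x' x < d \<longrightarrow> dist (q x') (q x) < e"
      by (intro exI[of _ d]) (auto simp: q dist_real_def)
  qed
  then obtain q1 where q1: "uniformly_continuous_on (closure (s ` D)) q1" "\<And>x. x \<in> s ` D \<Longrightarrow> q x = q1 x"
    using uniformly_continuous_on_extension_on_closure by metis
  define C where "C = closure (s ` D)"
  have C: "closed C" "s ` D \<subseteq> C" by (auto simp: C_def closure_subset)
  have cq: "continuous_on C q1" using q1(1) by (simp add: C_def uniformly_continuous_imp_continuous)
  have q1s: "q1 (s y) = y" if "y \<in> D" for y using q1(2)[of "s y"] q[OF that] that by simp
  have q1D: "q1 x \<in> D" if "x \<in> C" for x
  proof -
    have "q1 ` closure (s ` D) \<subseteq> closure (q1 ` s ` D)"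
      using continuous_image_closure_subset[of C q1 "s ` D"] cq C(2) by (simp add: C_def)
    also have "q1 ` s ` D = D" using q1s by force
    finally show ?thesis using that D by (auto simp: C_def compact_imp_closed)
  qed
  have Dne: "D \<noteq> {}" using \<Lambda>[of 0] set_pmf_not_empty[of "\<Lambda> 0"] by auto
  then obtain d0 where "d0 \<in> D" by blast
  define \<mu> where "\<mu> n = distr (measure_pmf (\<Lambda> n)) borel s" for n
  have \<mu>_prob: "real_distribution (\<mu> n)" for n
  proof -
    interpret prob_space "\<mu> n" unfolding \<mu>_def by (rule measure_pmf.prob_space_distr) simp
    show ?thesis by unfold_locales (auto simp: \<mu>_def)
  qed
  have "tight \<mu>"
    unfolding tight_def
  proof (intro conjI allI impI \<mu>_prob)
    fix e :: real assume "e > 0"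
    have "measure (\<mu> n) {-1<..1} = 1" for n
    proof -
      have "measure (\<mu> n) {-1<..1} = measure (measure_pmf (\<Lambda> n)) (s -` {-1<..1} \<inter> space (measure_pmf (\<Lambda> n)))"
        unfolding \<mu>_def by (rule measure_distr) auto
      also have "s -` {-1<..1} = UNIV"
        using s(1) by (force simp: atLeastAtMost_iff)
      finally show ?thesis by simp
    qed
    then show "\<exists>a b. a < b \<and> (\<forall>n. 1 - e < measure (\<mu> n) {a<..b})"
      using \<open>e > 0\<close> by (intro exI[of _ "-1"] exI[of _ 1]) auto
  qed
  then obtain r M where r: "strict_mono (r :: nat \<Rightarrow> nat)" "real_distribution M" "weak_conv_m (\<mu> \<circ> id \<circ> r) M"
    using tight_imp_convergent_subsubsequence[of \<mu> id] by (auto simp: strict_mono_id)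
  interpret M: real_distribution M by fact
  have conv: "(\<lambda>n. measure_pmf.expectation (\<Lambda> (r n)) (\<lambda>y. g (s y))) \<longlonglongrightarrow> (\<integral>x. g x \<partial>M)"
    if g: "continuous_on UNIV g" "\<And>x. \<bar>g x\<bar> \<le> B" for g :: "real \<Rightarrow> real" and B
  proof -
    have "(\<lambda>n. integral\<^sup>L ((\<mu> \<circ> id \<circ> r) n) g) \<longlonglongrightarrow> integral\<^sup>L M g"
      by (rule weak_conv_imp_integral_bdd_continuous_conv[OF _ r(2) r(3)])
        (use g \<mu>_prob in \<open>auto simp: continuous_on_eq_continuous_at\<close>)
    moreover have "integral\<^sup>L (\<mu> n) g = measure_pmf.expectation (\<Lambda> n) (\<lambda>y. g (s y))" for n
      unfolding \<mu>_def using g(1) by (intro integral_distr) (auto intro: borel_measurable_continuous_onI)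
    ultimately show ?thesis by simp
  qed
  have exp_cong: "measure_pmf.expectation (\<Lambda> n) f = measure_pmf.expectation (\<Lambda> n) g"
    if "\<And>y. y \<in> D \<Longrightarrow> f y = g y" for f g :: "'a \<Rightarrow> real" and n
    using \<Lambda>[of n] that by (intro integral_cong_AE) (auto simp: AE_measure_pmf_iff)
  have AEC: "AE x in M. x \<in> C"
  proof -
    \<comment> \<open>A bounded continuous function whose integral vanishes for all the
      approximating measures, hence for the limit, and whose zero set is C.\<close>
    let ?g = "\<lambda>x. min 1 (infdist x C)"
    have c: "continuous_on UNIV ?g" by (intro continuous_intros)
    have "(\<lambda>n. measure_pmf.expectation (\<Lambda> (r n)) (\<lambda>y. ?g (s y))) \<longlonglongrightarrow> (\<integral>x. ?g x \<partial>M)"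
      by (rule conv[OF c, of 1]) (auto simp: infdist_nonneg)
    moreover have "measure_pmf.expectation (\<Lambda> n) (\<lambda>y. ?g (s y)) = 0" for n
      using exp_cong[of "\<lambda>y. ?g (s y)" "\<lambda>_. 0" n] C(2) by (auto simp: image_subset_iff)
    ultimately have "(\<integral>x. ?g x \<partial>M) = 0"
      by (simp add: LIMSEQ_const_iff)
    moreover have "integrable M ?g"
      by (rule M.integrable_const_bound[of _ 1]) (auto simp: infdist_nonneg borel_measurable_continuous_onI[OF c])
    ultimately have "AE x in M. ?g x = 0"
      by (subst (asm) integral_nonneg_eq_0_iff_AE) (auto simp: infdist_nonneg)
    moreover have "C \<noteq> {}" using C(2) Dne by auto
    ultimately show ?thesis
      by (elim eventually_mono) (use in_closed_iff_infdist_zero[OF C(1)] in \<open>simp add: min_def split: if_splits\<close>)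
  qed
  \<comment> \<open>The default value d0 off the full measure set C keeps the map total, measurable
    and with values in D.\<close>
  define q2 where "q2 x = (if x \<in> C then q1 x else d0)" for x
  have q2[measurable]: "q2 \<in> borel_measurable borel"
    unfolding q2_def using C(1) cq by (intro borel_measurable_continuous_on_if) auto
  have q2D: "q2 x \<in> D" for x using q1D \<open>d0 \<in> D\<close> by (simp add: q2_def)
  define \<nu> where "\<nu> = distr M borel q2"
  show thesis
  proof (rule that[OF r(1), of \<nu>])
    show "prob_space \<nu>" unfolding \<nu>_def by (rule M.prob_space_distr) simp
    show "sets \<nu> = sets borel" by (simp add: \<nu>_def)
    show "AE y in \<nu>. y \<in> D" unfolding \<nu>_def using D
      by (subst AE_distr_iff) (auto simp: q2D compact_imp_closed)
  next
    fix f :: "'a \<Rightarrow> real" assume f: "continuous_on D f"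
    obtain B where B: "B \<ge> 0" "\<And>y. y \<in> D \<Longrightarrow> \<bar>f y\<bar> \<le> B"
      using compact_imp_bounded[OF compact_continuous_image[OF f D]]
      by (metis bounded_pos imageI less_imp_le real_norm_def)
    \<comment> \<open>Weak convergence is tested by bounded continuous functions on the whole line,
      whereas f after q1 lives on C only.\<close>
    obtain g where g: "continuous_on UNIV g" "\<And>x. x \<in> C \<Longrightarrow> g x = f (q1 x)" "\<And>x. norm (g x) \<le> B"
    proof (rule Tietze[of C "\<lambda>x. f (q1 x)" UNIV B])
      show "continuous_on C (\<lambda>x. f (q1 x))"
        using q1D by (intro continuous_on_compose2[OF f cq]) auto
    qed (use C B q1D in auto)
    have "(\<lambda>n. measure_pmf.expectation (\<Lambda> (r n)) (\<lambda>y. g (s y))) \<longlonglongrightarrow> (\<integral>x. g x \<partial>M)"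
      using g(3) by (intro conv[OF g(1), of B]) simp
    moreover have "measure_pmf.expectation (\<Lambda> n) (\<lambda>y. g (s y)) = measure_pmf.expectation (\<Lambda> n) f" for n
      using C(2) by (intro exp_cong) (auto simp: g(2) q1s image_subset_iff)
    moreover have "(\<integral>y. indicator D y *\<^sub>R f y \<partial>\<nu>) = (\<integral>x. g x \<partial>M)"
    proof -
      have m: "(\<lambda>y. indicator D y *\<^sub>R f y) \<in> borel_measurable borel"
        using f D by (intro borel_measurable_continuous_on_indicator) (auto simp: compact_imp_closed)
      have "(\<integral>y. indicator D y *\<^sub>R f y \<partial>\<nu>) = (\<integral>x. indicator D (q2 x) *\<^sub>R f (q2 x) \<partial>M)"
        unfolding \<nu>_def using m by (intro integral_distr) auto
      also have "\<dots> = (\<integral>x. g x \<partial>M)"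
      proof (rule integral_cong_AE)
        show "(\<lambda>x. indicator D (q2 x) *\<^sub>R f (q2 x)) \<in> borel_measurable M"
          using measurable_compose[OF q2 m] by simp
        show "g \<in> borel_measurable M" using g(1) by (simp add: borel_measurable_continuous_onI)
        show "AE x in M. indicator D (q2 x) *\<^sub>R f (q2 x) = g x"
          using AEC by eventually_elim (use q1D in \<open>simp add: q2_def g(2)\<close>)
      qed
      finally show ?thesis .
    qed
    ultimately show "(\<lambda>n. measure_pmf.expectation (\<Lambda> (r n)) f) \<longlonglongrightarrow> (\<integral>y. indicator D y *\<^sub>R f y \<partial>\<nu>)" by simp
  qed
qed

subsection \<open>A theorem of the alternative\<close>

lemma pmf_mixture_expectation:
  fixes \<psi> :: "'a \<Rightarrow> real"
  assumes "finite (set_pmf \<tau>)" "t \<in> {0..1}"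
  shows "measure_pmf.expectation (bernoulli_pmf t \<bind> (\<lambda>b. if b then return_pmf y else \<tau>)) \<psi>
    = t * \<psi> y + (1 - t) * measure_pmf.expectation \<tau> \<psi>"
  using assms by (subst pmf_expectation_bind[of UNIV]) (auto simp: UNIV_bool)

text \<open>
  Almost minimise the length of the vector of the expectations: if the infimum is positive, then the
  almost minimal vector itself separates.
\<close>

lemma pmf_alternative:
  fixes \<psi> :: "nat \<Rightarrow> 'a \<Rightarrow> real"
  assumes D: "D \<noteq> {}" and B: "\<And>j y. j < k \<Longrightarrow> y \<in> D \<Longrightarrow> \<bar>\<psi> j y\<bar> \<le> B"
    and no: "\<And>\<beta> \<delta>. \<delta> > 0 \<Longrightarrow> \<exists>y\<in>D. (\<Sum>j<k. \<beta> j * \<psi> j y) < \<delta>" and "\<epsilon> > 0"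
  obtains \<tau> where "set_pmf \<tau> \<subseteq> D" "(\<Sum>j<k. (measure_pmf.expectation \<tau> (\<psi> j))\<^sup>2) < \<epsilon>"
proof (rule ccontr)
  assume "\<not> thesis"
  then have all: "\<And>\<tau>. set_pmf \<tau> \<subseteq> D \<Longrightarrow> (\<Sum>j<k. (measure_pmf.expectation \<tau> (\<psi> j))\<^sup>2) \<ge> \<epsilon>"
    using that by (meson not_le)
  define N where "N \<tau> = (\<Sum>j<k. (measure_pmf.expectation \<tau> (\<psi> j))\<^sup>2)" for \<tau>
  define S where "S = N ` {\<tau>. finite (set_pmf \<tau>) \<and> set_pmf \<tau> \<subseteq> D}"
  obtain y0 where "y0 \<in> D" using D by blast
  then have "N (return_pmf y0) \<in> S" by (auto simp: S_def)
  then have ne: "S \<noteq> {}" by blast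
  have bdd: "bdd_below S" by (auto simp: S_def N_def bdd_below_def intro!: exI[of _ 0] sum_nonneg)
  define d where "d = Inf S"
  have "d \<ge> \<epsilon>" unfolding d_def using all by (intro cInf_greatest[OF ne]) (auto simp: S_def N_def)
  then have "d > 0" using \<open>\<epsilon> > 0\<close> by simp
  define C where "C = real k * (2 * B)\<^sup>2"
  have "C \<ge> 0" by (simp add: C_def)
  define t where "t = min 1 (d / (2 * (C + 1)))"
  have t: "0 < t" "t \<le> 1" "t * C \<le> d / 2"
  proof -
    show "0 < t" "t \<le> 1" using \<open>d > 0\<close> \<open>C \<ge> 0\<close> by (auto simp: t_def)
    have "t * C \<le> d / (2 * (C + 1)) * (C + 1)"
      using \<open>C \<ge> 0\<close> \<open>d > 0\<close> by (intro mult_mono) (auto simp: t_def)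
    also have "\<dots> = d / 2" using \<open>C \<ge> 0\<close> by (simp add: field_simps add_nonneg_eq_0_iff)
    finally show "t * C \<le> d / 2" .
  qed
  \<comment> \<open>The infimum need not be attained. The excess over d is made small relative to
    the step t, so that it cannot mask the first-order term below.\<close>
  obtain x where "x \<in> S" "x < d + t * d / 2"
    using cInf_lessD[OF ne, of "d + t * d / 2"] t \<open>d > 0\<close> by (auto simp: d_def)
  then obtain \<tau> where \<tau>: "finite (set_pmf \<tau>)" "set_pmf \<tau> \<subseteq> D" "N \<tau> < d + t * d / 2"
    by (auto simp: S_def)
  define \<beta> where "\<beta> j = measure_pmf.expectation \<tau> (\<psi> j)" for j
  have N\<beta>: "N \<tau> = (\<Sum>j<k. (\<beta> j)\<^sup>2)" by (simp add: N_def \<beta>_def)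
  have \<beta>B: "\<bar>\<beta> j\<bar> \<le> B" if "j < k" for j
  proof -
    have "\<bar>\<beta> j\<bar> \<le> measure_pmf.expectation \<tau> (\<lambda>y. \<bar>\<psi> j y\<bar>)"
      unfolding \<beta>_def by (rule integral_abs_bound)
    also have "\<dots> \<le> measure_pmf.expectation \<tau> (\<lambda>y. B)"
      using \<tau> B[OF that] by (intro integral_mono_AE) (auto simp: AE_measure_pmf_iff integrable_measure_pmf_finite)
    finally show ?thesis by simp
  qed
  have "d / 4 \<le> (\<Sum>j<k. \<beta> j * \<psi> j y)" if y: "y \<in> D" for y
  proof -
    \<comment> \<open>Moving \<tau> towards y by the weight t cannot bring the squared length below
      d. The second-order term is at most t d/2 by the choice of t, so the first-order term bounds
      the combination at y from below.\<close>
    define \<kappa> where "\<kappa> = bernoulli_pmf t \<bind> (\<lambda>b. if b then return_pmf y else \<tau>)"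
    have set: "set_pmf \<kappa> \<subseteq> insert y (set_pmf \<tau>)"
      by (auto simp: \<kappa>_def set_bind_pmf split: if_splits)
    then have "finite (set_pmf \<kappa>)" "set_pmf \<kappa> \<subseteq> D"
      using \<tau> y by (auto intro: finite_subset)
    then have "d \<le> N \<kappa>" unfolding d_def by (intro cInf_lower bdd) (auto simp: S_def)
    also have "N \<kappa> = (\<Sum>j<k. (t * \<psi> j y + (1 - t) * \<beta> j)\<^sup>2)"
      unfolding N_def \<kappa>_def \<beta>_def using \<tau>(1) t by (simp add: pmf_mixture_expectation)
    also have "\<dots> = (\<Sum>j<k. (\<beta> j)\<^sup>2 + 2 * t * (\<beta> j * \<psi> j y) - 2 * t * (\<beta> j)\<^sup>2 + t\<^sup>2 * (\<psi> j y - \<beta> j)\<^sup>2)"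
      by (intro sum.cong refl) (simp add: power2_eq_square algebra_simps)
    also have "\<dots> = N \<tau> + 2 * t * (\<Sum>j<k. \<beta> j * \<psi> j y) - 2 * t * N \<tau> + t\<^sup>2 * (\<Sum>j<k. (\<psi> j y - \<beta> j)\<^sup>2)"
      by (simp add: sum.distrib sum_subtractf sum_distrib_left N\<beta>)
    also have "(\<Sum>j<k. (\<psi> j y - \<beta> j)\<^sup>2) \<le> C"
    proof -
      have "(\<psi> j y - \<beta> j)\<^sup>2 \<le> (2 * B)\<^sup>2" if "j < k" for j
        using B[OF that y] \<beta>B[OF that] by (intro power2_le_iff_abs_le[THEN iffD2]) auto
      then have "(\<Sum>j<k. (\<psi> j y - \<beta> j)\<^sup>2) \<le> (\<Sum>j<k. (2 * B)\<^sup>2)" by (intro sum_mono) auto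
      then show ?thesis by (simp add: C_def)
    qed
    finally have 1: "d \<le> N \<tau> + 2 * t * (\<Sum>j<k. \<beta> j * \<psi> j y) - 2 * t * N \<tau> + t\<^sup>2 * C"
      by (simp add: mult_left_mono)
    have "d \<le> N \<tau>" unfolding d_def using \<tau> by (intro cInf_lower bdd) (auto simp: S_def)
    then have "t * d \<le> t * N \<tau>" using t(1) by simp
    moreover have "t\<^sup>2 * C \<le> t * (d / 2)"
      using mult_left_mono[OF t(3), of t] t(1) by (simp add: power2_eq_square mult.assoc)
    moreover have "t * d \<ge> 0" using t(1) \<open>d > 0\<close> by simp
    ultimately have "t * (d / 4) \<le> t * (\<Sum>j<k. \<beta> j * \<psi> j y)"
      using 1 \<tau>(3) by (simp add: mult.assoc)
    then show ?thesis using t(1) by (simp add: mult_le_cancel_left)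
  qed
  then show False using no[of "d / 4" \<beta>] \<open>d > 0\<close> by force
qed

text \<open>Separability of continuous functions on a compact set, but with the dense sequence
  chosen inside the given family: for every countable piece of approximate data one member matching
  it is picked, if there is one.\<close>

lemma countable_sup_dense_subset:
  fixes D :: "'a::euclidean_space set" and \<Psi> :: "'i \<Rightarrow> 'a \<Rightarrow> real"
  assumes D: "compact D" and I: "I \<noteq> {}" and cont: "\<And>i. i \<in> I \<Longrightarrow> continuous_on D (\<Psi> i)"
  obtains F :: "nat \<Rightarrow> 'i" where "\<And>n. F n \<in> I"
    "\<And>i e. i \<in> I \<Longrightarrow> e > 0 \<Longrightarrow> \<exists>n. \<forall>y\<in>D. \<bar>\<Psi> i y - \<Psi> (F n) y\<bar> \<le> e"
proof -
  have "\<exists>T. finite T \<and> T \<subseteq> D \<and> (\<forall>y\<in>D. \<exists>x\<in>T. dist x y < 1 / real (Suc m))" for m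
  proof -
    obtain T where "T \<subseteq> D" "finite T" "D \<subseteq> (\<Union>x\<in>T. ball x (1 / real (Suc m)))"
      by (rule compactE_image[OF D, of D "\<lambda>x. ball x (1 / real (Suc m))"]) (force simp del: of_nat_Suc)+
    then show ?thesis by (intro exI[of _ T]) fastforce
  qed
  then obtain T where T: "\<And>m. finite (T m)" "\<And>m. T m \<subseteq> D" "\<And>m y. y \<in> D \<Longrightarrow> \<exists>x\<in>T m. dist x y < 1 / real (Suc m)"
    by metis
  \<comment> \<open>The data are an oscillation bound at the scale of the net \<open>T m\<close> and
    rational values on the net. Two members matching the same data differ by at most 4/(n+1) on
    D.\<close>
  define close where "close n m q i \<longleftrightarrow> i \<in> I \<and>
     (\<forall>x\<in>D. \<forall>y\<in>D. dist x y < 1 / real (Suc m) \<longrightarrow> \<bar>\<Psi> i x - \<Psi> i y\<bar> \<le> 1 / real (Suc n)) \<and>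
     (\<forall>x\<in>T m. \<bar>\<Psi> i x - of_rat (q x)\<bar> \<le> 1 / real (Suc n))" for n m and q :: "'a \<Rightarrow> rat" and i
  define Q where "Q m = {q :: 'a \<Rightarrow> rat. \<forall>x. x \<notin> T m \<longrightarrow> q x = 0}" for m
  have "countable (Q m)" for m
  proof -
    have "Q m \<subseteq> (\<lambda>g x. if x \<in> T m then g x else 0) ` (T m \<rightarrow>\<^sub>E UNIV)"
    proof
      fix q assume "q \<in> Q m"
      then show "q \<in> (\<lambda>g x. if x \<in> T m then g x else 0) ` (T m \<rightarrow>\<^sub>E UNIV)"
        by (intro image_eqI[of _ _ "restrict q (T m)"]) (auto simp: Q_def)
    qed
    moreover have "countable (T m \<rightarrow>\<^sub>E (UNIV :: rat set))"
      using T(1) by (intro countable_PiE) auto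
    ultimately show ?thesis by (meson countable_image countable_subset)
  qed
  then have "countable (SIGMA n:(UNIV :: nat set). SIGMA m:UNIV. Q m)" by (intro countable_SIGMA) auto
  moreover define pick where "pick = (\<lambda>(n, m, q). if \<exists>i. close n m q i then SOME i. close n m q i else SOME i. i \<in> I)"
  ultimately have cnt: "countable (pick ` (SIGMA n:(UNIV :: nat set). SIGMA m:UNIV. Q m))" (is "countable ?P") by blast
  have pick: "close n m q (pick (n, m, q))" if "close n m q i" for n m q i
    using that someI[of "close n m q" i] by (auto simp: pick_def)
  have "?P \<subseteq> I"
  proof (clarify, rename_tac n m q)
    fix n m q
    show "pick (n, m, q) \<in> I"
    proof (cases "\<exists>i. close n m q i")
      case True
      then show ?thesis using pick close_def by blast
    next
      case False
      then have "pick (n, m, q) = (SOME i. i \<in> I)" unfolding pick_def by auto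
      then show ?thesis using some_in_eq[of I] I by simp
    qed
  qed
  have "pick (0, 0, \<lambda>_. 0) \<in> ?P" by (rule imageI) (simp add: Q_def)
  then have "?P \<noteq> {}" by blast
  show thesis
  proof (rule that[of "from_nat_into ?P"])
    show "from_nat_into ?P n \<in> I" for n
      using from_nat_into[OF \<open>?P \<noteq> {}\<close>] \<open>?P \<subseteq> I\<close> by blast
    fix i and e :: real assume i: "i \<in> I" and "e > 0"
    obtain n where n: "4 / real (Suc n) < e"
      using reals_Archimedean[of "e / 4"] \<open>e > 0\<close> by (auto simp: field_simps)
    have "uniformly_continuous_on D (\<Psi> i)" using compact_uniformly_continuous[OF cont[OF i] D] .
    then obtain d where d: "d > 0" "\<And>x y. x \<in> D \<Longrightarrow> y \<in> D \<Longrightarrow> dist x y < d \<Longrightarrow> \<bar>\<Psi> i x - \<Psi> i y\<bar> < 1 / real (Suc n)"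
      unfolding uniformly_continuous_on_def dist_real_def by (metis dist_commute of_nat_0_less_iff zero_less_Suc zero_less_divide_1_iff)
    obtain m where m: "1 / real (Suc m) < d" using reals_Archimedean[OF d(1)] by (auto simp: inverse_eq_divide)
    have "\<exists>r::rat. \<bar>a - of_rat r\<bar> \<le> 1 / real (Suc n)" for a :: real
    proof -
      obtain r where "a - 1 / real (Suc n) < of_rat r" "of_rat r < a"
        using of_rat_dense[of "a - 1 / real (Suc n)" a] by auto
      then show ?thesis by (intro exI[of _ r]) auto
    qed
    then obtain rr where rr: "\<And>a::real. \<bar>a - of_rat (rr a)\<bar> \<le> 1 / real (Suc n)" by metis
    define q where "q x = (if x \<in> T m then rr (\<Psi> i x) else 0)" for x
    have c1: "close n m q i"
      using i d(2) m rr unfolding close_def q_def by (auto intro: less_imp_le less_trans)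
    define j where "j = pick (n, m, q)"
    have c2: "close n m q j" unfolding j_def by (rule pick[OF c1])
    have "q \<in> Q m" by (simp add: Q_def q_def)
    then have "j \<in> ?P" by (auto simp: j_def)
    then obtain k where k: "from_nat_into ?P k = j" using cnt by (metis from_nat_into_surj)
    have "\<bar>\<Psi> i y - \<Psi> j y\<bar> \<le> e" if y: "y \<in> D" for y
    proof -
      obtain x where x: "x \<in> T m" "dist x y < 1 / real (Suc m)" using T(3)[OF y] by blast
      then have "x \<in> D" using T(2) by blast
      then have "\<bar>\<Psi> i x - \<Psi> i y\<bar> \<le> 1 / real (Suc n)" "\<bar>\<Psi> j x - \<Psi> j y\<bar> \<le> 1 / real (Suc n)"
        "\<bar>\<Psi> i x - of_rat (q x)\<bar> \<le> 1 / real (Suc n)" "\<bar>\<Psi> j x - of_rat (q x)\<bar> \<le> 1 / real (Suc n)"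
        using c1 c2 x y unfolding close_def by blast+
      moreover have "4 / real (Suc n) = 4 * (1 / real (Suc n))" by simp
      ultimately show ?thesis using n unfolding abs_le_iff by linarith
    qed
    then show "\<exists>n. \<forall>y\<in>D. \<bar>\<Psi> i y - \<Psi> (from_nat_into ?P n) y\<bar> \<le> e" using k by auto
  qed
qed

subsection \<open>Gradients\<close>

definition gr :: "('a::euclidean_space \<Rightarrow> real) \<Rightarrow> 'a \<Rightarrow> 'a" where
  "gr f z = (\<Sum>i\<in>Basis. frechet_derivative f (at z) i *\<^sub>R i)"

lemma gr_inner:
  assumes "f differentiable (at z)"
  shows "gr f z \<bullet> v = frechet_derivative f (at z) v"
proof -
  have lin: "linear (frechet_derivative f (at z))"
    using assms by (rule linear_frechet_derivative)
  have "frechet_derivative f (at z) v = frechet_derivative f (at z) (\<Sum>i\<in>Basis. (v \<bullet> i) *\<^sub>R i)"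
    by (simp add: euclidean_representation)
  also have "\<dots> = (\<Sum>i\<in>Basis. (v \<bullet> i) * frechet_derivative f (at z) i)"
    using lin by (simp add: linear_sum linear_scale)
  finally show ?thesis
    by (simp add: gr_def inner_sum_left) (simp add: inner_commute[of _ v] mult.commute)
qed

lemma gr_eqI:
  assumes "(f has_derivative (\<lambda>v. d \<bullet> v)) (at z)"
  shows "gr f z = d"
proof -
  have "frechet_derivative f (at z) = (\<lambda>v. d \<bullet> v)"
    using frechet_derivative_at[OF assms] by simp
  then show ?thesis by (simp add: gr_def euclidean_representation)
qed

lemma grad_on_gr:
  assumes "grad_on f D S"
  shows "grad_on f (gr f) S" and "x \<in> S \<Longrightarrow> gr f x = D x"
proof -
  show *: "gr f x = D x" if "x \<in> S" for x
    using grad_onD[OF assms that] by (rule gr_eqI)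
  show "grad_on f (gr f) S"
    using assms unfolding grad_on_def by (simp add: * cong: continuous_on_cong)
qed

lemma grad_on_local:
  assumes "\<And>x. x \<in> S \<Longrightarrow> \<exists>U D. open U \<and> x \<in> U \<and> grad_on f D U"
  shows "grad_on f (gr f) S"
  unfolding grad_on_def
proof (intro conjI ballI)
  fix x assume "x \<in> S"
  then obtain U D where U: "open U" "x \<in> U" "grad_on f D U" using assms by blast
  then show "(f has_derivative (\<lambda>v. gr f x \<bullet> v)) (at x)"
    using grad_on_gr(1)[OF U(3)] grad_onD by blast
next
  have "isCont (gr f) x" if x: "x \<in> S" for x
  proof -
    obtain U D where U: "open U" "x \<in> U" "grad_on f D U" using assms x by blast
    then have "continuous_on U (gr f)" using grad_on_gr(1)[OF U(3)] by (simp add: grad_on_def)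
    then show ?thesis using U by (simp add: continuous_on_eq_continuous_at)
  qed
  then show "continuous_on S (gr f)" by (simp add: continuous_at_imp_continuous_on)
qed

lemma grad_on_cong:
  assumes "grad_on f D S" "open S" "\<And>x. x \<in> S \<Longrightarrow> f x = h x"
  shows "grad_on h D S"
  unfolding grad_on_def
proof (intro conjI ballI)
  fix x assume x: "x \<in> S"
  show "(h has_derivative (\<lambda>v. D x \<bullet> v)) (at x)"
    by (rule has_derivative_transform_within_open[OF grad_onD[OF assms(1) x] assms(2) x assms(3)])
qed (use assms(1) in \<open>simp add: grad_on_def\<close>)

lemma Ck_on_1_iff_grad_on: "Ck_on 1 f S \<longleftrightarrow> grad_on f (gr f) S"
proof
  assume f: "Ck_on 1 f S"
  then have d: "\<And>x. x \<in> S \<Longrightarrow> f differentiable (at x)"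
    and c: "\<And>v. continuous_on S (\<lambda>x. frechet_derivative f (at x) v)"
    by (auto simp: One_nat_def)
  show "grad_on f (gr f) S"
    unfolding grad_on_def
  proof (intro conjI ballI)
    fix x assume "x \<in> S"
    then show "(f has_derivative (\<lambda>v. gr f x \<bullet> v)) (at x)"
      using d[of x] by (simp add: gr_inner frechet_derivative_works[symmetric])
  next
    show "continuous_on S (gr f)" unfolding gr_def by (intro continuous_intros c)
  qed
next
  assume f: "grad_on f (gr f) S"
  then have d: "\<And>x. x \<in> S \<Longrightarrow> f differentiable (at x)"
    unfolding grad_on_def differentiable_def by blast
  have "continuous_on S (\<lambda>x. gr f x \<bullet> v)" for v
    using f unfolding grad_on_def by (intro continuous_intros) auto
  then have "continuous_on S (\<lambda>x. frechet_derivative f (at x) v)" for v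
    by (rule continuous_on_cong[THEN iffD1, OF refl, rotated]) (simp add: gr_inner d)
  then show "Ck_on 1 f S" using d by (simp add: One_nat_def)
qed

lemma grad_on_compose_map:
  fixes T :: "'a::euclidean_space \<Rightarrow> 'b::euclidean_space"
  assumes T: "Ck_on 1 T S" and F: "grad_on F D U" and TS: "T ` S \<subseteq> U"
  shows "grad_on (F \<circ> T) (\<lambda>z. \<Sum>i\<in>Basis. (D (T z) \<bullet> frechet_derivative T (at z) i) *\<^sub>R i) S"
  unfolding grad_on_def
proof (intro conjI ballI)
  have d: "\<And>x. x \<in> S \<Longrightarrow> T differentiable (at x)"
    and c: "\<And>v. continuous_on S (\<lambda>x. frechet_derivative T (at x) v)"
    using T by (auto simp: One_nat_def)
  fix z assume z: "z \<in> S"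
  have lin: "linear (frechet_derivative T (at z))" using d[OF z] by (rule linear_frechet_derivative)
  have "(T has_derivative frechet_derivative T (at z)) (at z)"
    using d[OF z] by (simp add: frechet_derivative_works)
  moreover have "(F has_derivative (\<lambda>v. D (T z) \<bullet> v)) (at (T z))"
    using F TS z by (auto simp: grad_on_def)
  ultimately have der: "(F \<circ> T has_derivative (\<lambda>v. D (T z) \<bullet> frechet_derivative T (at z) v)) (at z)"
    using diff_chain_at[of T _ z F] by (simp add: o_def)
  have eq: "D (T z) \<bullet> frechet_derivative T (at z) v
      = (\<Sum>i\<in>Basis. (D (T z) \<bullet> frechet_derivative T (at z) i) *\<^sub>R i) \<bullet> v" for v
  proof -
    have "frechet_derivative T (at z) v = frechet_derivative T (at z) (\<Sum>i\<in>Basis. (v \<bullet> i) *\<^sub>R i)"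
      by (simp add: euclidean_representation)
    also have "\<dots> = (\<Sum>i\<in>Basis. (v \<bullet> i) *\<^sub>R frechet_derivative T (at z) i)"
      using lin by (simp add: linear_sum linear_scale)
    finally show ?thesis
      by (simp add: inner_sum_right inner_sum_left) (simp add: inner_commute[of _ v] mult.commute)
  qed
  then show "(F \<circ> T has_derivative (\<lambda>v. (\<Sum>i\<in>Basis. (D (T z) \<bullet> frechet_derivative T (at z) i) *\<^sub>R i) \<bullet> v)) (at z)"
    by (intro has_derivative_eq_rhs[OF der] ext eq)
next
  have d: "\<And>x. x \<in> S \<Longrightarrow> T differentiable (at x)"
    and c: "\<And>v. continuous_on S (\<lambda>x. frechet_derivative T (at x) v)"
    using T by (auto simp: One_nat_def)
  have "continuous_on S T"
    by (intro continuous_at_imp_continuous_on ballI differentiable_imp_continuous_within d)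
  moreover have "continuous_on U D" using F by (simp add: grad_on_def)
  ultimately have "continuous_on S (\<lambda>z. D (T z))" using continuous_on_compose2 TS by blast
  then show "continuous_on S (\<lambda>z. \<Sum>i\<in>Basis. (D (T z) \<bullet> frechet_derivative T (at z) i) *\<^sub>R i)"
    by (intro continuous_intros c)
qed

subsection \<open>Charts\<close>

locale manifold =
  fixes A :: "('m::t2_space, 'e::euclidean_space) chart set"
    and g :: "'m \<Rightarrow> ('m, 'e) tvec \<Rightarrow> ('m, 'e) tvec \<Rightarrow> real"
  assumes manifold: "closed_connected_riemannian_manifold A g"
begin

lemma atlas: "smooth_atlas A" and metric: "riemannian_metric A g"
  and compact_M: "compact (UNIV :: 'm set)" and connected_M: "connected (UNIV :: 'm set)"
  using manifold by (auto simp: closed_connected_riemannian_manifold_def)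

lemma chart_ex: "\<exists>c\<in>A. x \<in> cdom c"
  using atlas by (auto simp: smooth_atlas_def)

lemma chart_at: "chart_at A x \<in> A" "x \<in> cdom (chart_at A x)"
proof -
  have "\<exists>c. c \<in> A \<and> x \<in> cdom c" using chart_ex by blast
  from someI_ex[OF this] show "chart_at A x \<in> A" "x \<in> cdom (chart_at A x)"
    unfolding chart_at_def by blast+
qed

context
  fixes c assumes c: "c \<in> A"
begin

lemma open_cdom: "open (cdom c)" and open_cimage: "open (cimage c)"
  and chart_homeo: "homeomorphism (cdom c) (cimage c) (cmap c) (cinv c)"
  using atlas c by (auto simp: smooth_atlas_def)

lemma cinv_cmap: "x \<in> cdom c \<Longrightarrow> cinv c (cmap c x) = x"
  and cmap_cinv: "z \<in> cimage c \<Longrightarrow> cmap c (cinv c z) = z"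
  and cinv_in: "z \<in> cimage c \<Longrightarrow> cinv c z \<in> cdom c"
  and cont_cmap: "continuous_on (cdom c) (cmap c)"
  and cont_cinv: "continuous_on (cimage c) (cinv c)"
  using chart_homeo by (auto simp: homeomorphism_def)

lemma open_cinv_image:
  assumes "open S" "S \<subseteq> cimage c" shows "open (cinv c ` S)"
proof -
  have "cinv c ` S = cdom c \<inter> cmap c -` S"
    using assms(2) cinv_cmap cmap_cinv cinv_in by (force simp: image_iff)
  then show ?thesis
    using continuous_on_open_vimage[OF open_cdom, of "cmap c"] cont_cmap assms(1) by (simp add: Int_commute)
qed

lemma open_cinv_vimage: "open B \<Longrightarrow> open (cimage c \<inter> cinv c -` B)"
  using continuous_on_open_vimage[OF open_cimage, of "cinv c"] cont_cinv by (simp add: Int_commute[of "cimage c"])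

lemma compact_cinv_image: "compact K \<Longrightarrow> K \<subseteq> cimage c \<Longrightarrow> compact (cinv c ` K)"
  using cont_cinv by (meson compact_continuous_image continuous_on_subset)

lemma eventually_cinv:
  assumes "x \<in> cdom c" "\<forall>\<^sub>F y in nhds x. P y"
  shows "\<forall>\<^sub>F z in nhds (cmap c x). P (cinv c z)"
proof -
  obtain S where S: "open S" "x \<in> S" "\<And>y. y \<in> S \<Longrightarrow> P y"
    using assms(2) by (auto simp: eventually_nhds)
  have "open (cimage c \<inter> cinv c -` S)"
    using continuous_on_open_vimage[OF open_cimage, of "cinv c"] cont_cinv S(1) by (simp add: Int_commute)
  moreover have "cmap c x \<in> cimage c \<inter> cinv c -` S" using assms(1) S(2) by (simp add: cinv_cmap)
  ultimately show ?thesis unfolding eventually_nhds using S(3) by blast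
qed

lemma eventually_cmap:
  assumes "x \<in> cdom c" "\<forall>\<^sub>F z in nhds (cmap c x). P z"
  shows "\<forall>\<^sub>F y in nhds x. y \<in> cdom c \<and> P (cmap c y)"
proof -
  obtain S where S: "open S" "cmap c x \<in> S" "\<And>z. z \<in> S \<Longrightarrow> P z"
    using assms(2) by (auto simp: eventually_nhds)
  have "open (cinv c ` (S \<inter> cimage c))"
    using S(1) open_cimage by (intro open_cinv_image) auto
  moreover have "x \<in> cinv c ` (S \<inter> cimage c)"
    using S(2) assms(1) cinv_cmap by (metis IntI image_eqI)
  ultimately show ?thesis
    unfolding eventually_nhds using S(3) cmap_cinv cinv_in
    by (intro exI[of _ "cinv c ` (S \<inter> cimage c)"]) auto
qed

end

lemma transition:
  assumes "c \<in> A" "d \<in> A"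
  shows "Ck_on 1 (cmap d \<circ> cinv c) (cmap c ` (cdom c \<inter> cdom d))"
    and "open (cmap c ` (cdom c \<inter> cdom d))"
proof -
  show "Ck_on 1 (cmap d \<circ> cinv c) (cmap c ` (cdom c \<inter> cdom d))"
    using atlas assms unfolding smooth_atlas_def smooth_on_def by blast
  have "cmap c ` (cdom c \<inter> cdom d) = cimage c \<inter> cinv c -` cdom d"
    using cinv_cmap[OF assms(1)] cinv_in[OF assms(1)] cmap_cinv[OF assms(1)] by (force simp: image_iff)
  then show "open (cmap c ` (cdom c \<inter> cdom d))"
    using continuous_on_open_vimage[OF open_cimage[OF assms(1)], of "cinv c"] cont_cinv[OF assms(1)]
      open_cdom[OF assms(2)] by (simp add: Int_commute[of "cimage c"])
qed

abbreviation "dT c d x \<equiv> frechet_derivative (cmap d \<circ> cinv c) (at (cmap c x))"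

lemma transition_derivative:
  assumes "c \<in> A" "d \<in> A" "x \<in> cdom c" "x \<in> cdom d"
  shows "(cmap d \<circ> cinv c has_derivative dT c d x) (at (cmap c x))"
proof -
  have "cmap c x \<in> cmap c ` (cdom c \<inter> cdom d)" using assms by auto
  then have "cmap d \<circ> cinv c differentiable (at (cmap c x))"
    using transition(1)[OF assms(1,2)] by (auto simp: One_nat_def)
  then show ?thesis by (simp add: frechet_derivative_works)
qed

lemma linear_dT: "c \<in> A \<Longrightarrow> d \<in> A \<Longrightarrow> x \<in> cdom c \<Longrightarrow> x \<in> cdom d \<Longrightarrow> linear (dT c d x)"
  using transition_derivative has_derivative_linear by blast

lemma dT_self:
  assumes "c \<in> A" "x \<in> cdom c" shows "dT c c x w = w"
proof -
  have "((\<lambda>z. z) has_derivative (\<lambda>v. v)) (at (cmap c x))" by simp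
  then have "(cmap c \<circ> cinv c has_derivative (\<lambda>v. v)) (at (cmap c x))"
    by (rule has_derivative_transform_within_open[OF _ open_cimage[OF assms(1)]])
      (use assms cmap_cinv in auto)
  then show ?thesis using frechet_derivative_at by metis
qed

lemma dT_dT:
  assumes "c \<in> A" "d \<in> A" "e \<in> A" "x \<in> cdom c" "x \<in> cdom d" "x \<in> cdom e"
  shows "dT d e x (dT c d x w) = dT c e x w"
proof -
  have "(cmap e \<circ> cinv d has_derivative dT d e x) (at ((cmap d \<circ> cinv c) (cmap c x)))"
    using transition_derivative[of d e x] assms by (simp add: cinv_cmap)
  from diff_chain_at[OF transition_derivative[OF assms(1,2,4,5)] this]
  have 1: "((cmap e \<circ> cinv d) \<circ> (cmap d \<circ> cinv c) has_derivative (dT d e x \<circ> dT c d x)) (at (cmap c x))" .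
  have "(cmap e \<circ> cinv c has_derivative (dT d e x \<circ> dT c d x)) (at (cmap c x))"
    by (rule has_derivative_transform_within_open[OF 1 transition(2)[OF assms(1,2)]])
      (use assms in \<open>auto simp: cinv_cmap\<close>)
  then show ?thesis using frechet_derivative_at by (metis comp_apply)
qed

subsection \<open>Tangent vectors and covectors in coordinates\<close>

lemma tvec_of_eq: "d \<in> A \<Longrightarrow> x \<in> cdom d \<Longrightarrow> tvec_of A c x w d = dT c d x w"
  and tvec_of_zero: "\<not> (d \<in> A \<and> x \<in> cdom d) \<Longrightarrow> tvec_of A c x w d = 0"
  unfolding tvec_of_def by simp_all argo+

lemma tangent_spaceD:
  assumes "v \<in> tangent_space A x"
  shows "\<not> (c \<in> A \<and> x \<in> cdom c) \<Longrightarrow> v c = 0"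
    and "c \<in> A \<Longrightarrow> d \<in> A \<Longrightarrow> x \<in> cdom c \<Longrightarrow> x \<in> cdom d \<Longrightarrow> v d = dT c d x (v c)"
  using assms unfolding tangent_space_def by blast+

lemma tangent_spaceI:
  assumes "\<And>c. \<not> (c \<in> A \<and> x \<in> cdom c) \<Longrightarrow> v c = 0"
    and "\<And>c d. c \<in> A \<Longrightarrow> d \<in> A \<Longrightarrow> x \<in> cdom c \<Longrightarrow> x \<in> cdom d \<Longrightarrow> v d = dT c d x (v c)"
  shows "v \<in> tangent_space A x"
  using assms unfolding tangent_space_def by blast

lemma tvec_of_self: "c \<in> A \<Longrightarrow> x \<in> cdom c \<Longrightarrow> tvec_of A c x w c = w"
  by (simp add: tvec_of_eq dT_self)

lemma tvec_of_in: "c \<in> A \<Longrightarrow> x \<in> cdom c \<Longrightarrow> tvec_of A c x w \<in> tangent_space A x"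
  by (rule tangent_spaceI, erule tvec_of_zero) (simp only: tvec_of_eq dT_dT)

lemma tvec_of_coords: "c \<in> A \<Longrightarrow> x \<in> cdom c \<Longrightarrow> v \<in> tangent_space A x \<Longrightarrow> tvec_of A c x (v c) = v"
proof (rule ext)
  fix d assume "c \<in> A" "x \<in> cdom c" "v \<in> tangent_space A x"
  then show "tvec_of A c x (v c) d = v d"
    by (metis tvec_of_zero tvec_of_eq tangent_spaceD)
qed

lemma tvec_of_linear:
  "c \<in> A \<Longrightarrow> x \<in> cdom c \<Longrightarrow> tvec_of A c x (a *\<^sub>R v + b *\<^sub>R w)
    = (\<lambda>d. a *\<^sub>R tvec_of A c x v d + b *\<^sub>R tvec_of A c x w d)"
proof (rule ext)
  fix d assume c: "c \<in> A" "x \<in> cdom c"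
  show "tvec_of A c x (a *\<^sub>R v + b *\<^sub>R w) d = a *\<^sub>R tvec_of A c x v d + b *\<^sub>R tvec_of A c x w d"
  proof (cases "d \<in> A \<and> x \<in> cdom d")
    case True
    then have "linear (dT c d x)" using c linear_dT by blast
    then show ?thesis using True by (simp add: tvec_of_eq linear_add linear_scale)
  next
    case False
    then show ?thesis using tvec_of_zero[OF False] by simp
  qed
qed

lemma tangent_space_add:
  assumes "v \<in> tangent_space A x" "u \<in> tangent_space A x"
  shows "(\<lambda>d. v d + u d) \<in> tangent_space A x"
proof (rule tangent_spaceI)
  fix c d assume cd: "c \<in> A" "d \<in> A" "x \<in> cdom c" "x \<in> cdom d"
  show "v d + u d = dT c d x (v c + u c)"
    using tangent_spaceD(2)[OF assms(1) cd] tangent_spaceD(2)[OF assms(2) cd] linear_add[OF linear_dT[OF cd]] by simp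
qed (use tangent_spaceD(1)[OF assms(1)] tangent_spaceD(1)[OF assms(2)] in force)

lemma tangent_space_scale:
  assumes "v \<in> tangent_space A x"
  shows "(\<lambda>d. a *\<^sub>R v d) \<in> tangent_space A x"
proof (rule tangent_spaceI)
  fix c d assume cd: "c \<in> A" "d \<in> A" "x \<in> cdom c" "x \<in> cdom d"
  show "a *\<^sub>R v d = dT c d x (a *\<^sub>R v c)"
    using tangent_spaceD(2)[OF assms(1) cd] linear_scale[OF linear_dT[OF cd]] by simp
qed (use tangent_spaceD(1)[OF assms] in force)

lemma metric_bilinear:
  assumes c: "c \<in> A" "x \<in> cdom c"
  shows "bilinear (\<lambda>v w. g x (tvec_of A c x v) (tvec_of A c x w))"
proof -
  let ?B = "\<lambda>v w. g x (tvec_of A c x v) (tvec_of A c x w)"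
  have lin: "?B (a *\<^sub>R u + b *\<^sub>R v) w = a * ?B u w + b * ?B v w" for a b u v w
    using metric tvec_of_in[OF c] unfolding tvec_of_linear[OF c] riemannian_metric_def by blast
  have sym: "?B v w = ?B w v" for v w
    using metric tvec_of_in[OF c] unfolding riemannian_metric_def by blast
  have "linear (\<lambda>v. ?B v w)" for w
    using lin[of 1 _ 1 _ w] lin[of _ _ 0 0 w] by (intro linearI) auto
  then show ?thesis unfolding bilinear_def using sym by (metis (no_types, lifting) ext)
qed

lemma covec_of_in: "c \<in> A \<Longrightarrow> x \<in> cdom c \<Longrightarrow> covec_of A c x w \<in> cotangent_space A x"
proof -
  assume c: "c \<in> A" "x \<in> cdom c"
  show ?thesis
    unfolding cotangent_space_def covec_of_def
    by (intro CollectI conjI allI ballI impI)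
      (simp_all add: tangent_space_add tangent_space_scale inner_add_right)
qed

lemma covec_of_apply: "c \<in> A \<Longrightarrow> x \<in> cdom c \<Longrightarrow> covec_of A c x w (tvec_of A c x v) = w \<bullet> v"
  by (simp add: covec_of_def tvec_of_in tvec_of_self)

lemma cotangent_space_eq:
  assumes c: "c \<in> A" "x \<in> cdom c"
  shows "cotangent_space A x = range (covec_of A c x)"
proof (intro equalityI subsetI)
  fix p assume p: "p \<in> cotangent_space A x"
  define w where "w = (\<Sum>i\<in>Basis. p (tvec_of A c x i) *\<^sub>R i)"
  define q where "q v = p (tvec_of A c x v)" for v
  have "linear q"
  proof (rule linearI)
    fix v u :: 'e and a :: real
    show "q (v + u) = q v + q u"
      using p c tvec_of_linear[OF c, of 1 v 1 u] by (auto simp: q_def cotangent_space_def tvec_of_in)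
    show "q (a *\<^sub>R v) = a *\<^sub>R q v"
      using p c tvec_of_linear[OF c, of a v 0 0] by (auto simp: q_def cotangent_space_def tvec_of_in)
  qed
  have q: "q v = w \<bullet> v" for v
  proof -
    have "q v = q (\<Sum>i\<in>Basis. (v \<bullet> i) *\<^sub>R i)" by (simp add: euclidean_representation)
    also have "\<dots> = (\<Sum>i\<in>Basis. (v \<bullet> i) * q i)"
      using \<open>linear q\<close> by (simp add: linear_sum linear_scale)
    finally show ?thesis
      by (simp add: w_def q_def inner_sum_left) (simp add: inner_commute[of _ v] mult.commute)
  qed
  have "p = covec_of A c x w"
  proof
    fix v show "p v = covec_of A c x w v"
    proof (cases "v \<in> tangent_space A x")
      case True
      then show ?thesis using q[of "v c"] by (simp add: q_def covec_of_def tvec_of_coords[OF c])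
    next
      case False
      then show ?thesis using p by (simp add: covec_of_def cotangent_space_def)
    qed
  qed
  then show "p \<in> range (covec_of A c x)" by blast
qed (use covec_of_in[OF c] in blast)

lemma topspace_cotangent_bundle: "topspace (cotangent_bundle A) = Sigma UNIV (cotangent_space A)"
proof -
  have "{(z, w). z \<in> cimage c \<and> (cinv c z, covec_of A c (cinv c z) w) \<in> Sigma UNIV (cotangent_space A)}
      = cimage c \<times> UNIV" if "c \<in> A" for c
    using that covec_of_in[OF that cinv_in[OF that]] by blast
  then have "openin (cotangent_bundle A) (Sigma UNIV (cotangent_space A))"
    by (subst openin_cotangent_bundle[OF atlas]) (auto intro: open_Times open_cimage)
  then show ?thesis
    using openin_subset[of "cotangent_bundle A"] openin_cotangent_bundle[OF atlas, THEN iffD1, OF openin_topspace]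
    by blast
qed

lemma topspace_tangent_bundle: "topspace (tangent_bundle A) = Sigma UNIV (tangent_space A)"
proof -
  have "{(z, w). z \<in> cimage c \<and> (cinv c z, tvec_of A c (cinv c z) w) \<in> Sigma UNIV (tangent_space A)}
      = cimage c \<times> UNIV" if "c \<in> A" for c
    using that tvec_of_in[OF that cinv_in[OF that]] by blast
  then have "openin (tangent_bundle A) (Sigma UNIV (tangent_space A))"
    by (subst openin_tangent_bundle[OF atlas]) (auto intro: open_Times open_cimage)
  then show ?thesis
    using openin_subset[of "tangent_bundle A"] openin_tangent_bundle[OF atlas, THEN iffD1, OF openin_topspace]
    by blast
qed

subsection \<open>Continuously differentiable functions and their differentials\<close>

abbreviation "C1 \<equiv> C1_manifold A"

lemma C1_iff: "f \<in> C1 \<longleftrightarrow> (\<forall>c\<in>A. grad_on (f \<circ> cinv c) (gr (f \<circ> cinv c)) (cimage c))"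
  by (simp add: C1_manifold_def Ck_on_1_iff_grad_on del: One_nat_def)

lemma C1I: "(\<And>c. c \<in> A \<Longrightarrow> \<exists>D. grad_on (f \<circ> cinv c) D (cimage c)) \<Longrightarrow> f \<in> C1"
  unfolding C1_iff using grad_on_gr(1) by blast

lemma C1D: "f \<in> C1 \<Longrightarrow> c \<in> A \<Longrightarrow> grad_on (f \<circ> cinv c) (gr (f \<circ> cinv c)) (cimage c)"
  by (simp add: C1_iff)

lemma C1_continuous: "f \<in> C1 \<Longrightarrow> continuous_on UNIV f"
proof -
  assume f: "f \<in> C1"
  have "isCont f x" for x
  proof -
    obtain c where c: "c \<in> A" "x \<in> cdom c" using chart_ex by blast
    have "continuous_on (cdom c) (\<lambda>y. (f \<circ> cinv c) (cmap c y))"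
      by (rule continuous_on_compose2[OF grad_on_imp_continuous_on[OF C1D[OF f c(1)]] cont_cmap[OF c(1)]]) simp
    then have "continuous_on (cdom c) f"
      by (rule continuous_on_cong[THEN iffD1, OF refl, rotated]) (simp add: cinv_cmap c)
    then show ?thesis using open_cdom[OF c(1)] c(2) by (simp add: continuous_on_eq_continuous_at)
  qed
  then show ?thesis by (simp add: continuous_at_imp_continuous_on)
qed

abbreviation "dc f c x \<equiv> gr (f \<circ> cinv c) (cmap c x)"

lemma differential_eq_covec_of:
  assumes f: "f \<in> C1" and c: "c \<in> A" "x \<in> cdom c"
  shows "differential A f x = covec_of A c x (dc f c x)"
proof
  fix v
  define d where "d = chart_at A x"
  have d: "d \<in> A" "x \<in> cdom d" using chart_at by (auto simp: d_def)
  show "differential A f x v = covec_of A c x (dc f c x) v"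
  proof (cases "v \<in> tangent_space A x")
    case True
    have fd: "(f \<circ> cinv d has_derivative (\<lambda>v. dc f d x \<bullet> v)) (at ((cmap d \<circ> cinv c) (cmap c x)))"
      using C1D[OF f d(1)] d c by (simp add: grad_on_def cinv_cmap)
    from diff_chain_at[OF transition_derivative[OF c(1) d(1) c(2) d(2)] this]
    have 1: "((f \<circ> cinv d) \<circ> (cmap d \<circ> cinv c) has_derivative (\<lambda>v. dc f d x \<bullet> dT c d x v)) (at (cmap c x))"
      by (simp add: o_def)
    have "(f \<circ> cinv c has_derivative (\<lambda>v. dc f d x \<bullet> dT c d x v)) (at (cmap c x))"
      by (rule has_derivative_transform_within_open[OF 1 transition(2)[OF c(1) d(1)]])
        (use c d in \<open>auto simp: cinv_cmap\<close>)
    then have e1: "frechet_derivative (f \<circ> cinv c) (at (cmap c x)) = (\<lambda>v. dc f d x \<bullet> dT c d x v)"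
      by (rule frechet_derivative_at[symmetric])
    have e2: "frechet_derivative (f \<circ> cinv c) (at (cmap c x)) = (\<lambda>u. dc f c x \<bullet> u)" if "c \<in> A" "x \<in> cdom c" for c
      by (rule frechet_derivative_at[symmetric], rule grad_onD[OF C1D[OF f that(1)]]) (use that in simp)
    have "v d = dT c d x (v c)" using tangent_spaceD(2)[OF True c(1) d(1) c(2) d(2)] .
    then have "dc f d x \<bullet> v d = dc f c x \<bullet> v c"
      using fun_cong[OF e1, of "v c"] fun_cong[OF e2[OF c], of "v c"] by simp
    moreover have "differential A f x v = dc f d x \<bullet> v d"
      using True fun_cong[OF e2[OF d], of "v d"] by (simp add: differential_def Let_def flip: d_def)
    ultimately show ?thesis using True by (simp add: covec_of_def)
  qed (simp add: differential_def covec_of_def)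
qed

lemma differential_in: "f \<in> C1 \<Longrightarrow> differential A f x \<in> cotangent_space A x"
  using differential_eq_covec_of[OF _ chart_at] covec_of_in[OF chart_at] by simp

lemma differential_apply:
  "f \<in> C1 \<Longrightarrow> c \<in> A \<Longrightarrow> x \<in> cdom c \<Longrightarrow> v \<in> tangent_space A x
    \<Longrightarrow> differential A f x v = dc f c x \<bullet> v c"
  by (simp add: differential_eq_covec_of covec_of_def)

lemma differential_eqI:
  assumes "f \<in> C1" "c \<in> A" "x \<in> cdom c" "(f \<circ> cinv c has_derivative (\<lambda>v. d \<bullet> v)) (at (cmap c x))"
  shows "differential A f x = covec_of A c x d"
  using differential_eq_covec_of[OF assms(1-3)] gr_eqI[OF assms(4)] by simp

lemma C1_const: "(\<lambda>_. a) \<in> C1"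
  by (rule C1I) (auto simp: o_def intro: grad_on_const)

lemma C1_add: "f \<in> C1 \<Longrightarrow> h \<in> C1 \<Longrightarrow> (\<lambda>x. f x + h x) \<in> C1"
  by (rule C1I) (use grad_on_add[OF C1D C1D, of f _ h] in \<open>auto simp: o_def\<close>)

lemma C1_mult: "f \<in> C1 \<Longrightarrow> h \<in> C1 \<Longrightarrow> (\<lambda>x. f x * h x) \<in> C1"
  by (rule C1I) (use grad_on_mult[OF C1D C1D, of f _ h] in \<open>auto simp: o_def\<close>)

lemma C1_cmult: "f \<in> C1 \<Longrightarrow> (\<lambda>x. a * f x) \<in> C1"
  by (rule C1_mult[OF C1_const])

lemma C1_sum: "finite I \<Longrightarrow> (\<And>i. i \<in> I \<Longrightarrow> f i \<in> C1) \<Longrightarrow> (\<lambda>x. \<Sum>i\<in>I. f i x) \<in> C1"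
  by (induction I rule: finite_induct) (auto intro: C1_const C1_add)

lemma C1_compose_real:
  fixes \<theta> \<theta>' :: "real \<Rightarrow> real"
  assumes "f \<in> C1" "\<And>x. (\<theta> has_real_derivative \<theta>' (f x)) (at (f x))" "continuous_on (range f) \<theta>'"
  shows "(\<lambda>x. \<theta> (f x)) \<in> C1"
proof (rule C1I)
  fix c assume c: "c \<in> A"
  have "grad_on (\<lambda>x. \<theta> ((f \<circ> cinv c) x)) (\<lambda>x. \<theta>' ((f \<circ> cinv c) x) *\<^sub>R gr (f \<circ> cinv c) x) (cimage c)"
    using assms by (intro grad_on_compose_real C1D c) (auto intro: continuous_on_subset)
  then show "\<exists>D. grad_on ((\<lambda>x. \<theta> (f x)) \<circ> cinv c) D (cimage c)" by (auto simp: o_def)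
qed

section \<open>Rules for the differential at a fixed tangent vector\<close>

context
  fixes v :: "('m, 'e) tvec" and x :: 'm assumes v: "v \<in> tangent_space A x"
begin

lemma C1_has_derivative:
  "f \<in> C1 \<Longrightarrow> (f \<circ> cinv (chart_at A x) has_derivative (\<lambda>v. dc f (chart_at A x) x \<bullet> v)) (at (cmap (chart_at A x) x))"
  using C1D[OF _ chart_at(1)] chart_at(2) by (auto simp: grad_on_def)

lemma differential_const: "differential A (\<lambda>_. a) x v = 0"
proof -
  have "gr ((\<lambda>_. a) \<circ> cinv (chart_at A x)) (cmap (chart_at A x) x) = 0"
    by (rule gr_eqI) (simp add: o_def)
  then show ?thesis by (simp add: differential_apply[OF C1_const chart_at v])
qed

lemma differential_add:
  assumes "f \<in> C1" "h \<in> C1"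
  shows "differential A (\<lambda>x. f x + h x) x v = differential A f x v + differential A h x v"
proof -
  have "gr ((\<lambda>x. f x + h x) \<circ> cinv (chart_at A x)) (cmap (chart_at A x) x)
      = dc f (chart_at A x) x + dc h (chart_at A x) x"
    using has_derivative_add[OF C1_has_derivative[OF assms(1)] C1_has_derivative[OF assms(2)]]
    by (intro gr_eqI) (simp add: o_def inner_add_left)
  then show ?thesis
    by (simp add: differential_apply[OF C1_add chart_at v] differential_apply[OF _ chart_at v] assms inner_add_left)
qed

lemma differential_mult:
  assumes "f \<in> C1" "h \<in> C1"
  shows "differential A (\<lambda>x. f x * h x) x v = f x * differential A h x v + h x * differential A f x v"
proof -
  let ?c = "chart_at A x"
  have "((\<lambda>x. f x * h x) \<circ> cinv ?c has_derivative
      (\<lambda>v. (f x *\<^sub>R dc h ?c x + h x *\<^sub>R dc f ?c x) \<bullet> v)) (at (cmap ?c x))"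
    using has_derivative_mult[OF C1_has_derivative[OF assms(1)] C1_has_derivative[OF assms(2)]] chart_at
    by (simp add: o_def inner_add_left cinv_cmap algebra_simps)
  from gr_eqI[OF this] show ?thesis
    by (simp add: differential_apply[OF C1_mult chart_at v] differential_apply[OF _ chart_at v] assms inner_add_left)
qed

lemma differential_cmult: "f \<in> C1 \<Longrightarrow> differential A (\<lambda>x. a * f x) x v = a * differential A f x v"
  using differential_mult[OF C1_const[of a]] differential_const[of a] by simp

lemma differential_sum:
  "finite I \<Longrightarrow> (\<And>i. i \<in> I \<Longrightarrow> f i \<in> C1)
    \<Longrightarrow> differential A (\<lambda>x. \<Sum>i\<in>I. f i x) x v = (\<Sum>i\<in>I. differential A (f i) x v)"
proof (induction I rule: finite_induct)
  case (insert i I)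
  then show ?case using differential_add[of "f i" "\<lambda>x. \<Sum>i\<in>I. f i x"] by (simp add: C1_sum)
qed (simp add: differential_const)

lemma differential_compose_real:
  fixes \<theta> \<theta>' :: "real \<Rightarrow> real"
  assumes f: "f \<in> C1" "\<And>x. (\<theta> has_real_derivative \<theta>' (f x)) (at (f x))" "continuous_on (range f) \<theta>'"
  shows "differential A (\<lambda>x. \<theta> (f x)) x v = \<theta>' (f x) * differential A f x v"
proof -
  let ?c = "chart_at A x"
  have "(\<theta> has_derivative (\<lambda>h. \<theta>' (f x) * h)) (at ((f \<circ> cinv ?c) (cmap ?c x)))"
    using assms(2)[of x] chart_at by (simp add: has_field_derivative_def cinv_cmap)
  from diff_chain_at[OF C1_has_derivative[OF f(1)] this]
  have "((\<lambda>x. \<theta> (f x)) \<circ> cinv ?c has_derivative (\<lambda>v. (\<theta>' (f x) *\<^sub>R dc f ?c x) \<bullet> v)) (at (cmap ?c x))"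
    by (simp add: o_def)
  from gr_eqI[OF this] show ?thesis
    by (simp add: differential_apply[OF C1_compose_real[OF f] chart_at v] differential_apply[OF _ chart_at v] f)
qed

end

lemma differential_eq_if_touching:
  assumes f: "f \<in> C1" "k \<in> C1" and touch: "\<forall>\<^sub>F y in nhds x. f y - k y \<le> f x - k x"
  shows "differential A f x = differential A k x"
proof
  fix v
  show "differential A f x v = differential A k x v"
  proof (cases "v \<in> tangent_space A x")
    case True
    define q where "q y = f y + (- 1) * k y" for y
    have q: "q \<in> C1" unfolding q_def by (intro C1_add C1_cmult f)
    let ?c = "chart_at A x"
    have "\<forall>\<^sub>F z in nhds (cmap ?c x). f (cinv ?c z) - k (cinv ?c z) \<le> f x - k x"
      by (rule eventually_cinv[OF chart_at touch])
    then obtain T where T: "open T" "cmap ?c x \<in> T" "\<And>z. z \<in> T \<Longrightarrow> f (cinv ?c z) - k (cinv ?c z) \<le> f x - k x"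
      unfolding eventually_nhds by blast
    have "(\<lambda>v. dc q ?c x \<bullet> v) = (\<lambda>v. 0)"
    proof (rule differential_zero_maxmin[OF T(2,1) C1_has_derivative[OF True q]])
      show "(\<forall>y\<in>T. (q \<circ> cinv ?c) y \<le> (q \<circ> cinv ?c) (cmap ?c x)) \<or> (\<forall>y\<in>T. (q \<circ> cinv ?c) (cmap ?c x) \<le> (q \<circ> cinv ?c) y)"
        using T(3) by (simp add: q_def cinv_cmap[OF chart_at])
    qed
    then have "differential A q x v = 0" using differential_apply[OF q chart_at True] by metis
    then show ?thesis
      unfolding q_def differential_add[OF True f(1) C1_cmult[OF f(2)]] differential_cmult[OF True f(2)] by simp
  qed (simp add: differential_def)
qed

definition chart_extension :: "('m, 'e) chart \<Rightarrow> ('e \<Rightarrow> real) \<Rightarrow> 'm \<Rightarrow> real" where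
  "chart_extension c F x = (if x \<in> cdom c then F (cmap c x) else 0)"

text \<open>Seen from another chart, a point is either in the image of S, where the function is F
  after a coordinate change, or off the image of K, where it vanishes nearby. The image of K is
  closed because it is compact in a Hausdorff space.\<close>

lemma chart_extension_C1:
  assumes c: "c \<in> A" and K: "compact K" "K \<subseteq> S" "open S" "S \<subseteq> cimage c"
    and F: "grad_on F D S" "\<And>z. z \<notin> K \<Longrightarrow> F z = 0"
  shows "chart_extension c F \<in> C1"
proof (rule C1I)
  fix d assume d: "d \<in> A"
  let ?f = "chart_extension c F \<circ> cinv d"
  have "\<exists>U D. open U \<and> z \<in> U \<and> grad_on ?f D U" if z: "z \<in> cimage d" for z
  proof (cases "cinv d z \<in> cinv c ` S")
    case True
    define U where "U = cimage d \<inter> cinv d -` (cinv c ` S)"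
    have "open U"
      unfolding U_def by (intro open_cinv_vimage[OF d] open_cinv_image[OF c K(3,4)])
    have U: "cinv d y \<in> cdom c" "cinv d y \<in> cdom d" "cmap c (cinv d y) \<in> S" "y \<in> cimage d" if "y \<in> U" for y
      using that K(4) cinv_in[OF c] cmap_cinv[OF c] cinv_in[OF d] by (auto simp: U_def subset_iff)
    have "U \<subseteq> cmap d ` (cdom d \<inter> cdom c)"
      using U cmap_cinv[OF d] by (metis IntI image_eqI subsetI)
    moreover have "Ck_on 1 T X" if "Ck_on 1 T Y" "X \<subseteq> Y" for T :: "'e \<Rightarrow> 'e" and X Y
      using that by (auto simp: One_nat_def intro: continuous_on_subset)
    ultimately have T: "Ck_on 1 (cmap c \<circ> cinv d) U" using transition(1)[OF d c] by blast
    have "grad_on (F \<circ> (cmap c \<circ> cinv d))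
        (\<lambda>z. \<Sum>i\<in>Basis. (D ((cmap c \<circ> cinv d) z) \<bullet> frechet_derivative (cmap c \<circ> cinv d) (at z) i) *\<^sub>R i) U"
      by (rule grad_on_compose_map[OF T F(1)]) (use U in auto)
    then have "grad_on ?f (\<lambda>z. \<Sum>i\<in>Basis. (D ((cmap c \<circ> cinv d) z) \<bullet> frechet_derivative (cmap c \<circ> cinv d) (at z) i) *\<^sub>R i) U"
      by (rule grad_on_cong[OF _ \<open>open U\<close>]) (use U in \<open>auto simp: chart_extension_def\<close>)
    moreover have "z \<in> U" using True z by (auto simp: U_def)
    ultimately show ?thesis using \<open>open U\<close> by blast
  next
    case False
    define U where "U = cimage d \<inter> cinv d -` (- cinv c ` K)"
    have "closed (cinv c ` K)"
      using compact_cinv_image[OF c K(1)] K by (intro compact_imp_closed) auto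
    then have "open U"
      unfolding U_def by (intro open_cinv_vimage[OF d]) (simp add: open_Compl)
    have "?f y = 0" if "y \<in> U" for y
    proof (cases "cinv d y \<in> cdom c")
      case True
      then have "cmap c (cinv d y) \<notin> K"
        using that cinv_cmap[OF c] by (auto simp: U_def image_iff)
      then show ?thesis by (simp add: chart_extension_def F)
    qed (simp add: chart_extension_def)
    then have "grad_on ?f (\<lambda>_. 0) U"
      by (intro grad_on_cong[OF grad_on_const[of 0] \<open>open U\<close>]) auto
    moreover have "z \<in> U" using False z K(2) by (auto simp: U_def)
    ultimately show ?thesis using \<open>open U\<close> by blast
  qed
  then show "\<exists>D. grad_on ?f D (cimage d)" using grad_on_local by blast
qed

text \<open>Test functions for viscosity solutions are global, while they are constructed in charts.
  A bump equal to one on the smaller ball preserves both values and differentials there.\<close>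

lemma local_function_extends:
  assumes c: "c \<in> A" and z: "cball z s \<subseteq> cimage c" and F: "grad_on F D (ball z s)" and r: "0 < r" "r < s"
  obtains f where "f \<in> C1" "\<And>y. y \<in> cball z r \<Longrightarrow> f (cinv c y) = F y"
    "\<And>y. y \<in> ball z r \<Longrightarrow> differential A f (cinv c y) = covec_of A c (cinv c y) (D y)"
proof -
  define t where "t = (r + s) / 2"
  have t: "r < t" "t < s" using r by (auto simp: t_def)
  obtain E where E: "grad_on (bump z r t) E (ball z s)" using bump_grad[of r t z "ball z s"] r t by auto
  define H where "H y = bump z r t y * F y" for y
  define f where "f = chart_extension c H"
  have f: "f \<in> C1"
    unfolding f_def
  proof (rule chart_extension_C1[OF c])
    show "compact (cball z t)" by simp
    show "cball z t \<subseteq> ball z s" using t by auto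
    show "ball z s \<subseteq> cimage c" using z by (meson ball_subset_cball subset_trans)
    show "grad_on H (\<lambda>y. bump z r t y *\<^sub>R D y + F y *\<^sub>R E y) (ball z s)"
      unfolding H_def by (rule grad_on_mult[OF E F])
    show "H y = 0" if "y \<notin> cball z t" for y
      using that bump_eq_0[of r t z y] r t by (simp add: H_def)
  qed simp
  have cin: "y \<in> cimage c" if "y \<in> cball z r" for y using that z t by (auto simp: subset_iff)
  have eq: "f (cinv c y) = F y" if y: "y \<in> cball z r" for y
    using cin[OF y] cinv_in[OF c] cmap_cinv[OF c] bump_eq_1[of r t z y] y r t
    by (simp add: f_def chart_extension_def H_def)
  show thesis
  proof (rule that[OF f])
    fix y assume y: "y \<in> ball z r"
    have "(F has_derivative (\<lambda>v. D y \<bullet> v)) (at y)" using F y r by (auto simp: grad_on_def)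
    then have "(f \<circ> cinv c has_derivative (\<lambda>v. D y \<bullet> v)) (at y)"
      by (rule has_derivative_transform_within_open[OF _ open_ball y]) (simp add: eq)
    moreover have "cmap c (cinv c y) = y" "cinv c y \<in> cdom c"
      using cin[of y] y cmap_cinv[OF c] cinv_in[OF c] by auto
    ultimately show "differential A f (cinv c y) = covec_of A c (cinv c y) (D y)"
      by (intro differential_eqI[OF f c]) auto
  qed (rule eq)
qed

lemma chart_ball_ex:
  obtains c s where "c \<in> A" "x \<in> cdom c" "s > 0" "cball (cmap c x) s \<subseteq> cimage c"
proof -
  obtain c where c: "c \<in> A" "x \<in> cdom c" using chart_ex by blast
  then obtain s where "s > 0" "cball (cmap c x) s \<subseteq> cimage c"
    using open_cimage[OF c(1)] by (meson imageI open_contains_cball)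
  then show thesis using that c by blast
qed

end

subsection \<open>Hamiltonian and Lagrangian in coordinates\<close>

locale hamiltonian = manifold A g
  for A :: "('m::t2_space, 'e::euclidean_space) chart set"
    and g :: "'m \<Rightarrow> ('m, 'e) tvec \<Rightarrow> ('m, 'e) tvec \<Rightarrow> real" +
  fixes G :: "'m \<Rightarrow> ('m, 'e) covec \<Rightarrow> real"
  assumes G_continuous: "continuous_hamiltonian A G"
    and G_convex: "convex_hamiltonian A G"
    and G_superlinear: "superlinear_hamiltonian A g G"
begin

abbreviation "L \<equiv> lagrangian A G"

definition Gc :: "('m, 'e) chart \<Rightarrow> 'e \<Rightarrow> 'e \<Rightarrow> real" where
  "Gc c z w = G (cinv c z) (covec_of A c (cinv c z) w)"

definition Lc :: "('m, 'e) chart \<Rightarrow> 'e \<Rightarrow> 'e \<Rightarrow> real" where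
  "Lc c z v = L (cinv c z) (tvec_of A c (cinv c z) v)"

lemma G_differential: "f \<in> C1 \<Longrightarrow> c \<in> A \<Longrightarrow> x \<in> cdom c \<Longrightarrow> G x (differential A f x) = Gc c (cmap c x) (dc f c x)"
  by (simp add: Gc_def differential_eq_covec_of cinv_cmap)

lemma Gc_continuous:
  assumes c: "c \<in> A" shows "continuous_on (cimage c \<times> UNIV) (\<lambda>(z, w). Gc c z w)"
  unfolding continuous_on_open_vimage[OF open_Times[OF open_cimage[OF c] open_UNIV]]
proof (intro allI impI)
  fix B :: "real set" assume "open B"
  then have "openin (cotangent_bundle A) {p \<in> topspace (cotangent_bundle A). (case p of (x, p) \<Rightarrow> G x p) \<in> B}"
    using G_continuous unfolding continuous_hamiltonian_def continuous_map by simp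
  then have "open {(z, w). z \<in> cimage c \<and> (cinv c z, covec_of A c (cinv c z) w)
      \<in> {p \<in> topspace (cotangent_bundle A). (case p of (x, p) \<Rightarrow> G x p) \<in> B}}"
    using openin_cotangent_bundle[OF atlas] c by blast
  also have "{(z, w). z \<in> cimage c \<and> (cinv c z, covec_of A c (cinv c z) w)
      \<in> {p \<in> topspace (cotangent_bundle A). (case p of (x, p) \<Rightarrow> G x p) \<in> B}}
      = (\<lambda>(z, w). Gc c z w) -` B \<inter> cimage c \<times> UNIV"
    using covec_of_in[OF c cinv_in[OF c]] by (auto simp: topspace_cotangent_bundle Gc_def)
  finally show "open ((\<lambda>(z, w). Gc c z w) -` B \<inter> cimage c \<times> UNIV)" .
qed

lemma Gc_continuous_compose:
  assumes "c \<in> A" "continuous_on S f" "continuous_on S h" "f ` S \<subseteq> cimage c"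
  shows "continuous_on S (\<lambda>x. Gc c (f x) (h x))"
  using continuous_on_compose2[OF Gc_continuous[OF assms(1)] continuous_on_Pair[OF assms(2,3)]] assms(4)
  by auto

lemma Gc_convex:
  assumes c: "c \<in> A" "z \<in> cimage c" shows "convex_on UNIV (Gc c z)"
proof (rule convex_onI)
  fix t :: real and x y :: 'e assume t: "0 < t" "t < 1"
  have eq: "covec_of A c (cinv c z) ((1 - t) *\<^sub>R x + t *\<^sub>R y)
      = (\<lambda>v. (1 - t) * covec_of A c (cinv c z) x v + t * covec_of A c (cinv c z) y v)"
    by (rule ext) (simp add: covec_of_def inner_add_left)
  show "Gc c z ((1 - t) *\<^sub>R x + t *\<^sub>R y) \<le> (1 - t) * Gc c z x + t * Gc c z y"
    unfolding Gc_def eq using G_convex t covec_of_in[OF c(1) cinv_in[OF c]]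
    unfolding convex_hamiltonian_def by simp
qed simp

section \<open>Superlinear growth in coordinates, uniform on compact sets\<close>

lemma metric_bounds:
  assumes c: "c \<in> A" "x \<in> cdom c"
  obtains a b where "a > 0" "b > 0"
    "\<And>v. a * norm v \<le> tnorm g x (tvec_of A c x v)" "\<And>v. tnorm g x (tvec_of A c x v) \<le> b * norm v"
proof -
  define B where "B v w = g x (tvec_of A c x v) (tvec_of A c x w)" for v w
  have bl: "bilinear B" unfolding B_def by (rule metric_bilinear[OF c])
  then have bb: "bounded_bilinear B" by (rule bilinear_conv_bounded_bilinear[THEN iffD1])
  have cq: "continuous_on S (\<lambda>v. B v v)" for S
    by (intro bounded_bilinear.continuous_on[OF bb] continuous_on_id)
  have pos: "B v v > 0" if "v \<noteq> 0" for v
  proof -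
    have "tvec_of A c x v \<noteq> (\<lambda>_. 0)" using tvec_of_self[OF c, of v] that by metis
    then show ?thesis
      using metric tvec_of_in[OF c] unfolding B_def riemannian_metric_def by blast
  qed
  have "compact (sphere (0::'e) 1)" "sphere (0::'e) 1 \<noteq> {}" by auto
  then obtain v0 v1 where v01: "v0 \<in> sphere 0 1" "\<And>v. v \<in> sphere 0 1 \<Longrightarrow> B v0 v0 \<le> B v v"
    "v1 \<in> sphere 0 1" "\<And>v. v \<in> sphere 0 1 \<Longrightarrow> B v v \<le> B v1 v1"
    using continuous_attains_inf[OF _ _ cq] continuous_attains_sup[OF _ _ cq] by metis
  have p0: "B v0 v0 > 0" "B v1 v1 > 0" using v01(1,3) pos by (metis mem_sphere_0 norm_zero zero_neq_one)+
  have hom: "B v v = (norm v)\<^sup>2 * B (v /\<^sub>R norm v) (v /\<^sub>R norm v)" if "v \<noteq> 0" for v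
    using that by (simp add: bilinear_lmul[OF bl] bilinear_rmul[OF bl] power2_eq_square field_simps)
  have tn: "tnorm g x (tvec_of A c x v) = sqrt (B v v)" for v by (simp add: tnorm_def B_def)
  have nn: "B 0 0 = 0" using bilinear_lzero[OF bl] .
  show thesis
  proof (rule that[of "sqrt (B v0 v0)" "sqrt (B v1 v1)"])
    fix v
    show "sqrt (B v0 v0) * norm v \<le> tnorm g x (tvec_of A c x v)"
    proof (cases "v = 0")
      case False
      then have "B v0 v0 * (norm v)\<^sup>2 \<le> B v v"
        using hom[OF False] v01(2)[of "v /\<^sub>R norm v"] by (simp add: mult.commute mult_right_mono)
      then show ?thesis unfolding tn by (metis real_sqrt_le_iff real_sqrt_mult norm_ge_zero real_sqrt_abs abs_norm_cancel)
    qed (simp add: tn nn)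
    show "tnorm g x (tvec_of A c x v) \<le> sqrt (B v1 v1) * norm v"
    proof (cases "v = 0")
      case False
      then have "B v v \<le> B v1 v1 * (norm v)\<^sup>2"
        using hom[OF False] v01(4)[of "v /\<^sub>R norm v"] by (simp add: mult.commute mult_right_mono)
      then show ?thesis unfolding tn by (metis real_sqrt_le_iff real_sqrt_mult norm_ge_zero real_sqrt_abs abs_norm_cancel)
    qed (simp add: tn nn)
  qed (use p0 in auto)
qed

lemma Gc_superlinear:
  assumes c: "c \<in> A" "z \<in> cimage c" and "K \<ge> 0"
  obtains R where "\<And>w. norm w > R \<Longrightarrow> Gc c z w \<ge> K * norm w"
proof -
  define x where "x = cinv c z"
  have x: "x \<in> cdom c" using cinv_in[OF c] by (simp add: x_def)
  obtain a b where ab: "a > 0" "b > 0"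
    "\<And>v. a * norm v \<le> tnorm g x (tvec_of A c x v)" "\<And>v. tnorm g x (tvec_of A c x v) \<le> b * norm v"
    using metric_bounds[OF c(1) x] by blast
  have conorm: "conorm A g x (covec_of A c x w) \<ge> norm w / b" if "w \<noteq> 0" for w
  proof -
    define v where "v = (1 / (b * norm w)) *\<^sub>R w"
    have "norm v = 1 / b" using that ab by (simp add: v_def)
    then have "tnorm g x (tvec_of A c x v) \<le> 1" using ab(4)[of v] ab(2) by simp
    moreover have "covec_of A c x w (tvec_of A c x v) = norm w / b"
      using that ab by (simp add: covec_of_apply[OF c(1) x] v_def power2_eq_square flip: power2_norm_eq_inner)
    moreover have "bdd_above (covec_of A c x w ` {v \<in> tangent_space A x. tnorm g x v \<le> 1})"
    proof (rule bdd_aboveI2)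
      fix v assume v: "v \<in> {v \<in> tangent_space A x. tnorm g x v \<le> 1}"
      then have "a * norm (v c) \<le> 1" using ab(3)[of "v c"] tvec_of_coords[OF c(1) x, of v] by simp
      then have "norm (v c) \<le> 1 / a" using ab(1) by (simp add: field_simps)
      then have "w \<bullet> v c \<le> norm w * (1 / a)"
        by (meson norm_cauchy_schwarz mult_left_mono norm_ge_zero order_trans)
      then show "covec_of A c x w v \<le> norm w * (1 / a)" using v by (simp add: covec_of_def)
    qed
    ultimately show ?thesis
      unfolding conorm_def using tvec_of_in[OF c(1) x, of v] by (metis (no_types, lifting) cSUP_upper mem_Collect_eq)
  qed
  obtain R where R: "\<And>p. p \<in> cotangent_space A x \<Longrightarrow> conorm A g x p > R \<Longrightarrow> G x p / conorm A g x p \<ge> K * b"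
    using G_superlinear unfolding superlinear_hamiltonian_def by blast
  show thesis
  proof (rule that[of "b * max R 0"])
    fix w :: 'e assume w: "norm w > b * max R 0"
    moreover have "b * max R 0 \<ge> 0" using ab(2) by simp
    ultimately have "w \<noteq> 0" by auto
    have n: "norm w / b > max R 0" using w ab(2) by (subst pos_less_divide_eq) (simp_all only: mult.commute)
    define N where "N = conorm A g x (covec_of A c x w)"
    have N: "N \<ge> norm w / b" using conorm[OF \<open>w \<noteq> 0\<close>] by (simp add: N_def)
    then have "N > 0" "N > R" using n by auto
    then have "G x (covec_of A c x w) / N \<ge> K * b"
      using R[OF covec_of_in[OF c(1) x]] by (simp add: N_def)
    then have "G x (covec_of A c x w) \<ge> K * b * N" using \<open>N > 0\<close> by (simp add: field_simps)
    moreover have "K * b * N \<ge> K * b * (norm w / b)" using N \<open>K \<ge> 0\<close> ab(2) by (intro mult_left_mono) auto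
    ultimately show "Gc c z w \<ge> K * norm w" using ab(2) by (simp add: Gc_def x_def)
  qed
qed

text \<open>Superlinearity is assumed in each fibre separately; convexity makes it locally uniform.
  Growth on one sphere of momenta over z0 persists over nearby points by continuity and spreads
  outwards along rays by convexity.\<close>

lemma Gc_superlinear_local:
  assumes c: "c \<in> A" "z0 \<in> cimage c" and "k \<ge> 0"
  obtains \<delta> C where "\<delta> > 0" "cball z0 \<delta> \<subseteq> cimage c" "\<And>z w. z \<in> cball z0 \<delta> \<Longrightarrow> Gc c z w \<ge> k * norm w - C"
proof -
  \<comment> \<open>Chosen so that on the sphere of radius \<rho> \<ge> 1 the value exceeds the one
    at zero momentum by k \<rho> + 1; the extra 1 absorbs two continuity errors of 1/2.\<close>
  define K where "K = k + 1 + \<bar>Gc c z0 0\<bar>"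
  obtain R where R: "\<And>w. norm w > R \<Longrightarrow> Gc c z0 w \<ge> K * norm w"
    using Gc_superlinear[OF c, of K] \<open>k \<ge> 0\<close> by (auto simp: K_def)
  define \<rho> where "\<rho> = max R 0 + 1"
  have \<rho>: "\<rho> > R" "\<rho> \<ge> 1" by (auto simp: \<rho>_def)
  have far: "Gc c z0 w - Gc c z0 0 \<ge> k * \<rho> + 1" if "norm w = \<rho>" for w
  proof -
    have "Gc c z0 w \<ge> k * \<rho> + \<rho> + \<bar>Gc c z0 0\<bar> * \<rho>" using R[of w] that \<rho> by (simp add: K_def algebra_simps)
    moreover have "\<bar>Gc c z0 0\<bar> * \<rho> \<ge> \<bar>Gc c z0 0\<bar>" using \<rho>(2) by (simp add: mult_le_cancel_left1)
    ultimately show ?thesis using \<rho>(2) by linarith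
  qed
  obtain s where s: "s > 0" "cball z0 s \<subseteq> cimage c" using open_cimage[OF c(1)] c(2) by (meson open_contains_cball)
  have cont: "continuous_on (cball z0 s \<times> cball 0 \<rho>) (\<lambda>(z, w). Gc c z w)"
    by (rule continuous_on_subset[OF Gc_continuous[OF c(1)]]) (use s in auto)
  have comp: "compact (cball z0 s \<times> cball (0::'e) \<rho>)" by (intro compact_Times compact_cball)
  from compact_uniformly_continuous[OF cont comp] obtain d where d: "d > 0"
    "\<And>z w z' w'. (z, w) \<in> cball z0 s \<times> cball 0 \<rho> \<Longrightarrow> (z', w') \<in> cball z0 s \<times> cball 0 \<rho> \<Longrightarrow> dist (z', w') (z, w) < d
      \<Longrightarrow> \<bar>Gc c z' w' - Gc c z w\<bar> < 1 / 2"
    unfolding uniformly_continuous_on_def dist_real_def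
    by (metis (mono_tags, lifting) case_prod_conv half_gt_zero zero_less_one)
  obtain C1 where C1: "\<And>z w. z \<in> cball z0 s \<Longrightarrow> w \<in> cball 0 \<rho> \<Longrightarrow> \<bar>Gc c z w\<bar> \<le> C1"
  proof -
    obtain C1 where "\<forall>z\<in>cball z0 s. \<forall>w\<in>cball 0 \<rho>. \<bar>Gc c z w\<bar> \<le> C1"
      using compact_imp_bounded[OF compact_continuous_image[OF cont comp]] by (auto simp: bounded_iff)
    then show thesis using that by blast
  qed
  define \<delta> where "\<delta> = min s (d / 2)"
  have \<delta>: "\<delta> > 0" "\<delta> \<le> s" "\<delta> < d" using s d by (auto simp: \<delta>_def)
  have far': "Gc c z w - Gc c z 0 \<ge> k * \<rho>" if z: "z \<in> cball z0 \<delta>" and w: "norm w = \<rho>" for z w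
  proof -
    have "\<bar>Gc c z u - Gc c z0 u\<bar> < 1 / 2" if "norm u \<le> \<rho>" for u
      using z that \<delta> s by (intro d(2)) (auto simp: dist_Pair_Pair dist_commute)
    from this[of w] this[of 0] have "\<bar>Gc c z w - Gc c z0 w\<bar> < 1 / 2" "\<bar>Gc c z 0 - Gc c z0 0\<bar> < 1 / 2"
      using w \<rho> by auto
    then show ?thesis using far[OF w] by linarith
  qed
  show thesis
  proof (rule that[OF \<delta>(1), of "C1 + k * \<rho>"])
    show "cball z0 \<delta> \<subseteq> cimage c" using s(2) \<delta>(2) by (meson subset_cball subset_trans)
    fix z w assume z: "z \<in> cball z0 \<delta>"
    then have zs: "z \<in> cball z0 s" and zc: "z \<in> cimage c" using \<delta>(2) s(2) by auto
    show "Gc c z w \<ge> k * norm w - (C1 + k * \<rho>)"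
    proof (cases "norm w \<le> \<rho>")
      case True
      then have "Gc c z w \<ge> - C1" using C1[OF zs, of w] by auto
      moreover have "k * norm w \<le> k * \<rho>" using True \<open>k \<ge> 0\<close> by (rule mult_left_mono)
      ultimately show ?thesis by linarith
    next
      case False
      then have w: "norm w > \<rho>" "w \<noteq> 0" using \<rho> by auto
      define t where "t = \<rho> / norm w"
      have t: "0 < t" "t \<le> 1" using w \<rho> by (auto simp: t_def)
      have n: "norm (t *\<^sub>R w) = \<rho>" using w \<rho> by (simp add: t_def)
      have "Gc c z ((1 - t) *\<^sub>R 0 + t *\<^sub>R w) \<le> (1 - t) * Gc c z 0 + t * Gc c z w"
        using t by (intro convex_onD[OF Gc_convex[OF c(1) zc]]) auto
      then have "k * \<rho> \<le> t * (Gc c z w - Gc c z 0)" using far'[OF z n] by (simp add: algebra_simps)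
      then have "\<rho> * (k * norm w) \<le> \<rho> * (Gc c z w - Gc c z 0)" using w \<rho> by (simp add: t_def field_simps)
      then have "k * norm w \<le> Gc c z w - Gc c z 0" using \<rho>(2) by (simp add: mult_le_cancel_left)
      moreover have "Gc c z 0 \<ge> - C1" using C1[OF zs, of 0] \<rho> by auto
      moreover have "k * \<rho> \<ge> 0" using \<open>k \<ge> 0\<close> \<rho> by simp
      ultimately show ?thesis by linarith
    qed
  qed
qed

lemma Gc_superlinear_compact:
  assumes c: "c \<in> A" and K: "compact K" "K \<subseteq> cimage c" and "k \<ge> 0"
  obtains C where "\<And>z w. z \<in> K \<Longrightarrow> Gc c z w \<ge> k * norm w - C"
proof -
  have "\<forall>z0\<in>K. \<exists>\<delta> C. \<delta> > 0 \<and> (\<forall>z\<in>cball z0 \<delta>. \<forall>w. Gc c z w \<ge> k * norm w - C)"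
    using Gc_superlinear_local[OF c _ \<open>k \<ge> 0\<close>] K(2) by (metis subsetD)
  then obtain \<delta> C where \<delta>: "\<And>z0. z0 \<in> K \<Longrightarrow> \<delta> z0 > 0"
    "\<And>z0 z w. z0 \<in> K \<Longrightarrow> z \<in> cball z0 (\<delta> z0) \<Longrightarrow> Gc c z w \<ge> k * norm w - C z0" by metis
  obtain T where T: "T \<subseteq> K" "finite T" "K \<subseteq> (\<Union>z0\<in>T. ball z0 (\<delta> z0))"
  proof (rule compactE_image[OF K(1), of K "\<lambda>z0. ball z0 (\<delta> z0)"])
    show "K \<subseteq> (\<Union>z0\<in>K. ball z0 (\<delta> z0))" using \<delta>(1) by force
  qed auto
  show thesis
  proof (rule that[of "\<Sum>z0\<in>T. \<bar>C z0\<bar>"])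
    fix z w assume "z \<in> K"
    then obtain z0 where z0: "z0 \<in> T" "z \<in> cball z0 (\<delta> z0)" using T(3) by (auto simp: subset_iff less_imp_le)
    then have "Gc c z w \<ge> k * norm w - C z0" using \<delta>(2) T(1) by blast
    moreover have "C z0 \<le> (\<Sum>z0\<in>T. \<bar>C z0\<bar>)"
      using member_le_sum[of z0 T "\<lambda>z. \<bar>C z\<bar>"] z0(1) T(2) by simp
    ultimately show "Gc c z w \<ge> k * norm w - (\<Sum>z0\<in>T. \<bar>C z0\<bar>)" by linarith
  qed
qed

section \<open>The Legendre transform in coordinates\<close>

lemma Lc_eq_SUP:
  assumes c: "c \<in> A" "z \<in> cimage c"
  shows "Lc c z v = (SUP w. w \<bullet> v - Gc c z w)"
  unfolding Lc_def lagrangian_def cotangent_space_eq[OF c(1) cinv_in[OF c]] image_image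
  by (simp add: covec_of_apply[OF c(1) cinv_in[OF c]] Gc_def)

lemma Lc_bdd:
  assumes c: "c \<in> A" "z \<in> cimage c"
  shows "bdd_above (range (\<lambda>w. w \<bullet> v - Gc c z w))"
proof -
  obtain \<delta> C where C: "\<delta> > 0" "\<And>z' w. z' \<in> cball z \<delta> \<Longrightarrow> Gc c z' w \<ge> norm v * norm w - C"
    using Gc_superlinear_local[OF c, of "norm v"] by (metis norm_ge_zero)
  show ?thesis
  proof (rule bdd_aboveI2)
    fix w show "w \<bullet> v - Gc c z w \<le> C"
      using C(2)[of z w] C(1) norm_cauchy_schwarz[of w v] by (simp add: mult.commute)
  qed
qed

lemma Lc_ge: "c \<in> A \<Longrightarrow> z \<in> cimage c \<Longrightarrow> w \<bullet> v \<le> Lc c z v + Gc c z w"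
  using cSUP_upper[OF UNIV_I Lc_bdd, of c z w v] by (simp add: Lc_eq_SUP)

lemma Lc_le: "c \<in> A \<Longrightarrow> z \<in> cimage c \<Longrightarrow> (\<And>w. w \<bullet> v - Gc c z w \<le> a) \<Longrightarrow> Lc c z v \<le> a"
  by (simp add: Lc_eq_SUP cSUP_least)

lemma Gc_bounded:
  assumes c: "c \<in> A" and K: "compact K" "K \<subseteq> cimage c"
  obtains B where "B > 0" "\<And>z w. z \<in> K \<Longrightarrow> norm w \<le> \<rho> \<Longrightarrow> \<bar>Gc c z w\<bar> \<le> B"
proof -
  have cont: "continuous_on (K \<times> cball 0 \<rho>) (\<lambda>(z, w). Gc c z w)"
    by (rule continuous_on_subset[OF Gc_continuous[OF c(1)]]) (use K in auto)
  have "compact (K \<times> cball (0::'e) \<rho>)" by (intro compact_Times compact_cball K)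
  then obtain B where "B > 0" "\<forall>z\<in>K. \<forall>w\<in>cball 0 \<rho>. \<bar>Gc c z w\<bar> \<le> B"
    using compact_imp_bounded[OF compact_continuous_image[OF cont]] by (auto simp: bounded_pos)
  then show thesis using that[of B] by simp
qed

lemma Lc_upper_bound:
  assumes c: "c \<in> A" and K: "compact K" "K \<subseteq> cimage c"
  obtains B where "\<And>z (v :: 'e). z \<in> K \<Longrightarrow> norm v \<le> R \<Longrightarrow> Lc c z v \<le> B"
proof -
  obtain C where C: "\<And>z w. z \<in> K \<Longrightarrow> Gc c z w \<ge> \<bar>R\<bar> * norm w - C"
    using Gc_superlinear_compact[OF c K, of "\<bar>R\<bar>"] by auto
  show thesis
  proof (rule that[of C])
    fix z and v :: 'e assume z: "z \<in> K" and v: "norm v \<le> R"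
    show "Lc c z v \<le> C"
    proof (rule Lc_le[OF c])
      fix w
      have "w \<bullet> v \<le> norm w * norm v" by (rule norm_cauchy_schwarz)
      also have "\<dots> \<le> norm w * \<bar>R\<bar>" using v by (intro mult_left_mono) auto
      finally show "w \<bullet> v - Gc c z w \<le> C" using C[OF z, of w] by (simp add: mult.commute)
    qed (use z K in auto)
  qed
qed

text \<open>For bounded velocities only bounded momenta matter in the supremum: beyond norm \<rho>
  the expression drops below -B, a lower bound of L. On the remaining compact set G is uniformly
  continuous.\<close>

lemma Lc_uniform:
  assumes c: "c \<in> A" and K: "compact K" "K \<subseteq> cimage c" and "\<epsilon> > 0"
  obtains \<delta> where "\<delta> > 0" "\<And>z z' (v :: 'e) v'. z \<in> K \<Longrightarrow> z' \<in> K \<Longrightarrow> norm v \<le> R \<Longrightarrow> norm v' \<le> R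
    \<Longrightarrow> dist z z' < \<delta> \<Longrightarrow> dist v v' < \<delta> \<Longrightarrow> Lc c z v \<le> Lc c z' v' + \<epsilon>"
proof -
  obtain C where C: "\<And>z w. z \<in> K \<Longrightarrow> Gc c z w \<ge> (\<bar>R\<bar> + 1) * norm w - C"
    using Gc_superlinear_compact[OF c K, of "\<bar>R\<bar> + 1"] by auto
  obtain B where B: "B > 0" "\<And>z. z \<in> K \<Longrightarrow> \<bar>Gc c z 0\<bar> \<le> B"
    using Gc_bounded[OF c K, of 0] by (metis norm_zero order_refl)
  define \<rho> where "\<rho> = max 1 (C + B)"
  have cont: "continuous_on (K \<times> cball 0 \<rho>) (\<lambda>(z, w). Gc c z w)"
    by (rule continuous_on_subset[OF Gc_continuous[OF c(1)]]) (use K in auto)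
  have comp: "compact (K \<times> cball (0::'e) \<rho>)" by (intro compact_Times compact_cball K)
  from compact_uniformly_continuous[OF cont comp] obtain d where d: "d > 0"
    "\<And>z w z' w'. (z, w) \<in> K \<times> cball 0 \<rho> \<Longrightarrow> (z', w') \<in> K \<times> cball 0 \<rho> \<Longrightarrow> dist (z', w') (z, w) < d
      \<Longrightarrow> \<bar>Gc c z' w' - Gc c z w\<bar> < \<epsilon> / 2"
    unfolding uniformly_continuous_on_def dist_real_def
    using half_gt_zero[OF \<open>\<epsilon> > 0\<close>] by (metis (mono_tags, lifting) case_prod_conv)
  show thesis
  proof (rule that[of "min d (\<epsilon> / (2 * \<rho>))"])
    show "min d (\<epsilon> / (2 * \<rho>)) > 0" using d \<open>\<epsilon> > 0\<close> by (simp add: \<rho>_def)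
    fix z z' and v v' :: 'e assume z: "z \<in> K" "z' \<in> K" and v: "norm v \<le> R" "norm v' \<le> R"
      and dz: "dist z z' < min d (\<epsilon> / (2 * \<rho>))" and dv: "dist v v' < min d (\<epsilon> / (2 * \<rho>))"
    have zc: "z \<in> cimage c" "z' \<in> cimage c" using z K by auto
    show "Lc c z v \<le> Lc c z' v' + \<epsilon>"
    proof (rule Lc_le[OF c zc(1)])
      fix w
      show "w \<bullet> v - Gc c z w \<le> Lc c z' v' + \<epsilon>"
      proof (cases "norm w \<le> \<rho>")
        case True
        then have "\<bar>Gc c z' w - Gc c z w\<bar> < \<epsilon> / 2"
          using z dz by (intro d(2)) (auto simp: dist_Pair_Pair dist_commute)
        moreover have "w \<bullet> v - w \<bullet> v' \<le> \<epsilon> / 2"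
        proof -
          have "w \<bullet> v - w \<bullet> v' \<le> norm w * dist v v'"
            using norm_cauchy_schwarz[of w "v - v'"] by (simp add: inner_diff_right dist_norm)
          also have "\<dots> \<le> \<rho> * (\<epsilon> / (2 * \<rho>))" using True dv by (intro mult_mono) (auto simp: \<rho>_def)
          finally show ?thesis by (simp add: \<rho>_def split: if_splits)
        qed
        ultimately show ?thesis using Lc_ge[OF c zc(2), of w v'] by linarith
      next
        case False
        have "w \<bullet> v \<le> norm w * norm v" by (rule norm_cauchy_schwarz)
        also have "\<dots> \<le> norm w * \<bar>R\<bar>" using v by (intro mult_left_mono) auto
        finally have "w \<bullet> v - Gc c z w \<le> C - norm w" using C[OF z(1), of w] by (simp add: algebra_simps)
        also have "\<dots> \<le> - B" using False by (simp add: \<rho>_def)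
        also have "\<dots> \<le> Lc c z' v'" using B(2)[OF z(2)] Lc_ge[OF c zc(2), of 0 v'] by auto
        finally show ?thesis using \<open>\<epsilon> > 0\<close> by simp
      qed
    qed
  qed
qed

lemma Lc_continuous:
  assumes c: "c \<in> A" shows "continuous_on (cimage c \<times> UNIV) (\<lambda>(z, v). Lc c z v)"
proof (rule continuous_at_imp_continuous_on, rule ballI)
  fix p assume "p \<in> cimage c \<times> (UNIV :: 'e set)"
  then obtain z0 v0 where p: "p = (z0, v0)" "z0 \<in> cimage c" by auto
  from p(2) obtain s where s: "s > 0" "cball z0 s \<subseteq> cimage c" using open_cimage[OF c(1)] by (meson open_contains_cball)
  have "continuous_on (ball z0 s \<times> ball v0 1) (\<lambda>(z, v). Lc c z v)"
    unfolding continuous_on_iff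
  proof (intro ballI allI impI)
    fix p e assume p: "p \<in> ball z0 s \<times> ball v0 1" and "e > (0::real)"
    obtain \<delta> where \<delta>: "\<delta> > 0" "\<And>z z' v v'. z \<in> cball z0 s \<Longrightarrow> z' \<in> cball z0 s \<Longrightarrow> norm v \<le> norm v0 + 1 \<Longrightarrow> norm v' \<le> norm v0 + 1
      \<Longrightarrow> dist z z' < \<delta> \<Longrightarrow> dist v v' < \<delta> \<Longrightarrow> Lc c z v \<le> Lc c z' v' + e / 2"
      using Lc_uniform[OF c compact_cball s(2) half_gt_zero[OF \<open>e > 0\<close>], of "norm v0 + 1"] by blast
    have nb: "norm v \<le> norm v0 + 1" if "v \<in> ball v0 1" for v
      using that norm_triangle_ineq2[of v v0] by (auto simp: dist_norm norm_minus_commute)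
    show "\<exists>d>0. \<forall>q\<in>ball z0 s \<times> ball v0 1. dist q p < d
        \<longrightarrow> dist (case q of (z, v) \<Rightarrow> Lc c z v) (case p of (z, v) \<Rightarrow> Lc c z v) < e"
    proof (intro exI[of _ \<delta>] conjI ballI impI)
      fix q assume q: "q \<in> ball z0 s \<times> ball v0 1" "dist q p < \<delta>"
      have "dist (fst q) (fst p) < \<delta>" "dist (snd q) (snd p) < \<delta>"
        using q(2) dist_fst_le[of q p] dist_snd_le[of q p] by auto
      then have "Lc c (fst q) (snd q) \<le> Lc c (fst p) (snd p) + e / 2"
        "Lc c (fst p) (snd p) \<le> Lc c (fst q) (snd q) + e / 2"
        using p q nb by (auto intro!: \<delta>(2) simp: dist_commute)
      then show "dist (case q of (z, v) \<Rightarrow> Lc c z v) (case p of (z, v) \<Rightarrow> Lc c z v) < e"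
        using \<open>e > 0\<close> by (auto simp: case_prod_beta dist_real_def)
    qed (rule \<delta>)
  qed
  then show "isCont (\<lambda>(z, v). Lc c z v) p"
    using s(1) by (simp add: continuous_on_eq_continuous_at open_Times p(1))
qed

lemma Lc_continuous_compose:
  assumes "c \<in> A" "continuous_on S f" "continuous_on S h" "f ` S \<subseteq> cimage c"
  shows "continuous_on S (\<lambda>x. Lc c (f x) (h x))"
  using continuous_on_compose2[OF Lc_continuous[OF assms(1)] continuous_on_Pair[OF assms(2,3)]] assms(4)
  by auto

lemma Fenchel_attained:
  assumes c: "c \<in> A" "z \<in> cimage c"
  obtains v where "Lc c z v + Gc c z w = w \<bullet> v" "\<And>q. Gc c z q \<ge> Gc c z w + v \<bullet> (q - w)"
proof -
  obtain v where v: "\<And>q. Gc c z q \<ge> Gc c z w + v \<bullet> (q - w)"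
    using convex_subgradient_exists[OF Gc_convex[OF c]] by blast
  have "Lc c z v \<le> w \<bullet> v - Gc c z w"
  proof (rule Lc_le[OF c])
    show "q \<bullet> v - Gc c z q \<le> w \<bullet> v - Gc c z w" for q
      using v[of q] by (simp add: inner_diff_right inner_commute)
  qed
  then have "Lc c z v + Gc c z w = w \<bullet> v" using Lc_ge[OF c, of w v] by simp
  then show thesis using that v by blast
qed

lemma Gc_le_iff: "c \<in> A \<Longrightarrow> z \<in> cimage c \<Longrightarrow> Gc c z w \<le> a \<longleftrightarrow> (\<forall>v. w \<bullet> v \<le> Lc c z v + a)"
  using Lc_ge[of c z w] Fenchel_attained[of c z w] by (smt (verit))

text \<open>
  It suffices to test velocities in a bounded set: those of norm at most \<open>1\<close> bound \<open>w\<close>, and then the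
  subgradients at \<open>w\<close> are bounded. Velocity zero follows by continuity.
\<close>

lemma Gc_le_if_bounded_velocities:
  assumes c: "c \<in> A" and K: "compact K" "K \<subseteq> cimage c"
  obtains R where "R > 0" "\<And>z w b. b \<le> a \<Longrightarrow> z \<in> K \<Longrightarrow> (\<And>v. v \<noteq> 0 \<Longrightarrow> norm v \<le> R \<Longrightarrow> w \<bullet> v \<le> Lc c z v + b) \<Longrightarrow> Gc c z w \<le> b"
proof -
  obtain B where B: "\<And>z v. z \<in> K \<Longrightarrow> norm v \<le> 1 \<Longrightarrow> Lc c z v \<le> B"
    using Lc_upper_bound[OF c K] by blast
  define \<rho> where "\<rho> = max 0 (B + a)"
  obtain B' where B': "B' > 0" "\<And>z w. z \<in> K \<Longrightarrow> norm w \<le> \<rho> + 1 \<Longrightarrow> \<bar>Gc c z w\<bar> \<le> B'"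
    using Gc_bounded[OF c K] by blast
  show thesis
  proof (rule that[of "max 1 (2 * B')"])
    fix z w b assume ba: "b \<le> a" and z: "z \<in> K" and *: "\<And>v. v \<noteq> 0 \<Longrightarrow> norm v \<le> max 1 (2 * B') \<Longrightarrow> w \<bullet> v \<le> Lc c z v + b"
    have zc: "z \<in> cimage c" using z K by auto
    have w: "norm w \<le> \<rho>"
    proof (cases "w = 0")
      case False
      have "w \<bullet> (w /\<^sub>R norm w) \<le> Lc c z (w /\<^sub>R norm w) + b" using False by (intro *) auto
      moreover have "Lc c z (w /\<^sub>R norm w) \<le> B" using B[OF z, of "w /\<^sub>R norm w"] False by simp
      moreover have "w \<bullet> (w /\<^sub>R norm w) = norm w"
        using False by (simp add: power2_eq_square flip: power2_norm_eq_inner)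
      ultimately show ?thesis using ba by (simp add: \<rho>_def)
    qed (simp add: \<rho>_def)
    obtain v where v: "Lc c z v + Gc c z w = w \<bullet> v" "\<And>q. Gc c z q \<ge> Gc c z w + v \<bullet> (q - w)"
      using Fenchel_attained[OF c zc] by blast
    have vn: "norm v \<le> 2 * B'"
    proof (cases "v = 0")
      case False
      let ?q = "w + v /\<^sub>R norm v"
      have "norm ?q \<le> \<rho> + 1" using w False norm_triangle_ineq[of w "v /\<^sub>R norm v"] by simp
      then have "\<bar>Gc c z ?q\<bar> \<le> B'" "\<bar>Gc c z w\<bar> \<le> B'" using w by (auto intro: B'(2)[OF z])
      moreover have "v \<bullet> (v /\<^sub>R norm v) = norm v"
        using False by (simp add: power2_eq_square flip: power2_norm_eq_inner)
      ultimately show ?thesis using v(2)[of ?q] by (simp add: abs_le_iff)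
    qed (use B' in simp)
    have "w \<bullet> v \<le> Lc c z v + b"
    proof (cases "v = 0")
      case True
      obtain e :: 'e where e: "e \<in> Basis" by (meson nonempty_Basis ex_in_conv)
      have lim: "(\<lambda>n. (1 / real (Suc n)) *\<^sub>R e) \<longlonglongrightarrow> 0 *\<^sub>R e"
        by (intro tendsto_intros LIMSEQ_Suc lim_1_over_n)
      have cL: "continuous_on UNIV (\<lambda>v. Lc c z v)"
        by (rule Lc_continuous_compose[OF c]) (use zc in \<open>auto intro: continuous_intros\<close>)
      have "(\<lambda>n. w \<bullet> ((1 / real (Suc n)) *\<^sub>R e)) \<longlonglongrightarrow> w \<bullet> (0 *\<^sub>R e)"
        by (intro tendsto_intros lim)
      moreover have "(\<lambda>n. Lc c z ((1 / real (Suc n)) *\<^sub>R e) + b) \<longlonglongrightarrow> Lc c z (0 *\<^sub>R e) + b"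
        by (intro tendsto_intros continuous_on_tendsto_compose[OF cL lim]) auto
      moreover have "w \<bullet> ((1 / real (Suc n)) *\<^sub>R e) \<le> Lc c z ((1 / real (Suc n)) *\<^sub>R e) + b" for n
      proof (rule *)
        have "norm ((1 / real (Suc n)) *\<^sub>R e) \<le> 1" using e by (simp add: divide_le_eq)
        then show "norm ((1 / real (Suc n)) *\<^sub>R e) \<le> max 1 (2 * B')" by linarith
      qed (use nonzero_Basis[OF e] in simp)
      ultimately have "w \<bullet> (0 *\<^sub>R e) \<le> Lc c z (0 *\<^sub>R e) + b" by (intro LIMSEQ_le) auto
      then show ?thesis by (simp add: True)
    qed (use vn in \<open>intro *, auto\<close>)
    then show "Gc c z w \<le> b" using v(1) by simp
  qed simp
qed

lemma L_eq_Lc: "c \<in> A \<Longrightarrow> x \<in> cdom c \<Longrightarrow> v \<in> tangent_space A x \<Longrightarrow> L x v = Lc c (cmap c x) (v c)"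
  by (simp add: Lc_def cinv_cmap tvec_of_coords)

text \<open>Fenchel duality on the manifold. A bound on G becomes a family of inequalities that are
  linear in f, so it can be added, weighted and integrated; most later estimates use this
  side.\<close>

lemma G_le_iff:
  assumes f: "f \<in> C1"
  shows "G x (differential A f x) \<le> a \<longleftrightarrow> (\<forall>v\<in>tangent_space A x. differential A f x v \<le> L x v + a)"
proof -
  obtain c where c: "c \<in> A" "x \<in> cdom c" using chart_ex by blast
  then have z: "cmap c x \<in> cimage c" by auto
  have "(\<forall>v. dc f c x \<bullet> v \<le> Lc c (cmap c x) v + a) \<longleftrightarrow> (\<forall>v\<in>tangent_space A x. differential A f x v \<le> L x v + a)"
    using tvec_of_in[OF c] tvec_of_self[OF c] by (metis differential_apply[OF f c] L_eq_Lc[OF c])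
  then show ?thesis by (simp add: G_differential[OF f c] Gc_le_iff[OF c(1) z])
qed

lemma differential_le_L: "f \<in> C1 \<Longrightarrow> v \<in> tangent_space A x \<Longrightarrow> differential A f x v \<le> L x v + G x (differential A f x)"
  using G_le_iff by blast

lemma G_differential_continuous:
  assumes f: "f \<in> C1" shows "continuous_on UNIV (\<lambda>x. G x (differential A f x))"
proof (rule continuous_at_imp_continuous_on, rule ballI)
  fix x
  obtain c where c: "c \<in> A" "x \<in> cdom c" using chart_ex by blast
  have "continuous_on (cdom c) (\<lambda>y. Gc c (cmap c y) (dc f c y))"
  proof (rule Gc_continuous_compose[OF c(1) cont_cmap[OF c(1)]])
    have "continuous_on (cimage c) (gr (f \<circ> cinv c))" using C1D[OF f c(1)] by (simp add: grad_on_def)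
    then show "continuous_on (cdom c) (\<lambda>y. dc f c y)"
      by (rule continuous_on_compose2[OF _ cont_cmap[OF c(1)]]) auto
  qed auto
  then have "continuous_on (cdom c) (\<lambda>x. G x (differential A f x))"
    by (rule continuous_on_cong[THEN iffD1, OF refl, rotated]) (simp add: G_differential[OF f c(1)])
  then show "isCont (\<lambda>x. G x (differential A f x)) x"
    using open_cdom[OF c(1)] c(2) by (simp add: continuous_on_eq_continuous_at)
qed

lemma continuous_bounded:
  assumes "continuous_on UNIV (f :: 'm \<Rightarrow> real)"
  obtains B where "B > 0" "\<And>x. \<bar>f x\<bar> \<le> B"
  using compact_imp_bounded[OF compact_continuous_image[OF assms compact_M]] by (auto simp: bounded_pos)

lemma positive_outside_open:
  assumes V: "open V" and f: "continuous_on UNIV (f :: 'm \<Rightarrow> real)" and pos: "\<And>x. x \<notin> V \<Longrightarrow> f x > 0"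
  obtains \<eta> where "\<eta> > 0" "\<And>x. x \<notin> V \<Longrightarrow> \<eta> \<le> f x"
proof (cases "- V = {}")
  case True
  then show thesis using that[of 1] by auto
next
  case False
  have "compact (- V)" using V compact_Int_closed[OF compact_M, of "- V"] by (simp add: closed_def)
  then obtain y where "y \<in> - V" "\<And>x. x \<in> - V \<Longrightarrow> f y \<le> f x"
    using continuous_attains_inf[OF _ False continuous_on_subset[OF f]] by blast
  then show thesis using that[of "f y"] pos by simp
qed

end

subsection \<open>Smooth approximation of viscosity subsolutions\<close>

lemma derivative_le_if_increments_le:
  fixes F :: "'a::euclidean_space \<Rightarrow> real"
  assumes F: "(F has_derivative (\<lambda>h. d \<bullet> h)) (at y)" and le: "\<forall>\<^sub>F t in at_right 0. F (y + t *\<^sub>R v) - F y \<le> t * \<kappa>"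
  shows "d \<bullet> v \<le> \<kappa>"
proof -
  have 1: "((\<lambda>t::real. y + t *\<^sub>R v) has_derivative (\<lambda>t. t *\<^sub>R v)) (at 0)"
    by (auto intro!: derivative_eq_intros)
  have 2: "(F has_derivative (\<lambda>h. d \<bullet> h)) (at (y + 0 *\<^sub>R v))" using F by simp
  have "((\<lambda>t. F (y + t *\<^sub>R v)) has_derivative (\<lambda>t. t * (d \<bullet> v))) (at 0)"
    using has_derivative_compose[OF 1 2] by simp
  then have "((\<lambda>t. F (y + t *\<^sub>R v)) has_real_derivative (d \<bullet> v)) (at 0)"
    unfolding has_field_derivative_def by (rule has_derivative_eq_rhs) (simp add: mult.commute fun_eq_iff)
  then have "((\<lambda>t. (F (y + t *\<^sub>R v) - F y) / t) \<longlongrightarrow> d \<bullet> v) (at 0)"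
    by (simp add: DERIV_def)
  then have "((\<lambda>t. (F (y + t *\<^sub>R v) - F y) / t) \<longlongrightarrow> d \<bullet> v) (at_right 0)"
    by (rule tendsto_mono[rotated]) (simp add: at_le)
  moreover have "\<forall>\<^sub>F t in at_right 0. (F (y + t *\<^sub>R v) - F y) / t \<le> \<kappa>"
    using le eventually_at_right_less[of 0] by eventually_elim (simp add: field_simps)
  ultimately show ?thesis by (rule tendsto_upperbound) simp
qed

context hamiltonian
begin

text \<open>Viscosity subsolutions of level a, the first half of
  \<open>viscosity_solution\<close>.\<close>

definition VS :: "real \<Rightarrow> ('m \<Rightarrow> real) \<Rightarrow> bool" where
  "VS a u \<longleftrightarrow> continuous_on UNIV u \<and>
     (\<forall>f\<in>C1. \<forall>x. (\<forall>\<^sub>F y in nhds x. u y - f y \<le> u x - f x) \<longrightarrow> G x (differential A f x) \<le> a)"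

text \<open>Allows test functions that are given only on an open set of a chart.\<close>

lemma VS_local:
  assumes u: "VS a u" and c: "c \<in> A" and S: "open S" "S \<subseteq> cimage c" "z \<in> S" and F: "grad_on F D S"
    and max: "\<And>y. y \<in> S \<Longrightarrow> u (cinv c y) - F y \<le> u (cinv c z) - F z"
  shows "Gc c z (D z) \<le> a"
proof -
  obtain s where s: "s > 0" "cball z s \<subseteq> S" using S by (meson open_contains_cball)
  have sc: "cball z s \<subseteq> cimage c" using s S by blast
  have Fs: "grad_on F D (ball z s)" by (rule grad_on_subset[OF F]) (use s in auto)
  obtain f where f: "f \<in> C1" "\<And>y. y \<in> cball z (s / 2) \<Longrightarrow> f (cinv c y) = F y"
    "\<And>y. y \<in> ball z (s / 2) \<Longrightarrow> differential A f (cinv c y) = covec_of A c (cinv c y) (D y)"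
    using local_function_extends[OF c sc Fs, of "s / 2"] s(1) by auto
  define x where "x = cinv c z"
  have zc: "z \<in> cimage c" using S by blast
  have x: "x \<in> cdom c" "cmap c x = z" using zc cinv_in[OF c] cmap_cinv[OF c] by (auto simp: x_def)
  have "\<forall>\<^sub>F y in nhds (cmap c x). y \<in> ball z (s / 2)"
    using s(1) unfolding x(2) by (intro eventually_nhds_in_open) auto
  from eventually_cmap[OF c x(1) this]
  have "\<forall>\<^sub>F y in nhds x. u y - f y \<le> u x - f x"
  proof eventually_elim
    case (elim y)
    then have "u (cinv c (cmap c y)) - F (cmap c y) \<le> u (cinv c z) - F z"
      using s by (intro max) (auto simp: subset_iff dest!: spec[of _ "cmap c y"])
    then show ?case
      using f(2)[of "cmap c y"] f(2)[of z] elim s(1) cinv_cmap[OF c, of y] by (simp add: x_def)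
  qed
  then have "G x (differential A f x) \<le> a" using u f(1) by (simp add: VS_def)
  then show ?thesis using f(3)[of z] s(1) by (simp add: x_def Gc_def)
qed

text \<open>
  If the increment of \<open>u\<close> along the segment were larger, then \<open>u\<close> minus a test function which is steep
  across and behind the segment would have an interior maximum in a thin tube around it.
\<close>

lemma VS_segment:
  assumes u: "VS a u" and c: "c \<in> A" and B: "open B" "convex B" "B \<subseteq> cimage c"
    and v: "v \<noteq> 0" and r: "r > 0" and zB: "z \<in> B" "z + r *\<^sub>R v \<in> B"
    and \<kappa>: "\<And>y. y \<in> B \<Longrightarrow> Lc c y v + a \<le> \<kappa>"
  shows "u (cinv c (z + r *\<^sub>R v)) - u (cinv c z) \<le> r * \<kappa>"
proof (rule ccontr)
  define U where "U y = u (cinv c y)" for y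
  assume neg: "\<not> u (cinv c (z + r *\<^sub>R v)) - u (cinv c z) \<le> r * \<kappa>"
  define \<Delta> where "\<Delta> = U (z + r *\<^sub>R v) - U z - r * \<kappa>"
  have "\<Delta> > 0" using neg by (simp add: \<Delta>_def U_def)
  have contU: "continuous_on (cimage c) U"
    unfolding U_def using u cont_cinv[OF c] by (auto simp: VS_def intro: continuous_on_compose2)
  define seg where "seg = closed_segment z (z + r *\<^sub>R v)"
  have "seg \<subseteq> B" unfolding seg_def using zB B(2) by (simp add: closed_segment_subset)
  moreover have "compact seg" by (simp add: seg_def)
  ultimately obtain \<eta> where \<eta>: "\<eta> > 0" "(\<Union>p\<in>seg. cball p \<eta>) \<subseteq> B"
    using compact_subset_open_imp_cball_epsilon_subset[of seg B] B(1) by blast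
  have vv: "v \<bullet> v > 0" "norm v > 0" using v by auto
  \<comment> \<open>Normalised so that s measures the time along the segment; n is then the squared
    distance to the line through z in direction v.\<close>
  define e where "e = (1 / (v \<bullet> v)) *\<^sub>R v"
  have ev: "e \<bullet> v = 1" "v \<bullet> e = 1" "e \<bullet> e = 1 / (v \<bullet> v)" using vv by (auto simp: e_def)
  define s where "s y = (y - z) \<bullet> e" for y
  define n where "n y = (y - z) \<bullet> (y - z) - (v \<bullet> v) * (s y * s y)" for y
  have n_eq: "n y = (norm (y - z - s y *\<^sub>R v))\<^sup>2" for y
  proof -
    have "(y - z) \<bullet> v = s y * (v \<bullet> v)" using vv by (simp add: s_def e_def)
    then show ?thesis
      by (simp add: n_def power2_norm_eq_inner inner_diff_left inner_diff_right inner_commute algebra_simps)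
  qed
  \<comment> \<open>The tube continues beyond the endpoint by the length \<eta>/2. Together with its
    radius \<rho> \<le> \<eta>/2 it stays in the \<eta>-neighbourhood of the segment, hence in
    B.\<close>
  define b' where "b' = r + \<eta> / (2 * norm v)"
  have b': "b' > r" "(b' - r) * norm v = \<eta> / 2" using \<eta>(1) vv by (auto simp: b'_def)
  have "z \<in> cimage c" using zB B by blast
  then have "isCont U z" using contU continuous_on_eq_continuous_at[OF open_cimage[OF c]] by blast
  then obtain d where d: "d > 0" "\<And>y. dist y z < d \<Longrightarrow> \<bar>U y - U z\<bar> < \<Delta> / 4"
    unfolding continuous_at_eps_delta dist_real_def using \<open>\<Delta> > 0\<close> by (metis zero_less_divide_iff zero_less_numeral)
  define \<rho> where "\<rho> = min (\<eta> / 2) (d / 2)"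
  have \<rho>: "\<rho> > 0" "\<rho> \<le> \<eta> / 2" "\<rho> < d" using \<eta> d by (auto simp: \<rho>_def)
  define T where "T = {y. 0 \<le> s y \<and> s y \<le> b' \<and> n y \<le> \<rho>\<^sup>2}"
  have q\<rho>: "norm (y - z - s y *\<^sub>R v) \<le> \<rho>" if "n y \<le> \<rho>\<^sup>2" for y
    using that \<rho>(1) unfolding n_eq by (simp add: power2_le_iff_abs_le)
  have TB: "T \<subseteq> B"
  proof
    fix y assume y: "y \<in> T"
    define p where "p = z + min (s y) r *\<^sub>R v"
    have "p = z + (min (s y) r / r) *\<^sub>R (z + r *\<^sub>R v - z)" using r by (simp add: p_def)
    moreover have "0 \<le> min (s y) r / r" "min (s y) r / r \<le> 1" using y r by (auto simp: T_def)
    ultimately have "p \<in> seg"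
      unfolding seg_def closed_segment_def
      by (intro CollectI exI[of _ "min (s y) r / r"] conjI) (auto simp: algebra_simps)
    have "y - p = (y - z - s y *\<^sub>R v) + (s y - min (s y) r) *\<^sub>R v"
      by (simp add: p_def algebra_simps)
    then have "norm (y - p) \<le> norm (y - z - s y *\<^sub>R v) + norm ((s y - min (s y) r) *\<^sub>R v)"
      by (metis norm_triangle_ineq)
    also have "\<dots> \<le> \<rho> + (b' - r) * norm v"
      using y q\<rho>[of y] b'(1) by (intro add_mono) (auto simp: T_def min_def intro!: mult_right_mono)
    also have "\<dots> \<le> \<eta>" using b' \<rho> by simp
    finally have "y \<in> cball p \<eta>" by (simp add: dist_norm norm_minus_commute)
    then show "y \<in> B" using \<eta>(2) \<open>p \<in> seg\<close> by blast
  qed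
  have cs: "continuous_on X s" for X unfolding s_def by (intro continuous_intros)
  have cn: "continuous_on X n" for X unfolding n_def by (intro continuous_intros cs)
  have "compact T"
  proof -
    have "T \<subseteq> cball z (\<bar>b'\<bar> * norm v + \<rho>)"
    proof
      fix y assume y: "y \<in> T"
      have "norm (y - z) \<le> norm (y - z - s y *\<^sub>R v) + norm (s y *\<^sub>R v)"
        using norm_triangle_ineq[of "y - z - s y *\<^sub>R v" "s y *\<^sub>R v"] by simp
      also have "\<dots> \<le> \<rho> + \<bar>b'\<bar> * norm v"
        using y q\<rho>[of y] by (intro add_mono) (auto simp: T_def intro!: mult_right_mono)
      finally show "y \<in> cball z (\<bar>b'\<bar> * norm v + \<rho>)" by (simp add: dist_norm norm_minus_commute)
    qed
    then have "bounded T" using bounded_cball bounded_subset by blast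
    moreover have "closed T"
      unfolding T_def using cs cn by (intro closed_Collect_conj closed_Collect_le continuous_intros)
    ultimately show ?thesis by (simp add: compact_eq_bounded_closed)
  qed
  have contUT: "continuous_on T U" by (rule continuous_on_subset[OF contU]) (use TB B in auto)
  obtain M where M: "M > 0" "\<And>y. y \<in> T \<Longrightarrow> \<bar>U y\<bar> \<le> M"
    using compact_imp_bounded[OF compact_continuous_image[OF contUT \<open>compact T\<close>]] by (auto simp: bounded_pos)
  \<comment> \<open>The slope along the segment must exceed \<kappa> strictly. Raising it by
    \<epsilon> costs \<Delta>/4 at the endpoint; the remaining 3/4 \<Delta> still beats the face s =
    0, where U stays within \<Delta>/4 of its value at z.\<close>
  define \<epsilon> where "\<epsilon> = \<Delta> / (4 * r)"
  have \<epsilon>: "\<epsilon> > 0" "\<epsilon> * r = \<Delta> / 4" using \<open>\<Delta> > 0\<close> r by (auto simp: \<epsilon>_def)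
  define k where "k = \<kappa> + \<epsilon>"
  \<comment> \<open>Two penalties, both zero at the endpoint of the segment: N' beyond time r and N
    away from the line. They are so large that the maximum lies neither on the far face nor on the
    lateral face of the tube.\<close>
  define N' where "N' = (2 * M + \<bar>k\<bar> * b' + 1) / (b' - r)\<^sup>2"
  define N where "N = (2 * M + 2 * \<bar>k\<bar> * b' + 1) / \<rho>\<^sup>2"
  have N: "N' \<ge> 0" "N \<ge> 0" "N' * (b' - r)\<^sup>2 = 2 * M + \<bar>k\<bar> * b' + 1" "N * \<rho>\<^sup>2 = 2 * M + 2 * \<bar>k\<bar> * b' + 1"
    using M(1) b'(1) r \<rho>(1) by (auto simp: N'_def N_def)
  define f where "f y = (k * s y + N' * sqpos (s y - r)) + N * n y" for y
  define D where "D y = (k + N' * (2 * max 0 (s y - r))) *\<^sub>R e + N *\<^sub>R (2 *\<^sub>R (y - z) - (2 * (v \<bullet> v) * s y) *\<^sub>R e)" for y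
  have gs: "grad_on s (\<lambda>_. e) X" for X unfolding s_def by (rule grad_on_inner)
  have g1: "grad_on (\<lambda>y. k * s y) (\<lambda>y. k *\<^sub>R e + s y *\<^sub>R 0) X" for X
    by (rule grad_on_mult[OF grad_on_const gs])
  have gs': "grad_on (\<lambda>y. s y + (- r)) (\<lambda>_. e + 0) X" for X by (rule grad_on_add[OF gs grad_on_const])
  have g2: "grad_on (\<lambda>y. N' * sqpos (s y + (- r))) (\<lambda>y. N' *\<^sub>R ((2 * max 0 (s y + (- r))) *\<^sub>R (e + 0)) + sqpos (s y + (- r)) *\<^sub>R 0) X" for X
    by (intro grad_on_mult grad_on_const grad_on_compose_real[OF gs', of _ sqpos "\<lambda>t. 2 * max 0 t"]
        has_derivative_sqpos continuous_intros)
  have g3: "grad_on (\<lambda>y. (y - z) \<bullet> (y - z) + (- (v \<bullet> v)) * (s y * s y))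
      (\<lambda>y. 2 *\<^sub>R (y - z) + ((- (v \<bullet> v)) *\<^sub>R (s y *\<^sub>R e + s y *\<^sub>R e) + (s y * s y) *\<^sub>R 0)) X" for X
    by (intro grad_on_add grad_on_mult grad_on_norm2 grad_on_const gs)
  have gf: "grad_on f D X" for X
  proof -
    have "grad_on f (\<lambda>y. ((k *\<^sub>R e + s y *\<^sub>R 0) + (N' *\<^sub>R ((2 * max 0 (s y + (- r))) *\<^sub>R (e + 0)) + sqpos (s y + (- r)) *\<^sub>R 0))
        + (N *\<^sub>R (2 *\<^sub>R (y - z) + ((- (v \<bullet> v)) *\<^sub>R (s y *\<^sub>R e + s y *\<^sub>R e) + (s y * s y) *\<^sub>R 0))
          + ((y - z) \<bullet> (y - z) + (- (v \<bullet> v)) * (s y * s y)) *\<^sub>R 0)) X"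
      using grad_on_add[OF grad_on_add[OF g1 g2] grad_on_mult[OF grad_on_const[of N] g3]]
      unfolding f_def n_def by simp
    then show ?thesis
      by (rule back_subst[where P = "\<lambda>D. grad_on f D X"]) (auto simp: D_def fun_eq_iff scaleR_add_left algebra_simps simp flip: scaleR_add_left)
  qed
  have "T \<noteq> {}" and y1: "z + r *\<^sub>R v \<in> T"
  proof -
    have "s (z + r *\<^sub>R v) = r" using ev by (simp add: s_def)
    moreover from this have "n (z + r *\<^sub>R v) = 0" by (simp add: n_eq)
    ultimately show "z + r *\<^sub>R v \<in> T" using r b' by (simp add: T_def)
    then show "T \<noteq> {}" by blast
  qed
  have contf: "continuous_on T f" using gf grad_on_imp_continuous_on by blast
  obtain y where y: "y \<in> T" "\<And>y'. y' \<in> T \<Longrightarrow> U y' - f y' \<le> U y - f y"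
    using continuous_attains_sup[OF \<open>compact T\<close> \<open>T \<noteq> {}\<close> continuous_on_diff[OF contUT contf]] by blast
  have s1: "s (z + r *\<^sub>R v) = r" "n (z + r *\<^sub>R v) = 0" using ev by (simp_all add: s_def n_eq)
  have "U (z + r *\<^sub>R v) - f (z + r *\<^sub>R v) = U z + \<Delta> + r * \<kappa> - k * r"
    by (simp add: f_def s1 sqpos_eq_0 \<Delta>_def)
  then have val1: "U (z + r *\<^sub>R v) - f (z + r *\<^sub>R v) = U z + 3 / 4 * \<Delta>"
    using \<epsilon>(2) by (simp add: k_def algebra_simps)
  have val1': "U (z + r *\<^sub>R v) - f (z + r *\<^sub>R v) \<ge> - M - k * r"
    using M(2)[OF y1] by (simp add: f_def s1 sqpos_eq_0)
  have ge: "U y - f y \<ge> U z + 3 / 4 * \<Delta>" "U y - f y \<ge> - M - k * r"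
    using y(2)[OF y1] val1 val1' by linarith+
  have n0: "n y \<ge> 0" by (simp add: n_eq)
  have y0: "0 \<le> s y" "s y \<le> b'" "n y \<le> \<rho>\<^sup>2" using y(1) by (auto simp: T_def)
  have sN: "N' * sqpos (s y - r) \<ge> 0" "N * n y \<ge> 0" using N n0 by auto
  have "s y \<noteq> 0"
  proof
    assume sy: "s y = 0"
    then have "norm (y - z) \<le> \<rho>" using q\<rho>[OF y0(3)] by simp
    then have "dist y z < d" using \<rho> by (simp add: dist_norm)
    then have "U y < U z + \<Delta> / 4" using d(2)[of y] by linarith
    moreover have "f y \<ge> 0" using sN sy by (simp add: f_def)
    ultimately show False using ge(1) \<open>\<Delta> > 0\<close> by linarith
  qed
  have kb: "k * t \<ge> - \<bar>k\<bar> * b'" "k * t \<le> \<bar>k\<bar> * b'" if "0 \<le> t" "t \<le> b'" for t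
  proof -
    have "\<bar>k * t\<bar> \<le> \<bar>k\<bar> * b'" using that by (simp add: abs_mult mult_left_mono)
    then show "k * t \<ge> - \<bar>k\<bar> * b'" "k * t \<le> \<bar>k\<bar> * b'" by (simp_all add: abs_le_iff)
  qed
  have UM: "U y \<le> M" using M(2)[OF y(1)] by simp
  have "s y \<noteq> b'"
  proof
    assume sy: "s y = b'"
    then have "N' * sqpos (s y - r) = 2 * M + \<bar>k\<bar> * b' + 1"
      using b'(1) N(3) by (simp add: sqpos_def)
    then have "f y \<ge> k * b' + (2 * M + \<bar>k\<bar> * b' + 1)" using sN by (simp add: f_def sy)
    moreover have "k * b' - k * r \<ge> - \<bar>k\<bar> * b'" using kb(1)[of "b' - r"] b' r by (simp add: right_diff_distrib)
    ultimately show False using ge(2) UM by linarith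
  qed
  have "n y \<noteq> \<rho>\<^sup>2"
  proof
    assume "n y = \<rho>\<^sup>2"
    then have "f y \<ge> k * s y + (2 * M + 2 * \<bar>k\<bar> * b' + 1)" using sN N(4) by (simp add: f_def)
    moreover have "k * s y \<ge> - \<bar>k\<bar> * b'" using kb(1)[OF y0(1,2)] .
    moreover have "k * r \<le> \<bar>k\<bar> * b'" using kb(2)[of r] r b' by simp
    ultimately show False using ge(2) UM by linarith
  qed
  define S where "S = {y. 0 < s y \<and> s y < b' \<and> n y < \<rho>\<^sup>2}"
  have "open S"
    unfolding S_def using cs cn by (intro open_Collect_conj open_Collect_less continuous_intros)
  have "S \<subseteq> T" by (auto simp: S_def T_def)
  have "y \<in> S" using y0 \<open>s y \<noteq> 0\<close> \<open>s y \<noteq> b'\<close> \<open>n y \<noteq> \<rho>\<^sup>2\<close> by (auto simp: S_def)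
  have "Gc c y (D y) \<le> a"
  proof (rule VS_local[OF u c \<open>open S\<close> _ \<open>y \<in> S\<close> gf])
    show "S \<subseteq> cimage c" using \<open>S \<subseteq> T\<close> TB B by blast
    show "u (cinv c y') - f y' \<le> u (cinv c y) - f y" if "y' \<in> S" for y'
      using y(2)[of y'] that \<open>S \<subseteq> T\<close> by (auto simp: U_def)
  qed
  moreover have "y \<in> B" using TB y(1) by blast
  then have "D y \<bullet> v \<le> Lc c y v + Gc c y (D y)" using Lc_ge[OF c, of y "D y" v] B by blast
  ultimately have "D y \<bullet> v \<le> \<kappa>" using \<kappa>[OF \<open>y \<in> B\<close>] by linarith
  \<comment> \<open>The gradient of n is orthogonal to v, and the other penalty only increases along
    v, so the slope in direction v is still at least k.\<close>
  moreover have "D y \<bullet> v = k + N' * (2 * max 0 (s y - r))"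
  proof -
    have "(y - z) \<bullet> v = s y * (v \<bullet> v)" using vv by (simp add: s_def e_def)
    then show ?thesis by (simp add: D_def inner_add_left inner_diff_left ev)
  qed
  moreover have "N' * (2 * max 0 (s y - r)) \<ge> 0" using N(1) by simp
  ultimately show False using \<epsilon>(1) by (simp add: k_def)
qed

text \<open>By \<open>VS_segment\<close> the increments of w along short segments are bounded by L,
  and averaging preserves such bounds. The error in L from moving the base point is uniform because
  only velocities up to some R have to be tested.\<close>

lemma smooth_approximation_local:
  assumes w: "VS a w" and c: "c \<in> A" and r: "r > 0" "cball z0 (3 * r) \<subseteq> cimage c" and "\<eta> > 0"
  obtains f where "f \<in> C1" "\<And>y. y \<in> cball z0 r \<Longrightarrow> \<bar>f (cinv c y) - w (cinv c y)\<bar> \<le> \<eta>"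
    "\<And>y. y \<in> cball z0 r \<Longrightarrow> G (cinv c y) (differential A f (cinv c y)) \<le> a + \<eta>"
proof -
  define K where "K = cball z0 (3 * r)"
  have K: "compact K" "K \<subseteq> cimage c" using r by (auto simp: K_def)
  obtain R where R: "R > 0" "\<And>z w. z \<in> K \<Longrightarrow> (\<And>v. v \<noteq> 0 \<Longrightarrow> norm v \<le> R \<Longrightarrow> w \<bullet> v \<le> Lc c z v + (a + \<eta>)) \<Longrightarrow> Gc c z w \<le> a + \<eta>"
    using Gc_le_if_bounded_velocities[OF c K] by (metis order_refl)
  obtain \<delta> where \<delta>: "\<delta> > 0" "\<And>z z' (v :: 'e) v'. z \<in> K \<Longrightarrow> z' \<in> K \<Longrightarrow> norm v \<le> R \<Longrightarrow> norm v' \<le> R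
    \<Longrightarrow> dist z z' < \<delta> \<Longrightarrow> dist v v' < \<delta> \<Longrightarrow> Lc c z v \<le> Lc c z' v' + \<eta>"
    using Lc_uniform[OF c K \<open>\<eta> > 0\<close>] by blast
  define U where "U y = w (cinv c y)" for y
  have contU: "continuous_on K U"
    unfolding U_def using w cont_cinv[OF c] K
    by (auto simp: VS_def intro: continuous_on_compose2 continuous_on_subset)
  obtain \<delta>' where \<delta>': "\<delta>' > 0" "\<And>y y'. y \<in> K \<Longrightarrow> y' \<in> K \<Longrightarrow> dist y' y < \<delta>' \<Longrightarrow> \<bar>U y' - U y\<bar> < \<eta>"
    using compact_uniformly_continuous[OF contU K(1)] \<open>\<eta> > 0\<close>
    unfolding uniformly_continuous_on_def dist_real_def by metis
  \<comment> \<open>Projection onto the closed ball extends U continuously to the whole space, as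
    mollification requires; near the smaller ball nothing changes.\<close>
  define W where "W y = U (closest_point K y)" for y
  have Kne: "K \<noteq> {}" "convex K" "closed K" using r by (auto simp: K_def)
  have contW: "continuous_on UNIV W"
    unfolding W_def using Kne closest_point_in_set[OF Kne(3,1)]
    by (intro continuous_on_compose2[OF contU continuous_on_closest_point]) auto
  have WU: "W y = U y" if "y \<in> K" for y using that by (simp add: W_def closest_point_self)
  \<comment> \<open>Around a point of the inner ball, the ball of radius \<rho> stays in K and L
    varies there by at most \<eta>. The mollifying shift and the step along v each take up at most a
    quarter of it.\<close>
  define \<rho> where "\<rho> = min \<delta> r"
  define \<epsilon> where "\<epsilon> = min (\<rho> / 4) (\<delta>' / 2)"
  have \<epsilon>: "\<epsilon> > 0" "\<epsilon> \<le> \<rho> / 4" "\<epsilon> < \<delta>'" "\<rho> \<le> \<delta>" "\<rho> \<le> r" "\<rho> > 0"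
    using \<delta> \<delta>' r by (auto simp: \<rho>_def \<epsilon>_def)
  obtain F D where F: "grad_on F D (ball z0 (2 * r))"
    and F1: "\<And>z z' k. z \<in> ball z0 (2 * r) \<Longrightarrow> z' \<in> ball z0 (2 * r)
      \<Longrightarrow> (\<And>\<zeta>. norm \<zeta> \<le> \<epsilon> \<Longrightarrow> W (z' - \<zeta>) - W (z - \<zeta>) \<le> k) \<Longrightarrow> F z' - F z \<le> k"
    and F2: "\<And>z a k. z \<in> ball z0 (2 * r) \<Longrightarrow> (\<And>\<zeta>. norm \<zeta> \<le> \<epsilon> \<Longrightarrow> \<bar>W (z - \<zeta>) - a\<bar> \<le> k)
      \<Longrightarrow> \<bar>F z - a\<bar> \<le> k"
    using mollification[OF contW \<epsilon>(1), of z0 "2 * r"] by blast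
  have ballK: "y \<in> K" if "dist z0 y \<le> 3 * r" for y using that by (simp add: K_def)
  have near: "dist z0 (y - h) \<le> dist z0 y + norm h" for y h
    using dist_triangle[of z0 "y - h" y] by (simp add: dist_norm)
  have close: "\<bar>F y - U y\<bar> \<le> \<eta>" if y: "y \<in> cball z0 r" for y
  proof (rule F2)
    show "y \<in> ball z0 (2 * r)" using y r by auto
    fix \<zeta> :: 'e assume \<zeta>: "norm \<zeta> \<le> \<epsilon>"
    have "y \<in> K" "y - \<zeta> \<in> K" using y \<zeta> \<epsilon> near[of y \<zeta>] r by (auto intro!: ballK)
    then show "\<bar>W (y - \<zeta>) - U y\<bar> \<le> \<eta>"
      using \<delta>'(2)[of y "y - \<zeta>"] \<zeta> \<epsilon> by (simp add: WU dist_norm)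
  qed
  have grad: "Gc c y (D y) \<le> a + \<eta>" if y: "y \<in> cball z0 r" for y
  proof (rule R(2))
    show "y \<in> K" using y r by (auto intro!: ballK)
    fix v :: 'e assume v: "v \<noteq> 0" "norm v \<le> R"
    have y2: "y \<in> ball z0 (2 * r)" using y r by auto
    have "\<forall>\<^sub>F t in at_right 0. t < \<rho> / (4 * norm v)"
      using \<epsilon>(6) v(1) by (intro eventually_at_rightI[of 0 "\<rho> / (4 * norm v)"]) auto
    then have "\<forall>\<^sub>F t in at_right 0. F (y + t *\<^sub>R v) - F y \<le> t * (Lc c y v + (a + \<eta>))"
      using eventually_at_right_less[of 0]
    proof eventually_elim
      case (elim t)
      have tv: "norm (t *\<^sub>R v) \<le> \<rho> / 4" using elim v(1) by (simp add: field_simps)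
      show ?case
      proof (rule F1[OF y2])
        show "y + t *\<^sub>R v \<in> ball z0 (2 * r)" using near[of y "- (t *\<^sub>R v)"] y tv \<epsilon> r by auto
        fix \<zeta> :: 'e assume \<zeta>: "norm \<zeta> \<le> \<epsilon>"
        let ?B = "ball y \<rho>"
        have BK: "?B \<subseteq> K"
        proof
          fix y' assume "y' \<in> ?B"
          then show "y' \<in> K" using dist_triangle[of z0 y' y] y \<epsilon>(5) r by (intro ballK) auto
        qed
        have i1: "y - \<zeta> \<in> ?B" using \<zeta> \<epsilon> by (simp add: dist_norm)
        have i2: "y - \<zeta> + t *\<^sub>R v \<in> ?B"
          using \<zeta> \<epsilon> tv norm_triangle_ineq4[of \<zeta> "t *\<^sub>R v"] by (auto simp: dist_norm algebra_simps)
        have "w (cinv c (y - \<zeta> + t *\<^sub>R v)) - w (cinv c (y - \<zeta>)) \<le> t * (Lc c y v + (a + \<eta>))"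
        proof (rule VS_segment[OF w c open_ball convex_ball _ v(1) elim(2) i1 i2])
          show "?B \<subseteq> cimage c" using BK K by blast
          fix y' assume y': "y' \<in> ?B"
          then have "Lc c y' v \<le> Lc c y v + \<eta>"
            using BK v(2) \<epsilon>(4) \<delta>(1) \<open>y \<in> K\<close> by (intro \<delta>(2)) (auto simp: dist_commute)
          then show "Lc c y' v + a \<le> Lc c y v + (a + \<eta>)" by simp
        qed
        then show "W (y + t *\<^sub>R v - \<zeta>) - W (y - \<zeta>) \<le> t * (Lc c y v + (a + \<eta>))"
          using i1 i2 BK by (auto simp: WU U_def algebra_simps subset_iff)
      qed
    qed
    then show "D y \<bullet> v \<le> Lc c y v + (a + \<eta>)"
      using grad_onD[OF F y2] by (rule derivative_le_if_increments_le[rotated])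
  qed
  have "cball z0 (2 * r) \<subseteq> cimage c" using r subset_cball[of "2 * r" "3 * r" z0] by auto
  then obtain f where f: "f \<in> C1" "\<And>y. y \<in> cball z0 (3 / 2 * r) \<Longrightarrow> f (cinv c y) = F y"
    "\<And>y. y \<in> ball z0 (3 / 2 * r) \<Longrightarrow> differential A f (cinv c y) = covec_of A c (cinv c y) (D y)"
    using local_function_extends[OF c _ F, of "3 / 2 * r"] r(1) by auto
  show thesis
  proof (rule that[OF f(1)])
    fix y assume y: "y \<in> cball z0 r"
    then have y': "y \<in> ball z0 (3 / 2 * r)" using r(1) by auto
    show "\<bar>f (cinv c y) - w (cinv c y)\<bar> \<le> \<eta>" using close[OF y] f(2)[of y] y' by (simp add: U_def)
    show "G (cinv c y) (differential A f (cinv c y)) \<le> a + \<eta>"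
      using grad[OF y] f(3)[OF y'] by (simp add: Gc_def)
  qed
qed

section \<open>Patching local approximations\<close>

lemma partition_of_unity:
  obtains I :: "'m set" and c :: "'m \<Rightarrow> ('m, 'e) chart" and r :: "'m \<Rightarrow> real" and \<xi> :: "'m \<Rightarrow> 'm \<Rightarrow> real"
  where "finite I" "\<And>i. i \<in> I \<Longrightarrow> c i \<in> A \<and> i \<in> cdom (c i) \<and> r i > 0 \<and> cball (cmap (c i) i) (3 * r i) \<subseteq> cimage (c i)"
    "\<And>i. i \<in> I \<Longrightarrow> \<xi> i \<in> C1" "\<And>i x. i \<in> I \<Longrightarrow> \<xi> i x \<ge> 0" "\<And>x. (\<Sum>i\<in>I. \<xi> i x) = 1"
    "\<And>i x. i \<in> I \<Longrightarrow> x \<notin> cinv (c i) ` cball (cmap (c i) i) (r i) \<Longrightarrow> \<xi> i x = 0"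
proof -
  have "\<exists>c s. c \<in> A \<and> x \<in> cdom c \<and> s > 0 \<and> cball (cmap c x) s \<subseteq> cimage c" for x
    using chart_ball_ex by metis
  then obtain c s where cs: "\<And>x. c x \<in> A \<and> x \<in> cdom (c x) \<and> s x > 0 \<and> cball (cmap (c x) x) (s x) \<subseteq> cimage (c x)"
    by metis
  \<comment> \<open>Each function is supported in the ball of radius r, while three times this
    radius still fits into the chart: the room that the local mollification takes up.\<close>
  define r where "r x = s x / 3" for x
  have r: "r x > 0" "cball (cmap (c x) x) (3 * r x) \<subseteq> cimage (c x)" "c x \<in> A" "x \<in> cdom (c x)" for x
    using cs[of x] by (auto simp: r_def)
  have sub: "ball (cmap (c x) x) (t * r x) \<subseteq> cimage (c x)" "cball (cmap (c x) x) (t * r x) \<subseteq> cimage (c x)" if "t \<le> 3" for x t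
  proof -
    have "t * r x \<le> 3 * r x" using that r(1)[of x] by (intro mult_right_mono) auto
    then show "ball (cmap (c x) x) (t * r x) \<subseteq> cimage (c x)" "cball (cmap (c x) x) (t * r x) \<subseteq> cimage (c x)"
      using r(2)[of x] by (meson subset_cball ball_subset_cball subset_trans)+
  qed
  define U where "U x = cinv (c x) ` ball (cmap (c x) x) (r x / 2)" for x
  have "open (U x)" for x
    unfolding U_def using sub(1)[of "1/2" x] by (intro open_cinv_image r) auto
  moreover have xU: "x \<in> U x" for x
    unfolding U_def using r[of x] cinv_cmap[of "c x" x] by (metis centre_in_ball half_gt_zero image_eqI)
  ultimately obtain I where I: "finite I" "UNIV \<subseteq> (\<Union>i\<in>I. U i)"
    using compactE_image[OF compact_M, of UNIV U] by (metis UNIV_I UN_I subsetI)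
  define \<eta> where "\<eta> i = chart_extension (c i) (bump (cmap (c i) i) (r i / 2) (r i))" for i
  have \<eta>C1: "\<eta> i \<in> C1" for i
  proof -
    obtain E where E: "grad_on (bump (cmap (c i) i) (r i / 2) (r i)) E (ball (cmap (c i) i) (2 * r i))"
      using bump_grad[of "r i / 2" "r i"] r(1)[of i] by auto
    show ?thesis
      unfolding \<eta>_def
    proof (rule chart_extension_C1[OF r(3) _ _ _ _ E])
      show "cball (cmap (c i) i) (r i) \<subseteq> ball (cmap (c i) i) (2 * r i)" using r(1)[of i] by auto
      show "ball (cmap (c i) i) (2 * r i) \<subseteq> cimage (c i)" by (rule sub) simp
      show "bump (cmap (c i) i) (r i / 2) (r i) z = 0" if "z \<notin> cball (cmap (c i) i) (r i)" for z
        using that r(1)[of i] by (intro bump_eq_0) auto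
    qed auto
  qed
  have \<eta>0: "\<eta> i x \<ge> 0" for i x by (simp add: \<eta>_def chart_extension_def)
  have \<eta>1: "\<eta> i x = 1" if xi: "x \<in> U i" for i x
  proof -
    obtain z where z: "x = cinv (c i) z" "z \<in> ball (cmap (c i) i) (r i / 2)" using xi unfolding U_def by blast
    then have "z \<in> cimage (c i)" using sub(1)[of "1/2" i] by auto
    then have "x \<in> cdom (c i)" "cmap (c i) x = z" using z cinv_in cmap_cinv r(3) by auto
    then show ?thesis using z r(1)[of i] by (simp add: \<eta>_def chart_extension_def bump_eq_1)
  qed
  have \<eta>2: "\<eta> i x = 0" if "x \<notin> cinv (c i) ` cball (cmap (c i) i) (r i)" for i x
  proof (cases "x \<in> cdom (c i)")
    case True
    then have "cmap (c i) x \<notin> cball (cmap (c i) i) (r i)" using that cinv_cmap[OF r(3) True] by (metis image_eqI)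
    then show ?thesis using r(1)[of i] True by (simp add: \<eta>_def chart_extension_def bump_eq_0)
  qed (simp add: \<eta>_def chart_extension_def)
  define H where "H x = (\<Sum>i\<in>I. \<eta> i x)" for x
  have HC1: "H \<in> C1" unfolding H_def using I(1) \<eta>C1 by (intro C1_sum)
  have H1: "H x \<ge> 1" for x
  proof -
    obtain i where i: "i \<in> I" "x \<in> U i" using I(2) by blast
    then have "1 \<le> \<eta> i x" using \<eta>1 by simp
    also have "\<dots> \<le> H x" unfolding H_def using i(1) I(1) \<eta>0 by (intro member_le_sum) auto
    finally show ?thesis .
  qed
  have invC1: "(\<lambda>x. inverse (H x)) \<in> C1"
  proof (rule C1_compose_real[OF HC1, of inverse "\<lambda>t. - (inverse t ^ 2)"])
    show "(inverse has_real_derivative - ((inverse (H x))\<^sup>2)) (at (H x))" for x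
      using DERIV_inverse[of "H x" UNIV] H1[of x] by (simp add: numeral_2_eq_2)
    show "continuous_on (range H) (\<lambda>t. - ((inverse t)\<^sup>2))"
      using H1 by (intro continuous_intros) (metis imageE not_one_le_zero)
  qed
  show thesis
  proof (rule that[OF I(1), of c r "\<lambda>i x. \<eta> i x * inverse (H x)"])
    show "(\<lambda>x. \<eta> i x * inverse (H x)) \<in> C1" for i by (rule C1_mult[OF \<eta>C1 invC1])
    show "\<eta> i x * inverse (H x) \<ge> 0" for i x using \<eta>0[of i x] H1[of x] by simp
    show "(\<Sum>i\<in>I. \<eta> i x * inverse (H x)) = 1" for x
      using H1[of x] by (simp flip: sum_distrib_right H_def)
    show "\<eta> i x * inverse (H x) = 0" if "x \<notin> cinv (c i) ` cball (cmap (c i) i) (r i)" for i x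
      using \<eta>2[OF that] by simp
  qed (use r in blast)
qed

text \<open>The differentials of a partition of unity sum to zero, so patching adds only the terms
  (f_i - w) times the differential of \<xi> i. Each of these differentials is dominated by L + C,
  hence the patched function satisfies df \<le> (1 + \<tau>) L + const with small \<tau>; dividing
  by 1 + \<tau> restores the factor one.\<close>

theorem smooth_approximation:
  assumes w: "VS a w" and "\<epsilon> > 0"
  obtains f where "f \<in> C1" "\<And>x. \<bar>f x - w x\<bar> \<le> \<epsilon>" "\<And>x. G x (differential A f x) \<le> a + \<epsilon>"
proof -
  obtain I :: "'m set" and c :: "'m \<Rightarrow> ('m, 'e) chart" and r :: "'m \<Rightarrow> real" and \<xi> :: "'m \<Rightarrow> 'm \<Rightarrow> real"
    where I: "finite I"
    and cr: "\<And>i. i \<in> I \<Longrightarrow> c i \<in> A \<and> i \<in> cdom (c i) \<and> r i > 0 \<and> cball (cmap (c i) i) (3 * r i) \<subseteq> cimage (c i)"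
    and \<xi>: "\<And>i. i \<in> I \<Longrightarrow> \<xi> i \<in> C1" "\<And>i x. i \<in> I \<Longrightarrow> \<xi> i x \<ge> 0" "\<And>x. (\<Sum>i\<in>I. \<xi> i x) = 1"
      "\<And>i x. i \<in> I \<Longrightarrow> x \<notin> cinv (c i) ` cball (cmap (c i) i) (r i) \<Longrightarrow> \<xi> i x = 0"
    using partition_of_unity by blast
  obtain B where B: "B > 0" "\<And>x. \<bar>w x\<bar> \<le> B"
    using continuous_bounded[of w] w unfolding VS_def by blast
  have "\<exists>C>0. \<forall>x. G x (differential A (\<xi> i) x) \<le> C \<and> G x (differential A (\<lambda>x. (-1) * \<xi> i x) x) \<le> C" if i: "i \<in> I" for i
  proof -
    obtain C1 where "C1 > 0" "\<And>x. \<bar>G x (differential A (\<xi> i) x)\<bar> \<le> C1"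
      using continuous_bounded[OF G_differential_continuous[OF \<xi>(1)[OF i]]] by blast
    moreover obtain C2 where "C2 > 0" "\<And>x. \<bar>G x (differential A (\<lambda>x. (-1) * \<xi> i x) x)\<bar> \<le> C2"
      using continuous_bounded[OF G_differential_continuous[OF C1_cmult[OF \<xi>(1)[OF i]]]] by blast
    ultimately show ?thesis by (intro exI[of _ "max C1 C2"]) (auto simp: abs_le_iff le_max_iff_disj)
  qed
  then obtain Cf where Cf: "\<And>i. i \<in> I \<Longrightarrow> Cf i > 0"
    "\<And>i x. i \<in> I \<Longrightarrow> G x (differential A (\<xi> i) x) \<le> Cf i \<and> G x (differential A (\<lambda>x. (-1) * \<xi> i x) x) \<le> Cf i"
    by metis
  define C where "C = (\<Sum>i\<in>I. Cf i)"
  have "C \<ge> 0" unfolding C_def using Cf(1) by (intro sum_nonneg) (auto intro: less_imp_le)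
  have CfC: "Cf i \<le> C" if "i \<in> I" for i
    unfolding C_def using Cf(1) that I by (intro member_le_sum) (auto intro: less_imp_le)
  have d\<xi>: "\<bar>differential A (\<xi> i) x v\<bar> \<le> L x v + C" if i: "i \<in> I" and v: "v \<in> tangent_space A x" for i x v
  proof -
    have "differential A (\<xi> i) x v \<le> L x v + Cf i" "differential A (\<lambda>x. (-1) * \<xi> i x) x v \<le> L x v + Cf i"
      using Cf(2)[OF i, of x] G_le_iff[OF \<xi>(1)[OF i], of x "Cf i"] G_le_iff[OF C1_cmult[OF \<xi>(1)[OF i], of "-1"], of x "Cf i"] v
      by auto
    then show ?thesis using CfC[OF i] differential_cmult[OF v \<xi>(1)[OF i], of "-1"] by simp
  qed
  define k where "k = real (card I)"
  \<comment> \<open>Collects the local error, the patching error and the two errors of the final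
    rescaling, in the level and in the values.\<close>
  define Q where "Q = 1 + k * (C + \<bar>a\<bar> + B)"
  have "Q \<ge> 1" using \<open>C \<ge> 0\<close> B(1) by (simp add: Q_def k_def)
  define \<eta> where "\<eta> = \<epsilon> / Q"
  have \<eta>: "\<eta> > 0" "\<eta> * Q = \<epsilon>" using \<open>\<epsilon> > 0\<close> \<open>Q \<ge> 1\<close> by (auto simp: \<eta>_def)
  have "\<exists>f. f \<in> C1 \<and> (\<forall>y\<in>cball (cmap (c i) i) (r i). \<bar>f (cinv (c i) y) - w (cinv (c i) y)\<bar> \<le> \<eta> \<and>
      G (cinv (c i) y) (differential A f (cinv (c i) y)) \<le> a + \<eta>)" if i: "i \<in> I" for i
  proof -
    have ci: "c i \<in> A" "r i > 0" "cball (cmap (c i) i) (3 * r i) \<subseteq> cimage (c i)" using cr[OF i] by auto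
    show ?thesis by (rule smooth_approximation_local[OF w ci \<eta>(1)]) blast
  qed
  then have "\<forall>i\<in>I. \<exists>f. f \<in> C1 \<and> (\<forall>x\<in>cinv (c i) ` cball (cmap (c i) i) (r i). \<bar>f x - w x\<bar> \<le> \<eta> \<and>
      G x (differential A f x) \<le> a + \<eta>)"
    by blast
  from bchoice[OF this] obtain fi where fi: "\<And>i. i \<in> I \<Longrightarrow> fi i \<in> C1"
    "\<And>i x. i \<in> I \<Longrightarrow> x \<in> cinv (c i) ` cball (cmap (c i) i) (r i)
      \<Longrightarrow> \<bar>fi i x - w x\<bar> \<le> \<eta> \<and> G x (differential A (fi i) x) \<le> a + \<eta>"
    by blast
  define f where "f x = (\<Sum>i\<in>I. \<xi> i x * fi i x)" for x
  have fC1: "f \<in> C1" unfolding f_def using I \<xi>(1) fi(1) by (intro C1_sum C1_mult)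
  have close: "\<bar>f x - w x\<bar> \<le> \<eta>" for x
  proof -
    have "f x - w x = (\<Sum>i\<in>I. \<xi> i x * (fi i x - w x))"
      using \<xi>(3)[of x] by (simp add: f_def right_diff_distrib sum_subtractf flip: sum_distrib_right)
    also have "\<bar>\<dots>\<bar> \<le> (\<Sum>i\<in>I. \<bar>\<xi> i x * (fi i x - w x)\<bar>)" by (rule sum_abs)
    also have "\<dots> \<le> (\<Sum>i\<in>I. \<xi> i x * \<eta>)"
    proof (rule sum_mono)
      fix i assume i: "i \<in> I"
      show "\<bar>\<xi> i x * (fi i x - w x)\<bar> \<le> \<xi> i x * \<eta>"
        using fi(2)[OF i, of x] \<xi>(2)[OF i, of x] \<xi>(4)[OF i, of x]
        by (cases "x \<in> cinv (c i) ` cball (cmap (c i) i) (r i)") (auto simp: abs_mult intro!: mult_left_mono)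
    qed
    also have "\<dots> = \<eta>" using \<xi>(3)[of x] by (simp flip: sum_distrib_right)
    finally show ?thesis .
  qed
  define \<tau> where "\<tau> = k * \<eta>"
  have "\<tau> \<ge> 0" using \<eta>(1) by (simp add: \<tau>_def k_def)
  have df: "differential A f x v \<le> (1 + \<tau>) * L x v + (a + \<eta> + \<tau> * C)" if v: "v \<in> tangent_space A x" for x v
  proof -
    have 0: "(\<Sum>i\<in>I. differential A (\<xi> i) x v) = 0"
      using differential_sum[OF v I, of \<xi>] \<xi>(1) differential_const[OF v, of 1] by (simp add: \<xi>(3))
    have "differential A f x v = (\<Sum>i\<in>I. \<xi> i x * differential A (fi i) x v + fi i x * differential A (\<xi> i) x v)"
      unfolding f_def using I \<xi>(1) fi(1) by (simp add: differential_sum[OF v] C1_mult differential_mult[OF v])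
    also have "\<dots> = (\<Sum>i\<in>I. \<xi> i x * differential A (fi i) x v + (fi i x - w x) * differential A (\<xi> i) x v)"
      using 0 by (simp add: sum.distrib left_diff_distrib sum_subtractf flip: sum_distrib_left)
    also have "\<dots> \<le> (\<Sum>i\<in>I. \<xi> i x * (L x v + (a + \<eta>)) + \<eta> * (L x v + C))"
    proof (rule sum_mono)
      fix i assume i: "i \<in> I"
      show "\<xi> i x * differential A (fi i) x v + (fi i x - w x) * differential A (\<xi> i) x v
          \<le> \<xi> i x * (L x v + (a + \<eta>)) + \<eta> * (L x v + C)"
      proof (cases "x \<in> cinv (c i) ` cball (cmap (c i) i) (r i)")
        case True
        then have "differential A (fi i) x v \<le> L x v + (a + \<eta>)"
          using fi(2)[OF i True] G_le_iff[OF fi(1)[OF i]] v by blast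
        then have "\<xi> i x * differential A (fi i) x v \<le> \<xi> i x * (L x v + (a + \<eta>))"
          using \<xi>(2)[OF i] by (rule mult_left_mono)
        moreover have "(fi i x - w x) * differential A (\<xi> i) x v \<le> \<bar>fi i x - w x\<bar> * \<bar>differential A (\<xi> i) x v\<bar>"
          by (metis abs_ge_self abs_mult)
        moreover have "\<dots> \<le> \<eta> * (L x v + C)"
          using fi(2)[OF i True] d\<xi>[OF i v] \<eta>(1) by (intro mult_mono) auto
        ultimately show ?thesis by linarith
      next
        case False
        then have "\<xi> i x = 0" using \<xi>(4)[OF i] by blast
        then have "differential A (\<lambda>_. 0) x = differential A (\<xi> i) x"
          using \<xi>(2)[OF i] by (intro differential_eq_if_touching[OF C1_const \<xi>(1)[OF i]] always_eventually) simp
        then have "differential A (\<xi> i) x v = 0" using differential_const[OF v, of 0] by simp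
        moreover have "L x v + C \<ge> 0" using d\<xi>[OF i v] by linarith
        ultimately show ?thesis using \<open>\<xi> i x = 0\<close> \<eta>(1) by simp
      qed
    qed
    also have "\<dots> = (L x v + (a + \<eta>)) + \<tau> * (L x v + C)"
      using \<xi>(3)[of x] by (simp add: sum.distrib \<tau>_def k_def flip: sum_distrib_right)
    finally show ?thesis by (simp add: algebra_simps)
  qed
  define h where "h x = (1 / (1 + \<tau>)) * f x" for x
  show thesis
  proof (rule that[of h])
    show hC1: "h \<in> C1" unfolding h_def by (rule C1_cmult[OF fC1])
    have \<tau>Q: "\<eta> + \<tau> * (C + \<bar>a\<bar> + B) = \<epsilon>" using \<eta>(2) by (simp add: \<tau>_def Q_def algebra_simps)
    have nn: "\<tau> * C \<ge> 0" "\<tau> * \<bar>a\<bar> \<ge> 0" "\<tau> * B \<ge> 0" using \<open>\<tau> \<ge> 0\<close> \<open>C \<ge> 0\<close> B(1) by auto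
    show "\<bar>h x - w x\<bar> \<le> \<epsilon>" for x
    proof -
      have "h x - w x = (1 / (1 + \<tau>)) * ((f x - w x) - \<tau> * w x)"
        using \<open>\<tau> \<ge> 0\<close> by (simp add: h_def field_simps)
      also have "\<bar>\<dots>\<bar> \<le> 1 * \<bar>(f x - w x) - \<tau> * w x\<bar>"
        unfolding abs_mult using \<open>\<tau> \<ge> 0\<close> by (intro mult_right_mono) auto
      also have "\<dots> \<le> \<eta> + \<tau> * B"
      proof -
        have "\<bar>\<tau> * w x\<bar> \<le> \<tau> * B" using \<open>\<tau> \<ge> 0\<close> B(2)[of x] by (simp add: abs_mult mult_left_mono)
        then show ?thesis using close[of x] abs_triangle_ineq4[of "f x - w x" "\<tau> * w x"] by simp
      qed
      finally show ?thesis using \<tau>Q nn by (simp add: distrib_left)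
    qed
    show "G x (differential A h x) \<le> a + \<epsilon>" for x
      unfolding G_le_iff[OF hC1]
    proof
      fix v assume v: "v \<in> tangent_space A x"
      have "differential A h x v = (1 / (1 + \<tau>)) * differential A f x v"
        unfolding h_def by (rule differential_cmult[OF v fC1])
      also have "\<dots> \<le> (1 / (1 + \<tau>)) * ((1 + \<tau>) * L x v + (a + \<eta> + \<tau> * C))"
        using \<open>\<tau> \<ge> 0\<close> df[OF v] by (intro mult_left_mono) auto
      also have "\<dots> = L x v + (a + \<eta> + \<tau> * C) / (1 + \<tau>)" using \<open>\<tau> \<ge> 0\<close> by (simp add: field_simps)
      also have "(a + \<eta> + \<tau> * C) / (1 + \<tau>) \<le> a + \<epsilon>"
      proof -
        have "a + \<eta> + \<tau> * C \<le> a + \<epsilon> - \<tau> * \<bar>a\<bar>" using \<tau>Q nn by (simp add: distrib_left)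
        also have "\<dots> \<le> (a + \<epsilon>) * (1 + \<tau>)"
        proof -
          have "\<tau> * \<epsilon> \<ge> 0" using \<open>\<tau> \<ge> 0\<close> \<open>\<epsilon> > 0\<close> by simp
          moreover have "\<tau> * a \<ge> - (\<tau> * \<bar>a\<bar>)" using \<open>\<tau> \<ge> 0\<close> by (metis abs_ge_minus_self abs_minus minus_le_iff mult_left_mono mult_minus_right)
          ultimately show ?thesis by (simp add: algebra_simps)
        qed
        finally show ?thesis using \<open>\<tau> \<ge> 0\<close> by (simp add: divide_le_eq)
      qed
      finally show "differential A h x v \<le> L x v + (a + \<epsilon>)" by simp
    qed
  qed
qed

end

subsection \<open>The action along absolutely continuous curves\<close>

context hamiltonian
begin

lemma velocity_eq_tvec_of:
  assumes c: "c \<in> A" "\<gamma> s \<in> cdom c" and cont: "isCont \<gamma> s"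
    and d: "(cmap c \<circ> \<gamma> has_vector_derivative w) (at s)"
  shows "velocity A \<gamma> s = tvec_of A c (\<gamma> s) w"
proof
  fix d
  show "velocity A \<gamma> s d = tvec_of A c (\<gamma> s) w d"
  proof (cases "d \<in> A \<and> \<gamma> s \<in> cdom d")
    case True
    have "(cmap d \<circ> cinv c has_derivative dT c d (\<gamma> s)) (at ((cmap c \<circ> \<gamma>) s))"
      using transition_derivative[OF c(1) _ c(2), of d] True by simp
    from diff_chain_at[OF d[unfolded has_vector_derivative_def] this]
    have "((cmap d \<circ> cinv c) \<circ> (cmap c \<circ> \<gamma>) has_derivative (\<lambda>h. h *\<^sub>R dT c d (\<gamma> s) w)) (at s)"
      using linear_scale[OF linear_dT[OF c(1) _ c(2), of d]] True by (simp add: o_def)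
    moreover have "\<forall>\<^sub>F u in nhds s. \<gamma> u \<in> cdom c"
      using cont open_cdom[OF c(1)] c(2) by (simp add: isCont_def tendsto_def eventually_nhds_conv_at)
    then obtain S where S: "open S" "s \<in> S" "\<And>u. u \<in> S \<Longrightarrow> \<gamma> u \<in> cdom c" by (auto simp: eventually_nhds)
    ultimately have "(cmap d \<circ> \<gamma> has_derivative (\<lambda>h. h *\<^sub>R dT c d (\<gamma> s) w)) (at s)"
      by (elim has_derivative_transform_within_open[OF _ S(1,2)]) (simp add: cinv_cmap[OF c(1)] S(3))
    then have "vector_derivative (cmap d \<circ> \<gamma>) (at s) = dT c d (\<gamma> s) w"
      by (intro vector_derivative_at) (simp add: has_vector_derivative_def)
    then show ?thesis using True by (simp add: velocity_def tvec_of_eq)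
  next
    case False
    then show ?thesis unfolding velocity_def using tvec_of_zero[OF False] by (simp only: if_False)
  qed
qed

text \<open>Almost everywhere this is the chain rule followed by the Fenchel inequality; absolute
  continuity in charts makes f along the curve absolutely continuous, so the inequality can be
  integrated.\<close>

lemma C1_along_curve:
  assumes f: "f \<in> C1" "\<And>x v. v \<in> tangent_space A x \<Longrightarrow> differential A f x v \<le> L x v + a"
    and \<gamma>: "abs_continuous_curve A t \<gamma>" and "t \<ge> 0"
    and int: "(\<lambda>s. L (\<gamma> s) (velocity A \<gamma> s)) integrable_on {0..t}"
  shows "f (\<gamma> t) - f (\<gamma> 0) \<le> integral {0..t} (\<lambda>s. L (\<gamma> s) (velocity A \<gamma> s)) + a * t"
proof -
  define \<Phi> where "\<Phi> s = f (\<gamma> s)" for s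
  define good where "good u v \<longleftrightarrow> abs_continuous_on u v \<Phi> \<and> (\<exists>N. negligible N \<and> (\<forall>s\<in>{u..v} - N.
      \<exists>D. (\<Phi> has_real_derivative D) (at s) \<and> D \<le> L (\<gamma> s) (velocity A \<gamma> s) + a))" for u v
  have cont\<gamma>: "continuous_on {0..t} \<gamma>" using \<gamma> by (simp add: abs_continuous_curve_def)
  \<comment> \<open>Bisection takes the place of cutting the curve into pieces that lie in charts:
    \<open>good\<close> passes to unions of adjacent intervals and holds on every short
    interval.\<close>
  have "0 \<le> (0::real) \<and> t \<le> t \<longrightarrow> good 0 t"
  proof (rule Bolzano[OF \<open>t \<ge> 0\<close>, of "\<lambda>u v. 0 \<le> u \<and> v \<le> t \<longrightarrow> good u v"])
    fix u m v :: real
    assume 1: "0 \<le> u \<and> m \<le> t \<longrightarrow> good u m" and 2: "0 \<le> m \<and> v \<le> t \<longrightarrow> good m v" and le: "u \<le> m" "m \<le> v"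
    show "0 \<le> u \<and> v \<le> t \<longrightarrow> good u v"
    proof
      assume "0 \<le> u \<and> v \<le> t"
      then have "good u m" "good m v" using 1 2 le by auto
      then obtain N1 N2 where N: "negligible N1" "negligible N2"
        "\<And>s. s \<in> {u..m} - N1 \<Longrightarrow> \<exists>D. (\<Phi> has_real_derivative D) (at s) \<and> D \<le> L (\<gamma> s) (velocity A \<gamma> s) + a"
        "\<And>s. s \<in> {m..v} - N2 \<Longrightarrow> \<exists>D. (\<Phi> has_real_derivative D) (at s) \<and> D \<le> L (\<gamma> s) (velocity A \<gamma> s) + a"
        "abs_continuous_on u m \<Phi>" "abs_continuous_on m v \<Phi>"
        unfolding good_def by blast
      have "\<exists>D. (\<Phi> has_real_derivative D) (at s) \<and> D \<le> L (\<gamma> s) (velocity A \<gamma> s) + a"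
        if "s \<in> {u..v} - (N1 \<union> N2)" for s
        using N(3)[of s] N(4)[of s] that by (cases "s \<le> m") auto
      moreover have "negligible (N1 \<union> N2)" using N(1,2) by (rule negligible_Un)
      ultimately show "good u v"
        unfolding good_def using abs_continuous_on_join[OF N(5,6) le] by blast
    qed
  next
    fix x assume x: "0 \<le> x" "x \<le> t"
    obtain c \<rho> where c: "c \<in> A" "\<gamma> x \<in> cdom c" "\<rho> > 0" "cball (cmap c (\<gamma> x)) \<rho> \<subseteq> cimage c"
      using chart_ball_ex by blast
    define z0 where "z0 = cmap c (\<gamma> x)"
    define F where "F = f \<circ> cinv c"
    have gF: "grad_on F (gr F) (cimage c)" using C1D[OF f(1) c(1)] by (simp add: F_def)
    have Bsub: "ball z0 \<rho> \<subseteq> cimage c" using c(4) by (auto simp: z0_def)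
    then have op: "open (cinv c ` ball z0 \<rho>)" by (intro open_cinv_image[OF c(1)]) auto
    have "\<gamma> x \<in> cinv c ` ball z0 \<rho>"
      using c(3) cinv_cmap[OF c(1,2)] by (metis centre_in_ball image_eqI z0_def)
    moreover have "((\<gamma> \<longlongrightarrow> \<gamma> x) (at x within {0..t}))"
      using cont\<gamma> x by (simp add: continuous_on)
    ultimately have "\<forall>\<^sub>F s in at x within {0..t}. \<gamma> s \<in> cinv c ` ball z0 \<rho>"
      by (intro topological_tendstoD[OF _ op])
    then obtain d where d: "d > 0" "\<And>s. s \<in> {0..t} \<Longrightarrow> s \<noteq> x \<Longrightarrow> dist s x < d \<Longrightarrow> \<gamma> s \<in> cinv c ` ball z0 \<rho>"
      unfolding eventually_at by blast
    have near: "\<gamma> s \<in> cdom c \<and> cmap c (\<gamma> s) \<in> ball z0 \<rho>" if "s \<in> {0..t}" "dist s x < d" for s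
    proof -
      have "\<gamma> s \<in> cinv c ` ball z0 \<rho>"
        using d(2)[OF that(1) _ that(2)] \<open>\<gamma> x \<in> cinv c ` ball z0 \<rho>\<close> by blast
      then obtain y where y: "y \<in> ball z0 \<rho>" "\<gamma> s = cinv c y" by blast
      then have "y \<in> cimage c" using Bsub by blast
      then show ?thesis using y cinv_in[OF c(1)] cmap_cinv[OF c(1)] by simp
    qed
    obtain C where C: "\<And>y y'. y \<in> ball z0 \<rho> \<Longrightarrow> y' \<in> ball z0 \<rho> \<Longrightarrow> dist (F y) (F y') \<le> C * dist y y'"
    proof -
      have "continuous_on (cball z0 \<rho>) (gr F)"
        by (rule continuous_on_subset[of "cimage c"]) (use gF c(4) in \<open>simp_all add: grad_on_def z0_def\<close>)
      then have "bounded (gr F ` cball z0 \<rho>)"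
        by (intro compact_imp_bounded compact_continuous_image compact_cball)
      then obtain C where C: "\<And>y. y \<in> cball z0 \<rho> \<Longrightarrow> norm (gr F y) \<le> C"
        unfolding bounded_iff by blast
      show thesis
      proof (rule that[of C])
        fix y y' assume y: "y \<in> ball z0 \<rho>" "y' \<in> ball z0 \<rho>"
        have "norm (F y - F y') \<le> C * norm (y - y')"
        proof (rule differentiable_bound[OF convex_ball])
          fix u assume u: "u \<in> ball z0 \<rho>"
          show "(F has_derivative (\<lambda>v. gr F u \<bullet> v)) (at u within ball z0 \<rho>)"
            using grad_onD[OF gF] u Bsub by (blast intro: has_derivative_at_withinI)
          show "onorm (\<lambda>v. gr F u \<bullet> v) \<le> C"
          proof (rule onorm_le)
            fix v
            have "norm (gr F u \<bullet> v) \<le> norm (gr F u) * norm v" using Cauchy_Schwarz_ineq2[of "gr F u" v] by simp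
            also have "\<dots> \<le> C * norm v" using C[of u] u by (intro mult_right_mono) auto
            finally show "norm (gr F u \<bullet> v) \<le> C * norm v" .
          qed
        qed (use y in auto)
        then show "dist (F y) (F y') \<le> C * dist y y'" by (simp add: dist_norm)
      qed
    qed
    show "\<exists>d>0. \<forall>u v. u \<le> x \<and> x \<le> v \<and> v - u < d \<longrightarrow> 0 \<le> u \<and> v \<le> t \<longrightarrow> good u v"
    proof (intro exI[of _ d] conjI allI impI)
      fix u v assume uv: "u \<le> x \<and> x \<le> v \<and> v - u < d" "0 \<le> u \<and> v \<le> t"
      have nr: "\<gamma> s \<in> cdom c" "cmap c (\<gamma> s) \<in> ball z0 \<rho>" if "s \<in> {u..v}" for s
        using near[of s] that uv by (auto simp: dist_real_def)
      have im: "\<gamma> ` {u..v} \<subseteq> cdom c" using nr(1) by blast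
      have "u \<le> v" using uv by linarith
      then have ac: "abs_continuous_on u v (cmap c \<circ> \<gamma>)"
        using \<gamma> c(1) uv im unfolding abs_continuous_curve_def by blast
      have Phi: "\<Phi> s = F (cmap c (\<gamma> s))" if "s \<in> {u..v}" for s
        using nr(1)[OF that] by (simp add: \<Phi>_def F_def cinv_cmap[OF c(1)])
      have "abs_continuous_on u v (\<lambda>s. F ((cmap c \<circ> \<gamma>) s))"
        by (rule abs_continuous_on_lipschitz_compose[OF ac, of F C]) (use C nr in auto)
      then have "abs_continuous_on u v \<Phi>"
        by (rule abs_continuous_on_cong) (simp add: Phi)
      moreover obtain N where N: "negligible N" "\<And>s. s \<in> {u<..<v} - N \<Longrightarrow> (cmap c \<circ> \<gamma>) differentiable (at s)"
        using abs_continuous_on_differentiable_ae[OF ac] uv by auto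
      moreover have "\<exists>D. (\<Phi> has_real_derivative D) (at s) \<and> D \<le> L (\<gamma> s) (velocity A \<gamma> s) + a"
        if s: "s \<in> {u..v} - (N \<union> {u, v})" for s
      proof -
        have s': "s \<in> {u<..<v} - N" "s \<in> {u<..<v}" "s \<in> {u..v}" using s by auto
        define w where "w = vector_derivative (cmap c \<circ> \<gamma>) (at s)"
        have w: "(cmap c \<circ> \<gamma> has_vector_derivative w) (at s)"
          unfolding w_def using N(2)[OF s'(1)] by (simp add: vector_derivative_works)
        have "continuous_on {u<..<v} \<gamma>" by (rule continuous_on_subset[OF cont\<gamma>]) (use uv in auto)
        then have "isCont \<gamma> s" using s'(2) by (simp add: continuous_on_eq_continuous_at)
        then have vel: "velocity A \<gamma> s = tvec_of A c (\<gamma> s) w"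
          using velocity_eq_tvec_of[OF c(1) nr(1)[OF s'(3)] _ w] by blast
        have "(F has_derivative (\<lambda>h. gr F (cmap c (\<gamma> s)) \<bullet> h)) (at ((cmap c \<circ> \<gamma>) s))"
          using grad_onD[OF gF] nr(1)[OF s'(3)] by simp
        from diff_chain_at[OF w[unfolded has_vector_derivative_def] this]
        have "(F \<circ> (cmap c \<circ> \<gamma>) has_real_derivative (gr F (cmap c (\<gamma> s)) \<bullet> w)) (at s)"
          unfolding has_field_derivative_def by (rule has_derivative_eq_rhs) (simp add: fun_eq_iff mult.commute)
        then have "(\<Phi> has_real_derivative (gr F (cmap c (\<gamma> s)) \<bullet> w)) (at s)"
          by (rule has_field_derivative_transform_within_open[OF _ open_greaterThanLessThan s'(2)]) (simp add: Phi)
        moreover have "gr F (cmap c (\<gamma> s)) \<bullet> w \<le> L (\<gamma> s) (velocity A \<gamma> s) + a"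
          using f(2)[OF tvec_of_in[OF c(1) nr(1)[OF s'(3)]], of w]
            differential_apply[OF f(1) c(1) nr(1)[OF s'(3)] tvec_of_in[OF c(1) nr(1)[OF s'(3)]], of w]
          by (simp add: vel F_def tvec_of_self[OF c(1) nr(1)[OF s'(3)]])
        ultimately show ?thesis by blast
      qed
      moreover have "negligible (N \<union> {u, v})" using N(1) by (intro negligible_Un) auto
      ultimately show "good u v" unfolding good_def by blast
    qed (rule d)
  qed
  then obtain N where N: "negligible N" "abs_continuous_on 0 t \<Phi>"
    "\<And>s. s \<in> {0..t} - N \<Longrightarrow> \<exists>D. (\<Phi> has_real_derivative D) (at s) \<and> D \<le> L (\<gamma> s) (velocity A \<gamma> s) + a"
    unfolding good_def by auto
  have "\<Phi> t - \<Phi> 0 \<le> integral {0..t} (\<lambda>s. L (\<gamma> s) (velocity A \<gamma> s) + a)"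
    by (rule abs_continuous_on_le_integral[OF N(2) \<open>t \<ge> 0\<close> N(1) N(3)]) (auto intro: integrable_add int)
  also have "\<dots> = integral {0..t} (\<lambda>s. L (\<gamma> s) (velocity A \<gamma> s)) + a * t"
    using \<open>t \<ge> 0\<close> by (subst integral_add[OF int]) auto
  finally show ?thesis by (simp add: \<Phi>_def)
qed

text \<open>A strict real bound on the minimal action: it always provides an actual curve, so
  neither the existence of minimizers nor extended reals enter the arguments.\<close>

definition reach :: "real \<Rightarrow> 'm \<Rightarrow> 'm \<Rightarrow> real \<Rightarrow> bool" where
  "reach t x y k \<longleftrightarrow> minimal_action A G t x y < ereal k"

lemma reachE:
  assumes "reach t x y k"
  obtains \<gamma> where "abs_continuous_curve A t \<gamma>" "\<gamma> 0 = x" "\<gamma> t = y"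
    "(\<lambda>s. L (\<gamma> s) (velocity A \<gamma> s)) absolutely_integrable_on {0..t}"
    "integral {0..t} (\<lambda>s. L (\<gamma> s) (velocity A \<gamma> s)) < k"
proof -
  obtain \<gamma> where \<gamma>: "abs_continuous_curve A t \<gamma>" "\<gamma> 0 = x" "\<gamma> t = y" "action A G t \<gamma> < ereal k"
    using assms unfolding reach_def minimal_action_def INF_less_iff by auto
  then show thesis using that[OF \<gamma>(1-3)] by (auto simp: action_def split: if_splits)
qed

lemma reachI:
  assumes "abs_continuous_curve A t \<gamma>" "\<gamma> 0 = x" "\<gamma> t = y"
    "(\<lambda>s. L (\<gamma> s) (velocity A \<gamma> s)) absolutely_integrable_on {0..t}"
    "integral {0..t} (\<lambda>s. L (\<gamma> s) (velocity A \<gamma> s)) < k"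
  shows "reach t x y k"
  unfolding reach_def minimal_action_def INF_less_iff using assms by (intro bexI[of _ \<gamma>]) (auto simp: action_def)

lemma reach_mono: "reach t x y k \<Longrightarrow> k \<le> l \<Longrightarrow> reach t x y l"
  unfolding reach_def by (meson ereal_less_eq(3) order_less_le_trans)

lemma C1_reach:
  assumes "f \<in> C1" "\<And>x. G x (differential A f x) \<le> a" "t \<ge> 0" "reach t x y k"
  shows "f y - f x < k + a * t"
proof -
  obtain \<gamma> where \<gamma>: "abs_continuous_curve A t \<gamma>" "\<gamma> 0 = x" "\<gamma> t = y"
    "(\<lambda>s. L (\<gamma> s) (velocity A \<gamma> s)) absolutely_integrable_on {0..t}"
    "integral {0..t} (\<lambda>s. L (\<gamma> s) (velocity A \<gamma> s)) < k"
    using reachE[OF assms(4)] by blast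
  have "f (\<gamma> t) - f (\<gamma> 0) \<le> integral {0..t} (\<lambda>s. L (\<gamma> s) (velocity A \<gamma> s)) + a * t"
    using assms G_le_iff[OF assms(1)] \<gamma>(1,4)
    by (intro C1_along_curve) (auto intro: set_lebesgue_integral_eq_integral(1))
  then show ?thesis using \<gamma> by simp
qed

lemma VS_reach:
  assumes w: "VS a w" and "t \<ge> 0" "reach t x y k"
  shows "w y - w x \<le> k + a * t"
proof (rule field_le_epsilon)
  fix e :: real assume "e > 0"
  \<comment> \<open>Two errors at the endpoints, plus the error in the level accumulated over the
    time t.\<close>
  define \<epsilon> where "\<epsilon> = e / (2 + t)"
  have \<epsilon>: "\<epsilon> > 0" "\<epsilon> * (2 + t) = e" using \<open>e > 0\<close> \<open>t \<ge> 0\<close> by (auto simp: \<epsilon>_def)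
  obtain f where f: "f \<in> C1" "\<And>x. \<bar>f x - w x\<bar> \<le> \<epsilon>" "\<And>x. G x (differential A f x) \<le> a + \<epsilon>"
    using smooth_approximation[OF w \<epsilon>(1)] by blast
  have "f y - f x < k + (a + \<epsilon>) * t" by (rule C1_reach[OF f(1,3) assms(2,3)])
  then show "w y - w x \<le> k + a * t + e"
    using f(2)[of x] f(2)[of y] \<epsilon>(2) by (simp add: algebra_simps)
qed

text \<open>Segments in charts, traversed with constant coordinate velocity, and their
  concatenations are the only curves that are ever constructed.\<close>

lemma reach_line:
  assumes c: "c \<in> A" and r: "r \<ge> 0" and seg: "\<And>s. s \<in> {0..r} \<Longrightarrow> z + s *\<^sub>R v \<in> cimage c"
    and \<kappa>: "\<And>s. s \<in> {0..r} \<Longrightarrow> Lc c (z + s *\<^sub>R v) v \<le> \<kappa>" and k: "r * \<kappa> < k"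
  shows "reach r (cinv c z) (cinv c (z + r *\<^sub>R v)) k"
proof -
  define \<gamma> where "\<gamma> s = cinv c (z + s *\<^sub>R v)" for s
  have cont: "isCont \<gamma> s" if "s \<in> {0..r}" for s
  proof -
    have "isCont (cinv c) (z + s *\<^sub>R v)"
      using cont_cinv[OF c] continuous_on_eq_continuous_at[OF open_cimage[OF c]] seg[OF that] by blast
    then show ?thesis unfolding \<gamma>_def
      by (intro isCont_o2[where f = "\<lambda>s. z + s *\<^sub>R v" and g = "cinv c"] continuous_intros) auto
  qed
  have dom: "\<gamma> s \<in> cdom c" "cmap c (\<gamma> s) = z + s *\<^sub>R v" if "s \<in> {0..r}" for s
    using seg[OF that] cinv_in[OF c] cmap_cinv[OF c] by (auto simp: \<gamma>_def)
  have line: "((\<lambda>s. z + s *\<^sub>R v) has_vector_derivative v) (at s)" for s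
    by (auto intro!: derivative_eq_intros simp: has_vector_derivative_def)
  have AC: "abs_continuous_curve A r \<gamma>"
    unfolding abs_continuous_curve_def
  proof (intro conjI ballI allI impI)
    show "continuous_on {0..r} \<gamma>" using cont by (simp add: continuous_at_imp_continuous_on)
    fix d p q assume d: "d \<in> A" and pq: "0 \<le> p" "p \<le> q" "q \<le> r" and im: "\<gamma> ` {p..q} \<subseteq> cdom d"
    let ?T = "cmap d \<circ> cinv c"
    have inS: "z + s *\<^sub>R v \<in> cmap c ` (cdom c \<inter> cdom d)" if "s \<in> {p..q}" for s
    proof -
      have "s \<in> {0..r}" using that pq by auto
      then show ?thesis using dom[of s] im that by (metis IntI imageI image_subset_iff)
    qed
    have T: "Ck_on 1 ?T (cmap c ` (cdom c \<inter> cdom d))" by (rule transition(1)[OF c d])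
    have cT: "continuous_on {p..q} (\<lambda>s. frechet_derivative ?T (at (z + s *\<^sub>R v)) v)"
    proof (rule continuous_on_compose2[where f = "\<lambda>s. z + s *\<^sub>R v" and g = "\<lambda>y. frechet_derivative ?T (at y) v"])
      show "continuous_on (cmap c ` (cdom c \<inter> cdom d)) (\<lambda>y. frechet_derivative ?T (at y) v)"
        using T by (simp add: One_nat_def)
      show "continuous_on {p..q} (\<lambda>s. z + s *\<^sub>R v)" by (intro continuous_intros)
      show "(\<lambda>s. z + s *\<^sub>R v) ` {p..q} \<subseteq> cmap c ` (cdom c \<inter> cdom d)" using inS by blast
    qed
    obtain B where B: "\<And>s. s \<in> {p..q} \<Longrightarrow> norm (frechet_derivative ?T (at (z + s *\<^sub>R v)) v) \<le> B"
      using compact_imp_bounded[OF compact_continuous_image[OF cT compact_Icc]] unfolding bounded_iff by blast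
    have der: "((\<lambda>s. ?T (z + s *\<^sub>R v)) has_derivative (\<lambda>h. h *\<^sub>R frechet_derivative ?T (at (z + s *\<^sub>R v)) v)) (at s within {p..q})"
      if "s \<in> {p..q}" for s
    proof -
      have "?T differentiable (at (z + s *\<^sub>R v))" using T inS[OF that] by (auto simp: One_nat_def)
      then have dT': "(?T has_derivative frechet_derivative ?T (at (z + s *\<^sub>R v))) (at (z + s *\<^sub>R v))"
        by (rule frechet_derivative_works[THEN iffD1])
      show ?thesis
        by (rule has_derivative_at_withinI, rule has_derivative_eq_rhs[OF has_derivative_compose[OF line[unfolded has_vector_derivative_def] dT']])
          (intro ext linear_scale[OF has_derivative_linear[OF dT']])
    qed
    have lip: "norm (?T (z + s *\<^sub>R v) - ?T (z + s' *\<^sub>R v)) \<le> B * norm (s - s')" if "s \<in> {p..q}" "s' \<in> {p..q}" for s s'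
    proof (rule differentiable_bound[of "{p..q}", OF convex_real_interval(5) der])
      fix x assume x: "x \<in> {p..q}"
      show "onorm (\<lambda>h. h *\<^sub>R frechet_derivative ?T (at (z + x *\<^sub>R v)) v) \<le> B"
        using mult_left_mono[OF B[OF x] abs_ge_zero] by (intro onorm_le) (simp add: mult.commute)
    qed (use that in auto)
    have "abs_continuous_on p q (\<lambda>s. ?T (z + s *\<^sub>R v))"
      using lip by (intro abs_continuous_on_lipschitz_compose[OF abs_continuous_on_ident, where C = B]) (auto simp: dist_norm)
    then show "abs_continuous_on p q (cmap d \<circ> \<gamma>)" by (simp add: \<gamma>_def o_def)
  qed
  have vel: "L (\<gamma> s) (velocity A \<gamma> s) = Lc c (z + s *\<^sub>R v) v" if s: "s \<in> {0..r}" for s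
  proof -
    have "(cmap c \<circ> \<gamma> has_vector_derivative v) (at s)"
    proof (rule has_vector_derivative_transform_within_open[OF line])
      show "open ((\<lambda>s. z + s *\<^sub>R v) -` cimage c)"
        by (intro open_vimage open_cimage[OF c] continuous_intros)
      show "s \<in> (\<lambda>s. z + s *\<^sub>R v) -` cimage c" using seg[OF s] by simp
      show "z + u *\<^sub>R v = (cmap c \<circ> \<gamma>) u" if "u \<in> (\<lambda>s. z + s *\<^sub>R v) -` cimage c" for u
        using that cmap_cinv[OF c] by (simp add: \<gamma>_def)
    qed
    then have "velocity A \<gamma> s = tvec_of A c (\<gamma> s) v"
      using velocity_eq_tvec_of[OF c dom(1)[OF s] cont[OF s]] by blast
    then show ?thesis by (simp add: Lc_def \<gamma>_def)
  qed
  have cL: "continuous_on {0..r} (\<lambda>s. Lc c (z + s *\<^sub>R v) v)"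
    using seg by (intro Lc_continuous_compose[OF c] continuous_intros) auto
  have "(\<lambda>s. Lc c (z + s *\<^sub>R v) v) absolutely_integrable_on {0..r}"
    using absolutely_integrable_continuous_real[OF cL] .
  then have ai: "(\<lambda>s. L (\<gamma> s) (velocity A \<gamma> s)) absolutely_integrable_on {0..r}"
    by (rule absolutely_integrable_spike[OF _ negligible_empty]) (simp add: vel)
  have "integral {0..r} (\<lambda>s. L (\<gamma> s) (velocity A \<gamma> s)) = integral {0..r} (\<lambda>s. Lc c (z + s *\<^sub>R v) v)"
    by (rule integral_cong) (simp add: vel)
  also have "\<dots> \<le> integral {0..r} (\<lambda>s. \<kappa>)"
    by (rule integral_le) (use \<kappa> integrable_continuous_real[OF cL] in auto)
  also have "\<dots> = r * \<kappa>" using r by simp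
  finally have le: "integral {0..r} (\<lambda>s. L (\<gamma> s) (velocity A \<gamma> s)) \<le> r * \<kappa>" .
  have ends: "\<gamma> 0 = cinv c z" "\<gamma> r = cinv c (z + r *\<^sub>R v)" by (simp_all add: \<gamma>_def)
  show ?thesis
    using le k ends by (intro reachI[OF AC _ _ ai]) linarith+
qed

lemma reach_trans:
  assumes "reach s x y k" "reach t y z l" and st: "s \<ge> 0" "t \<ge> 0"
  shows "reach (s + t) x z (k + l)"
proof -
  obtain \<alpha> where \<alpha>: "abs_continuous_curve A s \<alpha>" "\<alpha> 0 = x" "\<alpha> s = y"
    "(\<lambda>u. L (\<alpha> u) (velocity A \<alpha> u)) absolutely_integrable_on {0..s}"
    "integral {0..s} (\<lambda>u. L (\<alpha> u) (velocity A \<alpha> u)) < k"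
    using reachE[OF assms(1)] by blast
  obtain \<beta> where \<beta>: "abs_continuous_curve A t \<beta>" "\<beta> 0 = y" "\<beta> t = z"
    "(\<lambda>u. L (\<beta> u) (velocity A \<beta> u)) absolutely_integrable_on {0..t}"
    "integral {0..t} (\<lambda>u. L (\<beta> u) (velocity A \<beta> u)) < l"
    using reachE[OF assms(2)] by blast
  define \<gamma> where "\<gamma> u = (if u \<le> s then \<alpha> u else \<beta> (u - s))" for u
  have \<gamma>1: "\<gamma> u = \<alpha> u" if "u \<le> s" for u using that by (simp add: \<gamma>_def)
  have \<gamma>2: "\<gamma> u = \<beta> (u - s)" if "u \<ge> s" for u using that \<alpha>(3) \<beta>(2) by (cases "u = s") (auto simp: \<gamma>_def)
  have AC: "abs_continuous_curve A (s + t) \<gamma>"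
    unfolding abs_continuous_curve_def
  proof (intro conjI ballI allI impI)
    have "continuous_on {0..s} \<gamma>"
      using \<alpha>(1) unfolding abs_continuous_curve_def by (elim conjE) (erule continuous_on_eq, simp add: \<gamma>1)
    moreover have "continuous_on {s..s + t} \<gamma>"
    proof -
      have "continuous_on {s..s + t} (\<lambda>u. \<beta> (u - s))"
      proof (rule continuous_on_compose2[where f = "\<lambda>u. u - s" and g = \<beta>])
        show "continuous_on {0..t} \<beta>" using \<beta>(1) by (simp add: abs_continuous_curve_def)
        show "continuous_on {s..s + t} (\<lambda>u. u - s)" by (intro continuous_intros)
      qed auto
      then show ?thesis by (rule continuous_on_eq) (simp add: \<gamma>2)
    qed
    moreover have "{0..s + t} = {0..s} \<union> {s..s + t}" using st by auto
    ultimately show "continuous_on {0..s + t} \<gamma>" by (simp add: continuous_on_closed_Un)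
  next
    fix d a b assume d: "d \<in> A" and ab: "0 \<le> a" "a \<le> b" "b \<le> s + t" and im: "\<gamma> ` {a..b} \<subseteq> cdom d"
    have left: "abs_continuous_on a' b' (cmap d \<circ> \<gamma>)" if "a \<le> a'" "a' \<le> b'" "b' \<le> b" "b' \<le> s" for a' b'
    proof -
      have "\<alpha> ` {a'..b'} \<subseteq> cdom d"
      proof
        fix y assume "y \<in> \<alpha> ` {a'..b'}"
        then obtain u where u: "u \<in> {a'..b'}" "y = \<alpha> u" by blast
        then have "u \<in> {a..b}" "y = \<gamma> u" using that \<gamma>1[of u] by auto
        then show "y \<in> cdom d" using im by blast
      qed
      then have "abs_continuous_on a' b' (cmap d \<circ> \<alpha>)"
        using \<alpha>(1) d that ab unfolding abs_continuous_curve_def by auto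
      then show ?thesis by (rule abs_continuous_on_cong) (use that \<gamma>1 in auto)
    qed
    have right: "abs_continuous_on a' b' (cmap d \<circ> \<gamma>)" if "a \<le> a'" "a' \<le> b'" "b' \<le> b" "s \<le> a'" for a' b'
    proof -
      have "\<beta> u \<in> cdom d" if "u \<in> {a' - s..b' - s}" for u
      proof -
        have "u + s \<in> {a..b}" "\<gamma> (u + s) = \<beta> u"
          using \<gamma>2[of "u + s"] that \<open>a \<le> a'\<close> \<open>b' \<le> b\<close> \<open>s \<le> a'\<close> by auto
        then show ?thesis using im by (metis imageI subsetD)
      qed
      then have "\<beta> ` {a' - s..b' - s} \<subseteq> cdom d" by blast
      moreover have "0 \<le> a' - s" "a' - s \<le> b' - s" "b' - s \<le> t" using that ab by auto
      ultimately have "abs_continuous_on (a' - s) (b' - s) (cmap d \<circ> \<beta>)"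
        using \<beta>(1) d unfolding abs_continuous_curve_def by blast
      from abs_continuous_on_shift[OF this, of s]
      have "abs_continuous_on a' b' (\<lambda>u. (cmap d \<circ> \<beta>) (u - s))" by simp
      then show ?thesis by (rule abs_continuous_on_cong) (use that \<gamma>2 in auto)
    qed
    show "abs_continuous_on a b (cmap d \<circ> \<gamma>)"
    proof (cases "b \<le> s \<or> s \<le> a")
      case True
      then show ?thesis using left[of a b] right[of a b] ab by auto
    next
      case False
      then show ?thesis
        using abs_continuous_on_join[OF left[of a s] right[of s b]] ab by auto
    qed
  qed
  have v1: "velocity A \<gamma> u = velocity A \<alpha> u" if "u \<in> {0<..<s}" for u
  proof -
    have "(cmap d \<circ> \<gamma> has_vector_derivative w) (at u) \<longleftrightarrow> (cmap d \<circ> \<alpha> has_vector_derivative w) (at u)" for d :: "('m, 'e) chart" and w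
      using that \<gamma>1 by (intro iffI; elim has_vector_derivative_transform_within_open[where S = "{0<..<s}"]) auto
    then have "vector_derivative (cmap d \<circ> \<gamma>) (at u) = vector_derivative (cmap d \<circ> \<alpha>) (at u)" for d :: "('m, 'e) chart"
      unfolding vector_derivative_def by simp
    then show ?thesis using that \<gamma>1[of u] by (auto simp: velocity_def fun_eq_iff)
  qed
  have v2: "velocity A \<gamma> u = velocity A \<beta> (u - s)" if "u \<in> {s<..<s + t}" for u
  proof -
    have "(cmap d \<circ> \<gamma> has_vector_derivative w) (at u) \<longleftrightarrow> (cmap d \<circ> \<beta> has_vector_derivative w) (at (u - s))" for d :: "('m, 'e) chart" and w
    proof
      assume 1: "(cmap d \<circ> \<gamma> has_vector_derivative w) (at u)"
      have 2: "((\<lambda>x. x + s) has_vector_derivative 1) (at (u - s))"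
        by (auto intro!: derivative_eq_intros)
      have "((cmap d \<circ> \<gamma>) \<circ> (\<lambda>x. x + s) has_vector_derivative 1 *\<^sub>R w) (at (u - s))"
        by (rule vector_diff_chain_at[OF 2]) (use 1 in simp)
      then have "((cmap d \<circ> \<gamma>) \<circ> (\<lambda>x. x + s) has_vector_derivative w) (at (u - s))" by simp
      then show "(cmap d \<circ> \<beta> has_vector_derivative w) (at (u - s))"
        by (rule has_vector_derivative_transform_within_open[where S = "{0<..<t}"]) (use that \<gamma>2 in auto)
    next
      assume 1: "(cmap d \<circ> \<beta> has_vector_derivative w) (at (u - s))"
      have 2: "((\<lambda>x. x - s) has_vector_derivative 1) (at u)"
        by (auto intro!: derivative_eq_intros)
      have "((cmap d \<circ> \<beta>) \<circ> (\<lambda>x. x - s) has_vector_derivative 1 *\<^sub>R w) (at u)"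
        by (rule vector_diff_chain_at[OF 2 1])
      then have "((cmap d \<circ> \<beta>) \<circ> (\<lambda>x. x - s) has_vector_derivative w) (at u)" by simp
      then show "(cmap d \<circ> \<gamma> has_vector_derivative w) (at u)"
        by (rule has_vector_derivative_transform_within_open[where S = "{s<..<s + t}"]) (use that \<gamma>2 in auto)
    qed
    then have "vector_derivative (cmap d \<circ> \<gamma>) (at u) = vector_derivative (cmap d \<circ> \<beta>) (at (u - s))" for d :: "('m, 'e) chart"
      unfolding vector_derivative_def by simp
    then show ?thesis using that \<gamma>2[of u] by (auto simp: velocity_def fun_eq_iff)
  qed
  let ?f = "\<lambda>u. L (\<gamma> u) (velocity A \<gamma> u)"
  \<comment> \<open>Stated for a functional H that acts pointwise, because absolute integrability
    asks for the integral of the Lagrangian and also of its absolute value. Velocities at the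
    junction are excluded as a null set.\<close>
  have comb: "(H (\<lambda>u. ?f u) has_integral I + J) {0..s + t}"
    if "(H (\<lambda>u. L (\<alpha> u) (velocity A \<alpha> u)) has_integral I) {0..s}"
      "(H (\<lambda>u. L (\<beta> u) (velocity A \<beta> u)) has_integral J) {0..t}"
      "\<And>f. H f = (\<lambda>u. h (f u))" for H :: "(real \<Rightarrow> real) \<Rightarrow> real \<Rightarrow> real" and h and I J
  proof (rule has_integral_combine[of 0 s "s + t"])
    show "(H (\<lambda>u. ?f u) has_integral I) {0..s}"
      by (rule has_integral_spike[OF _ _ that(1), of "{0, s}"]) (use v1 \<gamma>1 that(3) in auto)
    have "((\<lambda>x. H (\<lambda>u. L (\<beta> u) (velocity A \<beta> u)) (x + (- s))) has_integral J) {0 - (- s)..t - (- s)}"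
      by (rule has_integral_shift_real_ivl[OF that(2)])
    then have "((\<lambda>x. H (\<lambda>u. L (\<beta> u) (velocity A \<beta> u)) (x - s)) has_integral J) {s..s + t}"
      by (simp add: add.commute)
    then show "(H (\<lambda>u. ?f u) has_integral J) {s..s + t}"
      by (rule has_integral_spike[rotated 2, where S = "{s, s + t}"]) (use v2 \<gamma>2 that(3) in auto)
  qed (use st in auto)
  have i1: "(\<lambda>u. L (\<alpha> u) (velocity A \<alpha> u)) integrable_on {0..s}" "(\<lambda>u. \<bar>L (\<alpha> u) (velocity A \<alpha> u)\<bar>) integrable_on {0..s}"
    and i2: "(\<lambda>u. L (\<beta> u) (velocity A \<beta> u)) integrable_on {0..t}" "(\<lambda>u. \<bar>L (\<beta> u) (velocity A \<beta> u)\<bar>) integrable_on {0..t}"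
    using \<alpha>(4) \<beta>(4) by (auto simp: absolutely_integrable_on_def)
  have hi: "(?f has_integral integral {0..s} (\<lambda>u. L (\<alpha> u) (velocity A \<alpha> u)) + integral {0..t} (\<lambda>u. L (\<beta> u) (velocity A \<beta> u))) {0..s + t}"
    using comb[of "\<lambda>f. f" _ _ "\<lambda>x. x"] i1(1) i2(1) by (simp add: has_integral_integral)
  have "(\<lambda>u. \<bar>?f u\<bar>) integrable_on {0..s + t}"
    using comb[of "\<lambda>f u. \<bar>f u\<bar>" _ _ abs] i1(2) i2(2) unfolding integrable_on_def by blast
  then have ai: "?f absolutely_integrable_on {0..s + t}"
    using hi by (auto simp: absolutely_integrable_on_def integrable_on_def)
  show ?thesis
  proof (rule reachI[OF AC _ _ ai])
    show "\<gamma> 0 = x" using \<gamma>1[of 0] st \<alpha> by simp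
    show "\<gamma> (s + t) = z" using \<gamma>2[of "s + t"] st \<beta> by simp
    show "integral {0..s + t} ?f < k + l" using integral_unique[OF hi] \<alpha>(5) \<beta>(5) by simp
  qed
qed

end

context hamiltonian
begin

subsection \<open>Short curves\<close>

text \<open>The segment arrives at z with velocity v, as \<open>VSb_if_increments\<close> requires;
  over a short time L along it changes by less than \<eta>.\<close>

lemma reach_line_eventually:
  assumes c: "c \<in> A" "z \<in> cimage c" and "\<eta> > 0"
  shows "\<forall>\<^sub>F r in at_right 0. z - r *\<^sub>R v \<in> cimage c \<and> reach r (cinv c (z - r *\<^sub>R v)) (cinv c z) (r * (Lc c z v + \<eta>))"
proof -
  obtain s where s: "s > 0" "cball z s \<subseteq> cimage c" using open_cimage[OF c(1)] c(2) by (meson open_contains_cball)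
  obtain \<delta> where \<delta>: "\<delta> > 0" "\<And>y y' (v' :: 'e) v''. y \<in> cball z s \<Longrightarrow> y' \<in> cball z s \<Longrightarrow> norm v' \<le> norm v \<Longrightarrow> norm v'' \<le> norm v
    \<Longrightarrow> dist y y' < \<delta> \<Longrightarrow> dist v' v'' < \<delta> \<Longrightarrow> Lc c y v' \<le> Lc c y' v'' + \<eta> / 2"
    using Lc_uniform[OF c(1) compact_cball s(2) half_gt_zero[OF \<open>\<eta> > 0\<close>]] by blast
  define m where "m = min s \<delta> / (norm v + 1)"
  have "m > 0" using s \<delta> by (simp add: m_def add_nonneg_pos)
  then have "\<forall>\<^sub>F r in at_right 0. r < m" by (intro eventually_at_rightI[of 0 m]) auto
  then show ?thesis using eventually_at_right_less[of 0]
  proof eventually_elim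
    case (elim r)
    have "r * (norm v + 1) < min s \<delta>"
      using elim by (simp add: m_def pos_less_divide_eq add_nonneg_pos del: min_less_iff_conj)
    moreover have "r * norm v \<le> r * (norm v + 1)" using elim by (intro mult_left_mono) auto
    ultimately have rv: "r * norm v < s" "r * norm v < \<delta>" by auto
    have seg: "z - r *\<^sub>R v + t *\<^sub>R v \<in> cball z s" "dist (z - r *\<^sub>R v + t *\<^sub>R v) z < \<delta>" if "t \<in> {0..r}" for t
    proof -
      have "z - r *\<^sub>R v + t *\<^sub>R v - z = - ((r - t) *\<^sub>R v)" by (simp add: algebra_simps)
      then have "dist (z - r *\<^sub>R v + t *\<^sub>R v) z = (r - t) * norm v"
        unfolding dist_norm using that by (metis abs_of_nonneg atLeastAtMost_iff diff_ge_0_iff_ge norm_minus_cancel norm_scaleR)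
      also have "\<dots> \<le> r * norm v" using that by (intro mult_right_mono) auto
      finally show "z - r *\<^sub>R v + t *\<^sub>R v \<in> cball z s" "dist (z - r *\<^sub>R v + t *\<^sub>R v) z < \<delta>"
        using rv by (auto simp: dist_commute)
    qed
    have "reach r (cinv c (z - r *\<^sub>R v)) (cinv c (z - r *\<^sub>R v + r *\<^sub>R v)) (r * (Lc c z v + \<eta>))"
    proof (rule reach_line[OF c(1)])
      show "z - r *\<^sub>R v + t *\<^sub>R v \<in> cimage c" if "t \<in> {0..r}" for t using seg(1)[OF that] s(2) by blast
      show "Lc c (z - r *\<^sub>R v + t *\<^sub>R v) v \<le> Lc c z v + \<eta> / 2" if "t \<in> {0..r}" for t
        using seg[OF that] \<delta>(1) s(1) by (intro \<delta>(2)) auto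
      show "r * (Lc c z v + \<eta> / 2) < r * (Lc c z v + \<eta>)" using elim \<open>\<eta> > 0\<close> by simp
    qed (use elim in simp)
    moreover have "z - r *\<^sub>R v \<in> cimage c" using seg(1)[of 0] elim s(2) by auto
    ultimately show ?case by simp
  qed
qed

lemma reach_rest:
  obtains k0 where "\<And>r. r > 0 \<Longrightarrow> reach r x x (r * k0)"
proof -
  obtain c where c: "c \<in> A" "x \<in> cdom c" using chart_ex by blast
  let ?z = "cmap c x"
  have "reach r x x (r * (Lc c ?z 0 + 1))" if "r > 0" for r
    using reach_line[OF c(1), of r ?z 0 "Lc c ?z 0" "r * (Lc c ?z 0 + 1)"] that c cinv_cmap[OF c] by simp
  then show thesis using that by blast
qed

lemma reach_local:
  obtains c \<rho> C where "c \<in> A" "x \<in> cdom c" "\<rho> > 0" "cball (cmap c x) \<rho> \<subseteq> cimage c" "C > 0"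
    "\<And>y z. y \<in> ball (cmap c x) \<rho> \<Longrightarrow> z \<in> ball (cmap c x) \<rho> \<Longrightarrow> y \<noteq> z
      \<Longrightarrow> reach (dist y z) (cinv c y) (cinv c z) (C * dist y z)"
proof -
  obtain c \<rho> where c: "c \<in> A" "x \<in> cdom c" "\<rho> > 0" "cball (cmap c x) \<rho> \<subseteq> cimage c"
    using chart_ball_ex by blast
  obtain B where B: "\<And>z (v :: 'e). z \<in> cball (cmap c x) \<rho> \<Longrightarrow> norm v \<le> 1 \<Longrightarrow> Lc c z v \<le> B"
    using Lc_upper_bound[OF c(1) compact_cball c(4)] by blast
  define C where "C = \<bar>B\<bar> + 1"
  show thesis
  proof (rule that[OF c])
    show "C > 0" by (simp add: C_def)
    fix y z assume yz: "y \<in> ball (cmap c x) \<rho>" "z \<in> ball (cmap c x) \<rho>" "y \<noteq> z"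
    define r where "r = dist y z"
    define v where "v = (1 / r) *\<^sub>R (z - y)"
    have r: "r > 0" using yz by (simp add: r_def)
    have v: "norm v = 1" "y + r *\<^sub>R v = z" using r by (auto simp: v_def r_def dist_norm norm_minus_commute)
    have seg: "y + t *\<^sub>R v \<in> ball (cmap c x) \<rho>" if "t \<in> {0..r}" for t
    proof -
      have "y + t *\<^sub>R v = (1 - t / r) *\<^sub>R y + (t / r) *\<^sub>R z" using r by (simp add: v_def algebra_simps)
      moreover have "0 \<le> t / r" "t / r \<le> 1" using that r by auto
      ultimately show ?thesis
        using convexD_alt[OF convex_ball yz(1,2), of "t / r"] by simp
    qed
    have "reach r (cinv c y) (cinv c (y + r *\<^sub>R v)) (C * r)"
    proof (rule reach_line[OF c(1)])
      show "y + t *\<^sub>R v \<in> cimage c" if "t \<in> {0..r}" for t using seg[OF that] c(4) by auto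
      show "Lc c (y + t *\<^sub>R v) v \<le> B" if "t \<in> {0..r}" for t using seg[OF that] v by (intro B) auto
      show "r * B < C * r" using r by (simp add: C_def)
    qed (use r in simp)
    then show "reach (dist y z) (cinv c y) (cinv c z) (C * dist y z)" by (simp only: v(2) r_def[symmetric])
  qed
qed

text \<open>The reachable set is open and closed. Reachability is not symmetric at finite cost by
  definition, so curves to and from the nearby points are both provided.\<close>

lemma reach_connected: "\<exists>r>0. \<exists>k. reach r x y k"
proof -
  define R where "R = {y. \<exists>r>0. \<exists>k. reach r x y k}"
  have loc: "\<exists>U. open U \<and> y \<in> U \<and> (\<forall>y'\<in>U. (\<exists>r>0. \<exists>k. reach r y y' k) \<and> (\<exists>r>0. \<exists>k. reach r y' y k))" for y
  proof -
    obtain c \<rho> C where c: "c \<in> A" "y \<in> cdom c" "\<rho> > 0" "cball (cmap c y) \<rho> \<subseteq> cimage c" "C > 0"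
      "\<And>p q. p \<in> ball (cmap c y) \<rho> \<Longrightarrow> q \<in> ball (cmap c y) \<rho> \<Longrightarrow> p \<noteq> q
        \<Longrightarrow> reach (dist p q) (cinv c p) (cinv c q) (C * dist p q)"
      using reach_local by blast
    have y: "cinv c (cmap c y) = y" by (rule cinv_cmap[OF c(1,2)])
    define U where "U = cinv c ` ball (cmap c y) \<rho>"
    have "open U" unfolding U_def using c(4) by (intro open_cinv_image[OF c(1)]) auto
    moreover have "y \<in> U" unfolding U_def using y c(3) by (metis centre_in_ball image_eqI)
    moreover have "(\<exists>r>0. \<exists>k. reach r y y' k) \<and> (\<exists>r>0. \<exists>k. reach r y' y k)" if y': "y' \<in> U" for y'
    proof -
      obtain p where p: "p \<in> ball (cmap c y) \<rho>" "y' = cinv c p" using y' unfolding U_def by blast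
      show ?thesis
      proof (cases "p = cmap c y")
        case True
        obtain k0 where "\<And>r. r > 0 \<Longrightarrow> reach r y y (r * k0)" using reach_rest by blast
        then show ?thesis using True p(2) y zero_less_one by metis
      next
        case False
        then show ?thesis
          using c(6)[of p "cmap c y"] c(6)[of "cmap c y" p] p c(3) y by (metis centre_in_ball zero_less_dist_iff)
      qed
    qed
    ultimately show ?thesis by blast
  qed
  have tr: "\<exists>r>0. \<exists>k. reach r p q k" if "\<exists>r>0. \<exists>k. reach r p m k" and "\<exists>r>0. \<exists>k. reach r m q k" for p m q
    using that reach_trans[of _ p m _ _ q] by (meson add_pos_pos less_imp_le)
  have "open R"
  proof (rule Topological_Spaces.openI)
    fix y assume y: "y \<in> R"
    obtain U where U: "open U" "y \<in> U" "\<And>y'. y' \<in> U \<Longrightarrow> \<exists>r>0. \<exists>k. reach r y y' k" using loc[of y] by meson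
    have "U \<subseteq> R" using tr[OF y[unfolded R_def mem_Collect_eq] U(3)] by (auto simp: R_def)
    then show "\<exists>T. open T \<and> y \<in> T \<and> T \<subseteq> R" using U by meson
  qed
  moreover have "open (- R)"
  proof (rule Topological_Spaces.openI)
    fix y assume y: "y \<in> - R"
    obtain U where U: "open U" "y \<in> U" "\<And>y'. y' \<in> U \<Longrightarrow> \<exists>r>0. \<exists>k. reach r y' y k" using loc[of y] by meson
    have "U \<subseteq> - R"
    proof
      fix y' assume "y' \<in> U"
      from tr[OF _ U(3)[OF this], of x] y show "y' \<in> - R" by (auto simp: R_def)
    qed
    then show "\<exists>T. open T \<and> y \<in> T \<and> T \<subseteq> - R" using U by meson
  qed
  moreover have "x \<in> R" unfolding R_def using reach_rest zero_less_one by (metis mem_Collect_eq)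
  ultimately have "- R = {}"
    using connectedD[OF connected_M, of R "- R"] by auto
  then show ?thesis unfolding R_def by blast
qed

text \<open>Short segments in a chart cost at most a multiple of their length in either direction,
  so the bound makes u locally Lipschitz in coordinates.\<close>

lemma continuous_if_reach_bound:
  fixes u :: "'m \<Rightarrow> real"
  assumes "r0 > 0" "B \<ge> 0" and bound: "\<And>r x y k. 0 < r \<Longrightarrow> r \<le> r0 \<Longrightarrow> reach r x y k \<Longrightarrow> u y - u x \<le> B * (\<bar>k\<bar> + r)"
  shows "continuous_on UNIV u"
proof (rule continuous_at_imp_continuous_on, rule ballI)
  fix x
  obtain c \<rho> C where c: "c \<in> A" "x \<in> cdom c" "\<rho> > 0" "cball (cmap c x) \<rho> \<subseteq> cimage c" "C > 0"
    "\<And>p q. p \<in> ball (cmap c x) \<rho> \<Longrightarrow> q \<in> ball (cmap c x) \<rho> \<Longrightarrow> p \<noteq> q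
      \<Longrightarrow> reach (dist p q) (cinv c p) (cinv c q) (C * dist p q)"
    using reach_local by blast
  define \<rho>' where "\<rho>' = min \<rho> (r0 / 2)"
  have \<rho>': "\<rho>' > 0" "\<rho>' \<le> \<rho>" "\<rho>' \<le> r0 / 2" using c \<open>r0 > 0\<close> by (auto simp: \<rho>'_def)
  let ?B = "ball (cmap c x) \<rho>'"
  have Bsub: "?B \<subseteq> cimage c" using c(4) \<rho>' by auto
  have lip: "u (cinv c q) - u (cinv c p) \<le> B * (C + 1) * dist p q" if "p \<in> ?B" "q \<in> ?B" for p q
  proof (cases "p = q")
    case False
    have "dist p q < r0" using that \<rho>' dist_triangle[of p q "cmap c x"] by (simp add: dist_commute)
    then have "u (cinv c q) - u (cinv c p) \<le> B * (\<bar>C * dist p q\<bar> + dist p q)"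
      using that \<rho>' False by (intro bound c(6)) auto
    then show ?thesis using c(5) by (simp add: abs_mult algebra_simps)
  qed simp
  have "(B * (C + 1))-lipschitz_on ?B (\<lambda>p. u (cinv c p))"
  proof (rule lipschitz_onI)
    fix p q assume pq: "p \<in> ?B" "q \<in> ?B"
    show "dist (u (cinv c p)) (u (cinv c q)) \<le> B * (C + 1) * dist p q"
      using lip[OF pq] lip[OF pq(2,1)] by (simp add: dist_real_def abs_le_iff dist_commute[of q p])
  qed (use \<open>B \<ge> 0\<close> c(5) in auto)
  then have cu: "continuous_on ?B (\<lambda>p. u (cinv c p))" by (rule lipschitz_on_continuous_on)
  define U where "U = cinv c ` ?B"
  have oU: "open U" unfolding U_def by (intro open_cinv_image[OF c(1)] open_ball Bsub)
  have U: "y \<in> cdom c" "cmap c y \<in> ?B" if "y \<in> U" for y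
  proof -
    obtain p where p: "p \<in> ?B" "y = cinv c p" using \<open>y \<in> U\<close> unfolding U_def by blast
    then show "y \<in> cdom c" "cmap c y \<in> ?B" using Bsub cinv_in[OF c(1)] cmap_cinv[OF c(1)] by (metis subsetD)+
  qed
  have "continuous_on U (\<lambda>y. u (cinv c (cmap c y)))"
  proof (rule continuous_on_compose2[OF cu])
    show "continuous_on U (cmap c)" using U(1) by (intro continuous_on_subset[OF cont_cmap[OF c(1)]]) auto
  qed (use U(2) in blast)
  then have "continuous_on U u"
    by (rule continuous_on_eq) (simp add: cinv_cmap[OF c(1)] U)
  moreover have "x \<in> U" unfolding U_def using cinv_cmap[OF c(1,2)] \<rho>'(1) by (metis centre_in_ball image_eqI)
  ultimately show "isCont u x" using oU by (simp add: continuous_on_eq_continuous_at)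
qed

subsection \<open>The critical value\<close>

abbreviation "cG \<equiv> critical_value A G"

lemma critical_C1:
  assumes "\<epsilon> > 0" obtains f where "f \<in> C1" "\<And>x. G x (differential A f x) \<le> cG + \<epsilon>"
proof -
  have "C1 \<noteq> {}" using C1_const by blast
  then obtain f where f: "f \<in> C1" "(SUP x. G x (differential A f x)) < cG + \<epsilon>"
    using cInf_lessD[of "(\<lambda>f. SUP x. G x (differential A f x)) ` C1" "cG + \<epsilon>"] \<open>\<epsilon> > 0\<close>
    by (auto simp: critical_value_def)
  have "bdd_above (range (\<lambda>x. G x (differential A f x)))"
    using continuous_bounded[OF G_differential_continuous[OF f(1)]] by (metis abs_le_D1 bdd_aboveI2)
  then have "G x (differential A f x) \<le> cG + \<epsilon>" for x
    using cSUP_upper[of x UNIV "\<lambda>x. G x (differential A f x)"] f(2) by simp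
  then show thesis using that f(1) by blast
qed

lemma critical_le:
  assumes "f \<in> C1" "\<And>x. G x (differential A f x) \<le> a" shows "cG \<le> a"
proof -
  have "bdd_below ((\<lambda>f. SUP x. G x (differential A f x)) ` C1)"
  proof (rule bdd_belowI2)
    fix h assume h: "h \<in> C1"
    \<comment> \<open>Any point will do: testing the zero velocity there bounds all competitors of
      the infimum from below by the same number.\<close>
    define x0 :: 'm where "x0 = undefined"
    have "tvec_of A (chart_at A x0) x0 0 \<in> tangent_space A x0" (is "?v \<in> _") by (rule tvec_of_in[OF chart_at])
    then have "differential A h x0 ?v \<le> L x0 ?v + G x0 (differential A h x0)" by (rule differential_le_L[OF h])
    moreover have "differential A h x0 ?v = 0"
      by (simp add: differential_eq_covec_of[OF h chart_at] covec_of_apply[OF chart_at])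
    moreover have "bdd_above (range (\<lambda>x. G x (differential A h x)))"
      using continuous_bounded[OF G_differential_continuous[OF h]] by (metis abs_le_D1 bdd_aboveI2)
    then have "G x0 (differential A h x0) \<le> (SUP x. G x (differential A h x))" by (intro cSUP_upper) auto
    ultimately show "- L x0 ?v \<le> (SUP x. G x (differential A h x))" by linarith
  qed
  then have "cG \<le> (SUP x. G x (differential A f x))"
    unfolding critical_value_def by (rule cINF_lower[OF _ assms(1)])
  also have "\<dots> \<le> a" using assms(2) by (intro cSUP_least) auto
  finally show ?thesis .
qed

text \<open>Almost critical functions are tested with velocity zero. The sign is what makes the
  coefficient of the action positive in the separation argument.\<close>

lemma Lc_zero_ge:
  assumes c: "c \<in> A" "z \<in> cimage c" shows "Lc c z 0 + cG \<ge> 0"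
proof (rule field_le_epsilon)
  fix e :: real assume "e > 0"
  obtain f where f: "f \<in> C1" "\<And>x. G x (differential A f x) \<le> cG + e" using critical_C1[OF \<open>e > 0\<close>] by blast
  have "differential A f (cinv c z) (tvec_of A c (cinv c z) 0) \<le> L (cinv c z) (tvec_of A c (cinv c z) 0) + (cG + e)"
    using f G_le_iff[OF f(1)] tvec_of_in[OF c(1) cinv_in[OF c]] by blast
  then show "0 \<le> Lc c z 0 + cG + e"
    by (simp add: differential_eq_covec_of[OF f(1) c(1) cinv_in[OF c]] covec_of_apply[OF c(1) cinv_in[OF c]] Lc_def)
qed

subsection \<open>Subsolutions with a margin\<close>

definition VSb :: "('m \<Rightarrow> real) \<Rightarrow> real \<Rightarrow> ('m \<Rightarrow> real) \<Rightarrow> bool" where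
  "VSb b a u \<longleftrightarrow> continuous_on UNIV u \<and>
     (\<forall>f\<in>C1. \<forall>x. (\<forall>\<^sub>F y in nhds x. u y - f y \<le> u x - f x) \<longrightarrow> G x (differential A f x) + b x \<le> a)"

lemma VSb_zero: "VSb (\<lambda>_. 0) a u \<longleftrightarrow> VS a u"
  by (simp add: VSb_def VS_def)

text \<open>A margin b is absorbed into the Hamiltonian G + b, which satisfies the same hypotheses;
  the approximation theorem thus covers subsolutions with a margin.\<close>

lemma hamiltonian_add:
  assumes b: "continuous_on UNIV b"
  shows "hamiltonian A g (\<lambda>x p. G x p + b x)"
proof (unfold_locales)
  have "openin (cotangent_bundle A) {p \<in> topspace (cotangent_bundle A). fst p \<in> U}" if "open U" for U
    unfolding openin_cotangent_bundle[OF atlas]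
  proof (intro conjI ballI)
    fix c assume c: "c \<in> A"
    have "{(z, w). z \<in> cimage c \<and> (cinv c z, covec_of A c (cinv c z) w) \<in> {p \<in> topspace (cotangent_bundle A). fst p \<in> U}}
        = (cimage c \<inter> cinv c -` U) \<times> UNIV"
      using covec_of_in[OF c cinv_in[OF c]] by (auto simp: topspace_cotangent_bundle)
    then show "open {(z, w). z \<in> cimage c \<and> (cinv c z, covec_of A c (cinv c z) w) \<in> {p \<in> topspace (cotangent_bundle A). fst p \<in> U}}"
      using open_Times[OF open_cinv_vimage[OF c that] open_UNIV] by simp
  qed (auto simp: topspace_cotangent_bundle)
  then have fst: "continuous_map (cotangent_bundle A) euclidean (fst :: 'm \<times> ('m, 'e) covec \<Rightarrow> 'm)"
    unfolding continuous_map by simp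
  have "continuous_map euclidean euclideanreal b" using b by simp
  from continuous_map_compose[OF fst this]
  have "continuous_map (cotangent_bundle A) euclideanreal (\<lambda>p. b (fst p))" by (simp add: o_def)
  from continuous_map_add[OF G_continuous[unfolded continuous_hamiltonian_def] this]
  show "continuous_hamiltonian A (\<lambda>x p. G x p + b x)"
    unfolding continuous_hamiltonian_def by (simp add: case_prod_unfold)
next
  show "convex_hamiltonian A (\<lambda>x p. G x p + b x)"
    unfolding convex_hamiltonian_def
  proof (intro allI ballI)
    fix x p q and t :: real assume *: "p \<in> cotangent_space A x" "q \<in> cotangent_space A x" "t \<in> {0..1}"
    have "G x (\<lambda>v. (1 - t) * p v + t * q v) \<le> (1 - t) * G x p + t * G x q"
      using G_convex * unfolding convex_hamiltonian_def by blast
    then show "G x (\<lambda>v. (1 - t) * p v + t * q v) + b x \<le> (1 - t) * (G x p + b x) + t * (G x q + b x)"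
      by (simp add: algebra_simps)
  qed
  show "superlinear_hamiltonian A g (\<lambda>x p. G x p + b x)"
    unfolding superlinear_hamiltonian_def
  proof (intro allI)
    fix x K
    obtain R where R: "\<And>p. p \<in> cotangent_space A x \<Longrightarrow> conorm A g x p > R \<Longrightarrow> G x p / conorm A g x p \<ge> K + 1"
      using G_superlinear unfolding superlinear_hamiltonian_def by blast
    have "(G x p + b x) / conorm A g x p \<ge> K" if p: "p \<in> cotangent_space A x" "conorm A g x p > max R \<bar>b x\<bar>" for p
    proof -
      have "b x / conorm A g x p \<ge> - 1" using p(2) by (simp add: divide_simps) linarith
      then show ?thesis using R[OF p(1)] p(2) by (simp add: add_divide_distrib)
    qed
    then show "\<exists>R. \<forall>p\<in>cotangent_space A x. conorm A g x p > R \<longrightarrow> (G x p + b x) / conorm A g x p \<ge> K" by blast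
  qed
qed

lemma smooth_approximation_margin:
  assumes "continuous_on UNIV b" "VSb b a w" "\<epsilon> > 0"
  obtains f where "f \<in> C1" "\<And>x. \<bar>f x - w x\<bar> \<le> \<epsilon>" "\<And>x. G x (differential A f x) + b x \<le> a + \<epsilon>"
proof -
  interpret H: hamiltonian A g "\<lambda>x p. G x p + b x" by (rule hamiltonian_add[OF assms(1)])
  have "H.VS a w" using assms(2) unfolding H.VS_def VSb_def .
  then show thesis using H.smooth_approximation[OF _ assms(3)] that by blast
qed

text \<open>Where u - f is maximal, the increments of f over segments arriving at x are at most
  those of u. Each velocity v gives df(v) \<le> L + a - b, and duality collects these into the bound
  on G.\<close>

lemma VSb_if_increments:
  assumes cont: "continuous_on UNIV u"
    and inc: "\<And>c x v \<eta>. c \<in> A \<Longrightarrow> x \<in> cdom c \<Longrightarrow> \<eta> > 0 \<Longrightarrow> \<forall>\<^sub>F r in at_right 0. cmap c x - r *\<^sub>R v \<in> cimage c \<and>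
      u x - u (cinv c (cmap c x - r *\<^sub>R v)) \<le> r * (Lc c (cmap c x) v + a - b x + \<eta>)"
  shows "VSb b a u"
  unfolding VSb_def
proof (intro conjI cont ballI allI impI)
  fix f x assume f: "f \<in> C1" and touch: "\<forall>\<^sub>F y in nhds x. u y - f y \<le> u x - f x"
  obtain c where c: "c \<in> A" "x \<in> cdom c" using chart_ex by blast
  have z: "cmap c x \<in> cimage c" using c by blast
  have "dc f c x \<bullet> v \<le> Lc c (cmap c x) v + (a - b x)" for v
  proof (rule field_le_epsilon)
    fix \<eta> :: real assume "\<eta> > 0"
    have "((\<lambda>z. - (f \<circ> cinv c) z) has_derivative (\<lambda>h. - (dc f c x \<bullet> h))) (at (cmap c x))"
      using grad_onD[OF C1D[OF f c(1)] z] by (rule has_derivative_minus)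
    then have der: "((\<lambda>z. - (f \<circ> cinv c) z) has_derivative (\<lambda>h. (- dc f c x) \<bullet> h)) (at (cmap c x))" by simp
    have lim: "((\<lambda>r. cmap c x - r *\<^sub>R v) \<longlongrightarrow> cmap c x) (at_right 0)"
      by (rule tendsto_eq_intros | simp)+
    have "\<forall>\<^sub>F z in nhds (cmap c x). u (cinv c z) - f (cinv c z) \<le> u x - f x"
      by (rule eventually_cinv[OF c touch])
    then have "\<forall>\<^sub>F r in at_right 0. u (cinv c (cmap c x - r *\<^sub>R v)) - f (cinv c (cmap c x - r *\<^sub>R v)) \<le> u x - f x"
      using lim by (rule eventually_compose_filterlim)
    then have "\<forall>\<^sub>F r in at_right 0. (\<lambda>z. - (f \<circ> cinv c) z) (cmap c x + r *\<^sub>R (- v)) - (\<lambda>z. - (f \<circ> cinv c) z) (cmap c x)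
        \<le> r * (Lc c (cmap c x) v + a - b x + \<eta>)"
      using inc[OF c \<open>\<eta> > 0\<close>, of v]
      by eventually_elim (simp add: cinv_cmap[OF c])
    from derivative_le_if_increments_le[OF der this]
    show "dc f c x \<bullet> v \<le> Lc c (cmap c x) v + (a - b x) + \<eta>" by simp
  qed
  then have "Gc c (cmap c x) (dc f c x) \<le> a - b x" by (simp add: Gc_le_iff[OF c(1) z])
  then show "G x (differential A f x) + b x \<le> a" by (simp add: G_differential[OF f c])
qed

subsection \<open>Dominated functions\<close>

text \<open>The functions dominated by L + c of weak KAM theory. \<open>dominated_VS\<close> and
  \<open>VS_dominated\<close> identify them with the critical subsolutions.\<close>

definition dominated :: "('m \<Rightarrow> real) \<Rightarrow> bool" where
  "dominated u \<longleftrightarrow> (\<forall>r>0. \<forall>x y k. reach r x y k \<longrightarrow> u y - u x \<le> k + cG * r)"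

lemma dominatedD: "dominated u \<Longrightarrow> r > 0 \<Longrightarrow> reach r x y k \<Longrightarrow> u y - u x \<le> k + cG * r"
  by (simp add: dominated_def)

lemma cost_bound: "r > 0 \<Longrightarrow> k + cG * r \<le> (1 + \<bar>cG\<bar>) * (\<bar>k\<bar> + r)"
proof -
  assume "r > 0"
  have "cG * r \<le> \<bar>cG\<bar> * r" using \<open>r > 0\<close> by (intro mult_right_mono) auto
  moreover have "\<bar>cG\<bar> * \<bar>k\<bar> \<ge> 0" by simp
  ultimately show ?thesis using \<open>r > 0\<close> abs_ge_self[of k] by (simp only: ring_distribs mult_1_left)
qed

lemma dominated_continuous:
  assumes "dominated u" shows "continuous_on UNIV u"
proof (rule continuous_if_reach_bound[of 1 "1 + \<bar>cG\<bar>"])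
  fix r x y k assume "0 < (r::real)" "reach r x y k"
  then show "u y - u x \<le> (1 + \<bar>cG\<bar>) * (\<bar>k\<bar> + r)"
    using dominatedD[OF assms, of r x y k] cost_bound[of r k] by linarith
qed auto

lemma dominated_VS:
  assumes "dominated u" shows "VS cG u"
proof -
  have "VSb (\<lambda>_. 0) cG u"
  proof (rule VSb_if_increments[OF dominated_continuous[OF assms]])
    fix c x v and \<eta> :: real assume c: "c \<in> A" "x \<in> cdom c" and "\<eta> > 0"
    then have "cmap c x \<in> cimage c" by blast
    from reach_line_eventually[OF c(1) this \<open>\<eta> > 0\<close>, of v] eventually_at_right_less[of 0]
    show "\<forall>\<^sub>F r in at_right 0. cmap c x - r *\<^sub>R v \<in> cimage c \<and>
      u x - u (cinv c (cmap c x - r *\<^sub>R v)) \<le> r * (Lc c (cmap c x) v + cG - 0 + \<eta>)"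
    proof eventually_elim
      case (elim r)
      then show ?case
        using dominatedD[OF assms, of r "cinv c (cmap c x - r *\<^sub>R v)" x "r * (Lc c (cmap c x) v + \<eta>)"]
        by (simp add: cinv_cmap[OF c] algebra_simps)
    qed
  qed
  then show ?thesis by (simp add: VSb_zero)
qed

lemma VS_dominated: "VS cG u \<Longrightarrow> dominated u"
  unfolding dominated_def using VS_reach[of cG u] by (simp add: less_imp_le)

subsection \<open>Finite time potentials and the Peierls barrier\<close>

text \<open>The infimum runs over all durations t \<ge> s instead of fixing t. This makes S
  increasing in s and dominated in y. For s = 0 it is the Mane potential, and its limit as s grows
  is the Peierls barrier.\<close>

definition S :: "real \<Rightarrow> 'm \<Rightarrow> 'm \<Rightarrow> real" where
  "S s x y = Inf {k + cG * t |k t. t \<ge> s \<and> t > 0 \<and> reach t x y k}"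

text \<open>A fixed return curve from y to x closes every curve from x to y, and loops have
  nonnegative cost, as almost critical C1 functions show.\<close>

lemma S_lower:
  obtains m where "\<And>t k. t > 0 \<Longrightarrow> reach t x y k \<Longrightarrow> m \<le> k + cG * t"
proof -
  obtain r l where r: "r > 0" "reach r y x l" using reach_connected by blast
  have "- (l + cG * r) \<le> k + cG * t" if t: "t > 0" "reach t x y k" for t k
  proof (rule field_le_epsilon)
    fix e :: real assume "e > 0"
    \<comment> \<open>The excess of the level over the critical value accumulates along both curves,
      to e in total.\<close>
    define \<epsilon> where "\<epsilon> = e / (t + r)"
    have \<epsilon>: "\<epsilon> > 0" "\<epsilon> * (t + r) = e" using \<open>e > 0\<close> t r by (auto simp: \<epsilon>_def)
    obtain f where f: "f \<in> C1" "\<And>x. G x (differential A f x) \<le> cG + \<epsilon>" using critical_C1[OF \<epsilon>(1)] by blast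
    have "f y - f x < k + (cG + \<epsilon>) * t" "f x - f y < l + (cG + \<epsilon>) * r"
      using C1_reach[OF f] t r by (auto simp: less_imp_le)
    then show "- (l + cG * r) \<le> k + cG * t + e" using \<epsilon>(2) by (simp add: algebra_simps)
  qed
  then show thesis using that by blast
qed

lemma S_le: "t \<ge> s \<Longrightarrow> t > 0 \<Longrightarrow> reach t x y k \<Longrightarrow> S s x y \<le> k + cG * t"
proof -
  assume t: "t \<ge> s" "t > 0" "reach t x y k"
  obtain m where m: "\<And>t k. t > 0 \<Longrightarrow> reach t x y k \<Longrightarrow> m \<le> k + cG * t" using S_lower by blast
  show ?thesis unfolding S_def
    by (rule cInf_lower) (use t m in \<open>auto intro!: bdd_belowI[of _ m]\<close>)
qed

lemma S_set_nonempty: "\<exists>t k. t \<ge> s \<and> t > 0 \<and> reach t x y k"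
proof -
  obtain r l where r: "r > 0" "reach r x y l" using reach_connected by blast
  obtain k0 where "\<And>r. r > 0 \<Longrightarrow> reach r x x (r * k0)" using reach_rest by blast
  then have "reach (max s 1 + r) x y (max s 1 * k0 + l)" using r by (intro reach_trans) auto
  then show ?thesis using r(1) by (intro exI[of _ "max s 1 + r"] exI[of _ "max s 1 * k0 + l"]) auto
qed

lemma S_lessD: "S s x y < m \<Longrightarrow> \<exists>t k. t \<ge> s \<and> t > 0 \<and> reach t x y k \<and> k + cG * t < m"
  unfolding S_def using cInf_lessD[of "{k + cG * t |k t. t \<ge> s \<and> t > 0 \<and> reach t x y k}" m] S_set_nonempty[of s x y]
  by auto

lemma S_greatest: "(\<And>t k. t \<ge> s \<Longrightarrow> t > 0 \<Longrightarrow> reach t x y k \<Longrightarrow> m \<le> k + cG * t) \<Longrightarrow> m \<le> S s x y"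
  unfolding S_def using S_set_nonempty[of s x y] by (intro cInf_greatest) auto

lemma S_mono: "s \<le> s' \<Longrightarrow> S s x y \<le> S s' x y"
  by (rule S_greatest) (auto intro: S_le)

lemma S_step_right:
  assumes "r > 0" "reach r y y' l" shows "S (s + r) x y' \<le> S s x y + (l + cG * r)"
proof -
  have "S (s + r) x y' - (l + cG * r) \<le> S s x y"
  proof (rule S_greatest)
    fix t k assume t: "t \<ge> s" "t > 0" "reach t x y k"
    have "S (s + r) x y' \<le> (k + l) + cG * (t + r)"
      using t assms by (intro S_le reach_trans) auto
    then show "S (s + r) x y' - (l + cG * r) \<le> k + cG * t" by (simp add: algebra_simps)
  qed
  then show ?thesis by simp
qed

lemma S_step_left:
  assumes "r > 0" "reach r x' x l" shows "S (s + r) x' y \<le> (l + cG * r) + S s x y"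
proof -
  have "S (s + r) x' y - (l + cG * r) \<le> S s x y"
  proof (rule S_greatest)
    fix t k assume t: "t \<ge> s" "t > 0" "reach t x y k"
    have "reach (r + t) x' y (l + k)" using t assms by (intro reach_trans) auto
    then have "S (s + r) x' y \<le> (l + k) + cG * (r + t)"
      using t assms by (intro S_le) auto
    then show "S (s + r) x' y - (l + cG * r) \<le> k + cG * t" by (simp add: algebra_simps)
  qed
  then show ?thesis by simp
qed

lemma S_dominated: "dominated (S s x)"
  unfolding dominated_def
proof (intro allI impI)
  fix r y y' l assume "r > (0::real)" "reach r y y' l"
  then show "S s x y' - S s x y \<le> l + cG * r" using S_step_right[of r y y' l s x] S_mono[of s "s + r" x y'] by simp
qed

lemma dominated_le_S: "dominated u \<Longrightarrow> u y - u x \<le> S s x y"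
  by (rule S_greatest) (rule dominatedD)

text \<open>
  The time average of the potentials is a subsolution with a margin: shifting the time in a
  concatenation gains the difference of the potentials at both ends of the time interval.
\<close>

lemma S_average_VSb:
  assumes e: "0 < e" and N: "N > 0"
  shows "VSb (\<lambda>x. (S N x0 x - S e x0 x) / (N + 1)) cG (\<lambda>x. integral {0..N + 1} (\<lambda>\<tau>. S \<tau> x0 x) / (N + 1))"
proof -
  define V where "V x = integral {0..N + 1} (\<lambda>\<tau>. S \<tau> x0 x)" for x
  have int: "(\<lambda>\<tau>. S \<tau> x0 x) integrable_on {a..b}" for x a b
    by (intro integrable_on_mono_on mono_onI S_mono)
  \<comment> \<open>Times up to r \<le> e are compared with \<open>S e\<close>; r \<le> 1 keeps the
    last stretch of length r above N, which is why the average extends to N + 1.\<close>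
  define r0 where "r0 = min 1 e"
  have inc: "V x' - V x \<le> (N + 1 - r) * (k + cG * r) - r * (S N x0 x - S e x0 x')"
    if r: "0 < r" "r \<le> r0" and R: "reach r x x' k" for r x x' k
  proof -
    have r1: "r \<le> 1" "r \<le> e" using r by (auto simp: r0_def)
    have "V x' = integral {0..r} (\<lambda>\<tau>. S \<tau> x0 x') + integral {r..N + 1} (\<lambda>\<tau>. S \<tau> x0 x')"
      unfolding V_def using r r1 N Henstock_Kurzweil_Integration.integral_combine[OF _ _ int, of 0 r "N + 1" x'] by simp
    moreover have "integral {0..r} (\<lambda>\<tau>. S \<tau> x0 x') \<le> integral {0..r} (\<lambda>\<tau>. S e x0 x')"
      using r1 by (intro integral_le int S_mono) auto
    moreover have "integral {0..r} (\<lambda>\<tau>. S e x0 x') = r * S e x0 x'" using r by simp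
    moreover have "integral {r..N + 1} (\<lambda>\<tau>. S \<tau> x0 x') = integral {0..N + 1 - r} (\<lambda>\<tau>. S (\<tau> + r) x0 x')"
      using has_integral_shift_real_ivl[OF integrable_integral[OF int[of x' r "N + 1"]], of r]
      by (intro integral_unique[symmetric]) simp
    moreover have "integral {0..N + 1 - r} (\<lambda>\<tau>. S (\<tau> + r) x0 x') \<le> integral {0..N + 1 - r} (\<lambda>\<tau>. S \<tau> x0 x + (k + cG * r))"
    proof (rule integral_le)
      show "(\<lambda>\<tau>. S (\<tau> + r) x0 x') integrable_on {0..N + 1 - r}"
        by (intro integrable_on_mono_on mono_onI S_mono) simp
      show "(\<lambda>\<tau>. S \<tau> x0 x + (k + cG * r)) integrable_on {0..N + 1 - r}"
        by (intro integrable_add int) auto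
    qed (use S_step_right[OF r(1) R] in auto)
    moreover have "integral {0..N + 1 - r} (\<lambda>\<tau>. S \<tau> x0 x + (k + cG * r)) = integral {0..N + 1 - r} (\<lambda>\<tau>. S \<tau> x0 x) + (N + 1 - r) * (k + cG * r)"
      using r1 N by (subst integral_add[OF int]) auto
    moreover have "integral {0..N + 1 - r} (\<lambda>\<tau>. S \<tau> x0 x) = V x - integral {N + 1 - r..N + 1} (\<lambda>\<tau>. S \<tau> x0 x)"
      unfolding V_def using r r1 N Henstock_Kurzweil_Integration.integral_combine[OF _ _ int, of 0 "N + 1 - r" "N + 1" x] by simp
    moreover have "integral {N + 1 - r..N + 1} (\<lambda>\<tau>. S \<tau> x0 x) \<ge> integral {N + 1 - r..N + 1} (\<lambda>\<tau>. S N x0 x)"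
      using r1 by (intro integral_le int S_mono) auto
    moreover have "integral {N + 1 - r..N + 1} (\<lambda>\<tau>. S N x0 x) = r * S N x0 x" using r by simp
    ultimately show ?thesis unfolding right_diff_distrib by linarith
  qed
  have r0: "r0 > 0" using e by (simp add: r0_def)
  \<comment> \<open>A cruder bound without the gain, from which the continuity of V follows.\<close>
  have dom: "V x' - V x \<le> (N + 1) * (k + cG * r)" if r: "0 < r" "r \<le> r0" and R: "reach r x x' k" for r x x' k
  proof (cases "e \<le> N")
    case True
    have "S e x0 x' \<le> S e x0 x + (k + cG * r)"
      using S_step_right[OF r(1) R, of e x0] S_mono[of e "e + r" x0 x'] r by simp
    moreover have "S e x0 x \<le> S N x0 x" by (rule S_mono[OF True])
    ultimately have "- (S N x0 x - S e x0 x') \<le> k + cG * r" by linarith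
    then have "r * (- (S N x0 x - S e x0 x')) \<le> r * (k + cG * r)" using r by (intro mult_left_mono) auto
    then show ?thesis using inc[OF r R] by (simp add: algebra_simps)
  next
    case False
    have "integral {0..N + 1} (\<lambda>\<tau>. S \<tau> x0 x') \<le> integral {0..N + 1} (\<lambda>\<tau>. S \<tau> x0 x + (k + cG * r))"
      using dominatedD[OF S_dominated r(1) R] by (intro integral_le int integrable_add) (auto simp: algebra_simps)
    also have "\<dots> = V x + (N + 1) * (k + cG * r)"
      unfolding V_def using N by (subst integral_add[OF int]) auto
    finally show ?thesis by (simp add: V_def)
  qed
  have contV: "continuous_on UNIV V"
  proof (rule continuous_if_reach_bound[OF r0])
    show "0 \<le> (N + 1) * (1 + \<bar>cG\<bar>)" using N by simp
    fix r x y k assume r: "0 < r" "r \<le> r0" "reach r x y k"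
    have "V y - V x \<le> (N + 1) * (k + cG * r)" by (rule dom[OF r])
    also have "\<dots> \<le> (N + 1) * ((1 + \<bar>cG\<bar>) * (\<bar>k\<bar> + r))"
      using cost_bound[OF r(1), of k] N by (intro mult_left_mono) auto
    finally show "V y - V x \<le> (N + 1) * (1 + \<bar>cG\<bar>) * (\<bar>k\<bar> + r)" by (simp only: mult.assoc)
  qed
  have "VSb (\<lambda>x. (S N x0 x - S e x0 x) / (N + 1)) cG (\<lambda>x. V x / (N + 1))"
  proof (rule VSb_if_increments)
    show "continuous_on UNIV (\<lambda>x. V x / (N + 1))" using N by (intro continuous_intros contV) auto
    fix c x v and \<eta> :: real assume c: "c \<in> A" "x \<in> cdom c" and "\<eta> > 0"
    let ?z = "cmap c x" and ?y = "\<lambda>r. cinv c (cmap c x - r *\<^sub>R v)"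
    have z: "?z \<in> cimage c" using c by blast
    \<comment> \<open>The error \<eta> is spent in thirds: on the action of the segment, on the
      continuity of \<open>S N x0\<close> at x, and on the term of second order in r.\<close>
    define \<kappa>0 where "\<kappa>0 = Lc c ?z v + \<eta> / 3 + cG"
    have lim: "((\<lambda>r. ?z - r *\<^sub>R v) \<longlongrightarrow> ?z) (at_right 0)"
      by (rule tendsto_eq_intros | simp)+
    have "isCont (S N x0) x" using dominated_continuous[OF S_dominated] by (simp add: continuous_on_eq_continuous_at)
    then have "\<forall>\<^sub>F y in nhds x. S N x0 y > S N x0 x - (N + 1) * (\<eta> / 3)"
      using \<open>\<eta> > 0\<close> N by (intro order_tendstoD(1)[of _ "S N x0 x"]) (auto simp: isCont_def tendsto_at_iff_tendsto_nhds)
    from eventually_cinv[OF c this]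
    have e1: "\<forall>\<^sub>F r in at_right 0. S N x0 (?y r) > S N x0 x - (N + 1) * (\<eta> / 3)"
      using lim by (rule eventually_compose_filterlim)
    have "((\<lambda>r. - (r / (N + 1)) * \<kappa>0) \<longlongrightarrow> - (0 / (N + 1)) * \<kappa>0) (at_right 0)"
      using N by (intro tendsto_intros) auto
    then have e2: "\<forall>\<^sub>F r in at_right 0. - (r / (N + 1)) * \<kappa>0 < \<eta> / 3"
      using \<open>\<eta> > 0\<close> by (intro order_tendstoD(2)) auto
    have e3: "\<forall>\<^sub>F r in at_right 0. r < r0" using r0 by (intro eventually_at_rightI[of 0 r0]) auto
    have "\<eta> / 3 > 0" using \<open>\<eta> > 0\<close> by simp
    from reach_line_eventually[OF c(1) z this, of v] eventually_at_right_less[of 0] e1 e2 e3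
    show "\<forall>\<^sub>F r in at_right 0. ?z - r *\<^sub>R v \<in> cimage c \<and>
      V x / (N + 1) - V (?y r) / (N + 1) \<le> r * (Lc c ?z v + cG - (S N x0 x - S e x0 x) / (N + 1) + \<eta>)"
    proof eventually_elim
      case (elim r)
      have le: "(N + 1) * (- (r / (N + 1)) * \<kappa>0) \<le> (N + 1) * (\<eta> / 3)"
        using elim N by (intro mult_left_mono) auto
      have "V x - V (?y r) \<le> (N + 1 - r) * (r * (Lc c ?z v + \<eta> / 3) + cG * r) - r * (S N x0 (?y r) - S e x0 x)"
        using elim by (intro inc) (auto simp: cinv_cmap[OF c])
      also have "\<dots> = r * ((N + 1) * \<kappa>0 + (N + 1) * (- (r / (N + 1)) * \<kappa>0) - (S N x0 (?y r) - S e x0 x))"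
        using N by (simp add: \<kappa>0_def field_simps)
      also have "\<dots> \<le> r * ((N + 1) * \<kappa>0 + (N + 1) * (\<eta> / 3) - (S N x0 x - S e x0 x - (N + 1) * (\<eta> / 3)))"
        by (rule mult_left_mono) (use le elim in linarith)+
      also have "\<dots> = (N + 1) * (r * (Lc c ?z v + cG - (S N x0 x - S e x0 x) / (N + 1) + \<eta>))"
        using N by (simp add: \<kappa>0_def field_simps)
      finally have "V x - V (?y r) \<le> (N + 1) * (r * (Lc c ?z v + cG - (S N x0 x - S e x0 x) / (N + 1) + \<eta>))" .
      then have "(V x - V (?y r)) / (N + 1) \<le> r * (Lc c ?z v + cG - (S N x0 x - S e x0 x) / (N + 1) + \<eta>)"
        using N by (subst pos_divide_le_eq) (auto simp: mult.commute)
      then show ?case using elim by (simp add: diff_divide_distrib)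
    qed
  qed
  then show ?thesis by (simp add: V_def)
qed

text \<open>The lower limit is the supremum over n of infima over t \<ge> n. Comparing strictly with
  real numbers turns the extended action into \<open>reach\<close>, which covers infinite values as
  well.\<close>

lemma peierls_barrier_eq:
  assumes bdd: "\<And>n::nat. S (real n) x y \<le> B"
  shows "peierls_barrier A G x y = ereal (SUP n::nat. S (real n) x y)"
proof -
  define H where "H = (SUP n::nat. S (real n) x y)"
  have bdd': "bdd_above (range (\<lambda>n::nat. S (real n) x y))" using bdd by (intro bdd_aboveI2)
  have SH: "S s x y \<le> H" for s
  proof -
    obtain n :: nat where "s \<le> real n" using real_arch_simple by blast
    then have "S s x y \<le> S (real n) x y" by (rule S_mono)
    also have "\<dots> \<le> H" unfolding H_def by (rule cSUP_upper[OF UNIV_I bdd'])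
    finally show ?thesis .
  qed
  let ?X = "\<lambda>t. minimal_action A G t x y + ereal (cG * t)"
  have X: "?X t < ereal m \<longleftrightarrow> reach t x y (m - cG * t)" for t m
    unfolding reach_def by (cases "minimal_action A G t x y") auto
  have "peierls_barrier A G x y \<le> ereal H"
  proof (rule ccontr)
    assume "\<not> ?thesis"
    then obtain m where m: "ereal H < ereal m" "ereal m < peierls_barrier A G x y"
      using ereal_dense2[of "ereal H"] by (metis less_ereal.simps(1) not_le)
    from less_LiminfD[OF m(2)[unfolded peierls_barrier_def]]
    obtain T where T: "\<And>t. t \<ge> T \<Longrightarrow> ereal m < ?X t" by (auto simp: eventually_at_top_linorder)
    obtain t k where t: "t \<ge> T" "t > 0" "reach t x y k" "k + cG * t < m"
      using S_lessD[of T x y m] SH[of T] m(1) by auto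
    then have "?X t < ereal m" unfolding X by (auto intro: reach_mono)
    then show False using T[OF t(1)] by simp
  qed
  moreover have "ereal H \<le> peierls_barrier A G x y"
    unfolding peierls_barrier_def le_Liminf_iff
  proof (intro allI impI)
    fix q assume "q < ereal H"
    then obtain m where m: "q < ereal m" "ereal m < ereal H" using ereal_dense2 by blast
    then obtain n :: nat where n: "m < S (real n) x y"
      using less_cSUP_iff[OF _ bdd', of m] by (auto simp: H_def)
    have "q < ?X t" if t: "t \<ge> max (real n) 1" for t
    proof (rule ccontr)
      assume "\<not> q < ?X t"
      then have "?X t < ereal m" using m(1) by simp
      then have "reach t x y (m - cG * t)" by (simp add: X)
      then have "S (real n) x y \<le> (m - cG * t) + cG * t" using t by (intro S_le) auto
      then show False using n by simp
    qed
    then show "\<forall>\<^sub>F t in at_top. q < ?X t" unfolding eventually_at_top_linorder by blast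
  qed
  ultimately show ?thesis by (simp add: H_def)
qed

end

subsection \<open>Functions on the tangent bundle\<close>

context manifold
begin

abbreviation "dv f p \<equiv> differential A f (fst p) (snd p)"

text \<open>Continuity in all trivialisations. TM is a \<open>topology\<close> rather than a type
  with open sets, and this form gives measurability and can be checked in coordinates.\<close>

definition bundle_continuous :: "('m \<times> ('m, 'e) tvec \<Rightarrow> 'b::topological_space) \<Rightarrow> bool" where
  "bundle_continuous F \<longleftrightarrow>
     (\<forall>c\<in>A. continuous_on (cimage c \<times> UNIV) (\<lambda>(z, w). F (cinv c z, tvec_of A c (cinv c z) w)))"

lemma space_borel_of_tangent_bundle:
  assumes "sets m = sets (borel_of (tangent_bundle A))"
  shows "space m = Sigma UNIV (tangent_space A)"
  using sets_eq_imp_space_eq[OF assms] by (simp add: borel_of_def space_measure_of_conv topspace_tangent_bundle)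

lemma openin_in_borel_of: "openin X U \<Longrightarrow> U \<in> sets (borel_of X)"
  unfolding borel_of_def by (subst sets_measure_of) (auto dest: openin_subset)

lemma bundle_continuous_measurable:
  fixes F :: "'m \<times> ('m, 'e) tvec \<Rightarrow> 'b::topological_space"
  assumes F: "bundle_continuous F" and m: "sets m = sets (borel_of (tangent_bundle A))"
  shows "F \<in> borel_measurable m"
proof (rule borel_measurableI)
  fix U :: "'b set" assume U: "open U"
  have "openin (tangent_bundle A) (F -` U \<inter> Sigma UNIV (tangent_space A))"
    unfolding openin_tangent_bundle[OF atlas]
  proof (intro conjI ballI)
    fix c assume c: "c \<in> A"
    have "{(z, w). z \<in> cimage c \<and> (cinv c z, tvec_of A c (cinv c z) w) \<in> F -` U \<inter> Sigma UNIV (tangent_space A)}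
        = (\<lambda>(z, w). F (cinv c z, tvec_of A c (cinv c z) w)) -` U \<inter> cimage c \<times> UNIV"
      using tvec_of_in[OF c cinv_in[OF c]] by auto
    moreover have "open ((\<lambda>(z, w). F (cinv c z, tvec_of A c (cinv c z) w)) -` U \<inter> cimage c \<times> UNIV)"
      using F c U continuous_on_open_vimage[OF open_Times[OF open_cimage[OF c] open_UNIV]]
      unfolding bundle_continuous_def by blast
    ultimately show "open {(z, w). z \<in> cimage c \<and> (cinv c z, tvec_of A c (cinv c z) w) \<in> F -` U \<inter> Sigma UNIV (tangent_space A)}"
      by simp
  qed auto
  then show "F -` U \<inter> space m \<in> sets m"
    using openin_in_borel_of by (simp add: m space_borel_of_tangent_bundle[OF m])
qed

lemma bundle_continuous_base:
  assumes "continuous_on UNIV F" shows "bundle_continuous (\<lambda>p. F (fst p))"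
  unfolding bundle_continuous_def
proof
  fix c assume c: "c \<in> A"
  have "continuous_on (cimage c \<times> (UNIV :: 'e set)) (\<lambda>p. cinv c (fst p))"
    by (rule continuous_on_compose2[OF cont_cinv[OF c] continuous_on_fst[OF continuous_on_id]]) auto
  from continuous_on_compose2[OF assms this]
  show "continuous_on (cimage c \<times> UNIV) (\<lambda>(z, w). F (fst (cinv c z, tvec_of A c (cinv c z) w)))"
    by (simp add: case_prod_unfold)
qed

lemma bundle_continuous_differential:
  assumes f: "f \<in> C1" shows "bundle_continuous (\<lambda>p. dv f p)"
  unfolding bundle_continuous_def
proof
  fix c assume c: "c \<in> A"
  have "continuous_on (cimage c) (gr (f \<circ> cinv c))" using C1D[OF f c] by (simp add: grad_on_def)
  then have "continuous_on (cimage c \<times> (UNIV :: 'e set)) (\<lambda>p. gr (f \<circ> cinv c) (fst p))"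
    by (rule continuous_on_compose2[OF _ continuous_on_fst[OF continuous_on_id]]) auto
  then have *: "continuous_on (cimage c \<times> (UNIV :: 'e set)) (\<lambda>p. gr (f \<circ> cinv c) (fst p) \<bullet> snd p)"
    by (intro continuous_intros)
  show "continuous_on (cimage c \<times> UNIV) (\<lambda>(z, w). dv f (cinv c z, tvec_of A c (cinv c z) w))"
  proof (rule continuous_on_eq[OF *])
    fix p assume "p \<in> cimage c \<times> (UNIV :: 'e set)"
    then have z: "fst p \<in> cimage c" by auto
    show "gr (f \<circ> cinv c) (fst p) \<bullet> snd p = (case p of (z, w) \<Rightarrow>
        dv f (cinv c z, tvec_of A c (cinv c z) w))"
      using cinv_in[OF c z] cmap_cinv[OF c z]
      by (simp add: case_prod_unfold differential_eq_covec_of[OF f c] covec_of_apply[OF c])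
  qed
qed

lemma bundle_continuous_tnorm: "bundle_continuous (\<lambda>p. tnorm g (fst p) (snd p))"
  unfolding bundle_continuous_def
proof
  fix c assume c: "c \<in> A"
  define B where "B z v w = g (cinv c z) (tvec_of A c (cinv c z) v) (tvec_of A c (cinv c z) w)" for z v w
  \<comment> \<open>Smoothness of the metric is given for fixed coordinate vectors only; expansion
    in the basis yields joint continuity in the point and the vector.\<close>
  have expand: "B z v v = (\<Sum>(i, j)\<in>Basis \<times> Basis. (v \<bullet> i) * (v \<bullet> j) * B z i j)" if z: "z \<in> cimage c" for z v
  proof -
    have bl: "bilinear (B z)" unfolding B_def by (rule metric_bilinear[OF c cinv_in[OF c z]])
    have "B z v v = B z (\<Sum>i\<in>Basis. (v \<bullet> i) *\<^sub>R i) (\<Sum>i\<in>Basis. (v \<bullet> i) *\<^sub>R i)"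
      by (simp add: euclidean_representation)
    also have "\<dots> = (\<Sum>(i, j)\<in>Basis \<times> Basis. B z ((v \<bullet> i) *\<^sub>R i) ((v \<bullet> j) *\<^sub>R j))"
      by (rule bilinear_sum[OF bl])
    also have "\<dots> = (\<Sum>(i, j)\<in>Basis \<times> Basis. (v \<bullet> i) * (v \<bullet> j) * B z i j)"
      by (intro sum.cong) (auto simp: bilinear_lmul[OF bl] bilinear_rmul[OF bl])
    finally show ?thesis .
  qed
  have cB: "continuous_on (cimage c \<times> (UNIV :: 'e set)) (\<lambda>p. B (fst p) i j)" for i j
  proof (rule continuous_on_compose2[OF _ continuous_on_fst[OF continuous_on_id]])
    have "smooth_on (\<lambda>z. B z i j) (cimage c)" using metric c unfolding riemannian_metric_def B_def by blast
    then show "continuous_on (cimage c) (\<lambda>z. B z i j)" unfolding smooth_on_def by (metis Ck_on.simps(1))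
  qed auto
  have *: "continuous_on (cimage c \<times> (UNIV :: 'e set)) (\<lambda>p. sqrt (\<Sum>(i, j)\<in>Basis \<times> Basis. (snd p \<bullet> i) * (snd p \<bullet> j) * B (fst p) i j))"
    unfolding case_prod_unfold by (intro continuous_intros cB)
  show "continuous_on (cimage c \<times> UNIV) (\<lambda>(z, w). tnorm g (fst (cinv c z, tvec_of A c (cinv c z) w)) (snd (cinv c z, tvec_of A c (cinv c z) w)))"
  proof (rule continuous_on_eq[OF *])
    fix p assume "p \<in> cimage c \<times> (UNIV :: 'e set)"
    then have z: "fst p \<in> cimage c" by auto
    show "sqrt (\<Sum>(i, j)\<in>Basis \<times> Basis. (snd p \<bullet> i) * (snd p \<bullet> j) * B (fst p) i j) = (case p of (z, w) \<Rightarrow>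
        tnorm g (fst (cinv c z, tvec_of A c (cinv c z) w)) (snd (cinv c z, tvec_of A c (cinv c z) w)))"
      unfolding expand[OF z, symmetric] by (simp add: case_prod_unfold tnorm_def B_def)
  qed
qed

end

context hamiltonian
begin

abbreviation "Lv p \<equiv> L (fst p) (snd p)"

lemma bundle_continuous_L: "bundle_continuous (\<lambda>p. Lv p)"
  unfolding bundle_continuous_def using Lc_continuous by (simp add: Lc_def)

subsection \<open>Mather measures\<close>

abbreviation "mather \<equiv> mather_measure A g G"

context
  fixes m assumes m: "mather m"
begin

lemma sets_mather: "sets m = sets (borel_of (tangent_bundle A))"
  and prob_mather: "prob_space m"
  using m by (auto simp: mather_measure_def closed_measure_def)

interpretation prob_space m by (rule prob_mather)

lemma tangent_mather: "p \<in> space m \<Longrightarrow> snd p \<in> tangent_space A (fst p)"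
  by (auto simp: space_borel_of_tangent_bundle[OF sets_mather])

lemma fst_measurable_mather: "fst \<in> borel_measurable m"
  using bundle_continuous_measurable[OF bundle_continuous_base[OF continuous_on_id] sets_mather] by simp

lemma integrable_base_mather: 
  assumes "continuous_on UNIV F" shows "integrable m (\<lambda>p. F (fst p) :: real)"
proof -
  obtain B where "\<And>x. \<bar>F x\<bar> \<le> B" using continuous_bounded[OF assms] by blast
  then show ?thesis
    by (intro integrable_const_bound[of _ B] bundle_continuous_measurable[OF bundle_continuous_base[OF assms] sets_mather]) auto
qed

lemma integrable_L_mather: "integrable m (\<lambda>p. Lv p)"
  and integral_L_mather: "(\<integral>p. Lv p \<partial>m) = - cG"
  using m by (simp_all add: mather_measure_def case_prod_unfold)

lemma integrable_tnorm_mather: "integrable m (\<lambda>p. tnorm g (fst p) (snd p))"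
  using m by (simp add: mather_measure_def closed_measure_def case_prod_unfold)

lemma integral_differential_mather: "f \<in> C1 \<Longrightarrow> (\<integral>p. dv f p \<partial>m) = 0"
  using m by (simp add: mather_measure_def closed_measure_def case_prod_unfold)

text \<open>Both df and -df are dominated by L plus a constant, so the integrable function L
  controls |df|.\<close>

lemma integrable_differential_mather:
  assumes f: "f \<in> C1" shows "integrable m (\<lambda>p. dv f p)"
proof -
  have f': "(\<lambda>x. (- 1) * f x) \<in> C1" by (rule C1_cmult[OF f])
  obtain a where a: "\<And>x. \<bar>G x (differential A f x)\<bar> \<le> a" using continuous_bounded[OF G_differential_continuous[OF f]] by blast
  obtain a' where a': "\<And>x. \<bar>G x (differential A (\<lambda>x. (- 1) * f x) x)\<bar> \<le> a'"
    using continuous_bounded[OF G_differential_continuous[OF f']] by blast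
  show ?thesis
  proof (rule Bochner_Integration.integrable_bound)
    show "integrable m (\<lambda>p. Lv p + max a a')" by (intro Bochner_Integration.integrable_add integrable_L_mather) simp
    show "(\<lambda>p. dv f p) \<in> borel_measurable m"
      by (rule bundle_continuous_measurable[OF bundle_continuous_differential[OF f] sets_mather])
    show "AE p in m. norm (dv f p) \<le> norm (Lv p + max a a')"
    proof (rule AE_I2)
      fix p assume p: "p \<in> space m"
      note v = tangent_mather[OF p]
      show "norm (dv f p) \<le> norm (Lv p + max a a')"
        using differential_le_L[OF f v] differential_le_L[OF f' v] differential_cmult[OF v f, of "- 1"]
          a[of "fst p"] a'[of "fst p"] by auto
    qed
  qed
qed

lemma integrable_mult_mather:
  assumes F: "continuous_on UNIV F" and H: "integrable m (H :: _ \<Rightarrow> real)"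
  shows "integrable m (\<lambda>p. F (fst p) * H p)"
proof -
  obtain B where B: "\<And>x. \<bar>F x\<bar> \<le> B" using continuous_bounded[OF F] by blast
  have B0: "B \<ge> 0" using B[of undefined] by linarith
  show ?thesis
  proof (rule Bochner_Integration.integrable_bound)
    show "integrable m (\<lambda>p. B * H p)" using H by simp
    show "(\<lambda>p. F (fst p) * H p) \<in> borel_measurable m"
      using H by (intro borel_measurable_times bundle_continuous_measurable[OF bundle_continuous_base[OF F] sets_mather]) auto
    show "AE p in m. norm (F (fst p) * H p) \<le> norm (B * H p)"
      using B B0 by (auto simp: abs_mult intro!: mult_right_mono)
  qed
qed

lemma margin_null:
  assumes w: "VSb b cG w" and b: "continuous_on UNIV b" "\<And>x. b x \<ge> 0"
  shows "AE p in m. b (fst p) = 0"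
proof -
  have ib: "integrable m (\<lambda>p. b (fst p))" by (rule integrable_base_mather[OF b(1)])
  have "(\<integral>p. b (fst p) \<partial>m) \<le> 0"
  proof (rule field_le_epsilon)
    fix e :: real assume e: "e > 0"
    obtain f where f: "f \<in> C1" "\<And>x. \<bar>f x - w x\<bar> \<le> e" "\<And>x. G x (differential A f x) + b x \<le> cG + e"
      by (rule smooth_approximation_margin[OF b(1) w e]) (rule that)
    have "(\<integral>p. b (fst p) \<partial>m) \<le> (\<integral>p. (Lv p + (cG + e)) - dv f p \<partial>m)"
    proof (rule integral_mono[OF ib])
      fix p assume p: "p \<in> space m"
      show "b (fst p) \<le> Lv p + (cG + e) - dv f p"
        using differential_le_L[OF f(1) tangent_mather[OF p]] f(3)[of "fst p"] by linarith
    qed (intro Bochner_Integration.integrable_diff Bochner_Integration.integrable_add integrable_L_mather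
          integrable_differential_mather[OF f(1)]; simp)
    also have "\<dots> = e"
      using integrable_L_mather integrable_differential_mather[OF f(1)] integral_differential_mather[OF f(1)]
      by (simp add: integral_L_mather prob_space)
    finally show "(\<integral>p. b (fst p) \<partial>m) \<le> 0 + e" by simp
  qed
  moreover have "(\<integral>p. b (fst p) \<partial>m) \<ge> 0" using b(2) by (intro integral_nonneg_AE) auto
  ultimately show ?thesis
    using integral_nonneg_eq_0_iff_AE[OF ib] b(2) by auto
qed

end

subsection \<open>Existence of Mather measures\<close>

lemma finite_chart_cover:
  obtains n :: nat and c :: "nat \<Rightarrow> ('m, 'e) chart" and Q where
    "\<And>i. i < n \<Longrightarrow> c i \<in> A" "\<And>i. i < n \<Longrightarrow> compact (Q i)" "\<And>i. i < n \<Longrightarrow> Q i \<subseteq> cimage (c i)"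
    "\<And>x. \<exists>i<n. x \<in> cinv (c i) ` Q i"
proof -
  obtain I :: "'m set" and c :: "'m \<Rightarrow> ('m, 'e) chart" and r :: "'m \<Rightarrow> real" and \<xi> :: "'m \<Rightarrow> 'm \<Rightarrow> real"
    where I: "finite I" "\<And>i. i \<in> I \<Longrightarrow> c i \<in> A \<and> i \<in> cdom (c i) \<and> r i > 0 \<and> cball (cmap (c i) i) (3 * r i) \<subseteq> cimage (c i)"
      "\<And>x. (\<Sum>i\<in>I. \<xi> i x) = 1" "\<And>i x. i \<in> I \<Longrightarrow> x \<notin> cinv (c i) ` cball (cmap (c i) i) (r i) \<Longrightarrow> \<xi> i x = 0"
    using partition_of_unity by metis
  obtain e where e: "bij_betw e {0..<card I} I" using ex_bij_betw_nat_finite[OF I(1)] by blast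
  show thesis
  proof (rule that[of "card I" "\<lambda>i. c (e i)" "\<lambda>i. cball (cmap (c (e i)) (e i)) (r (e i))"])
    fix i assume "i < card I"
    then have i: "e i \<in> I" using e by (auto simp: bij_betw_def)
    show "c (e i) \<in> A" using I(2)[OF i] by blast
    show "cball (cmap (c (e i)) (e i)) (r (e i)) \<subseteq> cimage (c (e i))"
      using I(2)[OF i] by (meson order_trans subset_cball mult_le_cancel_right1 linorder_not_less one_le_numeral order_less_imp_le)
  next
    fix x
    have "\<exists>j\<in>I. \<xi> j x \<noteq> 0" using I(3)[of x] by (metis sum.neutral zero_neq_one)
    then obtain j where j: "j \<in> I" "x \<in> cinv (c j) ` cball (cmap (c j) j) (r j)" using I(4) by blast
    then obtain i where "i < card I" "e i = j" using e j(1) unfolding bij_betw_def by (metis atLeastLessThan_iff imageE)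
    then show "\<exists>i<card I. x \<in> cinv (c (e i)) ` cball (cmap (c (e i)) (e i)) (r (e i))" using j(2) by auto
  qed auto
qed

text \<open>Over K, consider L + c and the differentials of a dense sequence of functions, on a
  compact set of bounded velocities. If some finite combination is bounded below by a positive
  number, it yields a strict subsolution. Otherwise there are probabilities for which more and more
  of these functions have almost zero mean, and a weak limit is a Mather measure. Bounded velocities
  suffice by \<open>Gc_le_if_bounded_velocities\<close>.\<close>

lemma mather_or_strict_subsolution:
  assumes K: "compact K" "K \<noteq> {}"
  shows "(\<exists>m. mather m \<and> (AE p in m. fst p \<in> K)) \<or>
    (\<exists>f\<in>C1. \<exists>\<delta>>0. \<forall>x\<in>K. G x (differential A f x) \<le> cG - \<delta>)"
proof -
  obtain n :: nat and c :: "nat \<Rightarrow> ('m, 'e) chart" and Q where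
    c: "\<And>i. i < n \<Longrightarrow> c i \<in> A" and Q: "\<And>i. i < n \<Longrightarrow> compact (Q i)" "\<And>i. i < n \<Longrightarrow> Q i \<subseteq> cimage (c i)"
    and cover: "\<And>x. \<exists>i<n. x \<in> cinv (c i) ` Q i"
    using finite_chart_cover by blast
  have "\<exists>R>0. \<forall>z w b. b \<le> cG \<longrightarrow> z \<in> Q i \<longrightarrow> (\<forall>v. v \<noteq> 0 \<longrightarrow> norm v \<le> R \<longrightarrow> w \<bullet> v \<le> Lc (c i) z v + b) \<longrightarrow> Gc (c i) z w \<le> b"
    if i: "i < n" for i
    using Gc_le_if_bounded_velocities[OF c[OF i] Q(1)[OF i] Q(2)[OF i], of cG] by metis
  then obtain R where R: "\<And>i. i < n \<Longrightarrow> R i > 0"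
    "\<And>i z w b. i < n \<Longrightarrow> b \<le> cG \<Longrightarrow> z \<in> Q i \<Longrightarrow> (\<And>v. v \<noteq> 0 \<Longrightarrow> norm v \<le> R i \<Longrightarrow> w \<bullet> v \<le> Lc (c i) z v + b) \<Longrightarrow> Gc (c i) z w \<le> b"
    by metis
  define Z where "Z i = Q i \<inter> cinv (c i) -` K" for i
  have clK: "closed K" by (rule compact_imp_closed[OF K(1)])
  have Z: "compact (Z i)" "Z i \<subseteq> cimage (c i)" if i: "i < n" for i
  proof -
    have "closed (Z i)" unfolding Z_def
      using continuous_closed_preimage[OF continuous_on_subset[OF cont_cinv[OF c[OF i]] Q(2)[OF i]] compact_imp_closed[OF Q(1)[OF i]] clK]
      by (simp add: Int_commute)
    then have "compact (Q i \<inter> Z i)" by (rule compact_Int_closed[OF Q(1)[OF i]])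
    moreover have "Q i \<inter> Z i = Z i" by (auto simp: Z_def)
    ultimately show "compact (Z i)" by simp
    show "Z i \<subseteq> cimage (c i)" using Q(2)[OF i] by (auto simp: Z_def)
  qed
  \<comment> \<open>Charts overlap, so each coordinate piece carries its index as an extra real
    coordinate. D is then a compact subset of a Euclidean space, to which
    \<open>pmf_weak_limit\<close> applies.\<close>
  define P :: "nat \<Rightarrow> (real \<times> 'e \<times> 'e) set" where "P i = {real i} \<times> Z i \<times> cball 0 (R i)" for i
  define D where "D = (\<Union>i\<in>{..<n}. P i)"
  define q :: "real \<times> 'e \<times> 'e \<Rightarrow> 'm \<times> ('m, 'e) tvec" where
    "q y = (let i = nat \<lfloor>fst y\<rfloor>; z = fst (snd y) in (cinv (c i) z, tvec_of A (c i) (cinv (c i) z) (snd (snd y))))" for y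
  have q: "q (real i, z, v) = (cinv (c i) z, tvec_of A (c i) (cinv (c i) z) v)" for i z v
    by (simp add: q_def)
  have PE: "\<exists>z v. y = (real i, z, v) \<and> z \<in> Z i \<and> norm v \<le> R i" if "y \<in> P i" for y i
    using that by (auto simp: P_def)
  have cP: "compact (P i)" if "i < n" for i
    unfolding P_def by (intro compact_Times Z that) auto
  have cD: "compact D" unfolding D_def using cP by (intro compact_UN) auto
  have inD: "(real i, z, v) \<in> D" if "i < n" "z \<in> Z i" "norm v \<le> R i" for i z v
    using that by (auto simp: D_def P_def)
  have qD: "fst (q y) \<in> K" "snd (q y) \<in> tangent_space A (fst (q y))" if yD: "y \<in> D" for y
  proof -
    obtain i where i: "i < n" "y \<in> P i" using yD by (auto simp: D_def)
    obtain z v where zv: "y = (real i, z, v)" "z \<in> Z i" using PE[OF i(2)] by blast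
    show "fst (q y) \<in> K" using zv by (simp add: q Z_def)
    show "snd (q y) \<in> tangent_space A (fst (q y))"
      using zv Z(2)[OF i(1)] by (simp add: q subsetD tvec_of_in[OF c[OF i(1)] cinv_in[OF c[OF i(1)]]])
  qed
  have cont: "continuous_on D (\<lambda>y. F (q y))" if F: "bundle_continuous F" for F :: "'m \<times> ('m, 'e) tvec \<Rightarrow> real"
    unfolding D_def
  proof (rule continuous_on_closed_Union)
    fix i assume "i \<in> {..<n}"
    then have i: "i < n" by simp
    show "closed (P i)" by (rule compact_imp_closed[OF cP[OF i]])
  next
    fix i assume "i \<in> {..<n}"
    then have i: "i < n" by simp
    have "continuous_on (P i) (\<lambda>y. (\<lambda>(z, w). F (cinv (c i) z, tvec_of A (c i) (cinv (c i) z) w)) (snd y))"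
    proof (rule continuous_on_compose2[where g = "\<lambda>(z, w). F (cinv (c i) z, tvec_of A (c i) (cinv (c i) z) w)" and f = snd])
      show "continuous_on (cimage (c i) \<times> UNIV) (\<lambda>(z, w). F (cinv (c i) z, tvec_of A (c i) (cinv (c i) z) w))"
        using F c[OF i] unfolding bundle_continuous_def by blast
      show "continuous_on (P i) snd" by (intro continuous_intros)
      show "snd ` P i \<subseteq> cimage (c i) \<times> UNIV" using Z(2)[OF i] unfolding P_def by fastforce
    qed
    then show "continuous_on (P i) (\<lambda>y. F (q y))"
      by (rule continuous_on_eq) (use PE in \<open>fastforce simp: q\<close>)
  qed simp
  obtain x0 where x0: "x0 \<in> K" using K(2) by blast
  obtain i0 z0 where i0: "i0 < n" "z0 \<in> Q i0" "x0 = cinv (c i0) z0" using cover[of x0] by blast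
  have y0: "(real i0, z0, 0) \<in> D" using i0 x0 R(1)[OF i0(1)] by (intro inD) (auto simp: Z_def)
  define \<Psi> where "\<Psi> f y = dv f (q y)" for f y
  have c\<Psi>: "continuous_on D (\<Psi> f)" if "f \<in> C1" for f
    unfolding \<Psi>_def using cont[OF bundle_continuous_differential[OF that]] by simp
  have C1ne: "C1 \<noteq> {}" using C1_const by blast
  obtain F :: "nat \<Rightarrow> 'm \<Rightarrow> real" where F: "\<And>j. F j \<in> C1"
    "\<And>f e. f \<in> C1 \<Longrightarrow> e > 0 \<Longrightarrow> \<exists>j. \<forall>y\<in>D. \<bar>\<Psi> f y - \<Psi> (F j) y\<bar> \<le> e"
    by (rule countable_sup_dense_subset[OF cD C1ne c\<Psi>]) (assumption, rule that)
  \<comment> \<open>Index 0 is reserved for the action; the differentials are shifted by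
    one.\<close>
  define \<psi> where "\<psi> j y = (if j = 0 then Lv (q y) + cG else \<Psi> (F (j - 1)) y)" for j :: nat and y
  have c\<psi>: "continuous_on D (\<psi> j)" for j
    using cont[OF bundle_continuous_L] c\<Psi>[OF F(1)] by (cases "j = 0") (auto simp: \<psi>_def[abs_def] intro!: continuous_intros)
  have "\<exists>B. \<forall>y\<in>D. \<bar>\<psi> j y\<bar> \<le> B" for j
    using compact_imp_bounded[OF compact_continuous_image[OF c\<psi> cD]] unfolding bounded_iff by (metis imageI real_norm_def)
  then obtain B where B: "\<And>j y. y \<in> D \<Longrightarrow> \<bar>\<psi> j y\<bar> \<le> B j" by metis
  show ?thesis
  proof (cases "\<forall>k \<beta>. \<forall>\<delta>>0. \<exists>y\<in>D. (\<Sum>j<Suc k. \<beta> j * \<psi> j y) < \<delta>")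
    case False
    then obtain k \<beta> \<delta> where k: "\<delta> > 0" "\<And>y. y \<in> D \<Longrightarrow> (\<Sum>j<Suc k. \<beta> j * \<psi> j y) \<ge> \<delta>" by (meson not_less)
    define f0 where "f0 x = (\<Sum>j<k. \<beta> (Suc j) * F j x)" for x
    have f0: "f0 \<in> C1" unfolding f0_def by (intro C1_sum C1_cmult F) auto
    have ge: "\<beta> 0 * (Lv (q y) + cG) + \<Psi> f0 y \<ge> \<delta>" if y: "y \<in> D" for y
    proof -
      have "\<Psi> f0 y = (\<Sum>j<k. \<beta> (Suc j) * \<Psi> (F j) y)"
        unfolding f0_def \<Psi>_def using qD(2)[OF y] F(1)
        by (subst differential_sum[OF qD(2)[OF y]]) (auto intro!: C1_cmult simp: differential_cmult)
      then have "(\<Sum>j<Suc k. \<beta> j * \<psi> j y) = \<beta> 0 * (Lv (q y) + cG) + \<Psi> f0 y"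
        unfolding sum.lessThan_Suc_shift by (simp add: \<psi>_def)
      then show ?thesis using k(2)[OF y] by simp
    qed
    have z0: "z0 \<in> cimage (c i0)" using Q(2)[OF i0(1)] i0(2) by blast
    note c0 = c[OF i0(1)]
    \<comment> \<open>Velocity zero removes the differentials. As L + c is nonnegative there, the
      coefficient of the action must be positive, and one may divide by it.\<close>
    have "\<beta> 0 * (Lc (c i0) z0 0 + cG) \<ge> \<delta>"
      using ge[OF y0] by (simp add: q Lc_def \<Psi>_def differential_eq_covec_of[OF f0 c0 cinv_in[OF c0 z0]]
          covec_of_apply[OF c0 cinv_in[OF c0 z0]])
    with k(1) have "\<beta> 0 * (Lc (c i0) z0 0 + cG) > 0" by linarith
    then have \<beta>0: "\<beta> 0 > 0" using Lc_zero_ge[OF c0 z0] by (simp add: zero_less_mult_iff)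
    define f where "f x = (- 1 / \<beta> 0) * f0 x" for x
    have f: "f \<in> C1" unfolding f_def by (rule C1_cmult[OF f0])
    have le: "\<Psi> f y \<le> Lv (q y) + (cG - \<delta> / \<beta> 0)" if y: "y \<in> D" for y
    proof -
      have "\<Psi> f y = (- 1 / \<beta> 0) * \<Psi> f0 y" unfolding f_def \<Psi>_def by (rule differential_cmult[OF qD(2)[OF y] f0])
      then show ?thesis using ge[OF y] \<beta>0 by (simp add: field_simps)
    qed
    have "G x (differential A f x) \<le> cG - \<delta> / \<beta> 0" if x: "x \<in> K" for x
    proof -
      obtain i z where i: "i < n" "z \<in> Q i" "x = cinv (c i) z" using cover[of x] by blast
      have zc: "z \<in> cimage (c i)" using Q(2)[OF i(1)] i(2) by blast
      note ci = c[OF i(1)] and xc = cinv_in[OF c[OF i(1)] zc]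
      have "Gc (c i) z (gr (f \<circ> cinv (c i)) z) \<le> cG - \<delta> / \<beta> 0"
      proof (rule R(2)[OF i(1) _ i(2)])
        show "cG - \<delta> / \<beta> 0 \<le> cG" using k(1) \<beta>0 by simp
        fix v :: 'e assume "norm v \<le> R i"
        then have "(real i, z, v) \<in> D" using i x by (intro inD) (auto simp: Z_def)
        from le[OF this] show "gr (f \<circ> cinv (c i)) z \<bullet> v \<le> Lc (c i) z v + (cG - \<delta> / \<beta> 0)"
          by (simp add: q Lc_def \<Psi>_def differential_eq_covec_of[OF f ci xc] covec_of_apply[OF ci xc] cmap_cinv[OF ci zc])
      qed
      then show ?thesis using G_differential[OF f ci xc] by (simp add: i(3) cmap_cinv[OF ci zc])
    qed
    moreover have "\<delta> / \<beta> 0 > 0" using k(1) \<beta>0 by simp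
    ultimately show ?thesis using f by blast
  next
    case True
    have "\<exists>\<tau>. set_pmf \<tau> \<subseteq> D \<and> (\<Sum>j<Suc k. (measure_pmf.expectation \<tau> (\<psi> j))\<^sup>2) < 1 / real (Suc k)" for k
    proof (rule pmf_alternative[of D "Suc k" \<psi> "Max (B ` {..<Suc k})" "1 / real (Suc k)"])
      show "D \<noteq> {}" using y0 by blast
      show "\<bar>\<psi> j y\<bar> \<le> Max (B ` {..<Suc k})" if "j < Suc k" "y \<in> D" for j y
        using B[OF that(2), of j] that(1) by (meson Max_ge finite_imageI finite_lessThan imageI lessThan_iff order_trans)
    qed (use True in auto)
    then obtain \<Lambda> where \<Lambda>: "\<And>k. set_pmf (\<Lambda> k) \<subseteq> D"
      "\<And>k. (\<Sum>j<Suc k. (measure_pmf.expectation (\<Lambda> k) (\<psi> j))\<^sup>2) < 1 / real (Suc k)" by metis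
    have lim0: "(\<lambda>k. measure_pmf.expectation (\<Lambda> k) (\<psi> j)) \<longlonglongrightarrow> 0" for j
    proof -
      have sq: "\<forall>\<^sub>F k in sequentially. (measure_pmf.expectation (\<Lambda> k) (\<psi> j))\<^sup>2 \<le> 1 / real (Suc k)"
        using eventually_ge_at_top[of j]
      proof eventually_elim
        case (elim k)
        have "(measure_pmf.expectation (\<Lambda> k) (\<psi> j))\<^sup>2 \<le> (\<Sum>j<Suc k. (measure_pmf.expectation (\<Lambda> k) (\<psi> j))\<^sup>2)"
          using elim by (intro member_le_sum) auto
        then show ?case using \<Lambda>(2)[of k] by linarith
      qed
      have "(\<lambda>k. (measure_pmf.expectation (\<Lambda> k) (\<psi> j))\<^sup>2) \<longlonglongrightarrow> 0"
        by (rule tendsto_sandwich[OF _ sq tendsto_const LIMSEQ_Suc[OF lim_1_over_n]]) simp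
      from tendsto_real_sqrt[OF this] show ?thesis by (simp add: tendsto_rabs_zero_iff)
    qed
    obtain r :: "nat \<Rightarrow> nat" and \<nu> where \<nu>: "strict_mono r" "prob_space \<nu>" "sets \<nu> = sets borel" "AE y in \<nu>. y \<in> D"
      "\<And>f :: real \<times> 'e \<times> 'e \<Rightarrow> real. continuous_on D f
        \<Longrightarrow> (\<lambda>n. measure_pmf.expectation (\<Lambda> (r n)) f) \<longlonglongrightarrow> (\<integral>y. indicator D y *\<^sub>R f y \<partial>\<nu>)"
      by (rule pmf_weak_limit[OF cD \<Lambda>(1)]) (rule that)
    have \<psi>0: "(\<integral>y. indicator D y *\<^sub>R \<psi> j y \<partial>\<nu>) = 0" for j
      using LIMSEQ_unique[OF \<nu>(5)[OF c\<psi>] LIMSEQ_subseq_LIMSEQ[OF lim0 \<nu>(1), unfolded o_def]] .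
    interpret \<nu>: prob_space \<nu> by (rule \<nu>(2))
    define y1 where "y1 = (real i0, z0, 0 :: 'e)"
    \<comment> \<open>The complement of D is a null set; sending it to a fixed point of D's image
      keeps the map into the bundle total and supported over K.\<close>
    define q' where "q' y = (if y \<in> D then q y else q y1)" for y
    have sp\<nu>: "space \<nu> = UNIV" using sets_eq_imp_space_eq[OF \<nu>(3)] by simp
    let ?TM = "borel_of (tangent_bundle A)"
    have q'm: "q' \<in> measurable \<nu> ?TM"
      unfolding borel_of_def
    proof (rule measurable_measure_of)
      show "{U. openin (tangent_bundle A) U} \<subseteq> Pow (topspace (tangent_bundle A))" by (auto dest: openin_subset)
      show "q' \<in> space \<nu> \<rightarrow> topspace (tangent_bundle A)"
      proof (rule Pi_I)
        fix y
        have "q' y = q (if y \<in> D then y else y1)" "(if y \<in> D then y else y1) \<in> D" using y0 by (simp_all add: q'_def y1_def)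
        then show "q' y \<in> topspace (tangent_bundle A)"
          using qD(2)[of "if y \<in> D then y else y1"] by (metis UNIV_I mem_Sigma_iff prod.collapse topspace_tangent_bundle)
      qed
      fix T assume "T \<in> {U. openin (tangent_bundle A) U}"
      then have T: "openin (tangent_bundle A) T" by simp
      have "{y \<in> P i. q y \<in> T} \<in> sets borel" if i: "i < n" for i
      proof -
        let ?O = "{(z, w). z \<in> cimage (c i) \<and> (cinv (c i) z, tvec_of A (c i) (cinv (c i) z) w) \<in> T}"
        have "open ?O" using T c[OF i] openin_tangent_bundle[OF atlas] by blast
        then have "open (UNIV \<times> ?O :: (real \<times> 'e \<times> 'e) set)" by (intro open_Times) auto
        moreover have "{y \<in> P i. q y \<in> T} = P i \<inter> (UNIV \<times> ?O)"
          using PE[of _ i] Z(2)[OF i] by (fastforce simp: q P_def)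
        moreover have "closed (P i)" by (rule compact_imp_closed[OF cP[OF i]])
        ultimately show ?thesis by (simp add: borel_open borel_closed sets.Int)
      qed
      then have "(\<Union>i\<in>{..<n}. {y \<in> P i. q y \<in> T}) \<in> sets borel" by (intro sets.finite_UN) auto
      moreover have "(\<Union>i\<in>{..<n}. {y \<in> P i. q y \<in> T}) = {y \<in> D. q y \<in> T}" by (auto simp: D_def)
      moreover have "D \<in> sets borel" by (rule borel_closed[OF compact_imp_closed[OF cD]])
      moreover have "q' -` T \<inter> space \<nu> = {y \<in> D. q y \<in> T} \<union> (if q y1 \<in> T then - D else {})"
        by (rule set_eqI) (simp add: q'_def sp\<nu>)
      ultimately show "q' -` T \<inter> space \<nu> \<in> sets \<nu>" unfolding \<nu>(3) by (auto intro: borel_comp)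
    qed
    define m where "m = distr \<nu> ?TM q'"
    have sm: "sets m = sets ?TM" by (simp add: m_def)
    have int: "integrable m F" "(\<integral>p. F p \<partial>m) = (\<integral>y. indicator D y *\<^sub>R F (q y) \<partial>\<nu>)"
      if F: "bundle_continuous F" for F :: "_ \<Rightarrow> real"
    proof -
      have Fm: "F \<in> borel_measurable ?TM" by (rule bundle_continuous_measurable[OF F refl])
      have Fq: "(\<lambda>y. F (q' y)) \<in> borel_measurable \<nu>" using measurable_compose[OF q'm Fm] .
      obtain B where B: "\<And>y. y \<in> D \<Longrightarrow> \<bar>F (q y)\<bar> \<le> B"
        using compact_imp_bounded[OF compact_continuous_image[OF cont[OF F] cD]] unfolding bounded_iff by (metis imageI real_norm_def)
      have "integrable \<nu> (\<lambda>y. F (q' y))"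
        using B y0 by (intro \<nu>.integrable_const_bound[of _ B] Fq) (auto simp: q'_def y1_def)
      then show "integrable m F" unfolding m_def integrable_distr_eq[OF q'm Fm] .
      have mi: "(\<lambda>y. indicator D y *\<^sub>R F (q y)) = (\<lambda>y. indicator D y *\<^sub>R F (q' y))" by (auto simp: q'_def indicator_def)
      have "D \<in> sets \<nu>" using borel_closed[OF compact_imp_closed[OF cD]] \<nu>(3) by simp
      then show "(\<integral>p. F p \<partial>m) = (\<integral>y. indicator D y *\<^sub>R F (q y) \<partial>\<nu>)"
        unfolding m_def integral_distr[OF q'm Fm] mi
      proof (intro integral_cong_AE)
        show "AE y in \<nu>. F (q' y) = indicator D y *\<^sub>R F (q' y)" using \<nu>(4) by eventually_elim simp
      qed (use Fq in auto)
    qed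
    have pm: "prob_space m" unfolding m_def by (rule \<nu>.prob_space_distr[OF q'm])
    then interpret m: prob_space m .
    have "(\<integral>y. indicator D y *\<^sub>R (Lv (q y) + cG) \<partial>\<nu>) = 0" using \<psi>0[of 0] by (simp add: \<psi>_def)
    moreover have "(\<integral>y. indicator D y *\<^sub>R (Lv (q y) + cG) \<partial>\<nu>) = (\<integral>p. Lv p + cG \<partial>m)"
    proof (rule int(2)[symmetric])
      show "bundle_continuous (\<lambda>p. Lv p + cG)"
        using bundle_continuous_L unfolding bundle_continuous_def case_prod_unfold by (auto intro!: continuous_intros)
    qed
    ultimately have L: "(\<integral>p. Lv p \<partial>m) = - cG"
      using int(1)[OF bundle_continuous_L] by (simp add: m.prob_space)
    \<comment> \<open>The weak limit annihilates the dense sequence; uniform approximation of the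
      differentials on D extends this to every f.\<close>
    have diff: "(\<integral>p. dv f p \<partial>m) = 0" if f: "f \<in> C1" for f
    proof -
      have i2: "(\<integral>p. dv f p \<partial>m) = (\<integral>y. indicator D y *\<^sub>R \<Psi> f y \<partial>\<nu>)" if "f \<in> C1" for f
        unfolding \<Psi>_def by (rule int(2)[OF bundle_continuous_differential[OF that]])
      have "\<bar>\<integral>p. dv f p \<partial>m\<bar> \<le> 0"
      proof (rule field_le_epsilon)
        fix e :: real assume "e > 0"
        then obtain j where j: "\<And>y. y \<in> D \<Longrightarrow> \<bar>\<Psi> f y - \<Psi> (F j) y\<bar> \<le> e" using F(2)[OF f] by blast
        have "(\<integral>p. dv (F j) p \<partial>m) = 0" using \<psi>0[of "Suc j"] i2[OF F(1)] by (simp add: \<psi>_def)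
        then have "\<bar>\<integral>p. dv f p \<partial>m\<bar>
            = \<bar>\<integral>p. dv f p - dv (F j) p \<partial>m\<bar>"
          using int(1)[OF bundle_continuous_differential[OF f]] int(1)[OF bundle_continuous_differential[OF F(1)[of j]]] by simp
        also have "\<dots> \<le> (\<integral>p. \<bar>dv f p - dv (F j) p\<bar> \<partial>m)"
          by (rule integral_abs_bound)
        also have "\<dots> \<le> e"
        proof (rule m.integral_le_const)
          show "integrable m (\<lambda>p. \<bar>dv f p - dv (F j) p\<bar>)"
            by (intro integrable_abs Bochner_Integration.integrable_diff int(1) bundle_continuous_differential f F)
          have me: "{p \<in> space ?TM. \<bar>dv f p - dv (F j) p\<bar> \<le> e} \<in> sets ?TM"
            using bundle_continuous_measurable[OF bundle_continuous_differential[OF f] refl]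
              bundle_continuous_measurable[OF bundle_continuous_differential[OF F(1)[of j]] refl] by measurable
          show "AE p in m. \<bar>dv f p - dv (F j) p\<bar> \<le> e"
            unfolding m_def AE_distr_iff[OF q'm me] using \<nu>(4) by eventually_elim (use j in \<open>simp add: q'_def \<Psi>_def\<close>)
        qed
        finally show "\<bar>\<integral>p. dv f p \<partial>m\<bar> \<le> 0 + e" by simp
      qed
      then show ?thesis by simp
    qed
    have "mather m"
      unfolding mather_measure_def closed_measure_def
      using sm pm int(1)[OF bundle_continuous_tnorm] int(1)[OF bundle_continuous_L] L diff by (simp add: case_prod_unfold)
    moreover have "AE p in m. fst p \<in> K"
    proof -
      have "{p \<in> space ?TM. fst p \<in> K} \<in> sets ?TM"
        using measurable_sets[OF bundle_continuous_measurable[OF bundle_continuous_base[OF continuous_on_id] refl] borel_closed[OF clK]]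
        by (simp add: vimage_def Int_def conj_commute)
      from AE_distr_iff[OF q'm this] show ?thesis unfolding m_def
        using qD(1) y0 by (simp add: q'_def y1_def)
    qed
    ultimately show ?thesis by blast
  qed
qed

lemma mather_ex: "\<exists>m. mather m"
proof -
  have "\<not> (\<exists>f\<in>C1. \<exists>\<delta>>0. \<forall>x\<in>UNIV. G x (differential A f x) \<le> cG - \<delta>)"
    using critical_le by fastforce
  then show ?thesis using mather_or_strict_subsolution[OF compact_M] by blast
qed

end

context hamiltonian
begin

subsection \<open>Finiteness of the Peierls barrier\<close>

text \<open>The averaged potential is a subsolution with margin proportional to S_N - S_e, which
  must vanish almost everywhere: at almost every endpoint, forbidding short times costs
  nothing.\<close>

lemma S_stationary:
  assumes m: "mather m" and e: "e > 0"
  shows "AE p in m. \<forall>n::nat. S (real n) x0 (fst p) \<le> S e x0 (fst p)"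
proof -
  have "AE p in m. S (real n) x0 (fst p) \<le> S e x0 (fst p)" for n :: nat
  proof -
    define N where "N = max (real n) e"
    have N: "N > 0" "e \<le> N" "real n \<le> N" using e by (auto simp: N_def)
    have "AE p in m. (S N x0 (fst p) - S e x0 (fst p)) / (N + 1) = 0"
    proof (rule margin_null[OF m S_average_VSb[OF e N(1)]])
      show "continuous_on UNIV (\<lambda>x. (S N x0 x - S e x0 x) / (N + 1))"
        using N(1) by (intro continuous_intros dominated_continuous S_dominated) auto
      show "0 \<le> (S N x0 x - S e x0 x) / (N + 1)" for x using S_mono[OF N(2), of x0 x] N(1) by simp
    qed
    then show ?thesis
    proof eventually_elim
      case (elim p)
      then show ?case using N(1) S_mono[OF N(3), of x0 "fst p"] by simp
    qed
  qed
  then show ?thesis by (simp add: AE_all_countable)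
qed

text \<open>A single point at which the potentials stabilise suffices; a fixed curve leads from it
  to y.\<close>

lemma S_bounded: "\<exists>B. \<forall>n::nat. S (real n) x y \<le> B"
proof -
  obtain m where m: "mather m" using mather_ex by blast
  interpret m: prob_space m by (rule prob_mather[OF m])
  have "\<exists>p. \<forall>n::nat. S (real n) x (fst p) \<le> S 1 x (fst p)"
    using S_stationary[OF m, of 1 x] m.ae_filter_bot eventually_happens' by fastforce
  then obtain p where p: "\<And>n::nat. S (real n) x (fst p) \<le> S 1 x (fst p)" by blast
  obtain r l where r: "r > 0" "reach r (fst p) y l" using reach_connected by blast
  have "S (real n) x y \<le> S 1 x (fst p) + (l + cG * r)" for n :: nat
    using S_mono[of "real n" "real n + r" x y] S_step_right[OF r, of "real n" x] p[of n] r(1) by linarith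
  then show ?thesis by blast
qed

definition h :: "'m \<Rightarrow> 'm \<Rightarrow> real" where
  "h x y = (SUP n::nat. S (real n) x y)"

lemma peierls_barrier_eq_h: "peierls_barrier A G x y = ereal (h x y)"
  using S_bounded[of x y] peierls_barrier_eq[of x y] unfolding h_def by blast

lemma S_le_h: "S s x y \<le> h x y"
proof -
  obtain n :: nat where "s \<le> real n" using real_arch_simple by blast
  then have "S s x y \<le> S (real n) x y" by (rule S_mono)
  also have "\<dots> \<le> h x y" unfolding h_def using S_bounded[of x y] by (intro cSUP_upper) (auto simp: bdd_above_def)
  finally show ?thesis .
qed

lemma h_le: "(\<And>n::nat. S (real n) x y \<le> B) \<Longrightarrow> h x y \<le> B"
  unfolding h_def by (rule cSUP_least) auto

lemma h_step_left:
  assumes "r > 0" "reach r x' x l" shows "h x' y \<le> (l + cG * r) + h x y"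
proof (rule h_le)
  fix n :: nat
  show "S (real n) x' y \<le> (l + cG * r) + h x y"
    using S_mono[of "real n" "real n + r" x' y] S_step_left[OF assms, of "real n" y] S_le_h[of "real n" x y] assms(1) by linarith
qed

lemma h_dominated: "dominated (h x)"
  unfolding dominated_def
proof (intro allI impI)
  fix r y y' l assume r: "r > (0::real)" "reach r y y' l"
  have "h x y' \<le> h x y + (l + cG * r)"
  proof (rule h_le)
    fix n :: nat
    show "S (real n) x y' \<le> h x y + (l + cG * r)"
      using S_mono[of "real n" "real n + r" x y'] S_step_right[OF r, of "real n" x] S_le_h[of "real n" x y] r(1) by linarith
  qed
  then show "h x y' - h x y \<le> l + cG * r" by simp
qed

lemma neg_h_dominated: "dominated (\<lambda>x. - h x y)"
  unfolding dominated_def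
proof (intro allI impI)
  fix r x x' l assume r: "r > (0::real)" "reach r x x' l"
  show "- h x' y - - h x y \<le> l + cG * r" using h_step_left[OF r, of y] by simp
qed

lemma h_continuous: "continuous_on UNIV (h x)"
  by (rule dominated_continuous[OF h_dominated])

lemma h_continuous_left: "continuous_on UNIV (\<lambda>x. h x y)"
  using continuous_on_minus[OF dominated_continuous[OF neg_h_dominated[of y]]] by simp

lemma h_triangle: "h x z \<le> h x y + h y z"
proof -
  have "h x z - h y z \<le> S 1 x y"
  proof (rule S_greatest)
    fix t k assume "t > (0::real)" "reach t x y k"
    from h_step_left[OF this, of z] show "h x z - h y z \<le> k + cG * t" by linarith
  qed
  then show ?thesis using S_le_h[of 1 x y] by linarith
qed

lemma dominated_le_h: "dominated u \<Longrightarrow> u y - u x \<le> h x y"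
  using dominated_le_S[of u y x 1] S_le_h[of 1 x y] by linarith

text \<open>Resting at z for a short time is cheap, so h(z,z) > 0 means that short loops at z cost
  strictly less than long ones. This is an open condition on the endpoint, and
  \<open>S_stationary\<close> excludes it almost everywhere.\<close>

lemma h_pos_null:
  assumes m: "mather m" and z: "h z z > 0"
  shows "\<exists>U. open U \<and> z \<in> U \<and> (AE p in m. fst p \<notin> U)"
proof -
  obtain k0 where k0: "\<And>r. r > 0 \<Longrightarrow> reach r z z (r * k0)" using reach_rest by blast
  define q where "q = \<bar>k0 + cG\<bar> + 1"
  have q: "q > 0" "k0 + cG \<le> q" by (auto simp: q_def)
  \<comment> \<open>Resting for the time e costs at most e q, half of h z z.\<close>
  define e where "e = h z z / (2 * q)"
  have e: "e > 0" using z q by (simp add: e_def)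
  have "e * k0 + cG * e = e * (k0 + cG)" by (simp add: algebra_simps)
  also have "\<dots> \<le> e * q" using e q by (intro mult_left_mono) auto
  also have "\<dots> = h z z / 2" unfolding e_def using q by simp
  also have "\<dots> < h z z" using z by simp
  finally have "S e z z < h z z" using S_le[of e e z z "e * k0"] k0[OF e] e by simp
  define U where "U = {x. S e z x < h z x}"
  have "open U" unfolding U_def
    by (intro open_Collect_less dominated_continuous S_dominated h_dominated)
  moreover have "z \<in> U" using \<open>S e z z < h z z\<close> by (simp add: U_def)
  moreover have "AE p in m. fst p \<notin> U"
    using S_stationary[OF m e, of z] by eventually_elim (simp add: U_def not_less h_le)
  ultimately show ?thesis by blast
qed

subsection \<open>Splitting Mather measures\<close>

definition mean :: "('m \<times> ('m, 'e) tvec) measure \<Rightarrow> ('m \<Rightarrow> real) \<Rightarrow> real" where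
  "mean m F = (\<integral>p. F (fst p) \<partial>m)"

lemma mean_add:
  "mather m \<Longrightarrow> continuous_on UNIV F \<Longrightarrow> continuous_on UNIV H \<Longrightarrow> mean m (\<lambda>x. F x + H x) = mean m F + mean m H"
  unfolding mean_def by (intro Bochner_Integration.integral_add integrable_base_mather)

lemma mean_cmult: "mean m (\<lambda>x. a * F x) = a * mean m F"
  unfolding mean_def by simp

lemma mean_mono:
  "mather m \<Longrightarrow> continuous_on UNIV F \<Longrightarrow> continuous_on UNIV H \<Longrightarrow> (\<And>x. F x \<le> H x) \<Longrightarrow> mean m F \<le> mean m H"
  unfolding mean_def by (intro integral_mono integrable_base_mather)

lemma mean_const: "mather m \<Longrightarrow> mean m (\<lambda>_. a) = a"
  unfolding mean_def using prob_space.prob_space[OF prob_mather[of m]] by simp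

lemma mean_cong_AE:
  assumes "mather m" "continuous_on UNIV F" "continuous_on UNIV H" "AE p in m. F (fst p) = H (fst p)"
  shows "mean m F = mean m H"
  unfolding mean_def using assms(4) borel_measurable_integrable[OF integrable_base_mather[OF assms(1)]] assms(2,3)
  by (intro integral_cong_AE) auto

text \<open>Densities whose product with m is closed and minimal up to normalisation. Without
  normalisation the conditions are linear, so pieces can be split further and may have mass
  zero.\<close>

definition calibrated :: "('m \<times> ('m, 'e) tvec) measure \<Rightarrow> ('m \<Rightarrow> real) \<Rightarrow> bool" where
  "calibrated m \<rho> \<longleftrightarrow> continuous_on UNIV \<rho> \<and> (\<forall>x. 0 \<le> \<rho> x \<and> \<rho> x \<le> 1) \<and>
     (\<forall>f\<in>C1. (\<integral>p. \<rho> (fst p) * dv f p \<partial>m) = 0) \<and>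
     (\<integral>p. \<rho> (fst p) * (Lv p + cG) \<partial>m) = 0"

lemma integrable_L_add_mather: "mather m \<Longrightarrow> integrable m (\<lambda>p. Lv p + a)"
  using prob_space.finite_measure[OF prob_mather[of m]]
  by (intro Bochner_Integration.integrable_add integrable_L_mather finite_measure.integrable_const)

lemma calibrated_one:
  assumes m: "mather m" shows "calibrated m (\<lambda>_. 1)"
proof -
  interpret prob_space m by (rule prob_mather[OF m])
  show ?thesis unfolding calibrated_def
    using integral_differential_mather[OF m] integrable_L_mather[OF m] integral_L_mather[OF m] by (simp add: prob_space)
qed

lemma calibrated_normalize:
  assumes m: "mather m" and \<rho>: "calibrated m \<rho>" and I: "mean m \<rho> > 0"
  obtains m' where "mather m'" "\<And>F. continuous_on UNIV F \<Longrightarrow> mean m' F = mean m (\<lambda>x. \<rho> x * F x) / mean m \<rho>"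
proof -
  have c: "continuous_on UNIV \<rho>" and \<rho>0: "\<And>x. \<rho> x \<ge> 0"
    and \<rho>d: "\<And>f. f \<in> C1 \<Longrightarrow> (\<integral>p. \<rho> (fst p) * dv f p \<partial>m) = 0"
    and \<rho>L: "(\<integral>p. \<rho> (fst p) * (Lv p + cG) \<partial>m) = 0"
    using \<rho> by (auto simp: calibrated_def)
  let ?I = "mean m \<rho>"
  define d where "d x = \<rho> x / ?I" for x
  have cd: "continuous_on UNIV d" unfolding d_def[abs_def] using I by (intro continuous_intros c) auto
  have d0: "d x \<ge> 0" for x using \<rho>0 I by (simp add: d_def)
  have dm: "(\<lambda>p. d (fst p)) \<in> borel_measurable m" using borel_measurable_integrable[OF integrable_base_mather[OF m cd]] .
  define m' where "m' = density m (\<lambda>p. ennreal (d (fst p)))"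
  have int: "(\<integral>p. H p \<partial>m') = (\<integral>p. \<rho> (fst p) * H p \<partial>m) / ?I" if "integrable m H" for H :: "_ \<Rightarrow> real"
  proof -
    have "(\<integral>p. H p \<partial>m') = (\<integral>p. d (fst p) *\<^sub>R H p \<partial>m)"
      unfolding m'_def using that d0 by (intro integral_density dm) auto
    then show ?thesis by (simp add: d_def)
  qed
  have ib: "integrable m' H" if "integrable m H" for H :: "_ \<Rightarrow> real"
  proof -
    have "integrable m (\<lambda>p. d (fst p) *\<^sub>R H p)" using integrable_mult_mather[OF m cd that] by simp
    then show ?thesis
      unfolding m'_def using that d0 by (subst integrable_density[OF _ dm]) auto
  qed
  have sets: "sets m' = sets m" by (simp add: m'_def)
  have "prob_space m'"
  proof (rule prob_spaceI)
    have "emeasure m' (space m') = (\<integral>\<^sup>+p. ennreal (d (fst p)) * indicator (space m) p \<partial>m)"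
      unfolding m'_def using dm by (simp add: emeasure_density)
    also have "\<dots> = (\<integral>\<^sup>+p. ennreal (d (fst p)) \<partial>m)" by (intro nn_integral_cong) simp
    also have "\<dots> = ennreal (\<integral>p. d (fst p) \<partial>m)"
      using d0 by (intro nn_integral_eq_integral integrable_base_mather[OF m cd]) auto
    also have "(\<integral>p. d (fst p) \<partial>m) = 1" using I by (simp add: d_def mean_def)
    finally show "emeasure m' (space m') = 1" by simp
  qed
  then interpret m': prob_space m' .
  have "(\<integral>p. Lv p + cG \<partial>m') = 0"
    using int[OF integrable_L_add_mather[OF m, of cG]] \<rho>L by simp
  then have "(\<integral>p. Lv p \<partial>m') = - cG"
    using ib[OF integrable_L_mather[OF m]] by (simp add: m'.prob_space)
  then have "mather m'"
    unfolding mather_measure_def closed_measure_def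
    using sets sets_mather[OF m] m'.prob_space_axioms ib[OF integrable_tnorm_mather[OF m]] ib[OF integrable_L_mather[OF m]]
      int[OF integrable_differential_mather[OF m]] \<rho>d
    by (simp add: case_prod_unfold)
  moreover have "mean m' F = mean m (\<lambda>x. \<rho> x * F x) / ?I" if "continuous_on UNIV F" for F
    using int[OF integrable_base_mather[OF m that]] by (simp add: mean_def)
  ultimately show thesis using that by blast
qed

text \<open>
  Smooth approximations of two subsolutions have asymptotically the same differential on the support
  of a Mather measure, so a function of their difference acts as a constant density.
\<close>

lemma calibrated_mult:
  fixes \<theta> \<theta>' :: "real \<Rightarrow> real"
  assumes m: "mather m" and \<rho>: "calibrated m \<rho>" and u: "dominated u1" "dominated u2"
    and \<theta>: "\<And>t. (\<theta> has_real_derivative \<theta>' t) (at t)" "continuous_on UNIV \<theta>'" "\<And>t. \<bar>\<theta>' t\<bar> \<le> K" "\<And>t. 0 \<le> \<theta> t \<and> \<theta> t \<le> 1"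
  shows "calibrated m (\<lambda>x. \<rho> x * \<theta> (u1 x - u2 x))"
proof -
  have c: "continuous_on UNIV \<rho>" and \<rho>0: "\<And>x. \<rho> x \<ge> 0" and \<rho>1: "\<And>x. \<rho> x \<le> 1"
    and \<rho>d: "\<And>f. f \<in> C1 \<Longrightarrow> (\<integral>p. \<rho> (fst p) * dv f p \<partial>m) = 0"
    and \<rho>L: "(\<integral>p. \<rho> (fst p) * (Lv p + cG) \<partial>m) = 0"
    using \<rho> by (auto simp: calibrated_def)
  have K: "K \<ge> 0" using \<theta>(3)[of 0] by linarith
  have lip: "\<bar>\<theta> a - \<theta> b\<bar> \<le> K * \<bar>a - b\<bar>" for a b
    using field_differentiable_bound[of UNIV \<theta> \<theta>' K a b] \<theta>(1,3) by (auto simp: has_field_derivative_at_within)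
  define W where "W x = \<theta> (u1 x - u2 x)" for x
  have c\<theta>: "continuous_on UNIV \<theta>" using \<theta>(1) by (meson DERIV_isCont continuous_at_imp_continuous_on)
  have cW: "continuous_on UNIV W" unfolding W_def
    by (intro continuous_on_compose2[OF c\<theta>] continuous_intros dominated_continuous u) auto
  have W01: "0 \<le> W x" "W x \<le> 1" for x using \<theta>(4) by (auto simp: W_def)
  have \<rho>1mean: "mean m \<rho> \<le> 1" using mean_mono[OF m c continuous_on_const[of _ 1] \<rho>1] mean_const[OF m, of 1] by simp
  have zero: "(\<integral>p. (\<rho> (fst p) * W (fst p)) * dv f p \<partial>m) = 0" if f: "f \<in> C1" for f
  proof -
    obtain B where B: "B > 0" "\<And>x. \<bar>f x\<bar> \<le> B" using continuous_bounded[OF C1_continuous[OF f]] by blast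
    let ?df = "\<lambda>p. dv f p"
    define J where "J = (\<integral>p. \<bar>\<rho> (fst p) * ?df p\<bar> \<partial>m)"
    have iJ: "integrable m (\<lambda>p. \<bar>\<rho> (fst p) * ?df p\<bar>)"
      by (intro integrable_abs integrable_mult_mather[OF m c] integrable_differential_mather[OF m f])
    have J0: "J \<ge> 0" unfolding J_def by (intro integral_nonneg_AE) auto
    \<comment> \<open>Replacing the subsolutions by smooth functions costs 2 K J per unit of
      \<epsilon>, the two defects \<open>N\<close> cost 2 B K, and the 1 keeps C positive.\<close>
    define C where "C = 2 * K * J + 2 * B * K + 1"
    have C: "C > 0" using K J0 B(1) by (simp add: C_def add_nonneg_pos)
    have "\<bar>\<integral>p. (\<rho> (fst p) * W (fst p)) * ?df p \<partial>m\<bar> \<le> 0"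
    proof (rule field_le_epsilon)
      fix e :: real assume "e > 0"
      define \<epsilon> where "\<epsilon> = e / C"
      have \<epsilon>: "\<epsilon> > 0" using \<open>e > 0\<close> C by (simp add: \<epsilon>_def)
      obtain f1 where f1: "f1 \<in> C1" "\<And>x. \<bar>f1 x - u1 x\<bar> \<le> \<epsilon>" "\<And>x. G x (differential A f1 x) \<le> cG + \<epsilon>"
        by (rule smooth_approximation[OF dominated_VS[OF u(1)] \<epsilon>]) (rule that)
      obtain f2 where f2: "f2 \<in> C1" "\<And>x. \<bar>f2 x - u2 x\<bar> \<le> \<epsilon>" "\<And>x. G x (differential A f2 x) \<le> cG + \<epsilon>"
        by (rule smooth_approximation[OF dominated_VS[OF u(2)] \<epsilon>]) (rule that)
      \<comment> \<open>The nonnegative defect in the Fenchel inequality. Since \<rho> is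
        calibrated, its weighted integral is at most \<epsilon>; the differentials of f1 and f2
        differ by at most the sum of their defects, hence little in the mean.\<close>
      define N where "N f p = Lv p + (cG + \<epsilon>) - dv f p" for f p
      have iN: "integrable m (N f)" if "f \<in> C1" for f
        unfolding N_def[abs_def] by (intro Bochner_Integration.integrable_diff integrable_L_add_mather m integrable_differential_mather that)
      have N0: "N f p \<ge> 0" if "f \<in> C1" "\<And>x. G x (differential A f x) \<le> cG + \<epsilon>" "p \<in> space m" for f p
        using differential_le_L[OF that(1) tangent_mather[OF m that(3)]] that(2)[of "fst p"] by (simp add: N_def)
      have IN: "(\<integral>p. \<rho> (fst p) * N f p \<partial>m) \<le> \<epsilon>" if f: "f \<in> C1" for f
      proof -
        have "(\<integral>p. \<rho> (fst p) * N f p \<partial>m) = (\<integral>p. (\<rho> (fst p) * (Lv p + cG) + \<epsilon> * \<rho> (fst p))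
            - \<rho> (fst p) * dv f p \<partial>m)"
          by (intro Bochner_Integration.integral_cong) (auto simp: N_def algebra_simps)
        also have "\<dots> = \<epsilon> * mean m \<rho>"
          using integrable_mult_mather[OF m c integrable_L_add_mather[OF m]] integrable_base_mather[OF m c]
            integrable_mult_mather[OF m c integrable_differential_mather[OF m f]] \<rho>L \<rho>d[OF f]
          by (simp add: mean_def)
        also have "\<dots> \<le> \<epsilon> * 1" using \<epsilon> \<rho>1mean by (intro mult_left_mono) auto
        finally show ?thesis by simp
      qed
      \<comment> \<open>The closedness of \<rho> is tested with the product of \<psi> and f. In the
        product rule the term with the differential of \<psi> is controlled by the defects, which
        leaves \<psi> times df.\<close>
      define \<psi> where "\<psi> x = \<theta> (f1 x + (- 1) * f2 x)" for x
      have f12: "(\<lambda>x. f1 x + (- 1) * f2 x) \<in> C1" by (intro C1_add C1_cmult f1 f2)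
      have c\<theta>': "continuous_on (range (\<lambda>x. f1 x + (- 1) * f2 x)) \<theta>'" using \<theta>(2) continuous_on_subset by blast
      have \<psi>: "\<psi> \<in> C1" unfolding \<psi>_def by (rule C1_compose_real[OF f12 \<theta>(1) c\<theta>'])
      have \<psi>f: "(\<lambda>x. \<psi> x * f x) \<in> C1" by (rule C1_mult[OF \<psi> f])
      let ?dp = "\<lambda>p. dv (\<lambda>x. \<psi> x * f x) p"
      have pt: "\<bar>(\<rho> (fst p) * W (fst p)) * ?df p - \<rho> (fst p) * ?dp p\<bar>
          \<le> (2 * K * \<epsilon>) * \<bar>\<rho> (fst p) * ?df p\<bar> + (B * K) * (\<rho> (fst p) * N f1 p + \<rho> (fst p) * N f2 p)"
        if p: "p \<in> space m" for p
      proof -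
        define x where "x = fst p"
        have v: "snd p \<in> tangent_space A x" using tangent_mather[OF m p] by (simp add: x_def)
        define D where "D = differential A f1 x (snd p) - differential A f2 x (snd p)"
        define t where "t = \<theta>' (f1 x + (- 1) * f2 x)"
        have d\<psi>: "differential A \<psi> x (snd p) = t * D"
          unfolding \<psi>_def differential_compose_real[OF v f12 \<theta>(1) c\<theta>']
          by (simp only: differential_add[OF v f1(1) C1_cmult[OF f2(1)]] differential_cmult[OF v f2(1)] t_def D_def) simp
        have dp: "?dp p = \<psi> x * ?df p + f x * (t * D)"
          unfolding x_def[symmetric] differential_mult[OF v \<psi> f] d\<psi> ..
        have N: "N f1 p \<ge> 0" "N f2 p \<ge> 0" using N0[OF f1(1,3) p] N0[OF f2(1,3) p] .
        have D: "\<bar>D\<bar> \<le> N f1 p + N f2 p" using N by (simp add: D_def N_def x_def abs_le_iff)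
        have "\<bar>W x - \<psi> x\<bar> \<le> K * \<bar>(u1 x - u2 x) - (f1 x + (- 1) * f2 x)\<bar>" unfolding W_def \<psi>_def by (rule lip)
        also have "\<dots> \<le> K * (2 * \<epsilon>)" using f1(2)[of x] f2(2)[of x] K by (intro mult_left_mono) auto
        finally have W\<psi>: "\<bar>W x - \<psi> x\<bar> \<le> 2 * K * \<epsilon>" by simp
        have eq: "(\<rho> x * W x) * ?df p - \<rho> x * ?dp p = (W x - \<psi> x) * (\<rho> x * ?df p) - (f x * t) * (\<rho> x * D)"
          unfolding dp by (simp add: algebra_simps)
        have "\<bar>(\<rho> x * W x) * ?df p - \<rho> x * ?dp p\<bar> \<le> \<bar>W x - \<psi> x\<bar> * \<bar>\<rho> x * ?df p\<bar> + \<bar>f x * t\<bar> * \<bar>\<rho> x * D\<bar>"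
          unfolding eq abs_mult[symmetric] by (rule abs_triangle_ineq4)
        also have "\<dots> \<le> (2 * K * \<epsilon>) * \<bar>\<rho> x * ?df p\<bar> + (B * K) * (\<rho> x * (N f1 p + N f2 p))"
        proof (intro add_mono mult_mono W\<psi> order_refl)
          show "\<bar>f x * t\<bar> \<le> B * K" unfolding abs_mult using B \<theta>(3) K by (intro mult_mono) (auto simp: t_def)
          show "\<bar>\<rho> x * D\<bar> \<le> \<rho> x * (N f1 p + N f2 p)" unfolding abs_mult using \<rho>0 D by (intro mult_mono) auto
        qed (use K \<epsilon> B in auto)
        finally show ?thesis by (simp add: x_def distrib_left)
      qed
      have i1: "integrable m (\<lambda>p. (\<rho> (fst p) * W (fst p)) * ?df p)"
        by (rule integrable_mult_mather[OF m continuous_on_mult[OF c cW] integrable_differential_mather[OF m f]])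
      have i2: "integrable m (\<lambda>p. \<rho> (fst p) * ?dp p)"
        by (rule integrable_mult_mather[OF m c integrable_differential_mather[OF m \<psi>f]])
      have i3: "integrable m (\<lambda>p. \<rho> (fst p) * N f1 p)" "integrable m (\<lambda>p. \<rho> (fst p) * N f2 p)"
        by (intro integrable_mult_mather[OF m c] iN f1 f2)+
      have "\<bar>\<integral>p. (\<rho> (fst p) * W (fst p)) * ?df p \<partial>m\<bar> = \<bar>\<integral>p. (\<rho> (fst p) * W (fst p)) * ?df p - \<rho> (fst p) * ?dp p \<partial>m\<bar>"
        using \<rho>d[OF \<psi>f] by (simp add: Bochner_Integration.integral_diff[OF i1 i2])
      also have "\<dots> \<le> (\<integral>p. \<bar>(\<rho> (fst p) * W (fst p)) * ?df p - \<rho> (fst p) * ?dp p\<bar> \<partial>m)" by (rule integral_abs_bound)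
      also have "\<dots> \<le> (\<integral>p. (2 * K * \<epsilon>) * \<bar>\<rho> (fst p) * ?df p\<bar> + (B * K) * (\<rho> (fst p) * N f1 p + \<rho> (fst p) * N f2 p) \<partial>m)"
        by (rule integral_mono[OF _ _ pt])
          (intro integrable_abs Bochner_Integration.integrable_diff i1 i2 Bochner_Integration.integrable_add integrable_mult_right iJ i3; simp)+
      also have "\<dots> = (2 * K * \<epsilon>) * J + (B * K) * ((\<integral>p. \<rho> (fst p) * N f1 p \<partial>m) + (\<integral>p. \<rho> (fst p) * N f2 p \<partial>m))"
        using iJ i3 by (simp add: J_def)
      also have "\<dots> \<le> (2 * K * \<epsilon>) * J + (B * K) * (\<epsilon> + \<epsilon>)"
        using IN[OF f1(1)] IN[OF f2(1)] B K by (intro add_mono mult_left_mono order_refl) auto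
      also have "\<dots> \<le> \<epsilon> * C" using \<epsilon> by (simp add: C_def algebra_simps)
      also have "\<dots> = e" using C by (simp add: \<epsilon>_def)
      finally show "\<bar>\<integral>p. (\<rho> (fst p) * W (fst p)) * ?df p \<partial>m\<bar> \<le> 0 + e" by simp
    qed
    then show ?thesis by simp
  qed
  \<comment> \<open>Every closed density gives L + c a nonnegative integral. Applied to \<rho> W and
    \<rho> (1 - W), whose integrals add up to zero, this makes both vanish.\<close>
  have nonneg: "(\<integral>p. \<tau> (fst p) * (Lv p + cG) \<partial>m) \<ge> 0"
    if ct: "continuous_on UNIV \<tau>" and t01: "\<And>x. 0 \<le> \<tau> x" "\<And>x. \<tau> x \<le> 1"
      and z: "\<And>f. f \<in> C1 \<Longrightarrow> (\<integral>p. \<tau> (fst p) * dv f p \<partial>m) = 0" for \<tau>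
  proof (rule field_le_epsilon)
    fix e :: real assume e: "e > 0"
    obtain f where f: "f \<in> C1" "\<And>x. G x (differential A f x) \<le> cG + e" using critical_C1[OF e] by blast
    have "0 = (\<integral>p. \<tau> (fst p) * dv f p \<partial>m)" using z[OF f(1)] by simp
    also have "\<dots> \<le> (\<integral>p. \<tau> (fst p) * (Lv p + cG) + e \<partial>m)"
    proof (rule integral_mono)
      show "integrable m (\<lambda>p. \<tau> (fst p) * dv f p)"
        by (intro integrable_mult_mather m ct integrable_differential_mather f)
      show "integrable m (\<lambda>p. \<tau> (fst p) * (Lv p + cG) + e)"
        using prob_space.finite_measure[OF prob_mather[OF m]]
        by (intro Bochner_Integration.integrable_add integrable_mult_mather m ct integrable_L_add_mather finite_measure.integrable_const)
      fix p assume p: "p \<in> space m"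
      have "dv f p \<le> Lv p + cG + e"
        using differential_le_L[OF f(1) tangent_mather[OF m p]] f(2)[of "fst p"] by linarith
      then have "\<tau> (fst p) * dv f p \<le> \<tau> (fst p) * (Lv p + cG + e)"
        using t01 by (intro mult_left_mono) auto
      also have "\<dots> = \<tau> (fst p) * (Lv p + cG) + \<tau> (fst p) * e" by (simp add: algebra_simps)
      also have "\<tau> (fst p) * e \<le> 1 * e" using t01 e by (intro mult_right_mono) auto
      finally show "\<tau> (fst p) * dv f p \<le> \<tau> (fst p) * (Lv p + cG) + e" by simp
    qed
    also have "\<dots> = (\<integral>p. \<tau> (fst p) * (Lv p + cG) \<partial>m) + e"
      using integrable_mult_mather[OF m ct integrable_L_add_mather[OF m]] prob_space.finite_measure[OF prob_mather[OF m]]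
        prob_space.prob_space[OF prob_mather[OF m]]
      by (subst Bochner_Integration.integral_add) (auto intro: finite_measure.integrable_const)
    finally show "0 \<le> (\<integral>p. \<tau> (fst p) * (Lv p + cG) \<partial>m) + e" .
  qed
  let ?LG = "\<lambda>p. Lv p + cG"
  have c1: "continuous_on UNIV (\<lambda>x. \<rho> x * W x)" "continuous_on UNIV (\<lambda>x. \<rho> x * (1 - W x))"
    by (intro continuous_intros c cW)+
  have b1: "0 \<le> \<rho> x * W x" "\<rho> x * W x \<le> 1" "0 \<le> \<rho> x * (1 - W x)" "\<rho> x * (1 - W x) \<le> 1" for x
    using \<rho>0[of x] \<rho>1[of x] W01[of x] by (auto intro!: mult_le_one mult_nonneg_nonneg)
  have "(\<integral>p. (\<rho> (fst p) * W (fst p)) * ?LG p \<partial>m) \<ge> 0" by (rule nonneg[OF c1(1) b1(1,2) zero])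
  moreover have "(\<integral>p. (\<rho> (fst p) * (1 - W (fst p))) * ?LG p \<partial>m) \<ge> 0"
  proof (rule nonneg[OF c1(2) b1(3,4)])
    fix f assume f: "f \<in> C1"
    let ?df = "\<lambda>p. dv f p"
    have "(\<integral>p. (\<rho> (fst p) * (1 - W (fst p))) * ?df p \<partial>m) = (\<integral>p. \<rho> (fst p) * ?df p - (\<rho> (fst p) * W (fst p)) * ?df p \<partial>m)"
      by (intro Bochner_Integration.integral_cong) (auto simp: algebra_simps)
    also have "\<dots> = 0"
      using zero[OF f] \<rho>d[OF f] integrable_mult_mather[OF m c integrable_differential_mather[OF m f]]
        integrable_mult_mather[OF m c1(1) integrable_differential_mather[OF m f]] by simp
    finally show "(\<integral>p. (\<rho> (fst p) * (1 - W (fst p))) * ?df p \<partial>m) = 0" .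
  qed
  moreover have "(\<integral>p. (\<rho> (fst p) * W (fst p)) * ?LG p \<partial>m) + (\<integral>p. (\<rho> (fst p) * (1 - W (fst p))) * ?LG p \<partial>m) = 0"
  proof -
    have "(\<integral>p. (\<rho> (fst p) * W (fst p)) * ?LG p \<partial>m) + (\<integral>p. (\<rho> (fst p) * (1 - W (fst p))) * ?LG p \<partial>m)
        = (\<integral>p. (\<rho> (fst p) * W (fst p)) * ?LG p + (\<rho> (fst p) * (1 - W (fst p))) * ?LG p \<partial>m)"
      by (intro Bochner_Integration.integral_add[symmetric] integrable_mult_mather[OF m c1(1)] integrable_mult_mather[OF m c1(2)]
          integrable_L_add_mather m)
    also have "\<dots> = (\<integral>p. \<rho> (fst p) * ?LG p \<partial>m)"
      by (intro Bochner_Integration.integral_cong) (auto simp: algebra_simps)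
    finally show ?thesis using \<rho>L by simp
  qed
  ultimately have "(\<integral>p. (\<rho> (fst p) * W (fst p)) * ?LG p \<partial>m) = 0" by linarith
  then have "calibrated m (\<lambda>x. \<rho> x * W x)" unfolding calibrated_def using c1(1) b1 zero by simp
  then show ?thesis by (simp add: W_def)
qed

end

subsection \<open>The operator\<close>

lemma cutoff'_bounded: "\<exists>K. \<forall>t. \<bar>cutoff' t\<bar> \<le> K"
proof -
  obtain K where K: "\<And>t. t \<in> {0..1} \<Longrightarrow> \<bar>cutoff' t\<bar> \<le> K"
    using compact_imp_bounded[OF compact_continuous_image[OF continuous_on_cutoff' compact_Icc[of 0 1]]]
    unfolding bounded_iff by (metis imageI real_norm_def)
  have "\<bar>cutoff' t\<bar> \<le> max K 0" for t
  proof -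
    consider "t < 0" | "t \<in> {0..1}" | "t > 1" by fastforce
    then show ?thesis
    proof cases
      case 2
      then show ?thesis using K[of t] by linarith
    qed (simp_all add: cutoff'_def sqpos_eq_0 max_def)
  qed
  then show ?thesis by blast
qed

context hamiltonian
begin

lemma calibrated_cutoff:
  assumes m: "mather m" and \<rho>: "calibrated m \<rho>" and u: "dominated u1" "dominated u2" and b: "b > 0"
  shows "calibrated m (\<lambda>x. \<rho> x * cutoff ((u1 x - u2 x - a) / b))"
    "calibrated m (\<lambda>x. \<rho> x * (1 - cutoff ((u1 x - u2 x - a) / b)))"
proof -
  obtain K where K: "\<And>t. \<bar>cutoff' t\<bar> \<le> K" using cutoff'_bounded by blast
  have lin: "((\<lambda>t. (t - a) / b) has_real_derivative 1 / b) (at t)" for t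
    using b by (auto intro!: derivative_eq_intros)
  have der: "((\<lambda>t. cutoff ((t - a) / b)) has_real_derivative cutoff' ((t - a) / b) * (1 / b)) (at t)" for t
    by (rule DERIV_chain2[OF has_derivative_cutoff lin])
  have cont: "continuous_on UNIV (\<lambda>t. cutoff' ((t - a) / b) * (1 / b))"
    using b by (intro continuous_intros continuous_on_compose2[OF continuous_on_cutoff'[of UNIV]]) auto
  have bd: "\<bar>cutoff' ((t - a) / b) * (1 / b)\<bar> \<le> K * (1 / b)" for t
    unfolding abs_mult using K b by (intro mult_mono) (auto intro: order_trans[OF abs_ge_zero])
  show "calibrated m (\<lambda>x. \<rho> x * cutoff ((u1 x - u2 x - a) / b))"
    by (rule calibrated_mult[OF m \<rho> u der cont bd]) simp
  have der': "((\<lambda>t. 1 - cutoff ((t - a) / b)) has_real_derivative - (cutoff' ((t - a) / b) * (1 / b))) (at t)" for t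
    using DERIV_diff[OF DERIV_const der] by simp
  have bd': "\<bar>- (cutoff' ((t - a) / b) * (1 / b))\<bar> \<le> K * (1 / b)" for t using bd[of t] by (simp only: abs_minus_cancel)
  show "calibrated m (\<lambda>x. \<rho> x * (1 - cutoff ((u1 x - u2 x - a) / b)))"
    by (rule calibrated_mult[OF m \<rho> u der' continuous_on_minus[OF cont] bd']) simp
qed

section \<open>The operator in terms of Mather measures on the tangent bundle\<close>

definition Pr :: "('m \<Rightarrow> real) \<Rightarrow> ('m \<Rightarrow> real) \<Rightarrow> 'm \<Rightarrow> real" where
  "Pr \<sigma> \<phi> x = (INF m\<in>{m. mather m}. (mean m (\<lambda>y. \<sigma> y * h y x) + mean m (\<lambda>y. \<sigma> y * \<phi> y)) / mean m \<sigma>)"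

context
  fixes \<sigma> :: "'m \<Rightarrow> real" assumes c\<sigma>: "continuous_on UNIV \<sigma>" and \<sigma>: "\<And>x. \<sigma> x > 0"
begin

lemma weight_lower: obtains s where "s > 0" "\<And>x. s \<le> \<sigma> x"
  using continuous_attains_inf[OF compact_M _ c\<sigma>] \<sigma> by blast

lemma mean_weight_pos: assumes m: "mather m" shows "mean m \<sigma> > 0"
proof -
  obtain s where s: "s > 0" "\<And>x. s \<le> \<sigma> x" by (rule weight_lower) (rule that)
  have "s \<le> mean m \<sigma>"
    using mean_mono[OF m continuous_on_const c\<sigma> s(2)] by (simp add: mean_const[OF m])
  then show ?thesis using s by simp
qed

lemma P_operator_eq:
  assumes \<phi>: "continuous_on UNIV \<phi>" shows "P_operator A g G \<sigma> \<phi> x = Pr \<sigma> \<phi> x"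
proof -
  have dist: "(\<integral>y. F y \<partial>distr m borel fst) = mean m F" if "mather m" "continuous_on UNIV F" for m F
    unfolding mean_def using that by (intro integral_distr fst_measurable_mather borel_measurable_continuous_onI)
  show ?thesis
    unfolding P_operator_def Pr_def projected_mather_measures_def image_image peierls_barrier_eq_h real_of_ereal.simps
    by (intro arg_cong[where f = Inf] image_cong refl)
      (simp add: dist c\<sigma> \<phi> h_continuous_left continuous_on_mult add_divide_distrib)
qed

lemma Pr_le:
  assumes \<phi>: "continuous_on UNIV \<phi>" and m: "mather m"
  shows "Pr \<sigma> \<phi> x * mean m \<sigma> \<le> mean m (\<lambda>y. \<sigma> y * h y x) + mean m (\<lambda>y. \<sigma> y * \<phi> y)"
proof -
  obtain B1 where B1: "\<And>y. \<bar>h y x\<bar> \<le> B1" using continuous_bounded[OF h_continuous_left] by blast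
  obtain B2 where B2: "\<And>y. \<bar>\<phi> y\<bar> \<le> B2" using continuous_bounded[OF \<phi>] by blast
  have low: "- B * mean m \<sigma> \<le> mean m (\<lambda>y. \<sigma> y * F y)"
    if m: "mather m" and F: "continuous_on UNIV F" "\<And>y. \<bar>F y\<bar> \<le> B" for m F B
  proof -
    have "mean m (\<lambda>y. - B * \<sigma> y) \<le> mean m (\<lambda>y. \<sigma> y * F y)"
    proof (rule mean_mono[OF m])
      fix y
      have "\<sigma> y * (- B) \<le> \<sigma> y * F y" using F(2)[of y] \<sigma>[of y] by (intro mult_left_mono) auto
      then show "- B * \<sigma> y \<le> \<sigma> y * F y" by (simp add: mult.commute)
    qed (intro continuous_intros c\<sigma> F)+
    then show ?thesis unfolding mean_cmult .
  qed
  have "bdd_below ((\<lambda>m. (mean m (\<lambda>y. \<sigma> y * h y x) + mean m (\<lambda>y. \<sigma> y * \<phi> y)) / mean m \<sigma>) ` {m. mather m})"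
  proof (rule bdd_belowI2)
    fix m assume "m \<in> {m. mather m}"
    then have m: "mather m" by simp
    show "- B1 - B2 \<le> (mean m (\<lambda>y. \<sigma> y * h y x) + mean m (\<lambda>y. \<sigma> y * \<phi> y)) / mean m \<sigma>"
      using low[OF m h_continuous_left B1] low[OF m \<phi> B2] mean_weight_pos[OF m]
      by (subst pos_le_divide_eq) (auto simp: left_diff_distrib)
  qed
  from cINF_lower[OF this, of m] m
  have "Pr \<sigma> \<phi> x \<le> (mean m (\<lambda>y. \<sigma> y * h y x) + mean m (\<lambda>y. \<sigma> y * \<phi> y)) / mean m \<sigma>" by (simp add: Pr_def)
  then show ?thesis using mean_weight_pos[OF m] by (simp add: pos_le_divide_eq)
qed

lemma Pr_greatest:
  assumes "\<And>m. mather m \<Longrightarrow> a * mean m \<sigma> \<le> mean m (\<lambda>y. \<sigma> y * h y x) + mean m (\<lambda>y. \<sigma> y * \<phi> y)"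
  shows "a \<le> Pr \<sigma> \<phi> x"
  unfolding Pr_def
proof (rule cINF_greatest)
  show "{m. mather m} \<noteq> {}" using mather_ex by blast
  fix m assume "m \<in> {m. mather m}"
  then show "a \<le> (mean m (\<lambda>y. \<sigma> y * h y x) + mean m (\<lambda>y. \<sigma> y * \<phi> y)) / mean m \<sigma>"
    using assms[of m] mean_weight_pos[of m] by (simp add: pos_le_divide_eq)
qed

lemma Pr_dominated:
  assumes \<phi>: "continuous_on UNIV \<phi>" shows "dominated (Pr \<sigma> \<phi>)"
  unfolding dominated_def
proof (intro allI impI)
  fix r y y' l assume r: "r > (0::real)" "reach r y y' l"
  define k where "k = l + cG * r"
  have "Pr \<sigma> \<phi> y' - k \<le> Pr \<sigma> \<phi> y"
  proof (rule Pr_greatest)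
    fix m assume m: "mather m"
    have "mean m (\<lambda>z. \<sigma> z * h z y') \<le> mean m (\<lambda>z. \<sigma> z * h z y + k * \<sigma> z)"
    proof (rule mean_mono[OF m])
      fix z
      have "\<sigma> z * h z y' \<le> \<sigma> z * (h z y + k)"
        using dominatedD[OF h_dominated[of z] r] \<sigma>[of z] by (intro mult_left_mono) (auto simp: k_def)
      then show "\<sigma> z * h z y' \<le> \<sigma> z * h z y + k * \<sigma> z" by (simp add: algebra_simps)
    qed (intro continuous_intros c\<sigma> h_continuous_left)+
    also have "\<dots> = mean m (\<lambda>z. \<sigma> z * h z y) + k * mean m \<sigma>"
      by (subst mean_add[OF m]) (auto simp: mean_cmult intro!: continuous_intros c\<sigma> h_continuous_left)
    finally show "(Pr \<sigma> \<phi> y' - k) * mean m \<sigma> \<le> mean m (\<lambda>z. \<sigma> z * h z y) + mean m (\<lambda>z. \<sigma> z * \<phi> z)"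
      using Pr_le[OF \<phi> m, of y'] by (simp add: left_diff_distrib)
  qed
  then show "Pr \<sigma> \<phi> y' - Pr \<sigma> \<phi> y \<le> l + cG * r" by (simp add: k_def)
qed

text \<open>
  On a piece where \<open>h z x + h x z\<close> is small, the barrier \<open>h y x \<le> h y z + h z x\<close> averages to
  almost nothing over pairs \<open>(y, x)\<close> of points of the piece.
\<close>

lemma constraint_piece:
  assumes m: "mather m" and \<phi>: "continuous_on UNIV \<phi>" and \<rho>: "calibrated m \<rho>"
    and near: "\<And>x. \<rho> x \<noteq> 0 \<Longrightarrow> h z x + h x z \<le> \<epsilon>"
  shows "mean m (\<lambda>x. \<rho> x * (\<sigma> x * Pr \<sigma> \<phi> x)) \<le> mean m (\<lambda>x. \<rho> x * (\<sigma> x * \<phi> x)) + \<epsilon> * mean m (\<lambda>x. \<rho> x * \<sigma> x)"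
proof -
  define w where "w = Pr \<sigma> \<phi>"
  have cw: "continuous_on UNIV w" unfolding w_def by (rule dominated_continuous[OF Pr_dominated[OF \<phi>]])
  have c\<rho>: "continuous_on UNIV \<rho>" and \<rho>0: "\<And>x. 0 \<le> \<rho> x" using \<rho> by (auto simp: calibrated_def)
  note cont = continuous_intros c\<rho> c\<sigma> cw \<phi> h_continuous h_continuous_left
  define I where "I = mean m (\<lambda>x. \<rho> x * \<sigma> x)"
  define \<Phi> where "\<Phi> = mean m (\<lambda>x. \<rho> x * (\<sigma> x * \<phi> x))"
  define H where "H = mean m (\<lambda>y. \<rho> y * (\<sigma> y * h y z))"
  obtain s where s: "s > 0" "\<And>x. s \<le> \<sigma> x" by (rule weight_lower) (rule that)
  have sI: "s * mean m \<rho> \<le> I"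
  proof -
    have "mean m (\<lambda>x. s * \<rho> x) \<le> mean m (\<lambda>x. \<rho> x * \<sigma> x)"
    proof (rule mean_mono[OF m])
      show "s * \<rho> x \<le> \<rho> x * \<sigma> x" for x using mult_right_mono[OF s(2)[of x] \<rho>0[of x]] by (simp add: mult.commute)
    qed (intro cont)+
    then show ?thesis by (simp add: mean_cmult I_def)
  qed
  have mean0: "mean m \<rho> \<ge> 0" unfolding mean_def using \<rho>0 by (intro integral_nonneg_AE) auto
  show ?thesis
  \<comment> \<open>A piece of mass zero cannot be normalised, but both sides vanish on it.\<close>
  proof (cases "mean m \<rho> = 0")
    case True
    then have "AE p in m. \<rho> (fst p) = 0"
      using integral_nonneg_eq_0_iff_AE[OF integrable_base_mather[OF m c\<rho>]] \<rho>0 by (simp add: mean_def)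
    then have "mean m (\<lambda>x. \<rho> x * F x) = 0" for F
      unfolding mean_def by (intro integral_eq_zero_AE) (auto elim: eventually_mono)
    then show ?thesis by simp
  next
    case False
    then have M: "mean m \<rho> > 0" using mean0 by simp
    then have I: "I > 0" using sI s(1) by (meson less_le_trans mult_pos_pos)
    \<comment> \<open>The normalised piece is itself a Mather measure, hence a competitor in the
      infimum.\<close>
    obtain m' where m': "mather m'" "\<And>F. continuous_on UNIV F \<Longrightarrow> mean m' F = mean m (\<lambda>x. \<rho> x * F x) / mean m \<rho>"
      by (rule calibrated_normalize[OF m \<rho> M]) (rule that)
    have le: "w x * I \<le> H + I * h z x + \<Phi>" for x
    proof -
      have "w x * mean m' \<sigma> \<le> mean m' (\<lambda>y. \<sigma> y * h y x) + mean m' (\<lambda>y. \<sigma> y * \<phi> y)"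
        unfolding w_def by (rule Pr_le[OF \<phi> m'(1)])
      also have "mean m' \<sigma> = I / mean m \<rho>" unfolding I_def by (rule m'(2)[OF c\<sigma>])
      also have "mean m' (\<lambda>y. \<sigma> y * \<phi> y) = \<Phi> / mean m \<rho>" unfolding \<Phi>_def by (rule m'(2)) (intro cont)
      also have "mean m' (\<lambda>y. \<sigma> y * h y x) = mean m (\<lambda>y. \<rho> y * (\<sigma> y * h y x)) / mean m \<rho>" by (rule m'(2)) (intro cont)
      finally have "w x * I \<le> mean m (\<lambda>y. \<rho> y * (\<sigma> y * h y x)) + \<Phi>"
        using M by (simp add: field_simps)
      also have "mean m (\<lambda>y. \<rho> y * (\<sigma> y * h y x)) \<le> mean m (\<lambda>y. \<rho> y * (\<sigma> y * h y z) + h z x * (\<rho> y * \<sigma> y))"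
      proof (rule mean_mono[OF m])
        fix y
        have "(\<rho> y * \<sigma> y) * h y x \<le> (\<rho> y * \<sigma> y) * (h y z + h z x)"
          using \<rho>0[of y] \<sigma>[of y] h_triangle[of y x z] by (intro mult_left_mono) auto
        then show "\<rho> y * (\<sigma> y * h y x) \<le> \<rho> y * (\<sigma> y * h y z) + h z x * (\<rho> y * \<sigma> y)" by (simp add: algebra_simps)
      qed (intro cont)+
      also have "\<dots> = H + h z x * I"
        unfolding H_def I_def by (subst mean_add[OF m]) (auto simp: mean_cmult intro!: cont)
      finally show ?thesis by (simp add: algebra_simps)
    qed
    \<comment> \<open>The pointwise bound is integrated over x in the same piece. Then h y z and h z
      x carry equal weights and combine to the integral of h x z + h z x, which is small by
      assumption.\<close>
    have "I * mean m (\<lambda>x. \<rho> x * (\<sigma> x * w x)) = mean m (\<lambda>x. I * (\<rho> x * (\<sigma> x * w x)))" by (simp add: mean_cmult)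
    also have "\<dots> \<le> mean m (\<lambda>x. (H + \<Phi>) * (\<rho> x * \<sigma> x) + I * (\<rho> x * (\<sigma> x * h z x)))"
    proof (rule mean_mono[OF m])
      fix x
      have "(\<rho> x * \<sigma> x) * (w x * I) \<le> (\<rho> x * \<sigma> x) * (H + I * h z x + \<Phi>)"
        using \<rho>0[of x] \<sigma>[of x] le[of x] by (intro mult_left_mono) auto
      then show "I * (\<rho> x * (\<sigma> x * w x)) \<le> (H + \<Phi>) * (\<rho> x * \<sigma> x) + I * (\<rho> x * (\<sigma> x * h z x))" by (simp add: algebra_simps)
    qed (intro cont)+
    also have "\<dots> = (H + \<Phi>) * I + I * mean m (\<lambda>x. \<rho> x * (\<sigma> x * h z x))"
      unfolding I_def by (subst mean_add[OF m]) (auto simp: mean_cmult intro!: cont)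
    finally have "I * mean m (\<lambda>x. \<rho> x * (\<sigma> x * w x)) \<le> I * (H + \<Phi> + mean m (\<lambda>x. \<rho> x * (\<sigma> x * h z x)))"
      by (simp add: algebra_simps)
    then have "mean m (\<lambda>x. \<rho> x * (\<sigma> x * w x)) \<le> H + \<Phi> + mean m (\<lambda>x. \<rho> x * (\<sigma> x * h z x))"
      using I by simp
    also have "H + \<Phi> + mean m (\<lambda>x. \<rho> x * (\<sigma> x * h z x)) = \<Phi> + mean m (\<lambda>x. \<rho> x * (\<sigma> x * h x z) + \<rho> x * (\<sigma> x * h z x))"
      unfolding H_def by (subst mean_add[OF m]) (auto intro!: cont)
    also have "mean m (\<lambda>x. \<rho> x * (\<sigma> x * h x z) + \<rho> x * (\<sigma> x * h z x)) \<le> mean m (\<lambda>x. \<epsilon> * (\<rho> x * \<sigma> x))"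
    proof (rule mean_mono[OF m])
      fix x
      have "(\<rho> x * \<sigma> x) * (h z x + h x z) \<le> (\<rho> x * \<sigma> x) * \<epsilon>"
        using \<rho>0[of x] \<sigma>[of x] near[of x] by (cases "\<rho> x = 0") (auto intro!: mult_left_mono)
      then show "\<rho> x * (\<sigma> x * h x z) + \<rho> x * (\<sigma> x * h z x) \<le> \<epsilon> * (\<rho> x * \<sigma> x)" by (simp add: algebra_simps)
    qed (intro cont)+
    also have "mean m (\<lambda>x. \<epsilon> * (\<rho> x * \<sigma> x)) = \<epsilon> * I" by (simp add: mean_cmult I_def)
    finally show ?thesis by (simp add: w_def \<Phi>_def I_def)
  qed
qed

text \<open>Induction over the centres. The sum h z x + h x z is a difference of two dominated
  functions of x, so a cut-off of it splits a calibrated density: one part lives where the sum is at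
  most 4 \<epsilon> and is a small piece, the other where it is at least 3 \<epsilon> and is covered
  by the other centres.\<close>

lemma constraint_cover:
  assumes m: "mather m" and \<phi>: "continuous_on UNIV \<phi>" and \<epsilon>: "\<epsilon> > 0" and "finite Z" "calibrated m \<rho>"
    and "AE p in m. \<rho> (fst p) \<noteq> 0 \<longrightarrow> (\<exists>z\<in>Z. h z (fst p) + h (fst p) z < 3 * \<epsilon>)"
  shows "mean m (\<lambda>x. \<rho> x * (\<sigma> x * Pr \<sigma> \<phi> x)) \<le> mean m (\<lambda>x. \<rho> x * (\<sigma> x * \<phi> x)) + 4 * \<epsilon> * mean m (\<lambda>x. \<rho> x * \<sigma> x)"
  using assms(4-6)
proof (induction Z arbitrary: \<rho> rule: finite_induct)
  case empty
  then have "AE p in m. \<rho> (fst p) = 0" by simp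
  then have "mean m (\<lambda>x. \<rho> x * F x) = 0" for F
    unfolding mean_def by (intro integral_eq_zero_AE) (auto elim: eventually_mono)
  then show ?case by simp
next
  case (insert z Z)
  define W where "W x = cutoff ((h z x - (- h x z) - 3 * \<epsilon>) / \<epsilon>)" for x
  have 1: "calibrated m (\<lambda>x. \<rho> x * W x)" "calibrated m (\<lambda>x. \<rho> x * (1 - W x))"
    unfolding W_def by (rule calibrated_cutoff[OF m insert.prems(1) h_dominated neg_h_dominated \<epsilon>])+
  have cw: "continuous_on UNIV (Pr \<sigma> \<phi>)" by (rule dominated_continuous[OF Pr_dominated[OF \<phi>]])
  have c: "continuous_on UNIV (\<lambda>x. \<rho> x * W x)" "continuous_on UNIV (\<lambda>x. \<rho> x * (1 - W x))"
    using 1 by (auto simp: calibrated_def)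
  have "mean m (\<lambda>x. (\<rho> x * W x) * (\<sigma> x * Pr \<sigma> \<phi> x))
      \<le> mean m (\<lambda>x. (\<rho> x * W x) * (\<sigma> x * \<phi> x)) + 4 * \<epsilon> * mean m (\<lambda>x. (\<rho> x * W x) * \<sigma> x)"
  proof (rule constraint_piece[OF m \<phi> 1(1)])
    fix x assume "\<rho> x * W x \<noteq> 0"
    then have "\<not> (h z x - (- h x z) - 3 * \<epsilon>) / \<epsilon> \<ge> 1" using cutoff_eq_0 by (auto simp: W_def)
    then show "h z x + h x z \<le> 4 * \<epsilon>" using \<epsilon> by (simp add: field_simps)
  qed
  moreover have "mean m (\<lambda>x. (\<rho> x * (1 - W x)) * (\<sigma> x * Pr \<sigma> \<phi> x))
      \<le> mean m (\<lambda>x. (\<rho> x * (1 - W x)) * (\<sigma> x * \<phi> x)) + 4 * \<epsilon> * mean m (\<lambda>x. (\<rho> x * (1 - W x)) * \<sigma> x)"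
  proof (rule insert.IH[OF 1(2)])
    show "AE p in m. \<rho> (fst p) * (1 - W (fst p)) \<noteq> 0 \<longrightarrow> (\<exists>z\<in>Z. h z (fst p) + h (fst p) z < 3 * \<epsilon>)"
      using insert.prems(2)
    proof eventually_elim
      case (elim p)
      show ?case
      proof
        assume nz: "\<rho> (fst p) * (1 - W (fst p)) \<noteq> 0"
        then have "\<not> (h z (fst p) - (- h (fst p) z) - 3 * \<epsilon>) / \<epsilon> \<le> 0" using cutoff_eq_1 by (auto simp: W_def)
        then have "\<not> h z (fst p) + h (fst p) z < 3 * \<epsilon>" using \<epsilon> by (simp add: divide_le_0_iff)
        then show "\<exists>z\<in>Z. h z (fst p) + h (fst p) z < 3 * \<epsilon>" using elim nz by auto
      qed
    qed
  qed
  moreover have "mean m (\<lambda>x. \<rho> x * F x) = mean m (\<lambda>x. (\<rho> x * W x) * F x) + mean m (\<lambda>x. (\<rho> x * (1 - W x)) * F x)"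
    if "continuous_on UNIV F" for F
  proof -
    have "mean m (\<lambda>x. (\<rho> x * W x) * F x + (\<rho> x * (1 - W x)) * F x) = mean m (\<lambda>x. (\<rho> x * W x) * F x) + mean m (\<lambda>x. (\<rho> x * (1 - W x)) * F x)"
      by (intro mean_add[OF m] continuous_on_mult c that)
    then show ?thesis by (simp add: algebra_simps)
  qed
  note split = this[OF c\<sigma>] this[OF continuous_on_mult[OF c\<sigma> \<phi>]] this[OF continuous_on_mult[OF c\<sigma> cw]]
  ultimately show ?case unfolding split distrib_left by linarith
qed

text \<open>The exceptional null sets of \<open>h_pos_null\<close> depend on z. By compactness
  finitely many centres suffice: each has a neighbourhood that is null or on which h z x + h x z is
  below 3 \<epsilon>.\<close>

lemma constraint:
  assumes m: "mather m" and \<phi>: "continuous_on UNIV \<phi>"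
  shows "mean m (\<lambda>x. \<sigma> x * Pr \<sigma> \<phi> x) \<le> mean m (\<lambda>x. \<sigma> x * \<phi> x)"
proof (rule field_le_epsilon)
  fix e :: real assume e: "e > 0"
  define \<epsilon> where "\<epsilon> = e / (4 * mean m \<sigma>)"
  have \<epsilon>: "\<epsilon> > 0" "4 * \<epsilon> * mean m \<sigma> = e" using e mean_weight_pos[OF m] by (auto simp: \<epsilon>_def)
  define N where "N z x \<longleftrightarrow> h z x + h x z < 3 * \<epsilon>" for z x
  have "\<exists>U. open U \<and> z \<in> U \<and> ((\<forall>x\<in>U. N z x) \<or> (AE p in m. fst p \<notin> U))" for z
  proof (cases "h z z > 0")
    case False
    have "open {x. N z x}" unfolding N_def by (intro open_Collect_less continuous_intros h_continuous h_continuous_left)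
    moreover have "N z z" using False \<epsilon>(1) by (simp add: N_def)
    ultimately show ?thesis by (intro exI[of _ "{x. N z x}"]) auto
  qed (use h_pos_null[OF m] in blast)
  then obtain U where U: "\<And>z. open (U z)" "\<And>z. z \<in> U z" "\<And>z. (\<forall>x\<in>U z. N z x) \<or> (AE p in m. fst p \<notin> U z)"
    by metis
  have "UNIV \<subseteq> (\<Union>z\<in>UNIV. U z)" using U(2) by blast
  then obtain Z where Z: "finite Z" "UNIV \<subseteq> (\<Union>z\<in>Z. U z)"
    by (rule compactE_image[OF compact_M U(1)]) (rule that)
  have null: "AE p in m. \<forall>z\<in>{z \<in> Z. \<not> (\<forall>x\<in>U z. N z x)}. fst p \<notin> U z"
    using Z(1) U(3) by (intro AE_finite_allI) auto
  have "mean m (\<lambda>x. 1 * (\<sigma> x * Pr \<sigma> \<phi> x)) \<le> mean m (\<lambda>x. 1 * (\<sigma> x * \<phi> x)) + 4 * \<epsilon> * mean m (\<lambda>x. 1 * \<sigma> x)"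
  proof (rule constraint_cover[OF m \<phi> \<epsilon>(1) Z(1) calibrated_one[OF m]])
    show "AE p in m. (1::real) \<noteq> 0 \<longrightarrow> (\<exists>z\<in>Z. h z (fst p) + h (fst p) z < 3 * \<epsilon>)"
      using null
    proof eventually_elim
      case (elim p)
      obtain z where "z \<in> Z" "fst p \<in> U z" using Z(2) by blast
      then show ?case using elim by (auto simp: N_def)
    qed
  qed
  then show "mean m (\<lambda>x. \<sigma> x * Pr \<sigma> \<phi> x) \<le> mean m (\<lambda>x. \<sigma> x * \<phi> x) + e" using \<epsilon>(2) by simp
qed

text \<open>With \<open>Pr_greatest\<close> this puts a dominated u below
  \<open>Pr \<sigma> \<phi>\<close> as soon as its weighted means do not exceed those of \<phi>; in
  particular u lies below \<open>Pr \<sigma> u\<close>.\<close>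

lemma dominated_mean_le:
  assumes m: "mather m" and u: "dominated u"
  shows "u x * mean m \<sigma> \<le> mean m (\<lambda>y. \<sigma> y * h y x) + mean m (\<lambda>y. \<sigma> y * u y)"
proof -
  note cont = continuous_intros c\<sigma> dominated_continuous[OF u] h_continuous_left
  have "u x * mean m \<sigma> = mean m (\<lambda>y. u x * \<sigma> y)" by (simp add: mean_cmult)
  also have "\<dots> \<le> mean m (\<lambda>y. \<sigma> y * h y x + \<sigma> y * u y)"
  proof (rule mean_mono[OF m])
    fix y
    have "\<sigma> y * u x \<le> \<sigma> y * (h y x + u y)" using dominated_le_h[OF u, of x y] \<sigma>[of y] by (intro mult_left_mono) auto
    then show "u x * \<sigma> y \<le> \<sigma> y * h y x + \<sigma> y * u y" by (simp add: algebra_simps)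
  qed (intro cont)+
  also have "\<dots> = mean m (\<lambda>y. \<sigma> y * h y x) + mean m (\<lambda>y. \<sigma> y * u y)"
    by (intro mean_add[OF m] cont)
  finally show ?thesis .
qed

subsection \<open>Viscosity solutions\<close>

text \<open>Serves to turn a local touching into a strict and global one without changing the
  differential at x.\<close>

lemma peak_function:
  assumes U: "open U" "x \<in> U"
  obtains \<psi> where "\<psi> \<in> C1" "\<psi> x = 1" "\<And>y. 0 \<le> \<psi> y \<and> \<psi> y \<le> 1" "\<And>y. y \<noteq> x \<Longrightarrow> \<psi> y < 1" "\<And>y. y \<notin> U \<Longrightarrow> \<psi> y = 0"
proof -
  let ?c = "chart_at A x" and ?z = "cmap (chart_at A x) x"
  note c = chart_at(1)[of x]
  have "open (cimage ?c \<inter> cinv ?c -` U)" by (rule open_cinv_vimage[OF c U(1)])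
  moreover have "?z \<in> cimage ?c \<inter> cinv ?c -` U" using chart_at(2)[of x] U(2) by (simp add: cinv_cmap[OF chart_at])
  ultimately obtain s where s: "s > 0" "cball ?z s \<subseteq> cimage ?c \<inter> cinv ?c -` U" by (meson open_contains_cball)
  define r where "r = s / 2"
  have r: "0 < r" "r < s" using s by (auto simp: r_def)
  define Q where "Q y = 1 + (- 1 / r\<^sup>2) * ((y - ?z) \<bullet> (y - ?z))" for y
  have Q: "Q y \<le> 1" "Q y = 1 \<longleftrightarrow> y = ?z" "dist ?z y > r \<Longrightarrow> Q y < 0" for y
  proof -
    have eq: "Q y = 1 - (dist ?z y / r)\<^sup>2"
      by (simp add: Q_def dist_norm norm_minus_commute[of _ y] power_divide flip: power2_norm_eq_inner)
    show "Q y \<le> 1" unfolding eq by simp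
    show "Q y = 1 \<longleftrightarrow> y = ?z" unfolding eq using r by auto
    show "Q y < 0" if "dist ?z y > r"
      unfolding eq using that r power_strict_mono[of 1 "dist ?z y / r" 2] by simp
  qed
  have sq: "sqpos t \<le> 1" "sqpos t = 1 \<longleftrightarrow> t = 1" if "t \<le> 1" for t
  proof -
    have "0 \<le> max 0 t" "max 0 t \<le> 1" using that by auto
    then show "sqpos t \<le> 1" unfolding sqpos_def by (rule power_le_one)
    show "sqpos t = 1 \<longleftrightarrow> t = 1" unfolding sqpos_def using that by (auto simp: max_def power2_eq_1_iff)
  qed
  define \<psi> where "\<psi> = chart_extension ?c (\<lambda>y. sqpos (Q y))"
  obtain E where E: "grad_on Q E (ball ?z s)"
    unfolding Q_def using grad_on_add[OF grad_on_const grad_on_mult[OF grad_on_const grad_on_norm2]] by blast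
  have "\<psi> \<in> C1"
    unfolding \<psi>_def
  proof (rule chart_extension_C1[OF c compact_cball])
    show "cball ?z r \<subseteq> ball ?z s" using r by auto
    show "ball ?z s \<subseteq> cimage ?c" using s ball_subset_cball by blast
    show "grad_on (\<lambda>y. sqpos (Q y)) (\<lambda>y. (2 * max 0 (Q y)) *\<^sub>R E y) (ball ?z s)"
      by (rule grad_on_compose_real[OF E has_derivative_sqpos]) (intro continuous_intros)
    show "sqpos (Q y) = 0" if "y \<notin> cball ?z r" for y using Q(3)[of y] that by (intro sqpos_eq_0) auto
  qed simp
  moreover have "\<psi> x = 1"
    using Q(2)[of ?z] sq(2)[of 1] chart_at(2)[of x] by (simp add: \<psi>_def chart_extension_def)
  moreover have "0 \<le> \<psi> y \<and> \<psi> y \<le> 1" for y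
    using sq(1)[OF Q(1)] by (simp add: \<psi>_def chart_extension_def)
  moreover have "\<psi> y < 1" if y: "y \<noteq> x" for y
  proof (cases "y \<in> cdom ?c")
    case True
    have "cmap ?c y \<noteq> ?z" using y cinv_cmap[OF c True] cinv_cmap[OF chart_at] by metis
    then have "sqpos (Q (cmap ?c y)) \<noteq> 1" using Q(2) sq(2)[OF Q(1)] by blast
    then show ?thesis using sq(1)[OF Q(1), of "cmap ?c y"] True by (simp add: \<psi>_def chart_extension_def)
  qed (simp add: \<psi>_def chart_extension_def)
  moreover have "\<psi> y = 0" if y: "y \<notin> U" for y
  proof (cases "y \<in> cdom ?c")
    case True
    have "cmap ?c y \<notin> cball ?z s" using s(2) y cinv_cmap[OF c True] by auto
    then have "dist ?z (cmap ?c y) > r" using r by simp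
    then show ?thesis using Q(3) by (simp add: \<psi>_def chart_extension_def sqpos_eq_0 less_imp_le)
  qed (simp add: \<psi>_def chart_extension_def)
  ultimately show thesis by (rule that)
qed

lemma Pr_supersolution:
  assumes \<phi>: "continuous_on UNIV \<phi>" and f: "f \<in> C1"
    and touch: "\<forall>\<^sub>F y in nhds x0. Pr \<sigma> \<phi> y - f y \<ge> Pr \<sigma> \<phi> x0 - f x0"
  shows "G x0 (differential A f x0) \<ge> cG"
proof (rule ccontr)
  define w where "w = Pr \<sigma> \<phi>"
  assume neg: "\<not> G x0 (differential A f x0) \<ge> cG"
  have wd: "dominated w" unfolding w_def by (rule Pr_dominated[OF \<phi>])
  note cw = dominated_continuous[OF wd] and cf = C1_continuous[OF f]
  define a where "a = w x0 - f x0"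
  obtain U where U: "open U" "x0 \<in> U" "\<And>y. y \<in> U \<Longrightarrow> w y - f y \<ge> a"
    using touch unfolding eventually_nhds a_def w_def by blast
  obtain \<psi> where \<psi>: "\<psi> \<in> C1" "\<psi> x0 = 1" "\<And>y. 0 \<le> \<psi> y \<and> \<psi> y \<le> 1" "\<And>y. y \<noteq> x0 \<Longrightarrow> \<psi> y < 1" "\<And>y. y \<notin> U \<Longrightarrow> \<psi> y = 0"
    by (rule peak_function[OF U(1,2)]) (rule that)
  have "continuous_on UNIV (\<lambda>x. f x + a - w x)" by (intro continuous_intros cf cw)
  then obtain B where B: "B > 0" "\<And>x. \<bar>f x + a - w x\<bar> \<le> B" using continuous_bounded by blast
  \<comment> \<open>Outside U the peak vanishes and f + a is lowered by N, more than it can exceed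
    w.\<close>
  define N where "N = B + 1"
  have N: "N > 0" using B by (simp add: N_def)
  define F where "F x = f x + ((a - N) + N * \<psi> x)" for x
  have \<psi>N: "(\<lambda>x. (a - N) + N * \<psi> x) \<in> C1" by (intro C1_add C1_const C1_cmult \<psi>)
  have F: "F \<in> C1" unfolding F_def by (rule C1_add[OF f \<psi>N])
  note cF = C1_continuous[OF F]
  have F0: "F x0 = w x0" by (simp add: F_def \<psi>(2) a_def)
  have Fw: "F x < w x" if x: "x \<noteq> x0" for x
  proof (cases "x \<in> U")
    case True
    have "N * \<psi> x < N" using N \<psi>(4)[OF x] by simp
    then show ?thesis using U(3)[OF True] by (simp add: F_def)
  next
    case False
    then show ?thesis using B(2)[of x] \<psi>(5)[OF False] by (simp add: F_def N_def)
  qed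
  have "differential A F x0 = differential A f x0"
  proof (rule differential_eq_if_touching[OF F f], rule always_eventually, rule allI)
    fix y
    have "N * \<psi> y \<le> N * 1" using N \<psi>(3) by (intro mult_left_mono) auto
    then show "F y - f y \<le> F x0 - f x0" by (simp add: F_def \<psi>(2))
  qed
  then have GF: "G x0 (differential A F x0) < cG" using neg by simp
  define \<delta> where "\<delta> = (cG - G x0 (differential A F x0)) / 2"
  have \<delta>: "\<delta> > 0" "G x0 (differential A F x0) < cG - \<delta>" using GF by (auto simp: \<delta>_def field_simps)
  define V where "V = {x. G x (differential A F x) < cG - \<delta>}"
  have V: "open V" "x0 \<in> V"
    unfolding V_def using \<delta>(2) by (auto intro!: open_Collect_less G_differential_continuous[OF F] continuous_intros)
  have "w x - F x > 0" if "x \<notin> V" for x using Fw[of x] V(2) that by auto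
  then obtain \<eta> where \<eta>: "\<eta> > 0" "\<And>x. x \<notin> V \<Longrightarrow> \<eta> \<le> w x - F x"
    by (rule positive_outside_open[OF V(1) continuous_on_diff[OF cw cF]]) (assumption, rule that)
  \<comment> \<open>By the choice of \<eta> the lifted function can exceed w only inside V, where it
    is strictly subcritical; the margin b is positive exactly where w' is above w.\<close>
  define w' where "w' x = max (w x) (F x + \<eta>)" for x
  define b where "b x = min \<delta> (w' x - w x)" for x
  have cw': "continuous_on UNIV w'" unfolding w'_def by (intro continuous_intros cw cF)
  have cb: "continuous_on UNIV b" unfolding b_def by (intro continuous_intros cw cw')
  have b0: "b x \<ge> 0" for x using \<delta>(1) by (simp add: b_def w'_def)
  have VSb: "VSb b cG w'"
    unfolding VSb_def
  proof (intro conjI cw' ballI allI impI)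
    fix k x assume k: "k \<in> C1" and t: "\<forall>\<^sub>F y in nhds x. w' y - k y \<le> w' x - k x"
    show "G x (differential A k x) + b x \<le> cG"
    proof (cases "F x + \<eta> \<le> w x")
      case True
      then have wx: "w' x = w x" by (simp add: w'_def)
      have "\<forall>\<^sub>F y in nhds x. w y - k y \<le> w x - k x"
        using t by eventually_elim (use wx in \<open>auto simp: w'_def\<close>)
      then have "G x (differential A k x) \<le> cG" using dominated_VS[OF wd] k unfolding VS_def by blast
      then show ?thesis using \<delta>(1) by (simp add: b_def wx)
    next
      case False
      then have wx: "w' x = F x + \<eta>" by (simp add: w'_def)
      have "\<forall>\<^sub>F y in nhds x. F y - k y \<le> F x - k x"
        using t by eventually_elim (use wx in \<open>auto simp: w'_def\<close>)
      then have "differential A k x = differential A F x" using differential_eq_if_touching[OF F k] by simp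
      moreover have "x \<in> V" using False \<eta>(2)[of x] by linarith
      ultimately show ?thesis by (simp add: V_def b_def)
    qed
  qed
  have "VS cG w'"
    unfolding VS_def
  proof (intro conjI cw' ballI allI impI)
    fix k x assume "k \<in> C1" "\<forall>\<^sub>F y in nhds x. w' y - k y \<le> w' x - k x"
    then have "G x (differential A k x) + b x \<le> cG" using VSb unfolding VSb_def by blast
    then show "G x (differential A k x) \<le> cG" using b0[of x] by linarith
  qed
  then have dw': "dominated w'" by (rule VS_dominated)
  have "w' x0 \<le> Pr \<sigma> \<phi> x0"
  proof (rule Pr_greatest)
    fix m assume m: "mather m"
    have "AE p in m. \<sigma> (fst p) * w' (fst p) = \<sigma> (fst p) * w (fst p)"
      using margin_null[OF m VSb cb b0] by eventually_elim (use \<delta>(1) in \<open>simp add: b_def min_def split: if_splits\<close>)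
    then have "mean m (\<lambda>x. \<sigma> x * w' x) = mean m (\<lambda>x. \<sigma> x * w x)"
      by (intro mean_cong_AE[OF m] continuous_intros c\<sigma> cw cw')
    also have "\<dots> \<le> mean m (\<lambda>x. \<sigma> x * \<phi> x)" unfolding w_def by (rule constraint[OF m \<phi>])
    finally show "w' x0 * mean m \<sigma> \<le> mean m (\<lambda>y. \<sigma> y * h y x0) + mean m (\<lambda>y. \<sigma> y * \<phi> y)"
      using dominated_mean_le[OF m dw', of x0] by linarith
  qed
  moreover have "w' x0 > w x0" using F0 \<eta>(1) by (simp add: w'_def)
  ultimately show False by (simp add: w_def)
qed

lemma Pr_viscosity_solution:
  assumes \<phi>: "continuous_on UNIV \<phi>" shows "viscosity_solution A G cG (Pr \<sigma> \<phi>)"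
  using dominated_VS[OF Pr_dominated[OF \<phi>]] Pr_supersolution[OF \<phi>]
  unfolding VS_def viscosity_solution_def by blast

lemma Pr_fixes_viscosity_solution:
  assumes u: "viscosity_solution A G cG u" shows "Pr \<sigma> u x = u x"
proof -
  have cu: "continuous_on UNIV u" and "VS cG u"
    and super: "\<And>f x. f \<in> C1 \<Longrightarrow> (\<forall>\<^sub>F y in nhds x. u y - f y \<ge> u x - f x) \<Longrightarrow> G x (differential A f x) \<ge> cG"
    using u unfolding viscosity_solution_def VS_def by blast+
  then have ud: "dominated u" by (intro VS_dominated)
  define w where "w = Pr \<sigma> u"
  have wd: "dominated w" unfolding w_def by (rule Pr_dominated[OF cu])
  note cw = dominated_continuous[OF wd]
  have ge: "u y \<le> w y" for y
    unfolding w_def by (rule Pr_greatest) (rule dominated_mean_le[OF _ ud])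
  have cwu: "continuous_on UNIV (\<lambda>x. w x - u x)" by (intro continuous_intros cw cu)
  obtain x1 where x1: "\<And>x. w x - u x \<le> w x1 - u x1"
    using continuous_attains_sup[OF compact_M _ cwu] by blast
  define M where "M = w x1 - u x1"
  define K where "K = {x. w x - u x = M}"
  have "closed K" unfolding K_def by (intro closed_Collect_eq cwu continuous_intros)
  then have K: "compact K" using compact_Int_closed[OF compact_M, of K] by simp
  have Kne: "K \<noteq> {}" using x1 by (auto simp: K_def M_def)
  have "\<not> (\<exists>f\<in>C1. \<exists>\<delta>>0. \<forall>x\<in>K. G x (differential A f x) \<le> cG - \<delta>)"
  proof
    assume "\<exists>f\<in>C1. \<exists>\<delta>>0. \<forall>x\<in>K. G x (differential A f x) \<le> cG - \<delta>"
    then obtain f \<delta> where f: "f \<in> C1" and \<delta>: "\<delta> > 0" "\<And>x. x \<in> K \<Longrightarrow> G x (differential A f x) \<le> cG - \<delta>" by blast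
    define V where "V = {x. G x (differential A f x) < cG - \<delta> / 2}"
    have oV: "open V" unfolding V_def by (intro open_Collect_less G_differential_continuous[OF f] continuous_intros)
    have KV: "K \<subseteq> V" using \<delta> by (fastforce simp: V_def)
    have "M - (w x - u x) > 0" if "x \<notin> V" for x
      using x1[of x] that KV by (auto simp: M_def K_def less_le)
    then obtain \<eta> where \<eta>: "\<eta> > 0" "\<And>x. x \<notin> V \<Longrightarrow> \<eta> \<le> M - (w x - u x)"
      by (rule positive_outside_open[OF oV continuous_on_diff[OF continuous_on_const cwu]]) (assumption, rule that)
    have "continuous_on UNIV (\<lambda>x. w x - f x)" by (intro continuous_intros cw C1_continuous[OF f])
    then obtain B where B: "B > 0" "\<And>x. \<bar>w x - f x\<bar> \<le> B" using continuous_bounded by blast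
    \<comment> \<open>Weight of the strict subsolution: it moves the mixture by at most \<eta>/8
      away from w. The approximation adds another \<eta>/8, and its excess \<epsilon> \<le> l
      \<delta>/4 is outweighed by the gain l \<delta>/2 on V.\<close>
    define l where "l = min (1 / 2) (\<eta> / (8 * B))"
    have l: "0 < l" "l \<le> 1 / 2" "l * B \<le> \<eta> / 8"
      using \<eta>(1) B(1) mult_right_mono[of l "\<eta> / (8 * B)" B] by (auto simp: l_def)
    define \<epsilon> where "\<epsilon> = min (\<eta> / 8) (l * \<delta> / 4)"
    have \<epsilon>: "\<epsilon> > 0" "\<epsilon> \<le> \<eta> / 8" "\<epsilon> \<le> l * \<delta> / 4" using \<eta>(1) l(1) \<delta>(1) by (auto simp: \<epsilon>_def)
    obtain q where q: "q \<in> C1" "\<And>x. \<bar>q x - w x\<bar> \<le> \<epsilon>" "\<And>x. G x (differential A q x) \<le> cG + \<epsilon>"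
      by (rule smooth_approximation[OF dominated_VS[OF wd] \<epsilon>(1)]) (rule that)
    define k where "k x = (1 - l) * q x + l * f x" for x
    have k: "k \<in> C1" unfolding k_def by (intro C1_add C1_cmult q f)
    have kw: "\<bar>k x - w x\<bar> \<le> \<eta> / 4" for x
    proof -
      have "k x - w x = (1 - l) * (q x - w x) + l * (f x - w x)" by (simp add: k_def algebra_simps)
      also have "\<bar>\<dots>\<bar> \<le> \<bar>(1 - l) * (q x - w x)\<bar> + \<bar>l * (f x - w x)\<bar>" by (rule abs_triangle_ineq)
      also have "\<dots> \<le> 1 * \<epsilon> + l * B"
        unfolding abs_mult using l q(2)[of x] B(2)[of x] by (intro add_mono mult_mono) (auto simp: abs_minus_commute)
      finally show ?thesis using l(3) \<epsilon>(2) by linarith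
    qed
    \<comment> \<open>Outside V, u - w is at least \<eta> above its minimum, while k is within
      \<eta>/4 of w; hence the minimum of u - k lies in V, where k is strictly subcritical, against
      the supersolution property of u.\<close>
    obtain x2 where x2: "\<And>x. u x2 - k x2 \<le> u x - k x"
      using continuous_attains_inf[OF compact_M _ continuous_on_diff[OF cu C1_continuous[OF k]]] by blast
    have "x2 \<in> V"
    proof (rule ccontr)
      assume "x2 \<notin> V"
      then have "\<eta> \<le> M - (w x2 - u x2)" by (rule \<eta>(2))
      moreover have "w x1 - u x1 = M" by (simp add: M_def)
      ultimately show False using x2[of x1] kw[of x1] kw[of x2] \<eta>(1) by linarith
    qed
    have "G x2 (differential A k x2) \<ge> cG"
      using x2 by (intro super[OF k] always_eventually) simp
    moreover have "G x2 (differential A k x2) \<le> (1 - l) * (cG + \<epsilon>) + l * (cG - \<delta> / 2)"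
    proof -
      have "differential A k x2 = (\<lambda>v. (1 - l) * differential A q x2 v + l * differential A f x2 v)"
      proof
        fix v
        show "differential A k x2 v = (1 - l) * differential A q x2 v + l * differential A f x2 v"
        proof (cases "v \<in> tangent_space A x2")
          case True
          show ?thesis
            unfolding k_def differential_add[OF True C1_cmult[OF q(1)] C1_cmult[OF f]]
              differential_cmult[OF True q(1)] differential_cmult[OF True f] ..
        qed (simp add: differential_def)
      qed
      then have "G x2 (differential A k x2) \<le> (1 - l) * G x2 (differential A q x2) + l * G x2 (differential A f x2)"
        using G_convex differential_in[OF q(1), of x2] differential_in[OF f, of x2] l
        unfolding convex_hamiltonian_def by simp
      also have "\<dots> \<le> (1 - l) * (cG + \<epsilon>) + l * (cG - \<delta> / 2)"
        using q(3)[of x2] \<open>x2 \<in> V\<close> l by (intro add_mono mult_left_mono) (auto simp: V_def)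
      finally show ?thesis .
    qed
    moreover have "(1 - l) * (cG + \<epsilon>) + l * (cG - \<delta> / 2) = cG + (1 - l) * \<epsilon> - l * \<delta> / 2" by (simp add: algebra_simps)
    moreover have "(1 - l) * \<epsilon> \<le> 1 * \<epsilon>" using l \<epsilon>(1) by (intro mult_right_mono) auto
    moreover have "l * \<delta> > 0" using l(1) \<delta>(1) by simp
    ultimately show False using \<epsilon>(3) by linarith
  qed
  then obtain m where m: "mather m" and mK: "AE p in m. fst p \<in> K"
    using mather_or_strict_subsolution[OF K Kne] by blast
  \<comment> \<open>On K the difference w - u is constantly M, so the constraint for this measure
    says that M times its weight is at most zero.\<close>
  have "M * mean m \<sigma> = mean m (\<lambda>x. M * \<sigma> x)" by (simp add: mean_cmult)
  also have "\<dots> = mean m (\<lambda>x. \<sigma> x * w x + (- 1) * (\<sigma> x * u x))"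
  proof (rule mean_cong_AE[OF m])
    show "AE p in m. M * \<sigma> (fst p) = \<sigma> (fst p) * w (fst p) + (- 1) * (\<sigma> (fst p) * u (fst p))"
      using mK by eventually_elim (auto simp: K_def algebra_simps)
  qed (intro continuous_intros c\<sigma> cw cu)+
  also have "\<dots> = mean m (\<lambda>x. \<sigma> x * w x) + (- 1) * mean m (\<lambda>x. \<sigma> x * u x)"
    unfolding mean_cmult[symmetric] by (intro mean_add[OF m] continuous_intros c\<sigma> cw cu)
  also have "\<dots> \<le> 0" using constraint[OF m cu] by (simp add: w_def)
  finally have "M \<le> 0" using mean_weight_pos[OF m] by (simp add: mult_le_0_iff)
  then have "w x \<le> u x" using x1[of x] by (simp add: M_def)
  then show ?thesis using ge[of x] by (simp add: w_def)
qed

end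

end

theorem corollary4:
  fixes A :: "('m::t2_space, 'e::euclidean_space) chart set"
    and g :: "'m \<Rightarrow> ('m, 'e) tvec \<Rightarrow> ('m, 'e) tvec \<Rightarrow> real"
    and G :: "'m \<Rightarrow> ('m, 'e) covec \<Rightarrow> real"
    and \<sigma> :: "'m \<Rightarrow> real"
  assumes "closed_connected_riemannian_manifold A g"
    and "continuous_hamiltonian A G"
    and "convex_hamiltonian A G"
    and "superlinear_hamiltonian A g G"
    and "continuous_on UNIV \<sigma>"
    and "\<forall>x. \<sigma> x > 0"
  shows "P_operator A g G \<sigma> ` {\<phi>. continuous_on UNIV \<phi>}
    = {u. viscosity_solution A G (critical_value A G) u}"
proof -
  interpret hamiltonian A g G by unfold_locales (rule assms)+
  have \<sigma>: "\<And>x. \<sigma> x > 0" using assms(6) by blast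
  have P: "P_operator A g G \<sigma> \<phi> = Pr \<sigma> \<phi>" if "continuous_on UNIV \<phi>" for \<phi>
    using P_operator_eq[OF assms(5) \<sigma> that] by blast
  show ?thesis
  proof (intro equalityI subsetI)
    fix u assume "u \<in> P_operator A g G \<sigma> ` {\<phi>. continuous_on UNIV \<phi>}"
    then show "u \<in> {u. viscosity_solution A G (critical_value A G) u}"
      using P Pr_viscosity_solution[OF assms(5) \<sigma>] by auto
  next
    fix u assume "u \<in> {u. viscosity_solution A G (critical_value A G) u}"
    then have u: "viscosity_solution A G (critical_value A G) u" by simp
    then have cu: "continuous_on UNIV u" by (simp add: viscosity_solution_def)
    have "P_operator A g G \<sigma> u = u"
      unfolding P[OF cu] using Pr_fixes_viscosity_solution[OF assms(5) \<sigma> u] by blast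
    then show "u \<in> P_operator A g G \<sigma> ` {\<phi>. continuous_on UNIV \<phi>}" using cu by (metis imageI mem_Collect_eq)
  qed
qed

end
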